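(* Let $X$ be a ball Banach function space on $\mathbb{R}^n$, $p\in[1,\infty]$, $\gamma\in\mathbb{R}\setminus\{0\}$, $s\in(0,1)$, and $q\in[1,p]$ with $\frac1q=\frac{1-s}{p}+s$. Assume there is a sequence $\{\theta_m\}_{m\in\mathbb{N}}\subset(0,1)$ with $\lim_{m}\theta_m=1$ such that, for every $m$, $X^{1/\theta_m}$ is a ball Banach function space, $\mathcal{M}$ is bounded on $(X^{1/\theta_m})'$, and $\lim_{m\to\infty}\|\mathcal{M}\|_{(X^{1/\theta_m})'\to(X^{1/\theta_m})'}<\infty$. If $\gamma\in(-\infty,0)$, assume further that $\mathcal{M}$ is bounded on $X$, or that both $n=1$ and $\gamma\in(-\infty,-1)$. Then: (i) if $p\in[1,\infty)$, there exists $C>0$ such that for every $f\in C^1(\mathbb{R}^n)$ with $|\nabla f|\in C_{\mathrm c}(\mathbb{R}^n)$, $$\sup_{\lambda\in(0,\infty)}\lambda\left\|\left[\int_{\mathbb{R}^n}\mathbf{1}_{D_{\lambda,\gamma/q,s}[f]}(\cdot,y)|\cdot-y|^{\gamma-n}\,dy\right]^{1/q}\right\|_{X^q}\le C\|f\|_{X^p}^{1-s}\|\,|\nabla f|\,\|_X^s;\qquad(\ast)$$ if moreover $X$ has an absolutely continuous norm, $X^p$ is a ball Banach function space, and the centered ball average operators $\{\mathcal{B}_r\}_{r>0}$ are uniformly bounded on $X$, then $(\ast)$ holds for every $f\in\dot W^{1,X}(\mathbb{R}^n)$; (ii) if $p=\infty$, there exists $\widetilde C>0$ such that for every $f\in C^1(\mathbb{R}^n)$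 with $|\nabla f|\in C_{\mathrm c}(\mathbb{R}^n)$, $$\sup_{\lambda\in(0,\infty)}\lambda\left\|\left[\int_{\mathbb{R}^n}\mathbf{1}_{D_{\lambda,\gamma/q,s}[f]}(\cdot,y)|\cdot-y|^{\gamma-n}\,dy\right]^{1/q}\right\|_{X^q}\le \widetilde C\|f\|_{L^\infty(\mathbb{R}^n)}^{1-s}\|\,|\nabla f|\,\|_X^s;\qquad(\ast\ast)$$ if moreover $X$ has an absolutely continuous norm and $\{\mathcal{B}_r\}_{r>0}$ are uniformly bounded on $X$, then $(\ast\ast)$ holds for every $f\in\dot W^{1,X}(\mathbb{R}^n)$.
   Context: A quasi-Banach space $X$ of measurable functions on $\mathbb{R}^n$ with quasi-norm defined on all measurable functions is a ball quasi-Banach function space if: $\|f\|_X=0$ implies $f=0$ a.e.; $|g|\le|f|$ a.e. implies $\|g\|_X\le\|f\|_X$; $0\le f_m\uparrow f$ a.e. implies $\|f_m\|_X\uparrow\|f\|_X$; $\mathbf{1}_B\in X$ for every ball $B$. It is a ball Banach function space if moreover the triangle inequality holds and for every ball $B$ there is $C_B$ with $\int_B|f|\le C_B\|f\|_X$. For $t\in(0,\infty)$, $X^t:=\{f:|f|^t\in X\}$, $\|f\|_{X^t}:=\|\,|f|^t\|_X^{1/t}$. Associate space: $Y':=\{f:\|f\|_{Y'}:=\sup_{\|g\|_Y=1}\|fg\|_{L^1}<\infty\}$. Absolutely continuous norm: $\|f\mathbf{1}_{E_j}\|_X\to0$ whenever $f\in X$, $\mathbf{1}_{E_j}\to0$ a.e.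 $\mathcal{B}_rf(x):=|B(x,r)|^{-1}\int_{B(x,r)}|f|$; uniformly bounded means $\sup_r\|\mathcal{B}_r\|_{X\to X}<\infty$. $\mathcal{M}$ is the Hardy--Littlewood maximal operator; bounded on $Y$ with least constant $\|\mathcal{M}\|_{Y\to Y}$. $\dot W^{1,X}(\mathbb{R}^n)$: distributions $f$ with $|\nabla f|\in X$. For $\lambda>0$, $\beta\in\mathbb{R}$, $\sigma\in[0,1]$: $D_{\lambda,\beta,\sigma}[f]:=\{(x,y)\in\mathbb{R}^n\times\mathbb{R}^n:x\ne y,\ |f(x)-f(y)|/|x-y|^{\sigma+\beta}>\lambda\}$. *)

theory Defs
  imports "HOL-Analysis.Analysis"
begin

text \<open>A (quasi-)norm functional on measurable functions on the euclidean space 'n.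
  Since all spaces under consideration are lattices (the norm of f depends only on |f|),
  the functional is modelled on nonnegative (ennreal-valued) Lebesgue measurable functions;
  the norm of a real function f is  X (\<lambda>x. ennreal |f x|).\<close>

type_synonym 'n fnorm = "('n \<Rightarrow> ennreal) \<Rightarrow> ennreal"

definition epow :: "ennreal \<Rightarrow> real \<Rightarrow> ennreal" where
  "epow e r = (if e = \<infinity> then \<infinity> else ennreal (enn2real e powr r))"

definition absn :: "('n \<Rightarrow> real) \<Rightarrow> 'n \<Rightarrow> ennreal" where
  "absn f = (\<lambda>x. ennreal \<bar>f x\<bar>)"

definition ball_qBFS :: "('n::euclidean_space) fnorm \<Rightarrow> bool" where
  "ball_qBFS X \<longleftrightarrow>
     \<comment> \<open>quasi-norm: homogeneity and quasi-triangle inequality\<close>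
     (\<forall>f c. f \<in> borel_measurable lebesgue \<longrightarrow> c < \<infinity> \<longrightarrow> X (\<lambda>x. c * f x) = c * X f) \<and>
     (\<exists>K::real. K \<ge> 1 \<and> (\<forall>f g. f \<in> borel_measurable lebesgue \<longrightarrow> g \<in> borel_measurable lebesgue \<longrightarrow>
          X (\<lambda>x. f x + g x) \<le> ennreal K * (X f + X g))) \<and>
     \<comment> \<open>completeness (quasi-Banach)\<close>
     (\<forall>F::nat \<Rightarrow> 'n \<Rightarrow> real. (\<forall>k. F k \<in> borel_measurable lebesgue \<and> X (absn (F k)) < \<infinity>) \<longrightarrow>
        (\<forall>e>0. \<exists>N. \<forall>k\<ge>N. \<forall>l\<ge>N. X (absn (\<lambda>x. F k x - F l x)) < ennreal e) \<longrightarrow>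
        (\<exists>f. f \<in> borel_measurable lebesgue \<and> X (absn f) < \<infinity> \<and>
             (\<lambda>k. X (absn (\<lambda>x. F k x - f x))) \<longlonglongrightarrow> 0)) \<and>
     \<comment> \<open>definiteness\<close>
     (\<forall>f. f \<in> borel_measurable lebesgue \<longrightarrow> X f = 0 \<longrightarrow> (AE x in lebesgue. f x = 0)) \<and>
     \<comment> \<open>lattice property\<close>
     (\<forall>f g. f \<in> borel_measurable lebesgue \<longrightarrow> g \<in> borel_measurable lebesgue \<longrightarrow>
        (AE x in lebesgue. g x \<le> f x) \<longrightarrow> X g \<le> X f) \<and>
     \<comment> \<open>Fatou property\<close>
     (\<forall>F f. (\<forall>m. F m \<in> borel_measurable lebesgue) \<longrightarrow> f \<in> borel_measurable lebesgue \<longrightarrow>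
        (AE x in lebesgue. incseq (\<lambda>m. F m x) \<and> (\<lambda>m. F m x) \<longlonglongrightarrow> f x) \<longrightarrow>
        (\<lambda>m. X (F m)) \<longlonglongrightarrow> X f) \<and>
     \<comment> \<open>indicators of balls belong to X\<close>
     (\<forall>c r. X (indicator (ball c r)) < \<infinity>)"

definition ball_BFS :: "('n::euclidean_space) fnorm \<Rightarrow> bool" where
  "ball_BFS X \<longleftrightarrow> ball_qBFS X \<and>
     (\<forall>f g. f \<in> borel_measurable lebesgue \<longrightarrow> g \<in> borel_measurable lebesgue \<longrightarrow>
          X (\<lambda>x. f x + g x) \<le> X f + X g) \<and>
     (\<forall>c r. \<exists>C::real. \<forall>f. f \<in> borel_measurable lebesgue \<longrightarrow>
          (\<integral>\<^sup>+ x\<in>ball c r. f x \<partial>lebesgue) \<le> ennreal C * X f)"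

definition pow_space :: "real \<Rightarrow> 'n fnorm \<Rightarrow> 'n fnorm" where
  "pow_space t X = (\<lambda>f. epow (X (\<lambda>x. if f x = \<infinity> then \<infinity> else ennreal (enn2real (f x) powr t))) (1/t))"

definition assoc_space :: "('n::euclidean_space) fnorm \<Rightarrow> 'n fnorm" where
  "assoc_space Y = (\<lambda>f. SUP g\<in>{g. g \<in> borel_measurable lebesgue \<and> Y g = 1}.
                          \<integral>\<^sup>+ x. f x * g x \<partial>lebesgue)"

definition ball_avg :: "real \<Rightarrow> ('n::euclidean_space \<Rightarrow> ennreal) \<Rightarrow> 'n \<Rightarrow> ennreal" where
  "ball_avg r f x = (\<integral>\<^sup>+ y\<in>ball x r. f y \<partial>lebesgue) / emeasure lebesgue (ball x r)"

definition maximal_op :: "('n::euclidean_space \<Rightarrow> ennreal) \<Rightarrow> 'n \<Rightarrow> ennreal" where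
  "maximal_op f x = (SUP r\<in>{0<..}. ball_avg r f x)"

definition M_bounded :: "('n::euclidean_space) fnorm \<Rightarrow> bool" where
  "M_bounded Y \<longleftrightarrow> (\<exists>C::real. \<forall>f. f \<in> borel_measurable lebesgue \<longrightarrow>
       Y (maximal_op f) \<le> ennreal C * Y f)"

definition M_opnorm :: "('n::euclidean_space) fnorm \<Rightarrow> ennreal" where
  "M_opnorm Y = Inf {C. \<forall>f. f \<in> borel_measurable lebesgue \<longrightarrow> Y (maximal_op f) \<le> C * Y f}"

definition abs_cont_norm :: "('n::euclidean_space) fnorm \<Rightarrow> bool" where
  "abs_cont_norm X \<longleftrightarrow> (\<forall>f E. f \<in> borel_measurable lebesgue \<longrightarrow> X f < \<infinity> \<longrightarrow>
      (\<forall>j. E j \<in> sets lebesgue) \<longrightarrow>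
      (AE x in lebesgue. (\<lambda>j. indicator (E j) x :: real) \<longlonglongrightarrow> 0) \<longrightarrow>
      (\<lambda>j. X (\<lambda>x. f x * indicator (E j) x)) \<longlonglongrightarrow> 0)"

definition ball_avg_unif_bounded :: "('n::euclidean_space) fnorm \<Rightarrow> bool" where
  "ball_avg_unif_bounded X \<longleftrightarrow> (\<exists>C::real. \<forall>r>0. \<forall>f. f \<in> borel_measurable lebesgue \<longrightarrow>
       X (ball_avg r f) \<le> ennreal C * X f)"

coinductive smooth_fun :: "('n::euclidean_space \<Rightarrow> real) \<Rightarrow> bool" where
  "(\<forall>x. \<phi> differentiable (at x)) \<Longrightarrow>
   (\<forall>i\<in>Basis. smooth_fun (\<lambda>x. frechet_derivative \<phi> (at x) i)) \<Longrightarrow> smooth_fun \<phi>"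

definition test_fun :: "('n::euclidean_space \<Rightarrow> real) \<Rightarrow> bool" where
  "test_fun \<phi> \<longleftrightarrow> smooth_fun \<phi> \<and> compact (closure {x. \<phi> x \<noteq> 0})"

definition loc_integrable :: "('n::euclidean_space \<Rightarrow> 'b::{banach,second_countable_topology}) \<Rightarrow> bool" where
  "loc_integrable f \<longleftrightarrow> (\<forall>K. compact K \<longrightarrow> set_integrable lebesgue K f)"

definition weak_gradient :: "('n::euclidean_space \<Rightarrow> real) \<Rightarrow> ('n \<Rightarrow> 'n) \<Rightarrow> bool" where
  "weak_gradient f g \<longleftrightarrow> loc_integrable f \<and> loc_integrable g \<and>
     (\<forall>\<phi>. test_fun \<phi> \<longrightarrow> (\<forall>i\<in>Basis.
        (\<integral>x. f x * frechet_derivative \<phi> (at x) i \<partial>lebesgue) = - (\<integral>x. (g x \<bullet> i) * \<phi> x \<partial>lebesgue)))"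

definition Dset :: "('n::euclidean_space \<Rightarrow> real) \<Rightarrow> real \<Rightarrow> real \<Rightarrow> real \<Rightarrow> ('n \<times> 'n) set" where
  "Dset f lam \<beta> \<sigma> = {(x,y). x \<noteq> y \<and> \<bar>f x - f y\<bar> / norm (x - y) powr (\<sigma> + \<beta>) > lam}"

definition lhs_quant :: "'n fnorm \<Rightarrow> ('n::euclidean_space \<Rightarrow> real) \<Rightarrow> real \<Rightarrow> real \<Rightarrow> real \<Rightarrow> ennreal" where
  "lhs_quant X f \<gamma> q s = (SUP lam\<in>{0<..}. ennreal lam *
     pow_space q X (\<lambda>x. epow (\<integral>\<^sup>+ y. indicator (Dset f lam (\<gamma>/q) s) (x,y) *
                               ennreal (norm (x - y) powr (\<gamma> - real DIM('n))) \<partial>lebesgue) (1/q)))"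

definition Linf_norm :: "('n::euclidean_space \<Rightarrow> real) \<Rightarrow> ennreal" where
  "Linf_norm f = Inf {C. AE x in lebesgue. ennreal \<bar>f x\<bar> \<le> C}"

definition C1_grad_cc :: "('n::euclidean_space \<Rightarrow> real) \<Rightarrow> ('n \<Rightarrow> 'n) \<Rightarrow> bool" where
  "C1_grad_cc f g \<longleftrightarrow> (\<forall>x. (f has_derivative (\<lambda>h. g x \<bullet> h)) (at x)) \<and> continuous_on UNIV g \<and>
     compact (closure {x. norm (g x) \<noteq> 0})"

end

(* Write 1/q = (1-s)/p + s. If |f x - f y| is at most l1 |x-y|^(gamma/p) and at most
   l2 |x-y|^(1+gamma), then it is at most l1^(1-s) l2^s |x-y|^(s+gamma/q), so the set D of the
   theorem lies in the union of two level sets, one governed by |f|^p and one by |grad f|; at the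
   end the product l1^(1-s) l2^s is kept fixed and the sum of the two bounds is optimised.

   By extrapolation it is enough to bound both level sets in L^1(w) for weights w with M w <= A w.
   The function set needs no more than the integral of |x-y|^(gamma-n) w over |x-y|^gamma < t,
   which is at most C t M w. The gradient set reduces to the same integral: a large increment of f
   forces a heavy ball for |grad f| near x or y, and the radii of heavy balls are integrated against
   w by charging them to the mass of the balls. Extrapolation is available for the powers
   X^(1/theta) only; the Fatou property gives X itself as theta tends to 1, provided the
   right-hand side is bounded, so all estimates are localised to balls of radius R first.

   Functions in the Sobolev space are mollified: the mollified function and its gradient are
   dominated by ball averages, and D is lower semicontinuous under almost everywhere convergence. *)

theory Submission
  imports Defs
begin

section \<open>Lebesgue measure and the centered maximal operator\<close>

text \<open>The maximal operator M is controlled on the associate spaces, where the weights live;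
  estimating the gradient set through M |grad f| is therefore possible only if M is also assumed
  bounded on X. For \<gamma> > 0 the bound in L^1(w) must avoid that maximal function. An increment
  is averaged over balls of radius t r, one radius is selected, and the loss caused by a small t is
  repaid by the excess mass of the selected ball, leaving a geometric series. In dimension one with
  \<gamma> < -1 an increment is bounded by an integral over an interval, so a heavy ball appears
  without any selection.

  In every case w enters through w(B(y,r)) \<le> |B(y,r)| M w(y), followed by M w \<le> A w. Such w
  come from a Rubio de Francia series in the associate space. One A serves all theta near 1 because
  the operator norms have a finite limit. Returning from weights to norms requires Y'' = Y, whose
  nontrivial half is proved here through projections in L^2.\<close>

lemma sigma_finite_lebesgue: "sigma_finite_measure (lebesgue :: 'a::euclidean_space measure)"
proof
  show "\<exists>A::'a set set. countable A \<and> A \<subseteq> sets lebesgue \<and> \<Union>A = space lebesgue \<and> (\<forall>a\<in>A. emeasure lebesgue a \<noteq> \<infinity>)"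
  proof (intro exI[of _ "range (\<lambda>n::nat. ball 0 (real n))"] conjI ballI)
    show "(\<Union>n::nat. ball (0::'a) (real n)) = space lebesgue"
      by (auto simp: reals_Archimedean2)
  next
    fix a :: "'a set" assume "a \<in> range (\<lambda>n::nat. ball 0 (real n))"
    then obtain n :: nat where a: "a = ball 0 (real n)" by auto
    have "emeasure lebesgue a = emeasure lborel a" by (simp add: a)
    also have "\<dots> < \<infinity>" unfolding a by (intro emeasure_bounded_finite) simp
    finally show "emeasure lebesgue a \<noteq> \<infinity>" by simp
  qed auto
qed

text \<open>Functions and weights are only Lebesgue measurable, so pairs are measured in the product
  of two completed measures. All sets of pairs below are built from such functions of one variable
  and from powers of |x - y|, hence are measurable there.\<close>

lemma lebesgue_Fubini:
  fixes f :: "'a::euclidean_space \<Rightarrow> 'b::euclidean_space \<Rightarrow> ennreal"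
  assumes "case_prod f \<in> borel_measurable (lebesgue \<Otimes>\<^sub>M lebesgue)"
  shows "(\<integral>\<^sup>+y. (\<integral>\<^sup>+x. f x y \<partial>lebesgue) \<partial>lebesgue) = (\<integral>\<^sup>+x. (\<integral>\<^sup>+y. f x y \<partial>lebesgue) \<partial>lebesgue)"
proof -
  interpret pair_sigma_finite "lebesgue :: 'a measure" "lebesgue :: 'b measure"
    by (intro pair_sigma_finite.intro sigma_finite_lebesgue)
  show ?thesis using assms by (rule Fubini')
qed

lemma borel_measurable_lebesgue_nn_integral:
  fixes f :: "'a::euclidean_space \<Rightarrow> 'b::euclidean_space \<Rightarrow> ennreal"
  assumes "case_prod f \<in> borel_measurable (lebesgue \<Otimes>\<^sub>M lebesgue)"
  shows "(\<lambda>x. \<integral>\<^sup>+y. f x y \<partial>lebesgue) \<in> borel_measurable lebesgue"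
  using sigma_finite_measure.borel_measurable_nn_integral[OF sigma_finite_lebesgue assms] .

lemma borel_measurable_lebesgue_id [measurable]: "(\<lambda>x. x) \<in> borel_measurable lebesgue"
  by (rule measurable_completion) simp

lemma borel_measurable_lebesgue_fst [measurable]:
  "fst \<in> borel_measurable (lebesgue \<Otimes>\<^sub>M lebesgue)"
  by (rule measurable_compose[OF measurable_fst borel_measurable_lebesgue_id])

lemma borel_measurable_lebesgue_snd [measurable]:
  "snd \<in> borel_measurable (lebesgue \<Otimes>\<^sub>M lebesgue)"
  by (rule measurable_compose[OF measurable_snd borel_measurable_lebesgue_id])

lemma borel_measurable_continuous_lebesgue:
  "continuous_on UNIV f \<Longrightarrow> f \<in> borel_measurable lebesgue"
  by (intro measurable_completion) (simp add: borel_measurable_continuous_onI)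

lemma unit_ball_vol_of_nat_neq_0 [simp]: "unit_ball_vol (real k) \<noteq> 0"
  using unit_ball_vol_pos[of "real k"] by (metis less_irrefl of_nat_0_le_iff)

lemma sets_lebesgue_ball [measurable]: "ball c r \<in> sets lebesgue"
  by (simp add: lmeasurable_ball fmeasurableD)

lemma emeasure_lebesgue_ball:
  fixes c :: "'a::euclidean_space"
  assumes "0 \<le> r"
  shows "emeasure lebesgue (ball c r) = ennreal (unit_ball_vol (real DIM('a)) * r ^ DIM('a))"
  using emeasure_ball[OF assms, of c] by simp

text \<open>The form in which the maximal function enters the kernel estimates: the mass of a ball,
  rather than its average, is compared with M.\<close>

lemma ball_integral_le_maximal_op:
  fixes x :: "'a::euclidean_space"
  assumes "0 < r"
  shows "(\<integral>\<^sup>+y\<in>ball x r. f y \<partial>lebesgue) \<le> ennreal (unit_ball_vol (real DIM('a)) * r ^ DIM('a)) * maximal_op f x"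
proof -
  let ?e = "emeasure lebesgue (ball x r)"
  have e: "?e = ennreal (unit_ball_vol (real DIM('a)) * r ^ DIM('a))"
    using emeasure_lebesgue_ball[of r x] assms by simp
  have pos: "0 < unit_ball_vol (real DIM('a)) * r ^ DIM('a)" using assms by simp
  have "(\<integral>\<^sup>+y\<in>ball x r. f y \<partial>lebesgue) = ?e * ball_avg r f x"
    unfolding ball_avg_def e using pos
    by (subst ennreal_times_divide, subst mult.commute, subst mult_divide_eq_ennreal) (use assms in auto)
  also have "\<dots> \<le> ?e * maximal_op f x"
    unfolding maximal_op_def using assms by (intro mult_left_mono SUP_upper) auto
  finally show ?thesis unfolding e .
qed

text \<open>The volume does not depend on the centre, so only the integral matters. An open ball is
  exhausted by smaller concentric balls; one of them already carries enough mass, and it stays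
  inside the ball of radius \<open>r\<close> about every nearby centre.\<close>

lemma open_ball_avg_greater:
  fixes f :: "'a::euclidean_space \<Rightarrow> ennreal"
  assumes [measurable]: "f \<in> borel_measurable lebesgue" and r: "0 < r"
  shows "open {x. a < ball_avg r f x}"
proof (rule openI)
  fix x assume "x \<in> {x. a < ball_avg r f x}"
  then have ax: "a < ball_avg r f x" by simp
  define \<rho> where "\<rho> n = r - 1 / real (Suc n)" for n
  have inc: "\<rho> m \<le> \<rho> n" if "m \<le> n" for m n
    using that by (simp add: \<rho>_def frac_le)
  have lim: "\<exists>n. d < \<rho> n" if "d < r" for d
  proof -
    obtain n where "inverse (real (Suc n)) < r - d" using reals_Archimedean[of "r - d"] \<open>d < r\<close> by (auto simp del: of_nat_Suc)
    then show ?thesis by (auto simp: \<rho>_def inverse_eq_divide simp del: of_nat_Suc intro!: exI[of _ n])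
  qed
  have lt: "\<rho> n < r" for n by (simp add: \<rho>_def)
  have ind: "indicator (ball x r) y = (SUP n. indicator (ball x (\<rho> n)) y :: ennreal)" for y
  proof (rule antisym)
    show "indicator (ball x r) y \<le> (SUP n. indicator (ball x (\<rho> n)) y :: ennreal)"
    proof (cases "y \<in> ball x r")
      case True
      then obtain n where "dist x y < \<rho> n" using lim[of "dist x y"] by auto
      then show ?thesis by (intro SUP_upper2[of n]) (auto simp: indicator_def)
    qed auto
    show "(SUP n. indicator (ball x (\<rho> n)) y :: ennreal) \<le> indicator (ball x r) y"
    proof (intro SUP_least)
      fix n show "indicator (ball x (\<rho> n)) y \<le> (indicator (ball x r) y :: ennreal)"
        using lt[of n] by (auto simp: indicator_def)
    qed
  qed
  have "(\<integral>\<^sup>+y\<in>ball x r. f y \<partial>lebesgue) = (\<integral>\<^sup>+y. (SUP n. f y * indicator (ball x (\<rho> n)) y) \<partial>lebesgue)"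
    by (simp add: ind SUP_mult_left_ennreal)
  also have "\<dots> = (SUP n. \<integral>\<^sup>+y. f y * indicator (ball x (\<rho> n)) y \<partial>lebesgue)"
  proof (rule nn_integral_monotone_convergence_SUP)
    show "incseq (\<lambda>n y. f y * indicator (ball x (\<rho> n)) y)"
    proof (intro incseq_SucI le_funI mult_left_mono)
      fix n y show "indicator (ball x (\<rho> n)) y \<le> (indicator (ball x (\<rho> (Suc n))) y :: ennreal)"
        using inc[of n "Suc n"] by (auto simp: indicator_def)
    qed auto
  qed measurable
  finally have "ball_avg r f x = (SUP n. (\<integral>\<^sup>+y\<in>ball x (\<rho> n). f y \<partial>lebesgue) / emeasure lebesgue (ball x r))"
    by (simp add: ball_avg_def SUP_divide_ennreal)
  then obtain n where n: "a < (\<integral>\<^sup>+y\<in>ball x (\<rho> n). f y \<partial>lebesgue) / emeasure lebesgue (ball x r)"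
    using ax by (auto simp: less_SUP_iff)
  have "a < ball_avg r f z" if z: "z \<in> ball x (r - \<rho> n)" for z
  proof -
    have "(\<integral>\<^sup>+y\<in>ball x (\<rho> n). f y \<partial>lebesgue) \<le> (\<integral>\<^sup>+y\<in>ball z r. f y \<partial>lebesgue)"
    proof (intro nn_integral_mono mult_left_mono)
      fix y show "indicator (ball x (\<rho> n)) y \<le> (indicator (ball z r) y :: ennreal)"
        using z dist_triangle[of z y x] by (auto simp: indicator_def dist_commute)
    qed auto
    then have "(\<integral>\<^sup>+y\<in>ball x (\<rho> n). f y \<partial>lebesgue) / emeasure lebesgue (ball x r) \<le> ball_avg r f z"
      unfolding ball_avg_def using r emeasure_lebesgue_ball[of r x] emeasure_lebesgue_ball[of r z]
      by (auto intro: divide_right_mono_ennreal simp del: emeasure_completion)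
    with n show ?thesis by (rule less_le_trans)
  qed
  then show "\<exists>e>0. ball x e \<subseteq> {x. a < ball_avg r f x}"
    using lt[of n] by (intro exI[of _ "r - \<rho> n"]) auto
qed

lemma borel_measurable_ball_avg:
  fixes f :: "'a::euclidean_space \<Rightarrow> ennreal"
  assumes "f \<in> borel_measurable lebesgue" and "0 < r"
  shows "ball_avg r f \<in> borel_measurable lebesgue"
proof (rule borel_measurableI_greater)
  fix a
  have "{x. a < ball_avg r f x} \<in> sets borel"
    using open_ball_avg_greater[OF assms] by simp
  then show "{x \<in> space lebesgue. a < ball_avg r f x} \<in> sets lebesgue"
    by (auto intro: sets_completionI_sets)
qed

text \<open>The supremum runs over uncountably many radii; measurability comes from the superlevel
  sets being open.\<close>

lemma borel_measurable_maximal_op [measurable (raw)]: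
  fixes f :: "'a::euclidean_space \<Rightarrow> ennreal"
  assumes f: "f \<in> borel_measurable lebesgue"
  shows "maximal_op f \<in> borel_measurable lebesgue"
proof (rule borel_measurableI_greater)
  fix a
  have "{x. a < maximal_op f x} = (\<Union>r\<in>{0<..}. {x. a < ball_avg r f x})"
    by (auto simp: maximal_op_def less_SUP_iff)
  then have "open {x. a < maximal_op f x}"
    using open_ball_avg_greater[OF f] by auto
  then have "{x. a < maximal_op f x} \<in> sets borel" by simp
  then show "{x \<in> space lebesgue. a < maximal_op f x} \<in> sets lebesgue"
    by (auto intro: sets_completionI_sets)
qed

lemma maximal_op_suminf_le:
  fixes f :: "nat \<Rightarrow> 'a::euclidean_space \<Rightarrow> ennreal"
  assumes [measurable]: "\<And>k. f k \<in> borel_measurable lebesgue"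
  shows "maximal_op (\<lambda>x. \<Sum>k. f k x) x \<le> (\<Sum>k. maximal_op (f k) x)"
  unfolding maximal_op_def
proof (rule SUP_least)
  fix r :: real assume r: "r \<in> {0<..}"
  have "ball_avg r (\<lambda>x. \<Sum>k. f k x) x = (\<Sum>k. ball_avg r (f k) x)"
    unfolding ball_avg_def ennreal_suminf_divide
    by (subst nn_integral_suminf[symmetric]) (auto simp: ennreal_suminf_multc)
  also have "\<dots> \<le> (\<Sum>k. SUP r\<in>{0<..}. ball_avg r (f k) x)"
    using r by (intro suminf_le SUP_upper) auto
  finally show "ball_avg r (\<lambda>x. \<Sum>k. f k x) x \<le> (\<Sum>k. SUP r\<in>{0<..}. ball_avg r (f k) x)" .
qed

lemma maximal_op_cmult:
  fixes f :: "'a::euclidean_space \<Rightarrow> ennreal"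
  assumes [measurable]: "f \<in> borel_measurable lebesgue"
  shows "maximal_op (\<lambda>x. c * f x) x = c * maximal_op f x"
proof -
  have "(\<integral>\<^sup>+y. c * (f y * indicator (ball x r) y) \<partial>lebesgue) = c * (\<integral>\<^sup>+y. f y * indicator (ball x r) y \<partial>lebesgue)" for r
    by (rule nn_integral_cmult) measurable
  then have "ball_avg r (\<lambda>x. c * f x) x = c * ball_avg r f x" for r
    unfolding ball_avg_def by (simp add: mult.assoc ennreal_times_divide)
  then show ?thesis unfolding maximal_op_def by (simp add: SUP_mult_left_ennreal)
qed

lemma maximal_op_bounded:
  fixes f :: "'a::euclidean_space \<Rightarrow> ennreal"
  assumes "\<And>x. f x \<le> N"
  shows "maximal_op f x \<le> N"
  unfolding maximal_op_def
proof (rule SUP_least)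
  fix r :: real assume "r \<in> {0<..}"
  then have r: "0 < r" by simp
  let ?e = "emeasure lebesgue (ball x r)"
  have e: "?e \<noteq> 0" "?e \<noteq> \<infinity>" using r emeasure_lebesgue_ball[of r x] unit_ball_vol_pos[of "real DIM('a)"]
    by (auto simp del: emeasure_completion unit_ball_vol_pos)
  have "ball_avg r f x \<le> (\<integral>\<^sup>+y. N * indicator (ball x r) y \<partial>lebesgue) / ?e"
    unfolding ball_avg_def
    by (intro divide_right_mono_ennreal nn_integral_mono mult_right_mono assms) auto
  also have "\<dots> = N * ?e / ?e" by (subst nn_integral_cmult_indicator) auto
  also have "\<dots> = N" using e by (simp add: mult_divide_eq_ennreal)
  finally show "ball_avg r f x \<le> N" .
qed

section \<open>Ball Banach function spaces and their associate spaces\<close>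

lemma
  assumes X: "ball_BFS X"
  shows bfs_cmult: "f \<in> borel_measurable lebesgue \<Longrightarrow> c < \<infinity> \<Longrightarrow> X (\<lambda>x. c * f x) = c * X f"
    and bfs_eq_0: "f \<in> borel_measurable lebesgue \<Longrightarrow> X f = 0 \<Longrightarrow> AE x in lebesgue. f x = 0"
    and bfs_mono_AE: "f \<in> borel_measurable lebesgue \<Longrightarrow> g \<in> borel_measurable lebesgue \<Longrightarrow>
          AE x in lebesgue. g x \<le> f x \<Longrightarrow> X g \<le> X f"
    and bfs_Fatou: "(\<And>m::nat. F m \<in> borel_measurable lebesgue) \<Longrightarrow> f \<in> borel_measurable lebesgue \<Longrightarrow>
          AE x in lebesgue. incseq (\<lambda>m. F m x) \<and> (\<lambda>m. F m x) \<longlonglongrightarrow> f x \<Longrightarrow> (\<lambda>m. X (F m)) \<longlonglongrightarrow> X f"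
    and bfs_indicator_ball: "X (indicator (ball z r)) < \<infinity>"
    and bfs_add: "f \<in> borel_measurable lebesgue \<Longrightarrow> g \<in> borel_measurable lebesgue \<Longrightarrow>
          X (\<lambda>x. f x + g x) \<le> X f + X g"
proof -
  have q: "ball_qBFS X" using X by (simp add: ball_BFS_def)
  show "f \<in> borel_measurable lebesgue \<Longrightarrow> c < \<infinity> \<Longrightarrow> X (\<lambda>x. c * f x) = c * X f"
    using q unfolding ball_qBFS_def by (elim conjE) blast
  show "f \<in> borel_measurable lebesgue \<Longrightarrow> X f = 0 \<Longrightarrow> AE x in lebesgue. f x = 0"
    using q unfolding ball_qBFS_def by (elim conjE) blast
  show "f \<in> borel_measurable lebesgue \<Longrightarrow> g \<in> borel_measurable lebesgue \<Longrightarrow>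
          AE x in lebesgue. g x \<le> f x \<Longrightarrow> X g \<le> X f"
    using q unfolding ball_qBFS_def by (elim conjE) blast
  show "(\<And>m. F m \<in> borel_measurable lebesgue) \<Longrightarrow> f \<in> borel_measurable lebesgue \<Longrightarrow>
          AE x in lebesgue. incseq (\<lambda>m. F m x) \<and> (\<lambda>m. F m x) \<longlonglongrightarrow> f x \<Longrightarrow> (\<lambda>m. X (F m)) \<longlonglongrightarrow> X f"
    using q unfolding ball_qBFS_def by (elim conjE) blast
  show "X (indicator (ball z r)) < \<infinity>"
    using q unfolding ball_qBFS_def by (elim conjE) blast
  show "f \<in> borel_measurable lebesgue \<Longrightarrow> g \<in> borel_measurable lebesgue \<Longrightarrow>
          X (\<lambda>x. f x + g x) \<le> X f + X g"
    using X unfolding ball_BFS_def by blast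
qed

lemma bfs_mono:
  assumes "ball_BFS X" "f \<in> borel_measurable lebesgue" "g \<in> borel_measurable lebesgue" "\<And>x. g x \<le> f x"
  shows "X g \<le> X f"
  using bfs_mono_AE[OF assms(1-3)] assms(4) by simp

lemma bfs_cong_AE:
  assumes "ball_BFS X" "f \<in> borel_measurable lebesgue" "g \<in> borel_measurable lebesgue"
    "AE x in lebesgue. g x = f x"
  shows "X g = X f"
  using assms(4) by (intro antisym bfs_mono_AE[OF assms(1)] assms) auto

lemma bfs_zero: "ball_BFS X \<Longrightarrow> X (\<lambda>_. 0) = 0"
  using bfs_cmult[of X "\<lambda>_. 0" 0] by simp

lemma bfs_bounded_support:
  assumes X: "ball_BFS X" and [measurable]: "f \<in> borel_measurable lebesgue"
    and le: "\<And>x. f x \<le> ennreal N * indicator (ball z r) x"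
  shows "X f < \<infinity>"
proof -
  have "X f \<le> X (\<lambda>x. ennreal N * indicator (ball z r) x)"
    by (intro bfs_mono[OF X] le) measurable
  also have "\<dots> = ennreal N * X (indicator (ball z r))"
    by (intro bfs_cmult[OF X]) auto
  also have "\<dots> < \<infinity>"
    using bfs_indicator_ball[OF X, of z r] by (simp add: ennreal_mult_less_top)
  finally show ?thesis .
qed

text \<open>Fatou's lemma in X, from the Fatou property applied to the infima of tails. The bounds
  \<open>b\<close> are allowed to vary because the constants of extrapolation change as theta tends
  to 1.\<close>

lemma bfs_liminf_le:
  fixes F :: "nat \<Rightarrow> ('n::euclidean_space) \<Rightarrow> ennreal"
  assumes X: "ball_BFS X" and [measurable]: "\<And>m. F m \<in> borel_measurable lebesgue" "f \<in> borel_measurable lebesgue"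
    and f: "AE x in lebesgue. f x \<le> liminf (\<lambda>m. F m x)"
    and b: "\<And>m. X (F m) \<le> b m" "b \<longlonglongrightarrow> c"
  shows "X f \<le> c"
proof -
  define G where "G m x = (INF i\<in>{m..}. F i x)" for m x
  have [measurable]: "G m \<in> borel_measurable lebesgue" for m
    unfolding G_def by (intro borel_measurable_INF) auto
  have inc: "incseq (\<lambda>m. G m x)" for x
    unfolding G_def by (auto simp: incseq_def intro!: INF_superset_mono)
  have lim: "(\<lambda>m. G m x) \<longlonglongrightarrow> liminf (\<lambda>m. F m x)" for x
    unfolding liminf_SUP_INF G_def[symmetric] by (rule LIMSEQ_SUP[OF inc])
  have "X f \<le> X (\<lambda>x. liminf (\<lambda>m. F m x))"
    by (intro bfs_mono_AE[OF X] f) measurable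
  moreover have "(\<lambda>m. X (G m)) \<longlonglongrightarrow> X (\<lambda>x. liminf (\<lambda>m. F m x))"
    by (intro bfs_Fatou[OF X]) (auto simp: inc lim)
  moreover have "X (G m) \<le> b m" for m
  proof -
    have "X (G m) \<le> X (F m)"
      by (intro bfs_mono[OF X]) (auto simp: G_def intro!: INF_lower)
    with b(1)[of m] show ?thesis by simp
  qed
  ultimately show ?thesis
    using LIMSEQ_le[of "\<lambda>m. X (G m)" _ b c] b(2) by fastforce
qed

lemma not_AE_indicator_ball_0:
  fixes z :: "'a::euclidean_space"
  assumes "0 < r"
  shows "\<not> (AE x in lebesgue. indicator (ball z r) x = (0::ennreal))"
proof
  assume "AE x in lebesgue. indicator (ball z r) x = (0::ennreal)"
  then have "(\<integral>\<^sup>+x. indicator (ball z r) x \<partial>lebesgue) = 0"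
    by (subst nn_integral_0_iff_AE) auto
  then have "emeasure lebesgue (ball z r) = 0"
    by (subst (asm) nn_integral_indicator) auto
  then show False
    using emeasure_lebesgue_ball[of r z] assms unit_ball_vol_pos[of "real DIM('a)"]
    by (auto simp del: emeasure_completion unit_ball_vol_pos)
qed

lemma assoc_space_upper:
  "h \<in> borel_measurable lebesgue \<Longrightarrow> Y h = 1 \<Longrightarrow> (\<integral>\<^sup>+x. g x * h x \<partial>lebesgue) \<le> assoc_space Y g"
  unfolding assoc_space_def by (rule SUP_upper) auto

text \<open>The associate norm tests only with functions of norm exactly 1, so \<open>f\<close> is
  divided by its norm; if that norm is 0, definiteness makes the left-hand side vanish.\<close>

lemma assoc_space_Hoelder:
  assumes Y: "ball_BFS Y" and [measurable]: "f \<in> borel_measurable lebesgue" "g \<in> borel_measurable lebesgue"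
    and fin: "Y f < \<infinity>"
  shows "(\<integral>\<^sup>+x. f x * g x \<partial>lebesgue) \<le> Y f * assoc_space Y g"
proof (cases "Y f = 0")
  case True
  then have "AE x in lebesgue. f x * g x = 0"
    using bfs_eq_0[OF Y _ True] by auto
  then have "(\<integral>\<^sup>+x. f x * g x \<partial>lebesgue) = 0"
    by (subst nn_integral_0_iff_AE) auto
  then show ?thesis by simp
next
  case False
  define c where "c = Y f"
  have c: "c \<noteq> 0" "c \<noteq> \<infinity>" using False fin by (auto simp: c_def)
  have ci: "inverse c < \<infinity>" "c * inverse c = 1" "inverse c * c = 1" 
    using c ennreal_divide_self[of c] by (auto simp: top.not_eq_extremum[symmetric] divide_ennreal_def mult.commute)
  have "Y (\<lambda>x. inverse c * f x) = 1"
    using bfs_cmult[OF Y _ ci(1), of f] ci by (simp add: c_def)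
  then have le: "(\<integral>\<^sup>+x. g x * (inverse c * f x) \<partial>lebesgue) \<le> assoc_space Y g"
    by (intro assoc_space_upper) auto
  have "f x * g x = c * (g x * (inverse c * f x))" for x
    using ci by (metis mult.assoc mult.commute mult.right_neutral)
  then have "(\<integral>\<^sup>+x. f x * g x \<partial>lebesgue) = (\<integral>\<^sup>+x. c * (g x * (inverse c * f x)) \<partial>lebesgue)"
    by (intro nn_integral_cong)
  also have "\<dots> = c * (\<integral>\<^sup>+x. g x * (inverse c * f x) \<partial>lebesgue)"
    by (intro nn_integral_cmult) measurable
  also have "\<dots> \<le> c * assoc_space Y g"
    by (intro mult_left_mono le) simp
  finally show ?thesis by (simp add: c_def)
qed

text \<open>Monotone convergence against each test function. This and homogeneity are the properties
  of the associate norm that the Rubio de Francia series uses.\<close>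

lemma assoc_space_suminf_le:
  fixes g :: "nat \<Rightarrow> ('n::euclidean_space) \<Rightarrow> ennreal"
  assumes [measurable]: "\<And>k. g k \<in> borel_measurable lebesgue"
  shows "assoc_space Y (\<lambda>x. \<Sum>k. g k x) \<le> (\<Sum>k. assoc_space Y (g k))"
  unfolding assoc_space_def
proof (rule SUP_least)
  fix h assume "h \<in> {g. g \<in> borel_measurable lebesgue \<and> Y g = 1}"
  then have h[measurable]: "h \<in> borel_measurable lebesgue" "Y h = 1" by auto
  have "(\<integral>\<^sup>+x. (\<Sum>k. g k x) * h x \<partial>lebesgue) = (\<Sum>k. \<integral>\<^sup>+x. g k x * h x \<partial>lebesgue)"
    by (subst nn_integral_suminf[symmetric]) auto
  also have "\<dots> \<le> (\<Sum>k. SUP h\<in>{h. h \<in> borel_measurable lebesgue \<and> Y h = 1}. \<integral>\<^sup>+x. g k x * h x \<partial>lebesgue)"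
    using h by (intro suminf_le SUP_upper) auto
  finally show "(\<integral>\<^sup>+x. (\<Sum>k. g k x) * h x \<partial>lebesgue) \<le>
    (\<Sum>k. SUP h\<in>{h. h \<in> borel_measurable lebesgue \<and> Y h = 1}. \<integral>\<^sup>+x. g k x * h x \<partial>lebesgue)" .
qed

lemma assoc_space_cmult:
  fixes g :: "('n::euclidean_space) \<Rightarrow> ennreal"
  assumes [measurable]: "g \<in> borel_measurable lebesgue"
  shows "assoc_space Y (\<lambda>x. c * g x) = c * assoc_space Y g"
proof -
  have "(\<integral>\<^sup>+x. c * g x * h x \<partial>lebesgue) = c * (\<integral>\<^sup>+x. g x * h x \<partial>lebesgue)"
    if "h \<in> borel_measurable lebesgue" for h
    using that by (subst nn_integral_cmult[symmetric]) (auto simp: mult.assoc)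
  then show ?thesis
    unfolding assoc_space_def SUP_mult_left_ennreal by (intro SUP_cong) auto
qed

section \<open>Norming functions and the second associate space\<close>

lemma integrable_bounded_support:
  fixes f :: "'a::euclidean_space \<Rightarrow> real"
  assumes [measurable]: "f \<in> borel_measurable lebesgue"
    and "\<And>x. \<bar>f x\<bar> \<le> N" "\<And>x. x \<notin> ball z r \<Longrightarrow> f x = 0"
  shows "integrable lebesgue f"
proof (rule Bochner_Integration.integrable_bound)
  have "emeasure lebesgue (ball z r) < \<infinity>"
    using emeasure_bounded_finite[of "ball z r"] by simp
  then show "integrable lebesgue (\<lambda>x. N * indicator (ball z r) x)"
    by (intro integrable_mult_right integrable_real_indicator) auto
  show "AE x in lebesgue. norm (f x) \<le> norm (N * indicator (ball z r) x)"
  proof (rule AE_I2)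
    fix x show "norm (f x) \<le> norm (N * indicator (ball z r) x)"
      using assms(2)[of x] assms(3)[of x] by (auto simp: indicator_def)
  qed
qed simp

text \<open>The unit ball of \<open>Y\<close> is closed under almost everywhere convergence, so \<open>F\<close> has a nearest
  point \<open>P\<close> in it with respect to the \<open>L\<^sup>2\<close> distance; the functional is \<open>F - P\<close>. This replaces
  the Hahn-Banach theorem in the usual proof.\<close>

lemma bfs_L2_projection:
  fixes F :: "'n::euclidean_space \<Rightarrow> real"
  assumes Y: "ball_BFS Y" and F[measurable]: "F \<in> borel_measurable lebesgue"
    and F0: "\<And>x. 0 \<le> F x" and FN: "\<And>x. F x \<le> N" and FR: "\<And>x. x \<notin> ball 0 R \<Longrightarrow> F x = 0"
  obtains P where "P \<in> borel_measurable lebesgue" "\<forall>x. 0 \<le> P x \<and> P x \<le> F x"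
    "Y (\<lambda>x. ennreal (P x)) \<le> 1"
    "\<forall>h. h \<in> borel_measurable lebesgue \<longrightarrow> (\<forall>x. 0 \<le> h x \<and> h x \<le> F x) \<longrightarrow>
       Y (\<lambda>x. ennreal (h x)) \<le> 1 \<longrightarrow> (\<integral>x. (F x - P x)\<^sup>2 \<partial>lebesgue) \<le> (\<integral>x. (F x - h x)\<^sup>2 \<partial>lebesgue)"
proof -
  define J where "J h = (\<integral>x. (F x - h x)\<^sup>2 \<partial>lebesgue)" for h
  define K where "K = {h. h \<in> borel_measurable lebesgue \<and> (\<forall>x. 0 \<le> h x \<and> h x \<le> F x) \<and> Y (\<lambda>x. ennreal (h x)) \<le> 1}"
  define I where "I = Inf (J ` K)"
  have N0: "0 \<le> N" using F0[of 0] FN[of 0] by simp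
  have int: "integrable lebesgue (\<lambda>x. (F x - h x)\<^sup>2)" if "h \<in> K" for h
  proof (rule integrable_bounded_support[where N="N\<^sup>2" and z=0 and r=R])
    show "(\<lambda>x. (F x - h x)\<^sup>2) \<in> borel_measurable lebesgue" using that by (auto simp: K_def)
    fix x
    have "0 \<le> h x" "h x \<le> F x" using that by (auto simp: K_def)
    then show "\<bar>(F x - h x)\<^sup>2\<bar> \<le> N\<^sup>2" "x \<notin> ball 0 R \<Longrightarrow> (F x - h x)\<^sup>2 = 0"
      using FN[of x] FR[of x] by (auto intro!: power_mono)
  qed
  have bdd: "bdd_below (J ` K)" by (auto simp: J_def intro!: bdd_belowI[of _ 0])
  have zero: "(\<lambda>_. 0) \<in> K" using F0 bfs_zero[OF Y] by (auto simp: K_def)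
  have Ile: "I \<le> J h" if "h \<in> K" for h
    unfolding I_def using that bdd by (intro cInf_lower) auto
  \<comment> \<open>The rate 4^(-k) makes the distances of consecutive terms summable, so the
    minimising sequence converges almost everywhere without passing to a subsequence.\<close>
  have "\<exists>h\<in>K. J h < I + (1/4) ^ k" for k :: nat
  proof -
    have "I < I + (1/4) ^ k" by simp
    then have "\<exists>y\<in>J ` K. y < I + (1/4) ^ k"
      unfolding I_def using zero by (intro cInf_lessD) auto
    then show ?thesis by auto
  qed
  then obtain h where h: "\<And>k. h k \<in> K" "\<And>k. J (h k) < I + (1/4) ^ k" by metis
  have hm[measurable]: "h k \<in> borel_measurable lebesgue" for k using h(1)[of k] by (auto simp: K_def)
  have h0: "0 \<le> h k x" "h k x \<le> F x" for k x using h(1)[of k] by (auto simp: K_def)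
  have hY: "Y (\<lambda>x. ennreal (h k x)) \<le> 1" for k using h(1)[of k] by (auto simp: K_def)
  \<comment> \<open>Parallelogram law: the midpoint lies in the convex set \<open>K\<close>, so its
    squared distance to \<open>F\<close> is at least \<open>I\<close>.\<close>
  have diff: "(\<integral>x. (h k x - h (Suc k) x)\<^sup>2 \<partial>lebesgue) \<le> 4 * (1/4)^k" for k
  proof -
    let ?m = "\<lambda>x. (h k x + h (Suc k) x) / 2"
    have "Y (\<lambda>x. ennreal (?m x)) = Y (\<lambda>x. ennreal (1/2) * ennreal (h k x) + ennreal (1/2) * ennreal (h (Suc k) x))"
    proof (intro arg_cong[where f=Y] ext)
      fix x
      have "?m x = 1/2 * h k x + 1/2 * h (Suc k) x" by simp
      then show "ennreal (?m x) = ennreal (1/2) * ennreal (h k x) + ennreal (1/2) * ennreal (h (Suc k) x)"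
        using h0 by (simp only: ennreal_mult'[symmetric] ennreal_plus[symmetric] zero_le_mult_iff) auto
    qed
    also have "\<dots> \<le> ennreal (1/2) * Y (\<lambda>x. ennreal (h k x)) + ennreal (1/2) * Y (\<lambda>x. ennreal (h (Suc k) x))"
    proof -
      have e: "ennreal (1/2) * Y (\<lambda>x. ennreal (h j x)) = Y (\<lambda>x. ennreal (1/2) * ennreal (h j x))" for j
        unfolding infinity_ennreal_def by (intro bfs_cmult[OF Y, symmetric, unfolded infinity_ennreal_def] ennreal_less_top) measurable
      show ?thesis unfolding e by (intro bfs_add[OF Y]) measurable
    qed
    also have "\<dots> \<le> ennreal (1/2) * 1 + ennreal (1/2) * 1"
      by (intro add_mono mult_left_mono hY) auto
    also have "\<dots> = ennreal (1/2 + 1/2)" by (subst ennreal_plus) auto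
    finally have "Y (\<lambda>x. ennreal (?m x)) \<le> 1" by simp
    moreover have "0 \<le> ?m x \<and> ?m x \<le> F x" for x
      using h0[of k x] h0[of "Suc k" x] by auto
    ultimately have mK: "?m \<in> K"
      by (auto simp: K_def)
    have "(\<integral>x. (h k x - h (Suc k) x)\<^sup>2 \<partial>lebesgue)
      = (\<integral>x. 2 * (F x - h k x)\<^sup>2 + 2 * (F x - h (Suc k) x)\<^sup>2 - 4 * (F x - ?m x)\<^sup>2 \<partial>lebesgue)"
      by (intro Bochner_Integration.integral_cong) (auto simp: power2_eq_square field_simps)
    also have "\<dots> = 2 * J (h k) + 2 * J (h (Suc k)) - 4 * J ?m"
      unfolding J_def using int[OF h(1)[of k]] int[OF h(1)[of "Suc k"]] int[OF mK] by simp
    also have "\<dots> \<le> 2 * (I + (1/4)^k) + 2 * (I + (1/4)^k) - 4 * I"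
    proof -
      define a b c d where "a = J (h k)" and "b = J (h (Suc k))" and "c = J ?m" and "d = (1/4::real)^k"
      have "a < I + d" unfolding a_def d_def by (rule h(2))
      moreover have "b < I + d"
      proof -
        have "(1/4::real)^Suc k \<le> d" unfolding d_def by (intro power_decreasing) auto
        then show ?thesis unfolding b_def using h(2)[of "Suc k"] by linarith
      qed
      moreover have "I \<le> c" unfolding c_def by (rule Ile[OF mK])
      ultimately show ?thesis unfolding a_def[symmetric] b_def[symmetric] c_def[symmetric] d_def[symmetric] by argo
    qed
    finally show ?thesis by simp
  qed
  have bnd: "\<bar>h k x - h (Suc k) x\<bar> \<le> N" for k x
    using h0[of k x] h0[of "Suc k" x] FN[of x] by (auto simp: abs_le_iff)
  have off: "x \<notin> ball 0 R \<Longrightarrow> h k x = 0" for k x using h0[of k x] FR[of x] by auto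
  define c where "c = measure lebesgue (ball (0::'n) R)"
  have emc: "emeasure lebesgue (ball (0::'n) R) < \<infinity>"
    using emeasure_bounded_finite[of "ball (0::'n) R"] by simp
  \<comment> \<open>On the ball, completing a square gives |a| \<le> 2^(-k) + 2^k a^2, which turns
    the squared L^2 distance 4 * 4^(-k) into an L^1 bound of order 2^(-k).\<close>
  have L1: "(\<integral>\<^sup>+x. ennreal \<bar>h k x - h (Suc k) x\<bar> \<partial>lebesgue) \<le> ennreal ((c + 4) * (1/2)^k)" for k
  proof -
    have i1: "integrable lebesgue (\<lambda>x. \<bar>h k x - h (Suc k) x\<bar>)"
      by (rule integrable_bounded_support[where N=N and z=0 and r=R]) (auto simp: bnd off)
    have i2: "integrable lebesgue (\<lambda>x. (h k x - h (Suc k) x)\<^sup>2)"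
    proof (rule integrable_bounded_support[where N="N\<^sup>2" and z=0 and r=R])
      fix x show "\<bar>(h k x - h (Suc k) x)\<^sup>2\<bar> \<le> N\<^sup>2"
        using power_mono[OF bnd[of k x], of 2] by simp
    qed (auto simp: off)
    have i3: "integrable lebesgue (indicator (ball (0::'n) R) :: 'n \<Rightarrow> real)"
      using emc by (intro integrable_real_indicator) auto
    have "(\<integral>x. \<bar>h k x - h (Suc k) x\<bar> \<partial>lebesgue) \<le>
      (\<integral>x. (1/2)^k * indicator (ball 0 R) x + 2^k * (h k x - h (Suc k) x)\<^sup>2 \<partial>lebesgue)"
    proof (rule integral_mono)
      fix x
      show "\<bar>h k x - h (Suc k) x\<bar> \<le> (1/2)^k * indicator (ball 0 R) x + 2^k * (h k x - h (Suc k) x)\<^sup>2"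
      proof (cases "x \<in> ball 0 R")
        case True
        define a where "a = \<bar>h k x - h (Suc k) x\<bar>"
        have "0 \<le> (1/2)^k * (2^k * a - 1/2)\<^sup>2" by simp
        also have "\<dots> = (1/2)^k * 2^k * 2^k * a\<^sup>2 - (1/2)^k * 2^k * a + (1/2)^k / 4"
          by (simp add: power2_eq_square algebra_simps)
        also have "(1/2)^k * 2^k = (1::real)" by (simp add: power_mult_distrib[symmetric])
        finally have "a \<le> 2^k * a\<^sup>2 + (1/2)^k / 4" by simp
        also have "\<dots> \<le> 2^k * a\<^sup>2 + (1/2)^k" by simp
        finally show ?thesis using True by (simp add: a_def)
      qed (simp add: off)
    qed (use i1 i2 i3 in simp_all)
    also have "\<dots> = (1/2)^k * c + 2^k * (\<integral>x. (h k x - h (Suc k) x)\<^sup>2 \<partial>lebesgue)"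
      using i2 i3 emc by (simp add: c_def)
    also have "\<dots> \<le> (1/2)^k * c + 2^k * (4 * (1/4)^k)"
      by (intro add_left_mono mult_left_mono diff) auto
    also have "2^k * (4 * (1/4)^k) = 4 * (1/2::real)^k"
      by (simp add: power_mult_distrib[symmetric] mult.left_commute)
    finally have "(\<integral>x. \<bar>h k x - h (Suc k) x\<bar> \<partial>lebesgue) \<le> (c + 4) * (1/2)^k"
      by (simp add: algebra_simps)
    then show ?thesis
      using i1 by (subst nn_integral_eq_integral) (auto intro!: ennreal_leI)
  qed
  have c0: "0 \<le> c" by (simp add: c_def)
  have "(\<integral>\<^sup>+x. (\<Sum>k. ennreal \<bar>h k x - h (Suc k) x\<bar>) \<partial>lebesgue) \<le> (\<Sum>k. ennreal ((c + 4) * (1/2)^k))"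
    by (subst nn_integral_suminf) (auto intro!: suminf_le L1)
  also have "\<dots> < \<infinity>"
  proof -
    have "summable (\<lambda>k. (c + 4) * (1/2::real)^k)" by (intro summable_mult summable_geometric) auto
    then show ?thesis using c0 by (subst suminf_ennreal2) auto
  qed
  finally have "AE x in lebesgue. (\<Sum>k. ennreal \<bar>h k x - h (Suc k) x\<bar>) \<noteq> \<infinity>"
    by (intro nn_integral_noteq_infinite) auto
  then have conv: "AE x in lebesgue. convergent (\<lambda>k. h k x)"
  proof eventually_elim
    fix x assume "(\<Sum>k. ennreal \<bar>h k x - h (Suc k) x\<bar>) \<noteq> \<infinity>"
    then have "summable (\<lambda>k. \<bar>h k x - h (Suc k) x\<bar>)"
      by (intro summable_suminf_not_top) auto
    then have "summable (\<lambda>k. \<bar>h (Suc k) x - h k x\<bar>)"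
      by (subst abs_minus_commute)
    then have "summable (\<lambda>k. h (Suc k) x - h k x)"
      by (rule summable_rabs_cancel)
    then have "convergent (\<lambda>n. \<Sum>k<n. h (Suc k) x - h k x)"
      by (simp add: summable_iff_convergent)
    then have "convergent (\<lambda>n. h n x - h 0 x)" by (simp only: sum_lessThan_telescope[of "\<lambda>k. h k x"])
    then show "convergent (\<lambda>k. h k x)" by (simp add: convergent_diff_const_right_iff)
  qed
  \<comment> \<open>\<open>lim\<close> is unspecified where the sequence diverges; clamping keeps
    \<open>P\<close> between 0 and \<open>F\<close> at every point.\<close>
  define P where "P x = min (F x) (max 0 (lim (\<lambda>k. h k x)))" for x
  have Pm[measurable]: "P \<in> borel_measurable lebesgue"
    unfolding P_def by (intro borel_measurable_min borel_measurable_max borel_measurable_lim_metric) auto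
  have P0: "0 \<le> P x" "P x \<le> F x" for x using F0[of x] by (auto simp: P_def)
  have limP: "AE x in lebesgue. (\<lambda>k. h k x) \<longlonglongrightarrow> P x"
    using conv
  proof eventually_elim
    fix x assume "convergent (\<lambda>k. h k x)"
    then have l: "(\<lambda>k. h k x) \<longlonglongrightarrow> lim (\<lambda>k. h k x)" by (simp add: convergent_LIMSEQ_iff)
    have "0 \<le> lim (\<lambda>k. h k x)" "lim (\<lambda>k. h k x) \<le> F x"
      using h0 by (auto intro!: LIMSEQ_le_const[OF l] LIMSEQ_le_const2[OF l])
    then show "(\<lambda>k. h k x) \<longlonglongrightarrow> P x" using l by (simp add: P_def)
  qed
  have YP: "Y (\<lambda>x. ennreal (P x)) \<le> 1"
  proof (rule bfs_liminf_le[OF Y, where F="\<lambda>k x. ennreal (h k x)" and b="\<lambda>_. 1"])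
    show "AE x in lebesgue. ennreal (P x) \<le> liminf (\<lambda>k. ennreal (h k x))"
      using limP
    proof eventually_elim
      fix x assume "(\<lambda>k. h k x) \<longlonglongrightarrow> P x"
      then have "(\<lambda>k. ennreal (h k x)) \<longlonglongrightarrow> ennreal (P x)" by (rule tendsto_ennrealI)
      then show "ennreal (P x) \<le> liminf (\<lambda>k. ennreal (h k x))"
        by (simp add: lim_imp_Liminf)
    qed
  qed (auto simp: hY)
  have PK: "P \<in> K" using P0 YP Pm by (auto simp: K_def)
  have "(\<lambda>k. J (h k)) \<longlonglongrightarrow> J P"
    unfolding J_def
  proof (rule integral_dominated_convergence[where w="\<lambda>x. (F x)\<^sup>2"])
    show "integrable lebesgue (\<lambda>x. (F x)\<^sup>2)" using int[OF zero] by simp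
    show "AE x in lebesgue. (\<lambda>k. (F x - h k x)\<^sup>2) \<longlonglongrightarrow> (F x - P x)\<^sup>2"
      using limP by eventually_elim (intro tendsto_intros)
    show "AE x in lebesgue. norm ((F x - h k x)\<^sup>2) \<le> (F x)\<^sup>2" for k
      using h0 by (auto intro!: AE_I2 power_mono)
  qed measurable
  moreover have "(\<lambda>k. I + (1/4)^k) \<longlonglongrightarrow> I + 0"
    by (intro tendsto_intros LIMSEQ_power_zero) auto
  ultimately have "J P \<le> I"
    using h(2) by (intro LIMSEQ_le[of "\<lambda>k. J (h k)" "J P" "\<lambda>k. I + (1/4)^k" I]) (auto intro: less_imp_le)
  then have "J P \<le> J h" if "h \<in> K" for h using Ile[OF that] by simp
  then show ?thesis
    using P0 by (intro that[OF Pm _ YP]) (auto simp: K_def J_def)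
qed

text \<open>Since \<open>P\<close> is nearest to \<open>F\<close>, the difference g = F - P
  satisfies (g, u) \<le> (g, P) =: \<beta> for all u in the unit ball, so g / \<beta> has associate
  norm at most 1. On the other hand (F, g) = (P, g) + (g, g) = \<beta> + (g, g), which exceeds
  \<beta> because \<open>F\<close> lies outside the unit ball.\<close>

lemma bfs_norming_function:
  fixes F :: "'n::euclidean_space \<Rightarrow> real"
  assumes Y: "ball_BFS Y" and F[measurable]: "F \<in> borel_measurable lebesgue"
    and F0: "\<And>x. 0 \<le> F x" and FN: "\<And>x. F x \<le> N" and FR: "\<And>x. x \<notin> ball 0 R \<Longrightarrow> F x = 0"
    and big: "1 < Y (\<lambda>x. ennreal (F x))"
  obtains g where "g \<in> borel_measurable lebesgue" "assoc_space Y g \<le> 1"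
    "1 < (\<integral>\<^sup>+x. ennreal (F x) * g x \<partial>lebesgue)"
proof -
  obtain P where Pm[measurable]: "P \<in> borel_measurable lebesgue"
    and P0': "\<forall>x. 0 \<le> P x \<and> P x \<le> F x" and YP: "Y (\<lambda>x. ennreal (P x)) \<le> 1"
    and min: "\<forall>h. h \<in> borel_measurable lebesgue \<longrightarrow> (\<forall>x. 0 \<le> h x \<and> h x \<le> F x) \<longrightarrow>
       Y (\<lambda>x. ennreal (h x)) \<le> 1 \<longrightarrow> (\<integral>x. (F x - P x)\<^sup>2 \<partial>lebesgue) \<le> (\<integral>x. (F x - h x)\<^sup>2 \<partial>lebesgue)"
    by (rule bfs_L2_projection[OF Y F F0 FN FR])
  have P0: "0 \<le> P x" "P x \<le> F x" for x using P0' by auto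
  define g where "g x = F x - P x" for x
  have gm[measurable]: "g \<in> borel_measurable lebesgue" unfolding g_def by measurable
  have g0: "0 \<le> g x" "g x \<le> N" for x using P0[of x] FN[of x] by (auto simp: g_def)
  have off: "x \<notin> ball 0 R \<Longrightarrow> P x = 0" "x \<notin> ball 0 R \<Longrightarrow> g x = 0" for x
    using P0[of x] FR[of x] by (auto simp: g_def)
  have N0: "0 \<le> N" using g0[of 0] by simp
  have PN: "P x \<le> N" for x using P0[of x] FN[of x] by simp
  have prod: "\<bar>a * b\<bar> \<le> c * d" if "0 \<le> a" "a \<le> c" "\<bar>b\<bar> \<le> d" for a b c d :: real
    using that by (auto simp: abs_mult intro!: mult_mono)
  have igP: "integrable lebesgue (\<lambda>x. g x * P x)"
    by (rule integrable_bounded_support[where N="N*N" and z=0 and r=R])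
       (auto simp: off intro!: prod g0 simp: P0 PN)
  have igg: "integrable lebesgue (\<lambda>x. (g x)\<^sup>2)"
    unfolding power2_eq_square
    by (rule integrable_bounded_support[where N="N*N" and z=0 and r=R])
       (auto simp: off g0 N0 intro!: mult_mono)
  have var: "(\<integral>x. g x * u x \<partial>lebesgue) \<le> (\<integral>x. g x * P x \<partial>lebesgue)"
    if um[measurable]: "u \<in> borel_measurable lebesgue" and u0: "\<And>x. 0 \<le> u x" and uM: "\<And>x. u x \<le> M"
      and uR: "\<And>x. x \<notin> ball 0 R \<Longrightarrow> u x = 0" and uY: "Y (\<lambda>x. ennreal (u x)) \<le> 1" for u M
  proof -
    have M0: "0 \<le> M" using u0[of 0] uM[of 0] by simp
    have uP: "\<bar>u x - P x\<bar> \<le> M + N" for x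
      using u0[of x] uM[of x] P0[of x] PN[of x] by linarith
    have i1: "integrable lebesgue (\<lambda>x. g x * (u x - P x))"
      by (rule integrable_bounded_support[where N="N*(M+N)" and z=0 and r=R])
         (auto simp: off intro!: prod g0 uP)
    have i2: "integrable lebesgue (\<lambda>x. (u x - P x)\<^sup>2)"
    proof (rule integrable_bounded_support[where N="(M+N)\<^sup>2" and z=0 and r=R])
      fix x show "\<bar>(u x - P x)\<^sup>2\<bar> \<le> (M+N)\<^sup>2" using power_mono[OF uP[of x], of 2] by simp
    qed (auto simp: off uR)
    have igu: "integrable lebesgue (\<lambda>x. g x * u x)"
      by (rule integrable_bounded_support[where N="N*M" and z=0 and r=R])
         (auto simp: off intro!: prod g0 simp: u0 uM)
    define A where "A = (\<integral>x. g x * (u x - P x) \<partial>lebesgue)"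
    define D where "D = (\<integral>x. (u x - P x)\<^sup>2 \<partial>lebesgue)"
    have key: "2 * A \<le> t * D" if t: "0 < t" "t < 1" for t
    proof -
      define w where "w x = (1 - t) * P x + t * u x" for x
      \<comment> \<open>The convex combination \<open>w\<close> may exceed \<open>F\<close>, and
        only functions below \<open>F\<close> compete with \<open>P\<close>. Cutting at
        \<open>F\<close> lowers the norm and does not increase the distance to
        \<open>F\<close>.\<close>
      define v where "v x = min (F x) (w x)" for x
      have [measurable]: "w \<in> borel_measurable lebesgue" "v \<in> borel_measurable lebesgue"
        unfolding v_def w_def by measurable
      have w0: "0 \<le> w x" for x using t P0 u0 by (auto simp: w_def)
      have "Y (\<lambda>x. ennreal (w x)) = Y (\<lambda>x. ennreal (1 - t) * ennreal (P x) + ennreal t * ennreal (u x))"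
        unfolding w_def using t P0 u0 by (simp add: ennreal_mult' ennreal_plus)
      also have "\<dots> \<le> Y (\<lambda>x. ennreal (1 - t) * ennreal (P x)) + Y (\<lambda>x. ennreal t * ennreal (u x))"
        by (intro bfs_add[OF Y]) measurable
      also have "\<dots> = ennreal (1 - t) * Y (\<lambda>x. ennreal (P x)) + ennreal t * Y (\<lambda>x. ennreal (u x))"
        by (subst (1 2) bfs_cmult[OF Y]) auto
      also have "\<dots> \<le> ennreal (1 - t) * 1 + ennreal t * 1"
        by (intro add_mono mult_left_mono YP uY) auto
      also have "\<dots> = 1" using t by (simp add: ennreal_plus[symmetric] del: ennreal_plus)
      finally have "Y (\<lambda>x. ennreal (w x)) \<le> 1" .
      moreover have "Y (\<lambda>x. ennreal (v x)) \<le> Y (\<lambda>x. ennreal (w x))"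
        by (intro bfs_mono[OF Y]) (auto simp: v_def intro!: ennreal_leI)
      ultimately have "Y (\<lambda>x. ennreal (v x)) \<le> 1" by simp
      then have "(\<integral>x. (F x - P x)\<^sup>2 \<partial>lebesgue) \<le> (\<integral>x. (F x - v x)\<^sup>2 \<partial>lebesgue)"
        using F0 w0 by (intro min[rule_format]) (auto simp: v_def)
      also have "\<dots> \<le> (\<integral>x. (g x)\<^sup>2 - 2 * t * (g x * (u x - P x)) + t\<^sup>2 * (u x - P x)\<^sup>2 \<partial>lebesgue)"
      proof (rule integral_mono)
        show "integrable lebesgue (\<lambda>x. (F x - v x)\<^sup>2)"
        proof (rule integrable_bounded_support[where N="N\<^sup>2" and z=0 and r=R])
          fix x
          show "\<bar>(F x - v x)\<^sup>2\<bar> \<le> N\<^sup>2"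
            using F0[of x] FN[of x] w0[of x] by (auto simp: v_def min_def intro!: power_mono)
        qed (auto simp: FR v_def w_def off uR)
        fix x
        have "(g x)\<^sup>2 - 2 * t * (g x * (u x - P x)) + t\<^sup>2 * (u x - P x)\<^sup>2 = (F x - w x)\<^sup>2"
          by (simp add: g_def w_def power2_eq_square algebra_simps)
        then show "(F x - v x)\<^sup>2 \<le> (g x)\<^sup>2 - 2 * t * (g x * (u x - P x)) + t\<^sup>2 * (u x - P x)\<^sup>2"
          by (auto simp: v_def min_def)
      qed (use igg i1 i2 in simp)
      also have "\<dots> = (\<integral>x. (F x - P x)\<^sup>2 \<partial>lebesgue) - 2 * t * A + t\<^sup>2 * D"
        unfolding A_def D_def using igg i1 i2 by (simp add: g_def)
      finally have "t * (2 * A) \<le> t * (t * D)" by (simp add: power2_eq_square algebra_simps)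
      then show ?thesis using t by (simp add: mult_le_cancel_left)
    qed
    have "A \<le> 0"
    proof (rule ccontr)
      assume "\<not> A \<le> 0"
      then have A: "0 < A" by simp
      have D: "0 \<le> D" by (simp add: D_def)
      \<comment> \<open>So small that t D \<le> A < 2 A, against \<open>key\<close>; the summand 1
        covers D = 0, and 1/2 keeps t below 1.\<close>
      define t where "t = min (1/2) (A / (D + 1))"
      have t: "0 < t" "t < 1" using A D by (auto simp: t_def)
      have "t * D \<le> A / (D + 1) * D" using D by (intro mult_right_mono) (auto simp: t_def)
      also have "\<dots> \<le> A" using A D by (simp add: field_simps)
      finally show False using key[OF t] A by simp
    qed
    then show ?thesis unfolding A_def using igu igP by (simp add: right_diff_distrib)
  qed
  define \<beta> where "\<beta> = (\<integral>x. g x * P x \<partial>lebesgue)"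
  have \<beta>0: "0 \<le> \<beta>" unfolding \<beta>_def using g0 P0 by (intro integral_nonneg_AE AE_I2) auto
  have le\<beta>: "(\<integral>\<^sup>+x. ennreal (g x) * h x \<partial>lebesgue) \<le> ennreal \<beta>"
    if hm[measurable]: "h \<in> borel_measurable lebesgue" and h: "Y h = 1" for h
  proof -
    \<comment> \<open>\<open>var\<close> concerns bounded functions vanishing off the ball.
      Truncations of \<open>h\<close> increase to \<open>h\<close> on the ball, and outside of it
      \<open>g\<close> is 0.\<close>
    define u where "u k x = enn2real (min (h x) (of_nat k)) * indicator (ball 0 R) x" for k x
    have um[measurable]: "u k \<in> borel_measurable lebesgue" for k unfolding u_def by measurable
    have eu: "ennreal (u k x) = min (h x) (of_nat k) * indicator (ball 0 R) x" for k x
    proof -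
      have "min (h x) (of_nat k) < \<infinity>" by (simp add: min_less_iff_disj of_nat_less_top)
      then show ?thesis by (auto simp: u_def indicator_def)
    qed
    have "(\<integral>\<^sup>+x. ennreal (g x) * h x \<partial>lebesgue) = (\<integral>\<^sup>+x. (SUP k. ennreal (g x) * ennreal (u k x)) \<partial>lebesgue)"
    proof (rule nn_integral_cong)
      fix x
      have *: "(SUP k. min (h x) (of_nat k)) = h x"
      proof -
        have "(SUP k. min (h x) (of_nat k)) = inf (h x) (SUP k. of_nat k)"
          unfolding inf_min[symmetric] by (subst inf_Sup) (simp add: image_image)
        then show ?thesis by (simp add: ennreal_SUP_of_nat_eq_top)
      qed
      show "ennreal (g x) * h x = (SUP k. ennreal (g x) * ennreal (u k x))"
      proof (cases "x \<in> ball 0 R")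
        case True
        then show ?thesis unfolding SUP_mult_left_ennreal[symmetric] eu using * by simp
      qed (simp add: off)
    qed
    also have "\<dots> = (SUP k. \<integral>\<^sup>+x. ennreal (g x) * ennreal (u k x) \<partial>lebesgue)"
    proof (rule nn_integral_monotone_convergence_SUP)
      show "incseq (\<lambda>k x. ennreal (g x) * ennreal (u k x))"
        unfolding eu by (intro incseq_SucI le_funI mult_left_mono mult_right_mono min.mono) auto
    qed measurable
    also have "\<dots> \<le> ennreal \<beta>"
    proof (rule SUP_least)
      fix k
      have u0: "0 \<le> u k x" "u k x \<le> real k" "x \<notin> ball 0 R \<Longrightarrow> u k x = 0" for x
      proof -
        show "0 \<le> u k x" "x \<notin> ball 0 R \<Longrightarrow> u k x = 0" by (auto simp: u_def)
        have "enn2real (min (h x) (of_nat k)) \<le> real k" by (rule enn2real_leI) (auto simp: ennreal_of_nat_eq_real_of_nat[symmetric])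
        then show "u k x \<le> real k" by (auto simp: u_def indicator_def)
      qed
      have "Y (\<lambda>x. ennreal (u k x)) \<le> Y h"
        by (intro bfs_mono[OF Y]) (auto simp: eu indicator_def)
      then have "(\<integral>x. g x * u k x \<partial>lebesgue) \<le> \<beta>"
        unfolding \<beta>_def using h u0 by (intro var[where M="real k"]) auto
      moreover have "integrable lebesgue (\<lambda>x. g x * u k x)"
        by (rule integrable_bounded_support[where N="N * real k" and z=0 and r=R])
           (auto simp: off intro!: prod g0 simp: u0)
      then have "(\<integral>\<^sup>+x. ennreal (g x * u k x) \<partial>lebesgue) = ennreal (\<integral>x. g x * u k x \<partial>lebesgue)"
        by (rule nn_integral_eq_integral) (auto simp: u0 g0)
      ultimately show "(\<integral>\<^sup>+x. ennreal (g x) * ennreal (u k x) \<partial>lebesgue) \<le> ennreal \<beta>"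
        using g0 u0 by (simp add: ennreal_mult'[symmetric] ennreal_leI)
    qed
    finally show ?thesis .
  qed
  have nz: "\<not> (AE x in lebesgue. g x = 0)"
  proof
    assume "AE x in lebesgue. g x = 0"
    then have "AE x in lebesgue. ennreal (F x) = ennreal (P x)" by eventually_elim (simp add: g_def)
    then have "Y (\<lambda>x. ennreal (F x)) = Y (\<lambda>x. ennreal (P x))" by (intro bfs_cong_AE[OF Y]) auto
    with big YP show False by simp
  qed
  have gg: "0 < (\<integral>x. (g x)\<^sup>2 \<partial>lebesgue)"
  proof -
    have "(\<integral>x. (g x)\<^sup>2 \<partial>lebesgue) \<noteq> 0"
      using nz integral_nonneg_eq_0_iff_AE[OF igg] by auto
    moreover have "0 \<le> (\<integral>x. (g x)\<^sup>2 \<partial>lebesgue)" by simp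
    ultimately show ?thesis by linarith
  qed
  \<comment> \<open>If \<beta> were 0, testing with the normalised indicator of the ball would make
    \<open>g\<close> vanish almost everywhere.\<close>
  have \<beta>: "0 < \<beta>"
  proof (rule ccontr)
    assume "\<not> 0 < \<beta>"
    then have "\<beta> = 0" using \<beta>0 by simp
    define I where "I = Y (indicator (ball 0 R))"
    have "R > 0"
    proof (rule ccontr)
      assume "\<not> R > 0"
      then have "g x = 0" for x using off by (simp add: ball_empty)
      then show False using nz by simp
    qed
    have I: "I \<noteq> 0" "I \<noteq> \<infinity>"
      using bfs_eq_0[OF Y, of "indicator (ball 0 R)"] not_AE_indicator_ball_0[OF \<open>R > 0\<close>, of 0]
        bfs_indicator_ball[OF Y, of 0 R] by (auto simp: I_def)
    have "Y (\<lambda>x. inverse I * indicator (ball 0 R) x) = inverse I * I"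
      unfolding I_def[symmetric]
      using I by (subst bfs_cmult[OF Y]) (auto simp: I_def[symmetric] top.not_eq_extremum[symmetric])
    also have "\<dots> = 1" using I ennreal_divide_self[of I] by (simp add: divide_ennreal_def mult.commute top.not_eq_extremum)
    finally have "(\<integral>\<^sup>+x. ennreal (g x) * (inverse I * indicator (ball 0 R) x) \<partial>lebesgue) \<le> ennreal \<beta>"
      by (intro le\<beta>) auto
    then have "AE x in lebesgue. ennreal (g x) * (inverse I * indicator (ball 0 R) x) = 0"
      using \<open>\<beta> = 0\<close> by (subst nn_integral_0_iff_AE[symmetric]) auto
    then have "AE x in lebesgue. g x = 0"
    proof eventually_elim
      fix x assume "ennreal (g x) * (inverse I * indicator (ball 0 R) x) = 0"
      then show "g x = 0"
        using I g0[of x] off(2)[of x] by (cases "x \<in> ball 0 R") (auto simp: ennreal_eq_0_iff)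
    qed
    with nz show False by simp
  qed
  define G where "G x = ennreal (g x / \<beta>)" for x
  have Ge: "G x = ennreal (1 / \<beta>) * ennreal (g x)" for x
    unfolding G_def using g0 \<beta> by (subst ennreal_mult'[symmetric]) auto
  have "assoc_space Y G \<le> 1"
    unfolding assoc_space_def
  proof (rule SUP_least)
    fix h assume "h \<in> {g. g \<in> borel_measurable lebesgue \<and> Y g = 1}"
    then have hm[measurable]: "h \<in> borel_measurable lebesgue" and h: "Y h = 1" by auto
    have "(\<integral>\<^sup>+x. G x * h x \<partial>lebesgue) = ennreal (1 / \<beta>) * (\<integral>\<^sup>+x. ennreal (g x) * h x \<partial>lebesgue)"
      unfolding Ge by (subst nn_integral_cmult[symmetric]) (auto simp: mult.assoc)
    also have "\<dots> \<le> ennreal (1 / \<beta>) * ennreal \<beta>" by (intro mult_left_mono le\<beta> hm h) simp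
    also have "\<dots> = 1" using \<beta> by (subst ennreal_mult'[symmetric]) auto
    finally show "(\<integral>\<^sup>+x. G x * h x \<partial>lebesgue) \<le> 1" .
  qed
  moreover have "1 < (\<integral>\<^sup>+x. ennreal (F x) * G x \<partial>lebesgue)"
  proof -
    have i: "integrable lebesgue (\<lambda>x. g x * P x + (g x)\<^sup>2)" using igP igg by simp
    have "1 < (\<beta> + (\<integral>x. (g x)\<^sup>2 \<partial>lebesgue)) / \<beta>" using \<beta> gg by (simp add: field_simps)
    also have "\<dots> = (\<integral>x. (g x * P x + (g x)\<^sup>2) / \<beta> \<partial>lebesgue)"
      using igP igg by (simp add: \<beta>_def)
    finally have "1 < ennreal (\<integral>x. (g x * P x + (g x)\<^sup>2) / \<beta> \<partial>lebesgue)"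
      by (simp flip: ennreal_1 add: ennreal_less_iff)
    also have "\<dots> = (\<integral>\<^sup>+x. ennreal ((g x * P x + (g x)\<^sup>2) / \<beta>) \<partial>lebesgue)"
      using i g0 P0 \<beta> by (intro nn_integral_eq_integral[symmetric]) auto
    also have "\<dots> = (\<integral>\<^sup>+x. ennreal (F x) * G x \<partial>lebesgue)"
      using F0 by (intro nn_integral_cong) (simp add: G_def ennreal_mult'[symmetric] g_def power2_eq_square algebra_simps)
    finally show ?thesis .
  qed
  moreover have "G \<in> borel_measurable lebesgue" unfolding G_def by measurable
  ultimately show ?thesis by (intro that[of G])
qed

text \<open>The nontrivial half of \<open>Y'' = Y\<close>.\<close>

lemma Lorentz_Luxemburg:
  fixes F :: "'n::euclidean_space \<Rightarrow> ennreal"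
  assumes Y: "ball_BFS Y" and [measurable]: "F \<in> borel_measurable lebesgue"
    and le: "\<And>g. g \<in> borel_measurable lebesgue \<Longrightarrow> assoc_space Y g \<le> 1 \<Longrightarrow>
      (\<integral>\<^sup>+x. F x * g x \<partial>lebesgue) \<le> c"
  shows "Y F \<le> c"
proof (rule ccontr)
  assume "\<not> Y F \<le> c"
  then have less: "c < Y F" by simp
  \<comment> \<open>Truncated in height and in support, since norming functions are available for
    bounded functions vanishing off a ball.\<close>
  define T where "T k x = min (F x) (of_nat k) * indicator (ball 0 (real k)) x" for k x
  have [measurable]: "T k \<in> borel_measurable lebesgue" for k unfolding T_def by measurable
  have "(\<lambda>k. Y (T k)) \<longlonglongrightarrow> Y F"
  proof (intro bfs_Fatou[OF Y] AE_I2 conjI)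
    fix x
    show inc: "incseq (\<lambda>k. T k x)"
      unfolding T_def by (intro incseq_SucI mult_mono min.mono) (auto simp: indicator_def)
    have "(SUP k. T k x) = F x"
    proof (rule antisym)
      show "(SUP k. T k x) \<le> F x" by (intro SUP_least) (auto simp: T_def indicator_def)
      have "F x = (SUP k. min (F x) (of_nat k))"
      proof -
        have "(SUP k. min (F x) (of_nat k)) = inf (F x) (SUP k. of_nat k)"
          unfolding inf_min[symmetric] by (subst inf_Sup) (simp add: image_image)
        then show ?thesis by (simp add: ennreal_SUP_of_nat_eq_top)
      qed
      also have "\<dots> \<le> (SUP k. T k x)"
      proof (intro SUP_least)
        fix k
        obtain j where j: "norm x < real j" using reals_Archimedean2 by blast
        have "min (F x) (of_nat k) \<le> T (max k j) x"
          using j by (auto simp: T_def intro: min.coboundedI2)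
        also have "\<dots> \<le> (SUP k. T k x)" by (rule SUP_upper) simp
        finally show "min (F x) (of_nat k) \<le> (SUP k. T k x)" .
      qed
      finally show "F x \<le> (SUP k. T k x)" .
    qed
    then show "(\<lambda>k. T k x) \<longlonglongrightarrow> F x" using LIMSEQ_SUP[OF inc] by simp
  qed measurable
  then have "\<forall>\<^sub>F k in sequentially. c < Y (T k)" using less by (rule order_tendstoD)
  then obtain k where k: "c < Y (T k)" by (auto simp: eventually_sequentially)
  \<comment> \<open>Dividing by a number strictly between \<open>c\<close> and the norm of
    \<open>T k\<close> puts the norm above 1, while the pairing with any \<open>g\<close> of the
    associate unit ball stays at most c / c' \<le> 1.\<close>
  then obtain c' where c': "c < ennreal c'" "ennreal c' < Y (T k)" "0 < c'"
  proof -
    obtain d where d: "c < d" "d < Y (T k)" using dense[OF k] by auto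
    then have "d < top" by (meson le_less_trans less_le_trans top_greatest)
    then have "d = ennreal (enn2real d)" by simp
    moreover have "0 < enn2real d"
      using d \<open>d < top\<close> by (simp add: enn2real_positive_iff le_less_trans[OF zero_le])
    ultimately have "d = ennreal (enn2real d)" "0 < enn2real d" by auto
    with d that[of "enn2real d"] show ?thesis by simp
  qed
  define F' where "F' x = enn2real (T k x) / c'" for x
  have Tle: "T k x \<le> of_nat k" for x by (auto simp: T_def indicator_def)
  have Tfin: "T k x < \<infinity>" for x using le_less_trans[OF Tle[of x] of_nat_less_top] by simp
  have TF: "ennreal (F' x) = ennreal (1 / c') * T k x" for x
    using c' Tfin[of x] by (simp add: F'_def ennreal_mult'[symmetric] divide_inverse mult.commute ennreal_mult'')
  have YF': "Y (\<lambda>x. ennreal (F' x)) = ennreal (1 / c') * Y (T k)"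
    unfolding TF by (intro bfs_cmult[OF Y]) auto
  have "1 = ennreal (1 / c') * ennreal c'" using c' by (subst ennreal_mult'[symmetric]) auto
  also have "\<dots> < ennreal (1 / c') * Y (T k)" using c' by (intro ennreal_mult_strict_left_mono) auto
  finally have "1 < Y (\<lambda>x. ennreal (F' x))" by (simp add: YF')
  then obtain g where g[measurable]: "g \<in> borel_measurable lebesgue" "assoc_space Y g \<le> 1"
    and gg: "1 < (\<integral>\<^sup>+x. ennreal (F' x) * g x \<partial>lebesgue)"
  proof (rule bfs_norming_function[OF Y, rotated 4])
    show "F' \<in> borel_measurable lebesgue" unfolding F'_def by measurable
    show "0 \<le> F' x" for x using c' by (simp add: F'_def)
    show "F' x \<le> real k / c'" for x
      unfolding F'_def using Tle[of x] c'
      by (intro divide_right_mono enn2real_leI) (auto simp: ennreal_of_nat_eq_real_of_nat[symmetric])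
    show "x \<notin> ball 0 (real k) \<Longrightarrow> F' x = 0" for x by (simp add: F'_def T_def)
  qed blast
  have "(\<integral>\<^sup>+x. ennreal (F' x) * g x \<partial>lebesgue) = ennreal (1 / c') * (\<integral>\<^sup>+x. T k x * g x \<partial>lebesgue)"
    unfolding TF by (subst nn_integral_cmult[symmetric]) (auto simp: mult.assoc)
  also have "\<dots> \<le> ennreal (1 / c') * (\<integral>\<^sup>+x. F x * g x \<partial>lebesgue)"
    by (intro mult_left_mono nn_integral_mono mult_right_mono) (auto simp: T_def indicator_def)
  also have "\<dots> \<le> ennreal (1 / c') * c"
    by (intro mult_left_mono le g) simp
  also have "\<dots> \<le> ennreal (1 / c') * ennreal c'" using c' by (intro mult_left_mono) auto
  also have "\<dots> = 1" using c' by (subst ennreal_mult'[symmetric]) auto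
  finally show False using gg by simp
qed

section \<open>Extrapolation with respect to the weights in the Muckenhoupt class A1\<close>

lemma epow_mono: "0 < r \<Longrightarrow> a \<le> b \<Longrightarrow> epow a r \<le> epow b r"
  by (cases a; cases b) (auto simp: epow_def top_unique intro!: ennreal_leI powr_mono2)

lemma epow_0 [simp]: "epow 0 r = 0"
  by (simp add: epow_def)

lemma epow_top [simp]: "epow top r = top"
  by (simp add: epow_def)

lemma epow_ennreal: "0 \<le> a \<Longrightarrow> epow (ennreal a) r = ennreal (a powr r)"
  by (simp add: epow_def)

lemma epow_epow: "epow (epow e a) b = epow e (a * b)"
  by (cases e) (auto simp: epow_def powr_powr)

lemma epow_one [simp]: "epow e 1 = e"
  by (cases e) (auto simp: epow_def)

lemma epow_mult: "0 < r \<Longrightarrow> epow (a * b) r = epow a r * epow b r"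
  by (cases a; cases b)
     (auto simp: epow_def powr_mult ennreal_mult'[symmetric] ennreal_mult_top ennreal_top_mult)

lemma epow_eq_0_iff [simp]: "epow e r = 0 \<longleftrightarrow> e = 0"
  by (cases e) (auto simp: epow_def)

lemma epow_eq_top_iff [simp]: "epow e r = top \<longleftrightarrow> e = top"
  by (auto simp: epow_def)

lemma borel_measurable_epow [measurable (raw)]:
  assumes [measurable]: "f \<in> borel_measurable M"
  shows "(\<lambda>x. epow (f x) r) \<in> borel_measurable M"
  unfolding epow_def by measurable

lemma tendsto_epow_exponent:
  assumes "r \<longlonglongrightarrow> 1"
  shows "(\<lambda>m. epow e (r m)) \<longlonglongrightarrow> e"
proof (cases e)
  case (real a)
  show ?thesis
  proof (cases "a = 0")
    case False
    have "(\<lambda>m. a powr r m) \<longlonglongrightarrow> a powr 1"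
      using False assms by (intro tendsto_powr tendsto_const) auto
    then have "(\<lambda>m. ennreal (a powr r m)) \<longlonglongrightarrow> ennreal (a powr 1)" by (rule tendsto_ennrealI)
    then show ?thesis using real by (simp add: epow_def)
  qed (simp add: real)
qed simp

lemma pow_space_eq: "pow_space t X f = epow (X (\<lambda>x. epow (f x) t)) (1 / t)"
  by (simp add: pow_space_def epow_def)

section \<open>Rubio de Francia iteration and extrapolation\<close>

lemma measurable_maximal_op_funpow [measurable]:
  fixes g :: "'n::euclidean_space \<Rightarrow> ennreal"
  assumes "g \<in> borel_measurable lebesgue"
  shows "(maximal_op ^^ k) g \<in> borel_measurable lebesgue"
  using assms by (induction k) (auto intro: borel_measurable_maximal_op)

text \<open>Rubio de Francia's series: w is the sum of (2A)^(-k) M^k g. Applying M shifts it by one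
  index, which costs the factor 2A; since M has norm at most A, the k-th term has at most 2^(-k)
  times the associate norm of g, and these sum to the factor 2.\<close>

lemma A1_majorant:
  fixes g :: "'n::euclidean_space \<Rightarrow> ennreal"
  assumes A: "0 < A" and g[measurable]: "g \<in> borel_measurable lebesgue"
    and M: "\<And>f. f \<in> borel_measurable lebesgue \<Longrightarrow>
      assoc_space Y (maximal_op f) \<le> ennreal A * assoc_space Y f"
  obtains w where "w \<in> borel_measurable lebesgue" "\<And>x. g x \<le> w x"
    "\<And>x. maximal_op w x \<le> ennreal (2 * A) * w x" "assoc_space Y w \<le> 2 * assoc_space Y g"
proof -
  define c where "c = ennreal (1 / (2 * A))"
  define h where "h k x = c ^ k * (maximal_op ^^ k) g x" for k x
  have [measurable]: "(maximal_op ^^ k) g \<in> borel_measurable lebesgue" for k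
    by (rule measurable_maximal_op_funpow[OF g])
  have [measurable]: "h k \<in> borel_measurable lebesgue" for k
    unfolding h_def by measurable
  define w where "w x = (\<Sum>k. h k x)" for x
  have wm: "w \<in> borel_measurable lebesgue" unfolding w_def by measurable
  have gw: "g x \<le> w x" for x
  proof -
    have "sum (\<lambda>k. h k x) {..<1} \<le> w x" unfolding w_def by (intro sum_le_suminf) auto
    then show ?thesis by (simp add: h_def)
  qed
  have c2: "ennreal (2 * A) * c = 1"
    unfolding c_def using A by (subst ennreal_mult'[symmetric]) auto
  have hS: "maximal_op (h k) x = ennreal (2 * A) * h (Suc k) x" for k x
  proof -
    have "maximal_op (h k) x = c ^ k * (maximal_op ^^ Suc k) g x"
      unfolding h_def by (subst maximal_op_cmult) auto
    also have "\<dots> = (ennreal (2 * A) * c) * (c ^ k * (maximal_op ^^ Suc k) g x)" by (simp only: c2 mult_1_left)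
    also have "\<dots> = ennreal (2 * A) * h (Suc k) x" unfolding h_def power_Suc by (simp only: mult.assoc)
    finally show ?thesis .
  qed
  have Mw: "maximal_op w x \<le> ennreal (2 * A) * w x" for x
  proof -
    have "maximal_op w x \<le> (\<Sum>k. maximal_op (h k) x)"
      unfolding w_def by (intro maximal_op_suminf_le) measurable
    also have "\<dots> = ennreal (2 * A) * (\<Sum>k. h (Suc k) x)" unfolding hS by simp
    also have "(\<Sum>k. h (Suc k) x) \<le> w x"
    proof -
      have "(\<Sum>k<n. h (Suc k) x) \<le> w x" for n
      proof -
        have "(\<Sum>k<n. h (Suc k) x) \<le> (\<Sum>k<Suc n. h k x)"
          by (subst sum.lessThan_Suc_shift) simp
        also have "\<dots> \<le> w x" unfolding w_def by (intro sum_le_suminf) auto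
        finally show ?thesis .
      qed
      then show ?thesis by (subst suminf_eq_SUP) (auto intro: SUP_least)
    qed
    finally show ?thesis by (simp add: mult_left_mono)
  qed
  have hY: "assoc_space Y (h k) \<le> ennreal ((1/2)^k) * assoc_space Y g" for k
  proof (induction k)
    case 0 then show ?case by (simp add: h_def)
  next
    case (Suc k)
    have "h (Suc k) x = c * maximal_op (h k) x" for x
      unfolding hS using c2 by (simp add: mult.assoc[symmetric] mult.commute[of c])
    then have "assoc_space Y (h (Suc k)) = assoc_space Y (\<lambda>x. c * maximal_op (h k) x)" by presburger
    also have "\<dots> = c * assoc_space Y (maximal_op (h k))"
      by (intro assoc_space_cmult) measurable
    also have "\<dots> \<le> c * (ennreal A * (ennreal ((1/2)^k) * assoc_space Y g))"
      by (intro mult_left_mono order_trans[OF M] Suc.IH) auto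
    also have "\<dots> = (c * ennreal A * ennreal ((1/2)^k)) * assoc_space Y g" by (simp only: mult.assoc)
    also have "c * ennreal A * ennreal ((1/2)^k) = ennreal ((1/2)^Suc k)"
    proof -
      have p: "0 \<le> 1 / (2 * A)" "0 \<le> 1 / (2 * A) * A" using A by auto
      have "c * ennreal A * ennreal ((1/2)^k) = ennreal (1 / (2 * A) * A * (1/2)^k)"
        unfolding c_def by (simp only: ennreal_mult'[OF p(1)] ennreal_mult'[OF p(2)])
      also have "1 / (2 * A) * A * (1/2)^k = (1/2)^Suc k" using A by simp
      finally show ?thesis .
    qed
    finally show ?case .
  qed
  have "assoc_space Y w \<le> (\<Sum>k. assoc_space Y (h k))"
    unfolding w_def by (intro assoc_space_suminf_le) measurable
  also have "\<dots> \<le> (\<Sum>k. ennreal ((1/2)^k) * assoc_space Y g)"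
    by (intro suminf_le hY) auto
  also have "\<dots> = ennreal 2 * assoc_space Y g"
    unfolding ennreal_suminf_multc by (subst suminf_ennreal2) (auto simp: suminf_geometric)
  finally have "assoc_space Y w \<le> 2 * assoc_space Y g" by simp
  with wm gw Mw show ?thesis by (rule that)
qed

text \<open>By duality it suffices to test \<open>H\<close> with functions \<open>g\<close> of
  associate norm at most 1. Each is replaced by its majorant \<open>w\<close>, to which the weighted
  bound applies; Hoelder's inequality then returns to the norm of \<open>a\<close>. The majorant has
  associate norm at most 2, whence the factor 2.\<close>

lemma weighted_extrapolation:
  fixes H a :: "'n::euclidean_space \<Rightarrow> ennreal"
  assumes Y: "ball_BFS Y" and A: "0 < A" and c: "0 < c"
    and [measurable]: "H \<in> borel_measurable lebesgue" "a \<in> borel_measurable lebesgue"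
    and M: "\<And>f. f \<in> borel_measurable lebesgue \<Longrightarrow>
      assoc_space Y (maximal_op f) \<le> ennreal A * assoc_space Y f"
    and weighted: "\<And>w. w \<in> borel_measurable lebesgue \<Longrightarrow> (\<And>x. maximal_op w x \<le> ennreal (2 * A) * w x) \<Longrightarrow>
      (\<integral>\<^sup>+x. H x * w x \<partial>lebesgue) \<le> ennreal c * (\<integral>\<^sup>+x. a x * w x \<partial>lebesgue)"
  shows "Y H \<le> ennreal (2 * c) * Y a"
proof (cases "Y a < \<infinity>")
  case False
  then show ?thesis using c by (simp add: ennreal_mult_top top.not_eq_extremum[symmetric])
next
  case fin: True
  show ?thesis
  proof (rule Lorentz_Luxemburg[OF Y])
    fix g :: "'n \<Rightarrow> ennreal"
    assume [measurable]: "g \<in> borel_measurable lebesgue" and g1: "assoc_space Y g \<le> 1"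
    obtain w where w: "w \<in> borel_measurable lebesgue" "\<And>x. g x \<le> w x"
      "\<And>x. maximal_op w x \<le> ennreal (2 * A) * w x" "assoc_space Y w \<le> 2 * assoc_space Y g"
      using A1_majorant[OF A, of g Y] M by auto
    have "(\<integral>\<^sup>+x. H x * g x \<partial>lebesgue) \<le> (\<integral>\<^sup>+x. H x * w x \<partial>lebesgue)"
      by (intro nn_integral_mono mult_left_mono w) auto
    also have "\<dots> \<le> ennreal c * (\<integral>\<^sup>+x. a x * w x \<partial>lebesgue)" by (intro weighted w)
    also have "\<dots> \<le> ennreal c * (Y a * assoc_space Y w)"
      using w(1) fin by (intro mult_left_mono assoc_space_Hoelder[OF Y]) auto
    also have "\<dots> \<le> ennreal c * (Y a * (2 * 1))"
      using order_trans[OF w(4) mult_left_mono[OF g1, of 2]] by (intro mult_left_mono) auto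
    also have "\<dots> = ennreal (2 * c) * Y a"
      using c by (simp add: ennreal_mult' mult_ac)
    finally show "(\<integral>\<^sup>+x. H x * g x \<partial>lebesgue) \<le> ennreal (2 * c) * Y a" .
  qed measurable
qed

text \<open>Only the spaces \<open>X\<^bsup>1/\<theta>\<^esup>\<close> admit extrapolation; as \<open>\<theta> \<rightarrow> 1\<close> the Fatou property
  handles the left-hand side and boundedness of \<open>a\<close> the right-hand side.\<close>

lemma weighted_transfer:
  fixes X :: "('n::euclidean_space) fnorm"
  assumes X: "ball_BFS X"
    and \<theta>: "\<forall>m. 0 < \<theta> m \<and> \<theta> m < 1" "\<theta> \<longlonglongrightarrow> 1"
    and Xth: "\<forall>m. ball_BFS (pow_space (1 / \<theta> m) X)"
    and Mlim: "\<exists>L. L < \<infinity> \<and> (\<lambda>m. M_opnorm (assoc_space (pow_space (1 / \<theta> m) X))) \<longlonglongrightarrow> L"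
  shows "\<exists>A\<ge>1. \<forall>H a N c. H \<in> borel_measurable lebesgue \<longrightarrow> a \<in> borel_measurable lebesgue \<longrightarrow>
    (\<forall>x. a x \<le> ennreal N) \<longrightarrow> 0 < c \<longrightarrow>
    (\<forall>w. w \<in> borel_measurable lebesgue \<longrightarrow> (\<forall>x. maximal_op w x \<le> ennreal A * w x) \<longrightarrow>
      (\<integral>\<^sup>+x. H x * w x \<partial>lebesgue) \<le> ennreal c * (\<integral>\<^sup>+x. a x * w x \<partial>lebesgue)) \<longrightarrow>
    X H \<le> ennreal (2 * c) * X a"
proof -
  obtain L where L: "L < \<infinity>" "(\<lambda>m. M_opnorm (assoc_space (pow_space (1 / \<theta> m) X))) \<longlonglongrightarrow> L"
    using Mlim by blast
  \<comment> \<open>A number above the limit bounds the operator norms from some index on, so one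
    class of weights serves all the remaining spaces.\<close>
  define l where "l = enn2real L + 1"
  have "L < ennreal l"
    using L(1) by (cases L) (auto simp: l_def ennreal_less_iff)
  then have "\<forall>\<^sub>F m in sequentially. M_opnorm (assoc_space (pow_space (1 / \<theta> m) X)) < ennreal l"
    by (rule order_tendstoD(2)[OF L(2)])
  then obtain m0 where m0: "\<And>m. m \<ge> m0 \<Longrightarrow> M_opnorm (assoc_space (pow_space (1 / \<theta> m) X)) < ennreal l"
    by (auto simp: eventually_sequentially)
  have l: "1 \<le> l" by (simp add: l_def)
  have M: "assoc_space (pow_space (1 / \<theta> m) X) (maximal_op f) \<le> ennreal l * assoc_space (pow_space (1 / \<theta> m) X) f"
    if f: "f \<in> borel_measurable lebesgue" and m: "m \<ge> m0" for f m
  proof -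
    let ?Z = "assoc_space (pow_space (1 / \<theta> m) X)"
    obtain C where C: "C < ennreal l" "\<forall>f. f \<in> borel_measurable lebesgue \<longrightarrow> ?Z (maximal_op f) \<le> C * ?Z f"
      using m0[OF m] unfolding M_opnorm_def Inf_less_iff by auto
    then have "?Z (maximal_op f) \<le> C * ?Z f" using f by blast
    also have "\<dots> \<le> ennreal l * ?Z f" using C(1) by (intro mult_right_mono) auto
    finally show ?thesis .
  qed
  show ?thesis
  proof (intro exI[of _ "2 * l"] conjI allI impI)
    show "1 \<le> 2 * l" using l by simp
    fix H a :: "'n \<Rightarrow> ennreal" and N c :: real
    assume Hm[measurable]: "H \<in> borel_measurable lebesgue" and am[measurable]: "a \<in> borel_measurable lebesgue"
      and aN: "\<forall>x. a x \<le> ennreal N" and c: "0 < c"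
      and wt: "\<forall>w. w \<in> borel_measurable lebesgue \<longrightarrow> (\<forall>x. maximal_op w x \<le> ennreal (2 * l) * w x) \<longrightarrow>
      (\<integral>\<^sup>+x. H x * w x \<partial>lebesgue) \<le> ennreal c * (\<integral>\<^sup>+x. a x * w x \<partial>lebesgue)"
    define K where "K = max 1 N"
    have K: "1 \<le> K" "\<And>x. a x \<le> ennreal K"
      using aN by (auto simp: K_def intro: order_trans[OF _ ennreal_leI])
    define r where "r m = 1 / \<theta> (m + m0)" for m
    have r: "1 < r m" for m using \<theta>(1) by (auto simp: r_def)
    have "(\<lambda>m. \<theta> (m + m0)) \<longlonglongrightarrow> 1" using \<theta>(2) by (rule LIMSEQ_ignore_initial_segment)
    then have "(\<lambda>m. 1 / \<theta> (m + m0)) \<longlonglongrightarrow> 1 / 1" by (intro tendsto_divide tendsto_const) auto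
    then have rlim: "r \<longlonglongrightarrow> 1" by (simp add: r_def[abs_def])
    \<comment> \<open>Extrapolation in X^r, raised to the power r, leaves X(a^r) on the right, and
      a^r \<le> K^(r-1) a because a \<le> K. As r tends to 1 the constants converge to 2c.\<close>
    define b where "b m = ennreal ((2 * c) powr r m * K powr (r m - 1)) * X a" for m
    have bound: "X (\<lambda>x. epow (H x) (r m)) \<le> b m" for m
    proof -
      let ?Y = "pow_space (r m) X"
      have Y: "ball_BFS ?Y" using Xth by (simp add: r_def)
      have "?Y H \<le> ennreal (2 * c) * ?Y a"
        using l c wt M[of _ "m + m0"] by (intro weighted_extrapolation[OF Y, of l]) (auto simp: r_def)
      then have "epow (?Y H) (r m) \<le> epow (ennreal (2 * c) * ?Y a) (r m)"
        using r[of m] by (intro epow_mono) auto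
      then have "X (\<lambda>x. epow (H x) (r m)) \<le> ennreal ((2 * c) powr r m) * X (\<lambda>x. epow (a x) (r m))"
        using r[of m] c by (simp add: pow_space_eq epow_mult epow_epow epow_ennreal)
      also have "X (\<lambda>x. epow (a x) (r m)) \<le> X (\<lambda>x. ennreal (K powr (r m - 1)) * a x)"
      proof (rule bfs_mono[OF X])
        fix x
        have "a x < \<infinity>" using K(2)[of x] by (simp add: order_le_less_trans)
        then obtain t where t: "a x = ennreal t" "0 \<le> t" by (cases "a x") auto
        have "t \<le> K" using K(2)[of x] K(1) t by (simp add: ennreal_le_iff)
        have "t powr r m = t powr (r m - 1) * t"
          using t by (cases "t = 0") (simp_all add: powr_diff)
        also have "\<dots> \<le> K powr (r m - 1) * t"
          using t \<open>t \<le> K\<close> r[of m] by (intro mult_right_mono powr_mono2) auto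
        finally show "epow (a x) (r m) \<le> ennreal (K powr (r m - 1)) * a x"
          using t by (simp add: epow_ennreal ennreal_mult'[symmetric] ennreal_leI)
      qed measurable
      also have "\<dots> = ennreal (K powr (r m - 1)) * X a"
        by (intro bfs_cmult[OF X]) auto
      finally show ?thesis by (simp add: b_def ennreal_mult' mult.assoc mult_left_mono)
    qed
    have blim: "b \<longlonglongrightarrow> ennreal (2 * c) * X a"
    proof -
      have "(\<lambda>m. (2 * c) powr r m * K powr (r m - 1)) \<longlonglongrightarrow> (2 * c) powr 1 * K powr (1 - 1)"
        using c K(1) by (intro tendsto_intros rlim) auto
      then have "(\<lambda>m. ennreal ((2 * c) powr r m * K powr (r m - 1))) \<longlonglongrightarrow> ennreal (2 * c)"
        using c K(1) by (intro tendsto_ennrealI) simp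
      then show ?thesis
        unfolding b_def using c by (intro tendsto_mult_ennreal tendsto_const) auto
    qed
    show "X H \<le> ennreal (2 * c) * X a"
    proof (rule bfs_liminf_le[OF X _ _ _ bound blim])
      show "AE x in lebesgue. H x \<le> liminf (\<lambda>m. epow (H x) (r m))"
        using lim_imp_Liminf[OF _ tendsto_epow_exponent[OF rlim]] by (intro AE_I2) auto
    qed measurable
  qed
qed

section \<open>Weighted kernel estimates\<close>

definition riesz_kernel :: "real \<Rightarrow> 'n::euclidean_space \<Rightarrow> 'n \<Rightarrow> ennreal" where
  "riesz_kernel \<gamma> x y = ennreal (norm (x - y) powr (\<gamma> - real DIM('n)))"

lemma borel_measurable_riesz_kernel [measurable]:
  "(\<lambda>(x, y). riesz_kernel \<gamma> x y) \<in> borel_measurable (lebesgue \<Otimes>\<^sub>M lebesgue)"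
  unfolding riesz_kernel_def by measurable

lemma borel_measurable_riesz_kernel_left [measurable]:
  "(\<lambda>x. riesz_kernel \<gamma> x y) \<in> borel_measurable lebesgue"
  unfolding riesz_kernel_def by measurable

lemma riesz_kernel_commute: "riesz_kernel \<gamma> x y = riesz_kernel \<gamma> y x"
  by (simp add: riesz_kernel_def norm_minus_commute)

text \<open>On a dyadic shell a power of the distance is constant up to a factor, whatever the sign
  of the exponent.\<close>

lemma powr_le_two_powr_abs:
  fixes u :: real
  assumes "0 < \<rho>" "\<rho> / 2 \<le> u" "u \<le> \<rho>"
  shows "u powr e \<le> 2 powr \<bar>e\<bar> * \<rho> powr e"
proof (cases "0 \<le> e")
  case True
  then have "u powr e \<le> \<rho> powr e" using assms by (intro powr_mono2) auto
  moreover have "1 \<le> 2 powr \<bar>e\<bar>" by (simp add: ge_one_powr_ge_zero)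
  ultimately show ?thesis
    using mult_mono[of 1 "2 powr \<bar>e\<bar>" "u powr e" "\<rho> powr e"] by simp
next
  case False
  then have "u powr e \<le> (\<rho> / 2) powr e" using assms by (intro powr_mono2') auto
  also have "\<dots> = 2 powr \<bar>e\<bar> * \<rho> powr e"
    using False assms by (simp add: powr_divide powr_minus field_simps)
  finally show ?thesis .
qed

text \<open>Cut the region into dyadic shells. On a shell of outer radius \<rho> the kernel is of
  order \<rho>^(\<gamma>-n) and \<open>w\<close> has mass at most a constant times \<rho>^n M w(y),
  so the shell contributes \<rho>^\<gamma> M w(y). The numbers \<rho>^\<gamma> are dominated by a
  geometric series starting at t: for \<gamma> > 0 the shells shrink to y, for \<gamma> < 0 they
  escape to infinity.\<close>

lemma riesz_kernel_superlevel_integral_real: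
  fixes \<gamma> :: real
  assumes \<gamma>: "\<gamma> \<noteq> 0"
  shows "\<exists>C>0. \<forall>w (y::'n::euclidean_space) t. w \<in> borel_measurable lebesgue \<longrightarrow> 0 \<le> t \<longrightarrow>
    (\<integral>\<^sup>+x. indicator {x. norm (x - y) powr \<gamma> < t} x * riesz_kernel \<gamma> x y * w x \<partial>lebesgue)
      \<le> ennreal (C * t) * maximal_op w y"
proof -
  define n where "n = real DIM('n)"
  define V where "V = unit_ball_vol n"
  define D where "D = 2 powr \<bar>\<gamma> - n\<bar>"
  define q where "q = 2 powr (- \<bar>\<gamma>\<bar>)"
  have q: "0 < q" "q < 1" using \<gamma> powr_less_mono[of "- \<bar>\<gamma>\<bar>" 0 2] by (auto simp: q_def)
  have V: "0 < V" by (simp add: V_def n_def)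
  have D: "0 < D" by (simp add: D_def)
  show ?thesis
  proof (intro exI[of _ "D * V / (1 - q)"] conjI allI impI)
    show "0 < D * V / (1 - q)" using q V D by simp
    fix w :: "'n \<Rightarrow> ennreal" and y :: 'n and t :: real
    assume [measurable]: "w \<in> borel_measurable lebesgue" and "0 \<le> t"
    show "(\<integral>\<^sup>+x. indicator {x. norm (x - y) powr \<gamma> < t} x * riesz_kernel \<gamma> x y * w x \<partial>lebesgue)
      \<le> ennreal (D * V / (1 - q) * t) * maximal_op w y"
    proof (cases "t = 0")
      case True
      have "{x. norm (x - y) powr \<gamma> < t} = {}" by (auto simp: True not_less)
      then show ?thesis by simp
    next
      case False
      then have t: "0 < t" using \<open>0 \<le> t\<close> by simp
      define T where "T = t powr (1 / \<gamma>)"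
      \<comment> \<open>\<open>T\<close> is the distance at which |x-y|^\<gamma> = t. The region
        lies inside this radius for \<gamma> > 0 and outside for \<gamma> < 0; in the second case
        the first shell runs from \<open>T\<close> to 2 \<open>T\<close>, hence the exponent k +
        1.\<close>
      define \<rho> where "\<rho> k = T * 2 powr (if 0 < \<gamma> then - real k else real k + 1)" for k :: nat
      have T: "0 < T" "T powr \<gamma> = t" using t \<gamma> by (auto simp: T_def powr_powr)
      have \<rho>0: "0 < \<rho> k" for k using T by (simp add: \<rho>_def)
      have \<rho>\<gamma>: "\<rho> k powr \<gamma> \<le> t * q ^ k" for k
      proof -
        have "\<rho> k powr \<gamma> = t * 2 powr ((if 0 < \<gamma> then - real k else real k + 1) * \<gamma>)"
          using T by (simp add: \<rho>_def powr_mult powr_powr)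
        also have "\<dots> \<le> t * 2 powr (- \<bar>\<gamma>\<bar> * real k)"
          using t by (intro mult_left_mono powr_mono) (auto simp: algebra_simps)
        also have "2 powr (- \<bar>\<gamma>\<bar> * real k) = q ^ k"
          by (simp add: q_def powr_powr powr_realpow[symmetric])
        finally show ?thesis .
      qed
      have ex: "\<exists>k. \<rho> k / 2 \<le> u \<and> u < \<rho> k" if u: "0 < u" "u powr \<gamma> < t" for u
      proof (cases "0 < \<gamma>")
        case True
        have "u < T"
        proof (rule ccontr)
          assume "\<not> u < T"
          then have "T powr \<gamma> \<le> u powr \<gamma>" using T True by (intro powr_mono2) auto
          then show False using u T by simp
        qed
        obtain k where k: "\<rho> k \<le> u"
        proof -
          have "(\<lambda>k. T * (1/2) ^ k) \<longlonglongrightarrow> T * 0" by (intro tendsto_intros LIMSEQ_power_zero) auto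
          then have "\<forall>\<^sub>F k in sequentially. T * (1/2) ^ k < u" using u by (intro order_tendstoD(2)[where y = "T * 0"]) auto
          then obtain k where "T * (1/2) ^ k < u" by (auto simp: eventually_sequentially)
          moreover have "\<rho> k = T * (1/2) ^ k"
            using True by (simp add: \<rho>_def powr_minus powr_realpow power_one_over inverse_eq_divide)
          ultimately show ?thesis by (intro that[of k]) simp
        qed
        define j where "j = (LEAST k. \<rho> k \<le> u)"
        have j: "\<rho> j \<le> u" unfolding j_def using k by (rule LeastI)
        have "\<rho> 0 = T" using True by (simp add: \<rho>_def)
        then have "j \<noteq> 0" using j \<open>u < T\<close> by (metis not_le)
        then obtain i where i: "j = Suc i" by (cases j) auto
        have "u < \<rho> i" using not_less_Least[of i "\<lambda>k. \<rho> k \<le> u"] i by (auto simp: j_def)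
        moreover have "\<rho> i / 2 = \<rho> j"
          using True by (simp add: \<rho>_def i powr_diff powr_minus field_simps)
        ultimately show ?thesis using j by (intro exI[of _ i]) simp
      next
        case neg: False
        have "T < u"
        proof (rule ccontr)
          assume "\<not> T < u"
          then have "T powr \<gamma> \<le> u powr \<gamma>" using T neg \<gamma> u by (intro powr_mono2') auto
          then show False using u T by simp
        qed
        have \<rho>e: "\<rho> k = 2 * T * 2 ^ k" for k
          using neg by (simp add: \<rho>_def powr_add powr_realpow)
        obtain k where k: "u < \<rho> k"
        proof -
          obtain k where "u / (2 * T) < 2 ^ k" using real_arch_pow[of 2 "u / (2 * T)"] by auto
          then show ?thesis using T by (intro that[of k]) (simp add: \<rho>e field_simps)
        qed
        define j where "j = (LEAST k. u < \<rho> k)"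
        have j: "u < \<rho> j" unfolding j_def using k by (rule LeastI)
        have "\<rho> j / 2 \<le> u"
        proof (cases j)
          case 0
          then show ?thesis using \<open>T < u\<close> by (simp add: \<rho>e)
        next
          case (Suc i)
          then show ?thesis using not_less_Least[of i "\<lambda>k. u < \<rho> k"] by (auto simp: j_def \<rho>e)
        qed
        then show ?thesis using j by auto
      qed
      define c where "c k = ennreal (D * \<rho> k powr (\<gamma> - n))" for k
      have pt: "indicator {x. norm (x - y) powr \<gamma> < t} x * riesz_kernel \<gamma> x y \<le> (\<Sum>k. c k * indicator (ball y (\<rho> k)) x)" for x
      \<comment> \<open>The diagonal always belongs to the superlevel set, since
        \<open>0 powr e = 0\<close> for both signs of the exponent; for the same reason the kernel
        vanishes there.\<close>
      proof (cases "x \<noteq> y \<and> norm (x - y) powr \<gamma> < t")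
        case True
        then obtain k where k: "\<rho> k / 2 \<le> norm (x - y)" "norm (x - y) < \<rho> k" using ex[of "norm (x - y)"] by auto
        have "riesz_kernel \<gamma> x y \<le> c k"
          unfolding riesz_kernel_def c_def D_def n_def[symmetric]
          using powr_le_two_powr_abs[OF \<rho>0 k(1)] k(2) by (intro ennreal_leI) auto
        also have "\<dots> = (\<Sum>k\<in>{k}. c k * indicator (ball y (\<rho> k)) x)"
          using k by (simp add: dist_norm norm_minus_commute)
        also have "\<dots> \<le> (\<Sum>k. c k * indicator (ball y (\<rho> k)) x)"
          by (intro sum_le_suminf) auto
        finally show ?thesis by (auto simp: indicator_def)
      qed (auto simp: riesz_kernel_def indicator_def)
      have "(\<integral>\<^sup>+x. indicator {x. norm (x - y) powr \<gamma> < t} x * riesz_kernel \<gamma> x y * w x \<partial>lebesgue)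
          \<le> (\<integral>\<^sup>+x. (\<Sum>k. c k * (w x * indicator (ball y (\<rho> k)) x)) \<partial>lebesgue)"
      proof (rule nn_integral_mono)
        fix x
        have "indicator {x. norm (x - y) powr \<gamma> < t} x * riesz_kernel \<gamma> x y * w x \<le> (\<Sum>k. c k * indicator (ball y (\<rho> k)) x) * w x"
          by (intro mult_right_mono pt) auto
        also have "\<dots> = (\<Sum>k. c k * indicator (ball y (\<rho> k)) x * w x)"
          by (rule ennreal_suminf_multc[symmetric])
        also have "\<dots> = (\<Sum>k. c k * (w x * indicator (ball y (\<rho> k)) x))"
          by (simp only: mult.assoc mult.commute[of "w x"])
        finally show "indicator {x. norm (x - y) powr \<gamma> < t} x * riesz_kernel \<gamma> x y * w x \<le> (\<Sum>k. c k * (w x * indicator (ball y (\<rho> k)) x))" .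
      qed
      also have "\<dots> = (\<Sum>k. c k * (\<integral>\<^sup>+x. w x * indicator (ball y (\<rho> k)) x \<partial>lebesgue))"
        by (subst nn_integral_suminf) (auto simp: nn_integral_cmult)
      also have "\<dots> \<le> (\<Sum>k. ennreal (D * V * t * q ^ k) * maximal_op w y)"
      proof (intro suminf_le allI)
        fix k
        have "c k * (\<integral>\<^sup>+x. w x * indicator (ball y (\<rho> k)) x \<partial>lebesgue)
          \<le> c k * (ennreal (V * \<rho> k ^ DIM('n)) * maximal_op w y)"
          unfolding V_def n_def by (intro mult_left_mono ball_integral_le_maximal_op \<rho>0) auto
        also have "\<dots> = ennreal (D * V * \<rho> k powr \<gamma>) * maximal_op w y"
        proof -
          have "\<rho> k powr (\<gamma> - n) * \<rho> k ^ DIM('n) = \<rho> k powr \<gamma>"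
            using \<rho>0[of k] by (simp add: n_def powr_realpow[symmetric] powr_add[symmetric])
          then have eq: "D * \<rho> k powr (\<gamma> - n) * (V * \<rho> k ^ DIM('n)) = D * V * \<rho> k powr \<gamma>"
            by (simp add: mult_ac)
          have "c k * ennreal (V * \<rho> k ^ DIM('n)) = ennreal (D * V * \<rho> k powr \<gamma>)"
            unfolding c_def eq[symmetric] using D by (intro ennreal_mult'[symmetric]) simp
          then show ?thesis by (simp add: mult.assoc[symmetric])
        qed
        also have "\<dots> \<le> ennreal (D * V * t * q ^ k) * maximal_op w y"
          using \<rho>\<gamma>[of k] D V by (intro mult_right_mono ennreal_leI) (auto simp: mult.assoc)
        finally show "c k * (\<integral>\<^sup>+x. w x * indicator (ball y (\<rho> k)) x \<partial>lebesgue) \<le> ennreal (D * V * t * q ^ k) * maximal_op w y" .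
      qed auto
      also have "\<dots> = ennreal (D * V * t * (1 / (1 - q))) * maximal_op w y"
      proof -
        have "(\<lambda>k. D * V * t * q ^ k) sums (D * V * t * (1 / (1 - q)))"
          using q by (intro sums_mult geometric_sums) auto
        then have "(\<Sum>k. ennreal (D * V * t * q ^ k)) = ennreal (D * V * t * (1 / (1 - q)))"
          using D V t q by (intro suminf_ennreal_eq) auto
        then show ?thesis by simp
      qed
      finally show ?thesis by (simp add: mult_ac)
    qed
  qed
qed

text \<open>For t = \<infinity> the product t * M w(y) is 0 when M w(y) = 0; this shows that the
  integral it has to bound vanishes too.\<close>

lemma maximal_op_eq_0:
  fixes w :: "'n::euclidean_space \<Rightarrow> ennreal"
  assumes [measurable]: "w \<in> borel_measurable lebesgue" and "maximal_op w y = 0"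
  shows "AE x in lebesgue. w x = 0"
proof -
  have "AE x in lebesgue. \<forall>k. w x * indicator (ball y (real (Suc k))) x = 0"
  proof (subst AE_all_countable, intro allI)
    fix k
    have "(\<integral>\<^sup>+x\<in>ball y (real (Suc k)). w x \<partial>lebesgue) = 0"
      using ball_integral_le_maximal_op[of "real (Suc k)" w y] assms(2) by simp
    then show "AE x in lebesgue. w x * indicator (ball y (real (Suc k))) x = 0"
      by (subst (asm) nn_integral_0_iff_AE) auto
  qed
  then show ?thesis
  proof eventually_elim
    fix x assume *: "\<forall>k. w x * indicator (ball y (real (Suc k))) x = 0"
    obtain k where "dist y x < real k" using reals_Archimedean2 by blast
    then show "w x = 0" using *[rule_format, of k] by (auto simp: indicator_def split: if_splits)
  qed
qed

lemma riesz_kernel_superlevel_integral: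
  fixes \<gamma> :: real
  assumes \<gamma>: "\<gamma> \<noteq> 0"
  shows "\<exists>C>0. \<forall>w (y::'n::euclidean_space) t. w \<in> borel_measurable lebesgue \<longrightarrow>
    (\<integral>\<^sup>+x. indicator {x. ennreal (norm (x - y) powr \<gamma>) < t} x * riesz_kernel \<gamma> x y * w x \<partial>lebesgue)
      \<le> ennreal C * t * maximal_op w y"
proof -
  obtain C where C: "0 < C" and *: "\<forall>w (y::'n) t. w \<in> borel_measurable lebesgue \<longrightarrow> 0 \<le> t \<longrightarrow>
    (\<integral>\<^sup>+x. indicator {x. norm (x - y) powr \<gamma> < t} x * riesz_kernel \<gamma> x y * w x \<partial>lebesgue)
      \<le> ennreal (C * t) * maximal_op w y"
    using riesz_kernel_superlevel_integral_real[OF \<gamma>] by (elim exE conjE) (rule that)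
  show ?thesis
  proof (intro exI[of _ C] conjI allI impI C)
    fix w :: "'n \<Rightarrow> ennreal" and y :: 'n and t :: ennreal
    assume w[measurable]: "w \<in> borel_measurable lebesgue"
    show "(\<integral>\<^sup>+x. indicator {x. ennreal (norm (x - y) powr \<gamma>) < t} x * riesz_kernel \<gamma> x y * w x \<partial>lebesgue)
      \<le> ennreal C * t * maximal_op w y"
    proof (cases t)
      case (real s)
      then have "{x. ennreal (norm (x - y) powr \<gamma>) < t} = {x. norm (x - y) powr \<gamma> < s}"
        by (auto simp: ennreal_less_iff)
      then show ?thesis using *[rule_format, OF w, of s y] real C by (simp add: ennreal_mult')
    next
      case top
      show ?thesis
      proof (cases "maximal_op w y = 0")
        case True
        from maximal_op_eq_0[OF w this]
        have "AE x in lebesgue. indicator {x. ennreal (norm (x - y) powr \<gamma>) < t} x * riesz_kernel \<gamma> x y * w x = 0"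
          by eventually_elim simp
        then
        have "(\<integral>\<^sup>+x. indicator {x. ennreal (norm (x - y) powr \<gamma>) < t} x * riesz_kernel \<gamma> x y * w x \<partial>lebesgue) = (\<integral>\<^sup>+x. 0 \<partial>(lebesgue :: 'n measure))"
          by (rule nn_integral_cong_AE)
        then show ?thesis by simp
      next
        case False
        then show ?thesis using top C by (simp add: ennreal_mult_top ennreal_top_mult)
      qed
    qed
  qed
qed

text \<open>The bound on the set where \<open>a y\<close> is large is the one that needs the \<open>A\<^sub>1\<close> weight.\<close>

lemma symmetric_superlevel_integral:
  fixes \<gamma> :: real
  assumes \<gamma>: "\<gamma> \<noteq> 0"
  shows "\<exists>C>0. \<forall>(E::('n::euclidean_space \<times> 'n) set) a w A. E \<in> sets (lebesgue \<Otimes>\<^sub>M lebesgue) \<longrightarrow>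
    a \<in> borel_measurable lebesgue \<longrightarrow> w \<in> borel_measurable lebesgue \<longrightarrow> 1 \<le> A \<longrightarrow>
    (\<forall>x y. (x, y) \<in> E \<longrightarrow> ennreal (norm (x - y) powr \<gamma>) < a x \<or> ennreal (norm (x - y) powr \<gamma>) < a y) \<longrightarrow>
    (\<forall>x. maximal_op w x \<le> ennreal A * w x) \<longrightarrow>
    (\<integral>\<^sup>+x. (\<integral>\<^sup>+y. indicator E (x, y) * riesz_kernel \<gamma> x y \<partial>lebesgue) * w x \<partial>lebesgue)
      \<le> ennreal (C * A) * (\<integral>\<^sup>+x. a x * w x \<partial>lebesgue)"
proof -
  obtain C where C: "0 < C" and *: "\<forall>w (y::'n) t. w \<in> borel_measurable lebesgue \<longrightarrow>
    (\<integral>\<^sup>+x. indicator {x. ennreal (norm (x - y) powr \<gamma>) < t} x * riesz_kernel \<gamma> x y * w x \<partial>lebesgue)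
      \<le> ennreal C * t * maximal_op w y"
    using riesz_kernel_superlevel_integral[OF \<gamma>] by (elim exE conjE) (rule that)
  show ?thesis
  proof (intro exI[of _ "2 * C"] conjI allI impI)
    show "0 < 2 * C" using C by simp
    fix E :: "('n \<times> 'n) set" and a w :: "'n \<Rightarrow> ennreal" and A :: real
    assume [measurable]: "E \<in> sets (lebesgue \<Otimes>\<^sub>M lebesgue)" "a \<in> borel_measurable lebesgue" "w \<in> borel_measurable lebesgue"
      and A: "1 \<le> A"
      and E: "\<forall>x y. (x, y) \<in> E \<longrightarrow> ennreal (norm (x - y) powr \<gamma>) < a x \<or> ennreal (norm (x - y) powr \<gamma>) < a y"
      and Mw: "\<forall>x. maximal_op w x \<le> ennreal A * w x"
    define S where "S = (\<integral>\<^sup>+x. a x * w x \<partial>lebesgue)"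
    define I1 I2 :: "'n \<Rightarrow> 'n \<Rightarrow> ennreal"
      where "I1 x y = indicator {y. ennreal (norm (y - x) powr \<gamma>) < a x} y"
        and "I2 x y = indicator {x. ennreal (norm (x - y) powr \<gamma>) < a y} x" for x y
    have [measurable]: "(\<lambda>(x, y). I1 x y) \<in> borel_measurable (lebesgue \<Otimes>\<^sub>M lebesgue)"
      "(\<lambda>(x, y). I2 x y) \<in> borel_measurable (lebesgue \<Otimes>\<^sub>M lebesgue)"
      unfolding I1_def I2_def indicator_def by measurable
    have [measurable]: "(\<lambda>x. \<integral>\<^sup>+y. I1 x y * riesz_kernel \<gamma> x y \<partial>lebesgue) \<in> borel_measurable lebesgue"
      "(\<lambda>x. \<integral>\<^sup>+y. I2 x y * riesz_kernel \<gamma> x y \<partial>lebesgue) \<in> borel_measurable lebesgue"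
      by (intro borel_measurable_lebesgue_nn_integral; measurable)+
    have I1m[measurable]: "(\<lambda>y. I1 x y * riesz_kernel \<gamma> x y) \<in> borel_measurable lebesgue"
      "(\<lambda>y. I2 x y * riesz_kernel \<gamma> x y) \<in> borel_measurable lebesgue" for x
      by measurable
    \<comment> \<open>Here \<open>w x\<close> stands outside the inner integral, so the kernel
      estimate is applied with the constant weight 1, whose maximal function is at most 1.\<close>
    have first: "(\<integral>\<^sup>+y. I1 x y * riesz_kernel \<gamma> x y \<partial>lebesgue) \<le> ennreal C * a x" for x
    proof -
      have "(\<integral>\<^sup>+y. I1 x y * riesz_kernel \<gamma> x y \<partial>lebesgue) =
        (\<integral>\<^sup>+y. indicator {y. ennreal (norm (y - x) powr \<gamma>) < a x} y * riesz_kernel \<gamma> y x * 1 \<partial>lebesgue)"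
        by (simp add: I1_def riesz_kernel_commute)
      also have "\<dots> \<le> ennreal C * a x * maximal_op (\<lambda>_. 1) x" by (rule *[rule_format]) simp
      also have "\<dots> \<le> ennreal C * a x * 1" by (intro mult_left_mono maximal_op_bounded) auto
      finally show ?thesis by simp
    qed
    have "(\<integral>\<^sup>+x. (\<integral>\<^sup>+y. indicator E (x, y) * riesz_kernel \<gamma> x y \<partial>lebesgue) * w x \<partial>lebesgue)
      \<le> (\<integral>\<^sup>+x. (\<integral>\<^sup>+y. I1 x y * riesz_kernel \<gamma> x y \<partial>lebesgue) * w x + (\<integral>\<^sup>+y. I2 x y * riesz_kernel \<gamma> x y \<partial>lebesgue) * w x \<partial>lebesgue)"
    proof (rule nn_integral_mono)
      fix x
      have "indicator E (x, y) \<le> I1 x y + I2 x y" for y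
        using E[rule_format, of x y] by (auto simp: I1_def I2_def indicator_def norm_minus_commute)
      then have "(\<integral>\<^sup>+y. indicator E (x, y) * riesz_kernel \<gamma> x y \<partial>lebesgue) \<le> (\<integral>\<^sup>+y. I1 x y * riesz_kernel \<gamma> x y + I2 x y * riesz_kernel \<gamma> x y \<partial>lebesgue)"
        by (intro nn_integral_mono) (simp add: distrib_right[symmetric] mult_right_mono)
      also have "\<dots> = (\<integral>\<^sup>+y. I1 x y * riesz_kernel \<gamma> x y \<partial>lebesgue) + (\<integral>\<^sup>+y. I2 x y * riesz_kernel \<gamma> x y \<partial>lebesgue)"
        by (intro nn_integral_add I1m)
      finally show "(\<integral>\<^sup>+y. indicator E (x, y) * riesz_kernel \<gamma> x y \<partial>lebesgue) * w x
        \<le> (\<integral>\<^sup>+y. I1 x y * riesz_kernel \<gamma> x y \<partial>lebesgue) * w x + (\<integral>\<^sup>+y. I2 x y * riesz_kernel \<gamma> x y \<partial>lebesgue) * w x"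
        by (simp add: distrib_right[symmetric] mult_right_mono)
    qed
    also have "\<dots> = (\<integral>\<^sup>+x. (\<integral>\<^sup>+y. I1 x y * riesz_kernel \<gamma> x y \<partial>lebesgue) * w x \<partial>lebesgue)
      + (\<integral>\<^sup>+x. (\<integral>\<^sup>+y. I2 x y * riesz_kernel \<gamma> x y \<partial>lebesgue) * w x \<partial>lebesgue)"
      by (intro nn_integral_add) measurable
    also have "(\<integral>\<^sup>+x. (\<integral>\<^sup>+y. I1 x y * riesz_kernel \<gamma> x y \<partial>lebesgue) * w x \<partial>lebesgue) \<le> (\<integral>\<^sup>+x. ennreal C * (a x * w x) \<partial>lebesgue)"
      unfolding mult.assoc[symmetric] by (intro nn_integral_mono mult_right_mono first) auto
    also have "\<dots> = ennreal C * S" unfolding S_def by (intro nn_integral_cmult) measurable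
    also have "ennreal C * S \<le> ennreal (C * A) * S"
      using C A by (intro mult_right_mono ennreal_leI) auto
    also have "(\<integral>\<^sup>+x. (\<integral>\<^sup>+y. I2 x y * riesz_kernel \<gamma> x y \<partial>lebesgue) * w x \<partial>lebesgue)
      = (\<integral>\<^sup>+x. (\<integral>\<^sup>+y. I2 x y * riesz_kernel \<gamma> x y * w x \<partial>lebesgue) \<partial>lebesgue)"
      by (subst nn_integral_multc) auto
    \<comment> \<open>The superlevel condition now involves \<open>a y\<close>, so x is integrated
      first; this produces M w(y), which is exchanged for A w(y).\<close>
    also have "\<dots> = (\<integral>\<^sup>+y. (\<integral>\<^sup>+x. I2 x y * riesz_kernel \<gamma> x y * w x \<partial>lebesgue) \<partial>lebesgue)"
      by (intro lebesgue_Fubini[symmetric]) measurable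
    also have "\<dots> \<le> (\<integral>\<^sup>+y. ennreal (C * A) * (a y * w y) \<partial>lebesgue)"
    proof (rule nn_integral_mono)
      fix y
      have "(\<integral>\<^sup>+x. I2 x y * riesz_kernel \<gamma> x y * w x \<partial>lebesgue) \<le> ennreal C * a y * maximal_op w y"
        unfolding I2_def by (rule *[rule_format]) measurable
      also have "\<dots> \<le> ennreal C * a y * (ennreal A * w y)" using Mw by (intro mult_left_mono) auto
      also have "\<dots> = ennreal (C * A) * (a y * w y)"
        using C by (simp add: ennreal_mult' mult.assoc mult.left_commute)
      finally show "(\<integral>\<^sup>+x. I2 x y * riesz_kernel \<gamma> x y * w x \<partial>lebesgue) \<le> ennreal (C * A) * (a y * w y)" .
    qed
    also have "\<dots> = ennreal (C * A) * S" unfolding S_def by (intro nn_integral_cmult) measurable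
    also have "ennreal (C * A) * S + ennreal (C * A) * S = ennreal (2 * C * A) * S"
    proof -
      have "ennreal (C * A) + ennreal (C * A) = ennreal (C * A + C * A)"
        using C A by (intro ennreal_plus[symmetric]) auto
      then show ?thesis by (simp add: distrib_right[symmetric])
    qed
    finally show "(\<integral>\<^sup>+x. (\<integral>\<^sup>+y. indicator E (x, y) * riesz_kernel \<gamma> x y \<partial>lebesgue) * w x \<partial>lebesgue)
      \<le> ennreal (2 * C * A) * (\<integral>\<^sup>+x. a x * w x \<partial>lebesgue)"
      by (simp add: S_def add_mono)
  qed
qed

section \<open>Charging heavy balls to their mass\<close>

lemma charging_integral_le:
  fixes a w G :: "'n::euclidean_space \<Rightarrow> ennreal" and K :: "'n \<Rightarrow> 'n \<Rightarrow> ennreal"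
  assumes [measurable]: "G \<in> borel_measurable lebesgue" "w \<in> borel_measurable lebesgue"
      "(\<lambda>(x, y). K x y) \<in> borel_measurable (lebesgue \<Otimes>\<^sub>M lebesgue)"
    and a: "\<And>x. a x \<le> (\<integral>\<^sup>+y. G y * K x y \<partial>lebesgue)"
    and K: "\<And>y. (\<integral>\<^sup>+x. K x y * w x \<partial>lebesgue) \<le> B * maximal_op w y"
    and Mw: "\<And>x. maximal_op w x \<le> A * w x"
  shows "(\<integral>\<^sup>+x. a x * w x \<partial>lebesgue) \<le> B * A * (\<integral>\<^sup>+x. G x * w x \<partial>lebesgue)"
proof -
  have "(\<integral>\<^sup>+x. a x * w x \<partial>lebesgue) \<le> (\<integral>\<^sup>+x. (\<integral>\<^sup>+y. G y * K x y \<partial>lebesgue) * w x \<partial>lebesgue)"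
    by (intro nn_integral_mono mult_right_mono a) auto
  also have "\<dots> = (\<integral>\<^sup>+x. (\<integral>\<^sup>+y. G y * K x y * w x \<partial>lebesgue) \<partial>lebesgue)"
    by (subst nn_integral_multc) auto
  \<comment> \<open>After the exchange, \<open>K\<close> is integrated in its first variable: K x y
    measures what y has to pay for x, and y pays at most B M w(y) in total.\<close>
  also have "\<dots> = (\<integral>\<^sup>+y. (\<integral>\<^sup>+x. G y * K x y * w x \<partial>lebesgue) \<partial>lebesgue)"
    by (intro lebesgue_Fubini[symmetric]) measurable
  also have "\<dots> = (\<integral>\<^sup>+y. G y * (\<integral>\<^sup>+x. K x y * w x \<partial>lebesgue) \<partial>lebesgue)"
    unfolding mult.assoc by (subst nn_integral_cmult) auto
  also have "\<dots> \<le> (\<integral>\<^sup>+y. B * A * (G y * w y) \<partial>lebesgue)"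
  proof (rule nn_integral_mono)
    fix y
    have "(\<integral>\<^sup>+x. K x y * w x \<partial>lebesgue) \<le> B * (A * w y)"
      by (rule order_trans[OF K]) (intro mult_left_mono Mw zero_le)
    then have "G y * (\<integral>\<^sup>+x. K x y * w x \<partial>lebesgue) \<le> G y * (B * (A * w y))"
      by (intro mult_left_mono) auto
    then show "G y * (\<integral>\<^sup>+x. K x y * w x \<partial>lebesgue) \<le> B * A * (G y * w y)"
      by (simp only: mult_ac)
  qed
  also have "\<dots> = B * A * (\<integral>\<^sup>+x. G x * w x \<partial>lebesgue)" by (intro nn_integral_cmult) measurable
  finally show ?thesis .
qed

text \<open>Used for radii regularised by a supremum or infimum over uncountably many balls, whose
  measurability would otherwise be in doubt.\<close>

lemma continuous_half_Lipschitz: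
  fixes \<tau> :: "'n::euclidean_space \<Rightarrow> real"
  assumes "\<And>x y. \<tau> x \<le> \<tau> y + norm (x - y) / 2"
  shows "continuous_on UNIV \<tau>"
proof (rule continuous_onI)
  fix x :: 'n and e :: real assume "0 < e"
  show "\<exists>d>0. \<forall>x'\<in>UNIV. dist x' x < d \<longrightarrow> dist (\<tau> x') (\<tau> x) \<le> e"
  proof (intro exI[of _ e] conjI ballI impI \<open>0 < e\<close>)
    fix x' assume "dist x' x < e"
    then show "dist (\<tau> x') (\<tau> x) \<le> e"
      using assms[of x x'] assms[of x' x] by (auto simp: dist_real_def dist_norm norm_minus_commute abs_le_iff)
  qed
qed

text \<open>The factor 1/\<mu> is kept explicit because for \<gamma> > 0 a whole sequence of
  thresholds \<mu> is used and the resulting weights are summed.\<close>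

definition heavy_ball_weight ::
  "real \<Rightarrow> real \<Rightarrow> real \<Rightarrow> ('n::euclidean_space \<Rightarrow> ennreal) \<Rightarrow> ('n \<Rightarrow> ennreal) \<Rightarrow> bool" where
  "heavy_ball_weight \<gamma> C \<mu> G a \<longleftrightarrow> a \<in> borel_measurable lebesgue \<and>
    (\<forall>z r. 0 < r \<longrightarrow> ennreal (\<mu> * r powr (real DIM('n) + \<gamma>)) < (\<integral>\<^sup>+x\<in>ball z r. G x \<partial>lebesgue) \<longrightarrow>
      ennreal (r powr \<gamma>) \<le> a z) \<and>
    (\<forall>w A. w \<in> borel_measurable lebesgue \<longrightarrow> 0 \<le> A \<longrightarrow> (\<forall>x. maximal_op w x \<le> ennreal A * w x) \<longrightarrow>
      (\<integral>\<^sup>+x. a x * w x \<partial>lebesgue) \<le> ennreal (C * A / \<mu>) * (\<integral>\<^sup>+x. G x * w x \<partial>lebesgue))"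

text \<open>Call a ball of radius \<open>r\<close> heavy if the mass of \<open>G\<close> on it exceeds \<open>\<mu> r\<^bsup>n+\<gamma>\<^esup>\<close>. The radii of the heavy balls
  are regularised to a \<open>1/2\<close>-Lipschitz function \<open>\<tau>\<close>, largest radii for \<open>\<gamma> > 0\<close> and smallest ones for
  \<open>\<gamma> < -n\<close>. A nearly optimal heavy ball for \<open>x\<close> consists of points \<open>y\<close> at which \<open>\<tau> y\<close> is comparable
  to the radius of that ball, so its mass can be charged to these points; this replaces a covering lemma.\<close>

lemma heavy_ball_weight_pos:
  fixes \<gamma> :: real
  assumes \<gamma>: "0 < \<gamma>"
  shows "\<exists>C>0. \<forall>(G::'n::euclidean_space \<Rightarrow> ennreal) \<mu>. G \<in> borel_measurable lebesgue \<longrightarrow>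
    (\<integral>\<^sup>+x. G x \<partial>lebesgue) < \<infinity> \<longrightarrow> 0 < \<mu> \<longrightarrow>
    (\<exists>a. heavy_ball_weight \<gamma> C \<mu> G a)"
proof -
  define n where "n = real DIM('n)"
  have n: "0 < n" by (simp add: n_def)
  define V where "V = unit_ball_vol n"
  have V: "0 < V" by (simp add: V_def n_def)
  define D where "D = 2 powr \<gamma> * (5/2) powr n"
  have D: "0 < D" by (simp add: D_def)
  define C where "C = D * V * 6 ^ DIM('n)"
  have C: "0 < C" using D V by (simp add: C_def)
  show ?thesis
  proof (intro exI[of _ C] conjI allI impI C)
    fix G :: "'n \<Rightarrow> ennreal" and \<mu> :: real
    assume G[measurable]: "G \<in> borel_measurable lebesgue" and fin: "(\<integral>\<^sup>+x. G x \<partial>lebesgue) < \<infinity>" and \<mu>: "0 < \<mu>"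
    define heavy where "heavy z r \<longleftrightarrow> 0 < r \<and> ennreal (\<mu> * r powr (n + \<gamma>)) < (\<integral>\<^sup>+x\<in>ball z r. G x \<partial>lebesgue)" for z r
    define m where "m = enn2real (\<integral>\<^sup>+x. G x \<partial>lebesgue)"
    define Rmax where "Rmax = (m / \<mu>) powr (1 / (n + \<gamma>))"
    \<comment> \<open>The threshold grows with the radius while the total mass is finite, so heavy
      radii are bounded and the supremum below exists.\<close>
    have R: "r \<le> Rmax" if "heavy z r" for z r
    proof -
      have r: "0 < r" using that by (simp add: heavy_def)
      have "ennreal (\<mu> * r powr (n + \<gamma>)) < (\<integral>\<^sup>+x\<in>ball z r. G x \<partial>lebesgue)" using that by (simp add: heavy_def)
      also have "\<dots> \<le> (\<integral>\<^sup>+x. G x \<partial>lebesgue)" by (intro nn_integral_mono) (auto simp: indicator_def)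
      also have "\<dots> = ennreal m" using fin by (simp add: m_def)
      finally have "\<mu> * r powr (n + \<gamma>) < m" using \<mu> by (simp add: ennreal_less_iff)
      then have "r powr (n + \<gamma>) \<le> m / \<mu>" using \<mu> by (simp add: field_simps)
      then have "(r powr (n + \<gamma>)) powr (1 / (n + \<gamma>)) \<le> Rmax"
        unfolding Rmax_def using n \<gamma> by (intro powr_mono2) auto
      then show ?thesis using n \<gamma> r by (simp add: powr_powr)
    qed
    \<comment> \<open>The inserted 0 makes the set nonempty and \<tau> nonnegative where no heavy
      ball is near.\<close>
    define T where "T x = insert 0 {r - norm (x - z) / 2 | z r. heavy z r}" for x
    define \<tau> where "\<tau> x = Sup (T x)" for x
    have bdd: "bdd_above (T x)" for x
    proof (rule bdd_aboveI)
      fix t assume "t \<in> T x"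
      then consider "t = 0" | z r where "t = r - norm (x - z) / 2" "heavy z r" by (auto simp: T_def)
      then show "t \<le> max 0 Rmax"
      proof cases
        case 2
        then show ?thesis using R[of z r] norm_ge_zero[of "x - z"] by linarith
      qed simp
    qed
    have \<tau>0: "0 \<le> \<tau> x" for x unfolding \<tau>_def by (rule cSup_upper[OF _ bdd]) (simp add: T_def)
    have \<tau>ge: "r - norm (x - z) / 2 \<le> \<tau> x" if "heavy z r" for x z r
      unfolding \<tau>_def using that by (intro cSup_upper[OF _ bdd]) (auto simp: T_def)
    have lip: "\<tau> x \<le> \<tau> y + norm (x - y) / 2" for x y
    proof -
      have "t \<le> \<tau> y + norm (x - y) / 2" if "t \<in> T x" for t
      proof (cases "t = 0")
        case True then show ?thesis using \<tau>0[of y] by simp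
      next
        case False
        then obtain z r where zr: "t = r - norm (x - z) / 2" "heavy z r" using \<open>t \<in> T x\<close> by (auto simp: T_def)
        have "norm (y - z) \<le> norm (x - z) + norm (x - y)"
          using norm_triangle_ineq[of "y - x" "x - z"] by (simp add: norm_minus_commute)
        then show ?thesis using zr \<tau>ge[OF zr(2), of y] by simp
      qed
      then show ?thesis unfolding \<tau>_def[of x] by (intro cSup_least) (auto simp: T_def)
    qed
    have "\<tau> \<in> borel_measurable borel"
      by (intro borel_measurable_continuous_onI continuous_half_Lipschitz lip)
    then have [measurable]: "\<tau> \<in> borel_measurable lebesgue" by (auto intro: measurable_completion)
    \<comment> \<open>Let B(z,r) be heavy with \<tau> x < 2r - |x-z|, and let y lie in it. Then r/2
      < \<tau> y \<le> 5r/2 by the Lipschitz bound, and |x-y| < 3r < 6 \<tau> y. This gives the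
      radius 6 \<tau> y and the factor (5/2)^n of \<open>D\<close>; the factor 2^\<gamma> comes from
      \<tau> x < 2r.\<close>
    define K where "K x y = ennreal (D / \<mu> * \<tau> y powr (- n)) * indicator (ball y (6 * \<tau> y)) x" for x y
    have Km: "(\<lambda>(x, y). K x y) \<in> borel_measurable (lebesgue \<Otimes>\<^sub>M lebesgue)"
    proof -
      have "K x y = (if norm (y - x) < 6 * \<tau> y then ennreal (D / \<mu> * \<tau> y powr (- n)) else 0)" for x y
        by (simp add: K_def dist_norm)
      then show ?thesis by simp
    qed
    show "\<exists>a. heavy_ball_weight \<gamma> C \<mu> G a"
      unfolding heavy_ball_weight_def
    proof (intro exI[of _ "\<lambda>x. ennreal (\<tau> x powr \<gamma>)"] conjI allI impI)
      fix z r assume "0 < r" "ennreal (\<mu> * r powr (real DIM('n) + \<gamma>)) < (\<integral>\<^sup>+x\<in>ball z r. G x \<partial>lebesgue)"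
      then have "heavy z r" by (simp add: heavy_def n_def)
      from \<tau>ge[OF this, of z] have "r \<le> \<tau> z" by simp
      then show "ennreal (r powr \<gamma>) \<le> ennreal (\<tau> z powr \<gamma>)"
        using \<open>0 < r\<close> \<gamma> by (intro ennreal_leI powr_mono2) auto
    next
      fix w :: "'n \<Rightarrow> ennreal" and A :: real
      assume w[measurable]: "w \<in> borel_measurable lebesgue" and A: "0 \<le> A"
        and Mw: "\<forall>x. maximal_op w x \<le> ennreal A * w x"
      have "(\<integral>\<^sup>+x. ennreal (\<tau> x powr \<gamma>) * w x \<partial>lebesgue) \<le> ennreal (C / \<mu>) * ennreal A * (\<integral>\<^sup>+x. G x * w x \<partial>lebesgue)"
      proof (rule charging_integral_le[OF G w Km])
        fix x
        show "ennreal (\<tau> x powr \<gamma>) \<le> (\<integral>\<^sup>+y. G y * K x y \<partial>lebesgue)"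
        proof (cases "\<tau> x = 0")
          case True then show ?thesis by simp
        next
          case False
          then have \<tau>x: "0 < \<tau> x" using \<tau>0[of x] by simp
          then have less: "\<tau> x / 2 < Sup (T x)" by (simp add: \<tau>_def)
          have "T x \<noteq> {}" by (simp add: T_def)
          with less obtain t where t: "t \<in> T x" "\<tau> x / 2 < t"
            using less_cSupD by blast
          then obtain z r where zr: "t = r - norm (x - z) / 2" "heavy z r" using \<tau>x by (auto simp: T_def)
          have r: "0 < r" using zr by (simp add: heavy_def)
          have x1: "\<tau> x < 2 * r - norm (x - z)" using t zr by simp
          have "ennreal (\<tau> x powr \<gamma>) \<le> ennreal ((2 * r) powr \<gamma>)"
            using x1 \<tau>x \<gamma> norm_ge_zero[of "x - z"] by (intro ennreal_leI powr_mono2) linarith+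
          also have "(2 * r) powr \<gamma> = (2 powr \<gamma> / \<mu> * r powr (- n)) * (\<mu> * r powr (n + \<gamma>))"
            using r \<mu> by (simp add: powr_mult powr_add powr_minus field_simps)
          also have "ennreal \<dots> = ennreal (2 powr \<gamma> / \<mu> * r powr (- n)) * ennreal (\<mu> * r powr (n + \<gamma>))"
            using \<mu> by (intro ennreal_mult') simp
          also have "\<dots> \<le> ennreal (2 powr \<gamma> / \<mu> * r powr (- n)) * (\<integral>\<^sup>+y\<in>ball z r. G y \<partial>lebesgue)"
            using zr by (intro mult_left_mono) (auto simp: heavy_def)
          also have "\<dots> = (\<integral>\<^sup>+y. ennreal (2 powr \<gamma> / \<mu> * r powr (- n)) * (G y * indicator (ball z r) y) \<partial>lebesgue)"
            by (intro nn_integral_cmult[symmetric]) measurable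
          also have "\<dots> \<le> (\<integral>\<^sup>+y. G y * K x y \<partial>lebesgue)"
          proof (rule nn_integral_mono)
            fix y
            show "ennreal (2 powr \<gamma> / \<mu> * r powr (- n)) * (G y * indicator (ball z r) y) \<le> G y * K x y"
            proof (cases "y \<in> ball z r")
              case True
              then have yz: "norm (y - z) < r" by (simp add: dist_norm norm_minus_commute)
              have y1: "r / 2 < \<tau> y" using \<tau>ge[OF zr(2), of y] yz by simp
              have xy: "norm (y - x) \<le> norm (x - z) + norm (y - z)"
                using norm_triangle_ineq[of "y - z" "z - x"] by (simp add: norm_minus_commute)
              have y2: "\<tau> y \<le> 5 / 2 * r" using lip[of y x] x1 xy yz norm_ge_zero[of "x - z"] by linarith
              have "norm (y - x) < 3 * r" using xy yz x1 \<tau>x by simp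
              then have ball: "x \<in> ball y (6 * \<tau> y)" using y1 by (simp add: dist_norm)
              have "(5 / 2 * r) powr (- n) \<le> \<tau> y powr (- n)"
                using y1 y2 r n by (intro powr_mono2') auto
              moreover have "(5 / 2 * r) powr (- n) = (5/2) powr (- n) * r powr (- n)"
                by (rule powr_mult)
              ultimately have "(5/2) powr n * ((5/2) powr (- n) * r powr (- n)) \<le> (5/2) powr n * \<tau> y powr (- n)"
                by (intro mult_left_mono) auto
              moreover have "(5/2) powr n * (5/2) powr (- n) = (1::real)" by (simp add: powr_minus)
              ultimately have "r powr (- n) \<le> (5/2) powr n * \<tau> y powr (- n)"
                by (simp add: mult.assoc[symmetric])
              then have "2 powr \<gamma> / \<mu> * r powr (- n) \<le> 2 powr \<gamma> / \<mu> * ((5/2) powr n * \<tau> y powr (- n))"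
                using \<mu> by (intro mult_left_mono) auto
              also have "\<dots> = D / \<mu> * \<tau> y powr (- n)" by (simp add: D_def)
              finally have "ennreal (2 powr \<gamma> / \<mu> * r powr (- n)) \<le> K x y"
                using ball by (simp add: K_def ennreal_leI)
              then show ?thesis using True by (simp add: mult.commute[of "G y"] mult_right_mono)
            qed simp
          qed
          finally show ?thesis .
        qed
      next
        fix y
        show "(\<integral>\<^sup>+x. K x y * w x \<partial>lebesgue) \<le> ennreal (C / \<mu>) * maximal_op w y"
        proof (cases "\<tau> y = 0")
          case True then show ?thesis by (simp add: K_def)
        next
          case False
          then have \<tau>y: "0 < \<tau> y" using \<tau>0[of y] by simp
          have "(\<integral>\<^sup>+x. K x y * w x \<partial>lebesgue) = ennreal (D / \<mu> * \<tau> y powr (- n)) * (\<integral>\<^sup>+x\<in>ball y (6 * \<tau> y). w x \<partial>lebesgue)"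
            unfolding K_def by (subst nn_integral_cmult[symmetric]) (auto simp: mult_ac)
          also have "\<dots> \<le> ennreal (D / \<mu> * \<tau> y powr (- n)) * (ennreal (V * (6 * \<tau> y) ^ DIM('n)) * maximal_op w y)"
            unfolding V_def n_def using \<tau>y by (intro mult_left_mono ball_integral_le_maximal_op) auto
          also have "\<dots> = ennreal (D / \<mu> * \<tau> y powr (- n) * (V * (6 * \<tau> y) ^ DIM('n))) * maximal_op w y"
          proof -
            have "0 \<le> D / \<mu> * \<tau> y powr (- n)" using D \<mu> by simp
            from ennreal_mult'[OF this, of "V * (6 * \<tau> y) ^ DIM('n)"]
            show ?thesis by (simp only: mult.assoc[where 'a = ennreal])
          qed
          also have "D / \<mu> * \<tau> y powr (- n) * (V * (6 * \<tau> y) ^ DIM('n)) = C / \<mu>"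
            using \<tau>y by (simp add: C_def n_def powr_minus powr_realpow power_mult_distrib field_simps)
          finally show ?thesis .
        qed
      qed (use Mw in blast)
      also have "ennreal (C / \<mu>) * ennreal A = ennreal (C * A / \<mu>)"
        using C \<mu> A by (subst ennreal_mult'[symmetric]) auto
      finally show "(\<integral>\<^sup>+x. ennreal (\<tau> x powr \<gamma>) * w x \<partial>lebesgue) \<le> ennreal (C * A / \<mu>) * (\<integral>\<^sup>+x. G x * w x \<partial>lebesgue)" .
    qed measurable
  qed
qed

text \<open>For n + \<gamma> < 0 the threshold blows up at small radii, so heavy radii are bounded
  below and \<tau> is an infimum. The heavy ball nearly optimal for x may be far from x, hence the
  charging kernel needs a tail |x-y|^\<gamma>; the tail is integrable because \<gamma> < -n.\<close>

lemma heavy_ball_weight_neg: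
  fixes \<gamma> :: real
  assumes \<gamma>: "real DIM('n) + \<gamma> < 0"
  shows "\<exists>C>0. \<forall>(G::'n::euclidean_space \<Rightarrow> ennreal) \<mu>. G \<in> borel_measurable lebesgue \<longrightarrow>
    (\<integral>\<^sup>+x. G x \<partial>lebesgue) < \<infinity> \<longrightarrow> 0 < \<mu> \<longrightarrow>
    (\<exists>a. heavy_ball_weight \<gamma> C \<mu> G a)"
proof -
  define n where "n = real DIM('n)"
  have n: "0 < n" by (simp add: n_def)
  \<comment> \<open>With \<eta> > 0 the tail |x-y|^\<gamma> is the Riesz kernel of order -\<eta>, to
    which the superlevel estimate applies.\<close>
  define \<eta> where "\<eta> = - (n + \<gamma>)"
  have \<eta>: "0 < \<eta>" using \<gamma> by (simp add: \<eta>_def n_def)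
  have \<gamma>e: "\<gamma> = - n - \<eta>" by (simp add: \<eta>_def)
  define V where "V = unit_ball_vol n"
  have V: "0 < V" by (simp add: V_def n_def)
  obtain P where P: "0 < P" and P': "\<forall>w (y::'n) t. w \<in> borel_measurable lebesgue \<longrightarrow> 0 \<le> t \<longrightarrow>
    (\<integral>\<^sup>+x. indicator {x. norm (x - y) powr - \<eta> < t} x * riesz_kernel (- \<eta>) x y * w x \<partial>lebesgue)
      \<le> ennreal (P * t) * maximal_op w y"
    using riesz_kernel_superlevel_integral_real[of "- \<eta>"] \<eta> by (elim meta_mp[elim_format] exE conjE) (simp, rule that)
  define D where "D = 4 powr \<eta> * 2 powr (- \<gamma>)"
  have D: "0 < D" by (simp add: D_def)
  define C where "C = D * (V + 2 * P)"
  have C: "0 < C" using D V P by (simp add: C_def)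
  show ?thesis
  proof (intro exI[of _ C] conjI allI impI C)
    fix G :: "'n \<Rightarrow> ennreal" and \<mu> :: real
    assume G[measurable]: "G \<in> borel_measurable lebesgue" and fin: "(\<integral>\<^sup>+x. G x \<partial>lebesgue) < \<infinity>" and \<mu>: "0 < \<mu>"
    define heavy where "heavy z r \<longleftrightarrow> 0 < r \<and> ennreal (\<mu> * r powr (n + \<gamma>)) < (\<integral>\<^sup>+x\<in>ball z r. G x \<partial>lebesgue)" for z r
    define m where "m = enn2real (\<integral>\<^sup>+x. G x \<partial>lebesgue)"
    define Rmin where "Rmin = (m / \<mu>) powr (- 1 / \<eta>)"
    have R: "Rmin \<le> r \<and> 0 < Rmin" if "heavy z r" for z r
    proof -
      have r: "0 < r" using that by (simp add: heavy_def)
      have "ennreal (\<mu> * r powr (n + \<gamma>)) < (\<integral>\<^sup>+x\<in>ball z r. G x \<partial>lebesgue)" using that by (simp add: heavy_def)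
      also have "\<dots> \<le> (\<integral>\<^sup>+x. G x \<partial>lebesgue)" by (intro nn_integral_mono) (auto simp: indicator_def)
      also have "\<dots> = ennreal m" using fin by (simp add: m_def)
      finally have "\<mu> * r powr (n + \<gamma>) < m" using \<mu> by (simp add: ennreal_less_iff)
      then have lt: "r powr (- \<eta>) < m / \<mu>" using \<mu> by (simp add: \<eta>_def field_simps)
      moreover have "0 < r powr (- \<eta>)" using r by simp
      ultimately have pos: "0 < m / \<mu>" by linarith
      have "Rmin \<le> (r powr (- \<eta>)) powr (- 1 / \<eta>)"
        unfolding Rmin_def using lt r \<eta> by (intro powr_mono2') auto
      moreover have "m \<noteq> 0" using pos by auto
      ultimately show ?thesis using \<eta> r \<mu> by (simp add: powr_powr Rmin_def)
    qed
    show "\<exists>a. heavy_ball_weight \<gamma> C \<mu> G a"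
    proof (cases "\<exists>z r. heavy z r")
      \<comment> \<open>Without heavy balls the infimum would be over the empty set; the weight 0
        serves instead.\<close>
      case False
      then show ?thesis
        unfolding heavy_ball_weight_def by (intro exI[of _ "\<lambda>_. 0"]) (auto simp: heavy_def n_def)
    next
      case True
      then have Rpos: "0 < Rmin" using R by blast
      define T where "T x = {r + norm (x - z) / 2 | z r. heavy z r}" for x
      define \<tau> where "\<tau> x = Inf (T x)" for x
      have ne: "T x \<noteq> {}" for x using True by (auto simp: T_def)
      have bdd: "bdd_below (T x)" for x
      proof (rule bdd_belowI)
        fix t assume "t \<in> T x"
        then obtain z r where "t = r + norm (x - z) / 2" "heavy z r" by (auto simp: T_def)
        then show "Rmin \<le> t" using R[of z r] norm_ge_zero[of "x - z"] by linarith
      qed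
      have \<tau>R: "Rmin \<le> \<tau> x" for x
        unfolding \<tau>_def
      proof (rule cInf_greatest[OF ne])
        fix t assume "t \<in> T x"
        then obtain z r where "t = r + norm (x - z) / 2" "heavy z r" by (auto simp: T_def)
        then show "Rmin \<le> t" using R[of z r] norm_ge_zero[of "x - z"] by linarith
      qed
      have \<tau>0: "0 < \<tau> x" for x using \<tau>R[of x] Rpos by simp
      have \<tau>le: "\<tau> x \<le> r + norm (x - z) / 2" if "heavy z r" for x z r
        unfolding \<tau>_def using that by (intro cInf_lower[OF _ bdd]) (auto simp: T_def)
      have lip: "\<tau> x \<le> \<tau> y + norm (x - y) / 2" for x y
      proof -
        have "\<tau> x - norm (x - y) / 2 \<le> t" if "t \<in> T y" for t
        proof -
          obtain z r where zr: "t = r + norm (y - z) / 2" "heavy z r" using \<open>t \<in> T y\<close> by (auto simp: T_def)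
          have "norm (x - z) \<le> norm (x - y) + norm (y - z)"
            using norm_triangle_ineq[of "x - y" "y - z"] by simp
          then show ?thesis using zr \<tau>le[OF zr(2), of x] by simp
        qed
        then have "\<tau> x - norm (x - y) / 2 \<le> \<tau> y" unfolding \<tau>_def[of y] by (intro cInf_greatest ne)
        then show ?thesis by simp
      qed
      have "\<tau> \<in> borel_measurable borel"
        by (intro borel_measurable_continuous_onI continuous_half_Lipschitz lip)
      then have [measurable]: "\<tau> \<in> borel_measurable lebesgue" by (auto intro: measurable_completion)
      \<comment> \<open>The maximum joins the two regimes: for |x-y| < \<tau> y the kernel is
        (\<tau> y)^(-n), as for \<gamma> > 0, and beyond that it decays like |x-y|^\<gamma>. The
        factors 4^\<eta> and 2^(-\<gamma>) of \<open>D\<close> come from r \<le> 4 \<tau> y and max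
        (\<tau> y) |x-y| \<le> 2 \<tau> x.\<close>
      define K where "K x y = ennreal (D / \<mu> * \<tau> y powr \<eta> * max (\<tau> y) (norm (x - y)) powr \<gamma>)" for x y
      have Km[measurable]: "(\<lambda>(x, y). K x y) \<in> borel_measurable (lebesgue \<Otimes>\<^sub>M lebesgue)"
        unfolding K_def by measurable
      show ?thesis
        unfolding heavy_ball_weight_def
      proof (intro exI[of _ "\<lambda>x. ennreal (\<tau> x powr \<gamma>)"] conjI allI impI)
        fix z r assume "0 < r" "ennreal (\<mu> * r powr (real DIM('n) + \<gamma>)) < (\<integral>\<^sup>+x\<in>ball z r. G x \<partial>lebesgue)"
        then have "heavy z r" by (simp add: heavy_def n_def)
        from \<tau>le[OF this, of z] have "\<tau> z \<le> r" by simp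
        then show "ennreal (r powr \<gamma>) \<le> ennreal (\<tau> z powr \<gamma>)"
          using \<tau>0[of z] \<eta> n by (intro ennreal_leI powr_mono2') (auto simp: \<gamma>e)
      next
        fix w :: "'n \<Rightarrow> ennreal" and A :: real
        assume w[measurable]: "w \<in> borel_measurable lebesgue" and A: "0 \<le> A"
          and Mw: "\<forall>x. maximal_op w x \<le> ennreal A * w x"
        have "(\<integral>\<^sup>+x. ennreal (\<tau> x powr \<gamma>) * w x \<partial>lebesgue) \<le> ennreal (C / \<mu>) * ennreal A * (\<integral>\<^sup>+x. G x * w x \<partial>lebesgue)"
        proof (rule charging_integral_le[OF G w Km])
          fix x
          \<comment> \<open>Every heavy radius is at least \<open>Rmin\<close>, so this tolerance is
            at most r/4 and leaves 3r/4 + |x-z|/2 < \<tau> x.\<close>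
          have "Inf (T x) < \<tau> x + Rmin / 4" using Rpos by (simp add: \<tau>_def)
          then obtain t where t: "t \<in> T x" "t < \<tau> x + Rmin / 4"
            using cInf_lessD[OF ne] by blast
          then obtain z r where zr: "t = r + norm (x - z) / 2" "heavy z r" by (auto simp: T_def)
          have r: "0 < r" using zr by (simp add: heavy_def)
          have x1: "r * 3 / 4 + norm (x - z) / 2 < \<tau> x" using t zr R[OF zr(2)] by simp
          have "\<tau> x powr \<gamma> = (\<tau> x powr \<gamma> / \<mu> * r powr \<eta>) * (\<mu> * r powr (n + \<gamma>))"
            using r \<mu> by (simp add: \<eta>_def powr_add powr_minus powr_diff field_simps)
          then have "ennreal (\<tau> x powr \<gamma>) = ennreal (\<tau> x powr \<gamma> / \<mu> * r powr \<eta>) * ennreal (\<mu> * r powr (n + \<gamma>))"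
            using \<mu> by (metis ennreal_mult' divide_nonneg_pos mult_nonneg_nonneg powr_ge_zero)
          also have "\<dots> \<le> ennreal (\<tau> x powr \<gamma> / \<mu> * r powr \<eta>) * (\<integral>\<^sup>+y\<in>ball z r. G y \<partial>lebesgue)"
            using zr by (intro mult_left_mono) (auto simp: heavy_def)
          also have "\<dots> = (\<integral>\<^sup>+y. ennreal (\<tau> x powr \<gamma> / \<mu> * r powr \<eta>) * (G y * indicator (ball z r) y) \<partial>lebesgue)"
            by (intro nn_integral_cmult[symmetric]) measurable
          also have "\<dots> \<le> (\<integral>\<^sup>+y. G y * K x y \<partial>lebesgue)"
          proof (rule nn_integral_mono)
            fix y
            show "ennreal (\<tau> x powr \<gamma> / \<mu> * r powr \<eta>) * (G y * indicator (ball z r) y) \<le> G y * K x y"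
            proof (cases "y \<in> ball z r")
              case True
              then have yz: "norm (y - z) < r" by (simp add: dist_norm norm_minus_commute)
              have xy: "norm (x - y) \<le> norm (x - z) + norm (y - z)"
                using norm_triangle_ineq[of "x - z" "z - y"] by (simp add: norm_minus_commute)
              have y1: "\<tau> y \<le> r * 3 / 2" using \<tau>le[OF zr(2), of y] yz by simp
              have y2: "r / 4 \<le> \<tau> y" using lip[of x y] x1 xy yz by simp
              have mx: "max (\<tau> y) (norm (x - y)) \<le> 2 * \<tau> x" using y1 x1 xy yz r norm_ge_zero[of "x - z"]
                by (intro max.boundedI) linarith+
              have "r powr \<eta> \<le> (4 * \<tau> y) powr \<eta>" using y2 r \<eta> by (intro powr_mono2) auto
              also have "\<dots> = 4 powr \<eta> * \<tau> y powr \<eta>" using \<tau>0[of y] by (simp add: powr_mult)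
              finally have rr: "r powr \<eta> \<le> 4 powr \<eta> * \<tau> y powr \<eta>" .
              have "(2 * \<tau> x) powr \<gamma> \<le> max (\<tau> y) (norm (x - y)) powr \<gamma>"
                using mx \<tau>0[of y] \<eta> n by (intro powr_mono2') (auto simp: \<gamma>e)
              then have "\<tau> x powr \<gamma> \<le> 2 powr (- \<gamma>) * max (\<tau> y) (norm (x - y)) powr \<gamma>"
                using \<tau>0[of x] by (simp add: powr_mult powr_minus field_simps)
              then have "\<tau> x powr \<gamma> / \<mu> * r powr \<eta> \<le> (2 powr (- \<gamma>) * max (\<tau> y) (norm (x - y)) powr \<gamma>) / \<mu> * (4 powr \<eta> * \<tau> y powr \<eta>)"
                using rr \<mu> by (intro mult_mono divide_right_mono) auto
              also have "\<dots> = D / \<mu> * \<tau> y powr \<eta> * max (\<tau> y) (norm (x - y)) powr \<gamma>" by (simp add: D_def)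
              finally have "ennreal (\<tau> x powr \<gamma> / \<mu> * r powr \<eta>) \<le> K x y"
                by (simp only: K_def ennreal_leI)
              then show ?thesis using True by (simp add: mult.commute[of "G y"] mult_right_mono)
            qed simp
          qed
          finally show "ennreal (\<tau> x powr \<gamma>) \<le> (\<integral>\<^sup>+y. G y * K x y \<partial>lebesgue)" .
        next
          fix y
          define R where "R = \<tau> y"
          have R0: "0 < R" by (simp add: R_def \<tau>0)
          \<comment> \<open>The factor 2 turns the closed condition |x-y| \<ge> R into the strict
            one of the superlevel estimate.\<close>
          define U where "U = {x. norm (x - y) powr - \<eta> < 2 * R powr - \<eta>}"
          have "{x \<in> space lebesgue. norm (x - y) powr - \<eta> < 2 * R powr - \<eta>} \<in> sets lebesgue" by measurable
          then have [measurable]: "U \<in> sets lebesgue" by (simp add: U_def)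
          have split: "K x y \<le> ennreal (D / \<mu> * R powr (- n)) * indicator (ball y R) x
             + ennreal (D / \<mu> * R powr \<eta>) * (indicator U x * riesz_kernel (- \<eta>) x y)" for x
          proof (cases "norm (x - y) < R")
            case True
            have "R powr \<eta> * R powr \<gamma> = R powr (- n)" using R0 by (simp add: \<gamma>e powr_add[symmetric])
            then have "K x y = ennreal (D / \<mu> * R powr (- n))" using True by (simp add: K_def R_def[symmetric] mult.assoc)
            then show ?thesis using True by (simp add: dist_norm norm_minus_commute add_increasing2)
          next
            case False
            then have "norm (x - y) powr - \<eta> \<le> R powr - \<eta>" using R0 \<eta> by (intro powr_mono2') auto
            also have "\<dots> < 2 * R powr - \<eta>" using R0 by simp
            finally have "x \<in> U" by (simp add: U_def)
            have "- \<eta> - real DIM('n) = \<gamma>" by (simp add: \<gamma>e n_def)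
            then have "riesz_kernel (- \<eta>) x y = ennreal (norm (x - y) powr \<gamma>)" by (simp add: riesz_kernel_def)
            then have "K x y = ennreal (D / \<mu> * R powr \<eta>) * riesz_kernel (- \<eta>) x y"
              using False D \<mu> by (simp add: K_def R_def[symmetric] ennreal_mult'[symmetric] max_def)
            then show ?thesis using False \<open>x \<in> U\<close> by (simp add: dist_norm norm_minus_commute)
          qed
          have "(\<integral>\<^sup>+x. K x y * w x \<partial>lebesgue) \<le> (\<integral>\<^sup>+x. ennreal (D / \<mu> * R powr (- n)) * (w x * indicator (ball y R) x)
             + ennreal (D / \<mu> * R powr \<eta>) * (indicator U x * riesz_kernel (- \<eta>) x y * w x) \<partial>lebesgue)"
          proof (rule nn_integral_mono)
            fix x
            have "K x y * w x \<le> (ennreal (D / \<mu> * R powr (- n)) * indicator (ball y R) x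
             + ennreal (D / \<mu> * R powr \<eta>) * (indicator U x * riesz_kernel (- \<eta>) x y)) * w x"
              by (intro mult_right_mono split) simp
            then show "K x y * w x \<le> ennreal (D / \<mu> * R powr (- n)) * (w x * indicator (ball y R) x)
             + ennreal (D / \<mu> * R powr \<eta>) * (indicator U x * riesz_kernel (- \<eta>) x y * w x)"
              by (simp only: distrib_right mult.assoc mult.commute[of "w x"])
          qed
          also have "\<dots> = ennreal (D / \<mu> * R powr (- n)) * (\<integral>\<^sup>+x\<in>ball y R. w x \<partial>lebesgue)
             + ennreal (D / \<mu> * R powr \<eta>) * (\<integral>\<^sup>+x. indicator U x * riesz_kernel (- \<eta>) x y * w x \<partial>lebesgue)"
            by (subst nn_integral_add) (auto simp: nn_integral_cmult)
          also have "(\<integral>\<^sup>+x\<in>ball y R. w x \<partial>lebesgue) \<le> ennreal (V * R ^ DIM('n)) * maximal_op w y"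
            unfolding V_def n_def by (rule ball_integral_le_maximal_op[OF R0])
          also have "(\<integral>\<^sup>+x. indicator U x * riesz_kernel (- \<eta>) x y * w x \<partial>lebesgue) \<le> ennreal (P * (2 * R powr - \<eta>)) * maximal_op w y"
            unfolding U_def by (rule P'[rule_format]) auto
          also have "ennreal (D / \<mu> * R powr (- n)) * (ennreal (V * R ^ DIM('n)) * maximal_op w y) = ennreal (D * V / \<mu>) * maximal_op w y"
          proof -
            have "D / \<mu> * R powr (- n) * (V * R ^ DIM('n)) = D * V / \<mu>"
              using R0 by (simp add: n_def powr_minus powr_realpow field_simps)
            moreover have "ennreal (D / \<mu> * R powr (- n)) * ennreal (V * R ^ DIM('n)) = ennreal (D / \<mu> * R powr (- n) * (V * R ^ DIM('n)))"
              using D \<mu> by (intro ennreal_mult'[symmetric]) auto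
            ultimately show ?thesis by (simp only: mult.assoc[symmetric])
          qed
          also have "ennreal (D / \<mu> * R powr \<eta>) * (ennreal (P * (2 * R powr - \<eta>)) * maximal_op w y) = ennreal (2 * D * P / \<mu>) * maximal_op w y"
          proof -
            have "D / \<mu> * R powr \<eta> * (P * (2 * R powr - \<eta>)) = 2 * D * P / \<mu>"
              using R0 by (simp add: powr_minus field_simps)
            moreover have "ennreal (D / \<mu> * R powr \<eta>) * ennreal (P * (2 * R powr - \<eta>)) = ennreal (D / \<mu> * R powr \<eta> * (P * (2 * R powr - \<eta>)))"
              using D \<mu> by (intro ennreal_mult'[symmetric]) auto
            ultimately show ?thesis by (simp only: mult.assoc[symmetric])
          qed
          also have "ennreal (D * V / \<mu>) * maximal_op w y + ennreal (2 * D * P / \<mu>) * maximal_op w y = ennreal (C / \<mu>) * maximal_op w y"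
          proof -
            have "D * V / \<mu> + 2 * D * P / \<mu> = C / \<mu>" by (simp add: C_def algebra_simps add_divide_distrib)
            then have "ennreal (D * V / \<mu>) + ennreal (2 * D * P / \<mu>) = ennreal (C / \<mu>)"
              using D V P \<mu> by (subst ennreal_plus[symmetric]) auto
            then show ?thesis by (simp only: distrib_right[symmetric])
          qed
          finally show "(\<integral>\<^sup>+x. K x y * w x \<partial>lebesgue) \<le> ennreal (C / \<mu>) * maximal_op w y"
            by (simp add: add_mono mult_left_mono)
        qed (use Mw in blast)
        also have "ennreal (C / \<mu>) * ennreal A = ennreal (C * A / \<mu>)"
          using C \<mu> A by (subst ennreal_mult'[symmetric]) auto
        finally show "(\<integral>\<^sup>+x. ennreal (\<tau> x powr \<gamma>) * w x \<partial>lebesgue) \<le> ennreal (C * A / \<mu>) * (\<integral>\<^sup>+x. G x * w x \<partial>lebesgue)" .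
      qed measurable
    qed
  qed
qed

section \<open>Increments of a continuously differentiable function\<close>

text \<open>From here on this rule would misdirect the measurability prover: it would factor Borel maps
  through \<^term>\<open>lebesgue\<close>.\<close>

declare borel_measurable_lebesgue_id [measurable del]

lemma segment_gradient_bound:
  fixes f :: "'n::euclidean_space \<Rightarrow> real" and g :: "'n \<Rightarrow> 'n"
  assumes f: "\<And>x. (f has_derivative (\<lambda>h. g x \<bullet> h)) (at x)" and g: "continuous_on UNIV g"
  shows "ennreal \<bar>f y - f x\<bar> \<le> ennreal (norm (y - x)) *
    (\<integral>\<^sup>+t. indicator {0..1} t * ennreal (norm (g (x + t *\<^sub>R (y - x)))) \<partial>lborel)"
proof -
  let ?p = "\<lambda>t::real. x + t *\<^sub>R (y - x)"
  let ?h = "\<lambda>t. norm (g (?p t)) * norm (y - x)"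
  have der: "((\<lambda>t. f (?p t)) has_vector_derivative (g (?p t) \<bullet> (y - x))) (at t within {0..1})" for t
  proof -
    have "(?p has_derivative (\<lambda>t. t *\<^sub>R (y - x))) (at t within {0..1})"
      by (auto intro!: derivative_eq_intros)
    from has_derivative_compose[OF this f] show ?thesis
      by (simp add: has_vector_derivative_def)
  qed
  have int: "((\<lambda>t. g (?p t) \<bullet> (y - x)) has_integral (f (?p 1) - f (?p 0))) {0..1}"
    by (intro fundamental_theorem_of_calculus der) simp
  have cont: "continuous_on {0..1} (\<lambda>t. norm (g (?p t)))"
    by (intro continuous_intros continuous_on_compose2[OF g]) auto
  have "?h integrable_on {0..1}"
    by (intro integrable_continuous_real continuous_on_mult_right cont)
  then have hi: "(?h has_integral (integral {0..1} ?h)) {0..1}" by (rule integrable_integral)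
  have "norm (integral {0..1} (\<lambda>t. g (?p t) \<bullet> (y - x))) \<le> integral {0..1} ?h"
    using int hi Cauchy_Schwarz_ineq2 by (intro integral_norm_bound_integral) (auto simp: has_integral_integrable)
  then have "ennreal \<bar>f y - f x\<bar> \<le> ennreal (integral {0..1} ?h)"
    using integral_unique[OF int] by (intro ennreal_leI) simp
  also have "\<dots> = (\<integral>\<^sup>+t. ennreal (indicator {0..1} t * ?h t) \<partial>lborel)"
    by (rule nn_integral_has_integral_lebesgue[OF _ hi, symmetric]) simp
  also have "\<dots> = (\<integral>\<^sup>+t. ennreal (norm (y - x)) * (indicator {0..1} t * ennreal (norm (g (?p t)))) \<partial>lborel)"
    by (intro nn_integral_cong) (auto simp: indicator_def ennreal_mult' mult.commute)
  also have "\<dots> = ennreal (norm (y - x)) * (\<integral>\<^sup>+t. indicator {0..1} t * ennreal (norm (g (?p t))) \<partial>lborel)"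
  proof (intro nn_integral_cmult)
    have "g \<in> borel_measurable borel" using g by (rule borel_measurable_continuous_onI)
    from measurable_compose[OF _ this, of ?p lborel]
    have [measurable]: "(\<lambda>t. g (?p t)) \<in> borel_measurable lborel" by simp
    show "(\<lambda>t. indicator {0..1} t * ennreal (norm (g (?p t)))) \<in> borel_measurable lborel" by measurable
  qed
  finally show ?thesis .
qed

text \<open>The type stays abstract, so dimension one means that a single basis vector spans it;
  this carries integrals over to the real line.\<close>

lemma lborel_DIM_1:
  fixes e :: "'n::euclidean_space"
  assumes "Basis = {e}"
  shows "(lborel :: 'n measure) = distr lborel borel (\<lambda>s::real. s *\<^sub>R e)"
proof (rule lborel_eqI)
  fix l u :: 'n assume le: "\<And>b. b \<in> Basis \<Longrightarrow> l \<bullet> b \<le> u \<bullet> b"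
  have e: "e \<in> Basis" unfolding assms by (rule singletonI)
  have "(\<lambda>s::real. s *\<^sub>R e) -` box l u = {l \<bullet> e <..< u \<bullet> e}"
    using e by (auto simp: box_def assms)
  then have "emeasure (distr lborel borel (\<lambda>s::real. s *\<^sub>R e)) (box l u) = emeasure lborel {l \<bullet> e <..< u \<bullet> e}"
    by (subst emeasure_distr) auto
  also have "\<dots> = (\<Prod>b\<in>Basis. (u - l) \<bullet> b)"
    using le[OF e] by (simp add: assms inner_diff_left)
  finally show "emeasure (distr lborel borel (\<lambda>s::real. s *\<^sub>R e)) (box l u) = (\<Prod>b\<in>Basis. (u - l) \<bullet> b)" .
qed simp

text \<open>On a line the segment from x to y has positive measure, so the increment is bounded by
  an integral of the gradient over it, without averaging over nearby points.\<close>

lemma segment_gradient_bound_DIM_1: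
  fixes f :: "'n::euclidean_space \<Rightarrow> real" and g :: "'n \<Rightarrow> 'n"
  assumes f: "\<And>x. (f has_derivative (\<lambda>h. g x \<bullet> h)) (at x)" and g: "continuous_on UNIV g"
    and dim: "DIM('n) = 1"
  shows "ennreal \<bar>f y - f x\<bar> \<le> (\<integral>\<^sup>+z\<in>cball x (norm (y - x)). ennreal (norm (g z)) \<partial>lebesgue)"
proof (cases "x = y")
  case False
  obtain e where e: "Basis = {e::'n}" using dim card_1_singletonE by blast
  have eB: "e \<in> Basis" unfolding e by (rule singletonI)
  have rep: "v = (v \<bullet> e) *\<^sub>R e" for v
    using euclidean_representation[of v] by (simp add: e)
  define \<sigma> where "\<sigma> = (y - x) \<bullet> e"
  have yx: "y - x = \<sigma> *\<^sub>R e" unfolding \<sigma>_def by (rule rep)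
  have n\<sigma>: "norm (y - x) = \<bar>\<sigma>\<bar>" using eB by (simp add: yx)
  have \<sigma>: "\<sigma> \<noteq> 0" using False yx by auto
  let ?F = "\<lambda>z. ennreal (norm (g z)) * indicator (cball x (norm (y - x))) z"
  have [measurable]: "g \<in> borel_measurable borel" using g by (rule borel_measurable_continuous_onI)
  have [measurable]: "(\<lambda>s::real. g (s *\<^sub>R e)) \<in> borel_measurable borel"
    by (rule measurable_compose[OF _ \<open>g \<in> borel_measurable borel\<close>]) simp
  have [measurable]: "cball x (norm (y - x)) \<in> sets borel" by simp
  have "(\<integral>\<^sup>+z. ?F z \<partial>lebesgue) = (\<integral>\<^sup>+z. ?F z \<partial>lborel)" by (rule nn_integral_completion)
  also have "\<dots> = (\<integral>\<^sup>+s. ?F (s *\<^sub>R e) \<partial>lborel)"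
    by (subst lborel_DIM_1[OF e], subst nn_integral_distr) auto
  also have "\<dots> = ennreal \<bar>\<sigma>\<bar> * (\<integral>\<^sup>+t. ?F ((x \<bullet> e + \<sigma> * t) *\<^sub>R e) \<partial>lborel)"
    using \<sigma> by (intro nn_integral_real_affine) measurable
  finally have E: "(\<integral>\<^sup>+z. ?F z \<partial>lebesgue) = ennreal \<bar>\<sigma>\<bar> * (\<integral>\<^sup>+t. ?F ((x \<bullet> e + \<sigma> * t) *\<^sub>R e) \<partial>lborel)" .
  have "(\<integral>\<^sup>+t. ?F ((x \<bullet> e + \<sigma> * t) *\<^sub>R e) \<partial>lborel) \<ge>
      (\<integral>\<^sup>+t. indicator {0..1} t * ennreal (norm (g (x + t *\<^sub>R (y - x)))) \<partial>lborel)"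
  proof (rule nn_integral_mono)
    fix t :: real
    have "(x \<bullet> e + \<sigma> * t) *\<^sub>R e = x + t *\<^sub>R (y - x)"
      using rep[of x] by (simp add: yx scaleR_add_left mult.commute)
    moreover have "x + t *\<^sub>R (y - x) \<in> cball x (norm (y - x))" if "t \<in> {0..1}"
      using that by (auto simp: dist_norm mult_left_le_one_le)
    ultimately show "indicator {0..1} t * ennreal (norm (g (x + t *\<^sub>R (y - x)))) \<le> ?F ((x \<bullet> e + \<sigma> * t) *\<^sub>R e)"
      by (auto simp: indicator_def)
  qed
  then have "ennreal \<bar>\<sigma>\<bar> * (\<integral>\<^sup>+t. indicator {0..1} t * ennreal (norm (g (x + t *\<^sub>R (y - x)))) \<partial>lborel) \<le> (\<integral>\<^sup>+z. ?F z \<partial>lebesgue)"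
    unfolding E by (intro mult_left_mono) auto
  then show ?thesis
    using segment_gradient_bound[OF f g, of y x] unfolding n\<sigma> by (rule order_trans[rotated])
qed simp

section \<open>Increments and averages over balls\<close>

lemma nn_integral_lborel_affine:
  fixes F :: "'n::euclidean_space \<Rightarrow> ennreal"
  assumes [measurable]: "F \<in> borel_measurable borel" and t: "t \<noteq> 0"
  shows "(\<integral>\<^sup>+u. F u \<partial>lborel) = ennreal (\<bar>t\<bar> ^ DIM('n)) * (\<integral>\<^sup>+z. F (b + t *\<^sub>R z) \<partial>lborel)"
  by (subst lborel_affine[OF t, of b]) (simp add: nn_integral_density nn_integral_distr nn_integral_cmult)

text \<open>For n \<ge> 2, integrating in t first gives the kernel ((r/|u-x|)^(n-1) - 1)/(n-1) on
  B(x,r), a truncated Riesz potential of order one. The integral in t is kept because later a single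
  t is selected from it.\<close>

definition averaged_gradient :: "('n::euclidean_space \<Rightarrow> 'n) \<Rightarrow> 'n \<Rightarrow> real \<Rightarrow> ennreal" where
  "averaged_gradient g x r = (\<integral>\<^sup>+t. indicator {0<..<1} t * (ennreal (t powr (- real DIM('n))) *
     (\<integral>\<^sup>+u\<in>ball x (t * r). ennreal (norm (g u)) \<partial>lebesgue)) \<partial>lborel)"

text \<open>Integrate the bound along segments over z and exchange with t. The substitution u = x +
  t (z - x) maps B(x,r) onto B(x, t r) and produces the factor t^(-n).\<close>

lemma integral_increment_le_averaged_gradient:
  fixes f :: "'n::euclidean_space \<Rightarrow> real" and g :: "'n \<Rightarrow> 'n"
  assumes f: "\<And>x. (f has_derivative (\<lambda>h. g x \<bullet> h)) (at x)" and g: "continuous_on UNIV g"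
    and S: "S \<subseteq> ball x r" "S \<in> sets borel"
  shows "(\<integral>\<^sup>+z\<in>S. ennreal \<bar>f z - f x\<bar> \<partial>lebesgue) \<le> ennreal r * averaged_gradient g x r"
proof -
  have gb[measurable]: "g \<in> borel_measurable borel" using g by (rule borel_measurable_continuous_onI)
  have [measurable]: "S \<in> sets borel" "ball x r \<in> sets borel" using S by auto
  let ?G = "\<lambda>u. ennreal (norm (g u))"
  let ?k = "\<lambda>t z. indicator {0..1} t * ?G (x + t *\<^sub>R (z - x))"
  have [measurable]: "(\<lambda>(z, t). ?k t z * indicator S z) \<in> borel_measurable (lborel \<Otimes>\<^sub>M lborel)"
  proof -
    have "(\<lambda>p. g (x + snd p *\<^sub>R (fst p - x))) \<in> borel_measurable (lborel \<Otimes>\<^sub>M lborel)"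
      by (rule measurable_compose[OF _ gb]) measurable
    then show ?thesis unfolding split_beta' by measurable
  qed
  have gx: "(\<lambda>z. g (x + t *\<^sub>R (z - x))) \<in> borel_measurable lborel" for t
    by (rule measurable_compose[OF _ gb]) measurable
  have [measurable]: "(\<lambda>t. g (x + t *\<^sub>R (z - x))) \<in> borel_measurable borel" for z
    by (rule measurable_compose[OF _ gb]) measurable
  have kS: "(\<lambda>(t, z). ?k t z * indicator S z) \<in> borel_measurable (lborel \<Otimes>\<^sub>M lborel)"
  proof -
    have "(\<lambda>p. g (x + fst p *\<^sub>R (snd p - x))) \<in> borel_measurable (lborel \<Otimes>\<^sub>M lborel)"
      by (rule measurable_compose[OF _ gb]) measurable
    then show ?thesis unfolding split_beta' by measurable
  qed
  have scale: "(\<integral>\<^sup>+z. ?G (x + t *\<^sub>R (z - x)) * indicator (ball x r) z \<partial>lborel)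
      = ennreal (t powr (- real DIM('n))) * (\<integral>\<^sup>+u\<in>ball x (t * r). ?G u \<partial>lborel)" if t: "0 < t" for t
  proof -
    have eq: "(x - t *\<^sub>R x) + t *\<^sub>R z = x + t *\<^sub>R (z - x)" for z by (simp add: algebra_simps)
    have [measurable]: "ball x (t * r) \<in> sets borel" by simp
    have m: "(\<lambda>u. ?G u * indicator (ball x (t * r)) u) \<in> borel_measurable borel" by measurable
    have "(\<integral>\<^sup>+u. ?G u * indicator (ball x (t * r)) u \<partial>lborel)
      = ennreal (t ^ DIM('n)) * (\<integral>\<^sup>+z. ?G (x + t *\<^sub>R (z - x)) * indicator (ball x (t * r)) (x + t *\<^sub>R (z - x)) \<partial>lborel)"
      using t nn_integral_lborel_affine[OF m, of t "x - t *\<^sub>R x"]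
      by (simp add: eq)
    also have "(\<integral>\<^sup>+z. ?G (x + t *\<^sub>R (z - x)) * indicator (ball x (t * r)) (x + t *\<^sub>R (z - x)) \<partial>lborel) = (\<integral>\<^sup>+z. ?G (x + t *\<^sub>R (z - x)) * indicator (ball x r) z \<partial>lborel)"
      using t by (intro nn_integral_cong) (auto simp: indicator_def dist_norm norm_minus_commute)
    finally have "(\<integral>\<^sup>+u\<in>ball x (t * r). ?G u \<partial>lborel) = ennreal (t ^ DIM('n)) * (\<integral>\<^sup>+z. ?G (x + t *\<^sub>R (z - x)) * indicator (ball x r) z \<partial>lborel)" .
    moreover have "ennreal (t powr (- real DIM('n))) * ennreal (t ^ DIM('n)) = 1"
      using t by (subst ennreal_mult'[symmetric]) (auto simp: powr_minus powr_realpow)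
    ultimately show ?thesis by (simp add: mult.assoc[symmetric])
  qed
  have "(\<integral>\<^sup>+z\<in>S. ennreal \<bar>f z - f x\<bar> \<partial>lebesgue) = (\<integral>\<^sup>+z\<in>S. ennreal \<bar>f z - f x\<bar> \<partial>lborel)"
    by (rule nn_integral_completion)
  also have "\<dots> \<le> (\<integral>\<^sup>+z. ennreal r * (\<integral>\<^sup>+t. ?k t z * indicator S z \<partial>lborel) \<partial>lborel)"
  proof (rule nn_integral_mono)
    fix z
    show "ennreal \<bar>f z - f x\<bar> * indicator S z \<le> ennreal r * (\<integral>\<^sup>+t. ?k t z * indicator S z \<partial>lborel)"
    proof (cases "z \<in> S")
      case True
      then have "norm (z - x) \<le> r" using S by (auto simp: dist_norm norm_minus_commute subset_eq intro: less_imp_le)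
      then have "ennreal (norm (z - x)) * (\<integral>\<^sup>+t. ?k t z \<partial>lborel) \<le> ennreal r * (\<integral>\<^sup>+t. ?k t z \<partial>lborel)"
        by (intro mult_right_mono ennreal_leI) auto
      with segment_gradient_bound[OF f g, of z x] True show ?thesis by simp
    qed simp
  qed
  also have "\<dots> = ennreal r * (\<integral>\<^sup>+z. (\<integral>\<^sup>+t. ?k t z * indicator S z \<partial>lborel) \<partial>lborel)"
    by (intro nn_integral_cmult) measurable
  also have "(\<integral>\<^sup>+z. (\<integral>\<^sup>+t. ?k t z * indicator S z \<partial>lborel) \<partial>lborel) = (\<integral>\<^sup>+t. (\<integral>\<^sup>+z. ?k t z * indicator S z \<partial>lborel) \<partial>lborel)"
    by (rule lborel_pair.Fubini'[OF kS])
  also have "\<dots> \<le> (\<integral>\<^sup>+t. indicator {0..1} t * (\<integral>\<^sup>+z. ?G (x + t *\<^sub>R (z - x)) * indicator (ball x r) z \<partial>lborel) \<partial>lborel)"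
  proof (rule nn_integral_mono)
    fix t :: real
    have "(\<integral>\<^sup>+z. ?k t z * indicator S z \<partial>lborel) \<le> (\<integral>\<^sup>+z. indicator {0..1} t * (?G (x + t *\<^sub>R (z - x)) * indicator (ball x r) z) \<partial>lborel)"
      using S by (intro nn_integral_mono) (auto simp: indicator_def)
    also have "\<dots> = indicator {0..1} t * (\<integral>\<^sup>+z. ?G (x + t *\<^sub>R (z - x)) * indicator (ball x r) z \<partial>lborel)"
      by (intro nn_integral_cmult borel_measurable_times_ennreal borel_measurable_indicator
          measurable_compose[OF _ measurable_ennreal] measurable_compose[OF gx borel_measurable_norm]) auto
    finally show "(\<integral>\<^sup>+z. ?k t z * indicator S z \<partial>lborel) \<le> \<dots>" .
  qed
  also have "\<dots> = averaged_gradient g x r"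
    unfolding averaged_gradient_def nn_integral_completion
  proof (rule nn_integral_cong_AE)
    have "AE t in lborel. t \<noteq> (0::real)" "AE t in lborel. t \<noteq> (1::real)" by (auto intro: AE_lborel_singleton)
    then show "AE t in lborel. indicator {0..1} t * (\<integral>\<^sup>+z. ?G (x + t *\<^sub>R (z - x)) * indicator (ball x r) z \<partial>lborel)
      = indicator {0<..<1} t * (ennreal (t powr (- real DIM('n))) * (\<integral>\<^sup>+u\<in>ball x (t * r). ?G u \<partial>lborel))"
    proof eventually_elim
      fix t :: real assume "t \<noteq> 0" "t \<noteq> 1"
      then show "indicator {0..1} t * (\<integral>\<^sup>+z. ?G (x + t *\<^sub>R (z - x)) * indicator (ball x r) z \<partial>lborel)
        = indicator {0<..<1} t * (ennreal (t powr (- real DIM('n))) * (\<integral>\<^sup>+u\<in>ball x (t * r). ?G u \<partial>lborel))"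
        by (cases "0 < t \<and> t < 1") (simp add: scale, auto)
    qed
  qed
  finally show ?thesis by (simp add: mult_left_mono)
qed

text \<open>Averaging over the ball with diameter \<open>[x, y]\<close>, which lies in \<open>B(x, r)\<close> and in \<open>B(y, r)\<close>.\<close>

lemma increment_le_averaged_gradient:
  fixes f :: "'n::euclidean_space \<Rightarrow> real" and g :: "'n \<Rightarrow> 'n"
  assumes f: "\<And>x. (f has_derivative (\<lambda>h. g x \<bullet> h)) (at x)" and g: "continuous_on UNIV g"
    and r: "r = norm (x - y)" "0 < r"
  shows "ennreal (\<bar>f x - f y\<bar> * (unit_ball_vol (real DIM('n)) * (r / 2) ^ DIM('n)))
    \<le> ennreal r * (averaged_gradient g x r + averaged_gradient g y r)"
proof -
  define S where "S = ball ((1/2) *\<^sub>R (x + y)) (r / 2)"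
  have nx: "norm (x - (1/2) *\<^sub>R (x + y)) = r / 2"
  proof -
    have "x - (1/2) *\<^sub>R (x + y) = (1/2) *\<^sub>R (x - y)" by (simp add: algebra_simps flip: scaleR_2)
    then show ?thesis using r by simp
  qed
  have ny: "norm (y - (1/2) *\<^sub>R (x + y)) = r / 2"
  proof -
    have "y - (1/2) *\<^sub>R (x + y) = - ((1/2) *\<^sub>R (x - y))" by (simp add: algebra_simps flip: scaleR_2)
    then show ?thesis using r by (simp only: norm_minus_cancel) simp
  qed
  have Sx: "S \<subseteq> ball x r"
  proof
    fix z assume "z \<in> S"
    then have "norm ((1/2) *\<^sub>R (x + y) - z) < r / 2" by (simp add: S_def dist_norm)
    with nx norm_triangle_ineq[of "x - (1/2) *\<^sub>R (x + y)" "(1/2) *\<^sub>R (x + y) - z"] show "z \<in> ball x r"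
      by (simp add: dist_norm)
  qed
  have Sy: "S \<subseteq> ball y r"
  proof
    fix z assume "z \<in> S"
    then have "norm ((1/2) *\<^sub>R (x + y) - z) < r / 2" by (simp add: S_def dist_norm)
    with ny norm_triangle_ineq[of "y - (1/2) *\<^sub>R (x + y)" "(1/2) *\<^sub>R (x + y) - z"] show "z \<in> ball y r"
      by (simp add: dist_norm)
  qed
  have fc: "continuous_on UNIV f"
    using f by (intro continuous_at_imp_continuous_on ballI has_derivative_continuous) auto
  have [measurable]: "f \<in> borel_measurable lebesgue" by (rule borel_measurable_continuous_lebesgue[OF fc])
  have [measurable]: "S \<in> sets lebesgue" unfolding S_def by measurable
  have "ennreal (\<bar>f x - f y\<bar> * (unit_ball_vol (real DIM('n)) * (r / 2) ^ DIM('n)))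
    = ennreal \<bar>f x - f y\<bar> * emeasure lebesgue S"
    unfolding S_def using r by (subst emeasure_lebesgue_ball) (auto simp: ennreal_mult')
  also have "\<dots> = (\<integral>\<^sup>+z\<in>S. ennreal \<bar>f x - f y\<bar> \<partial>lebesgue)"
    by (rule nn_integral_cmult_indicator[symmetric]) measurable
  also have "\<dots> \<le> (\<integral>\<^sup>+z. ennreal \<bar>f z - f x\<bar> * indicator S z + ennreal \<bar>f z - f y\<bar> * indicator S z \<partial>lebesgue)"
  proof (rule nn_integral_mono)
    fix z
    have "ennreal \<bar>f x - f y\<bar> \<le> ennreal (\<bar>f z - f x\<bar> + \<bar>f z - f y\<bar>)" by (intro ennreal_leI) simp
    also have "\<dots> = ennreal \<bar>f z - f x\<bar> + ennreal \<bar>f z - f y\<bar>" by simp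
    finally show "ennreal \<bar>f x - f y\<bar> * indicator S z \<le> ennreal \<bar>f z - f x\<bar> * indicator S z + ennreal \<bar>f z - f y\<bar> * indicator S z"
      by (auto simp: indicator_def)
  qed
  also have "\<dots> = (\<integral>\<^sup>+z\<in>S. ennreal \<bar>f z - f x\<bar> \<partial>lebesgue) + (\<integral>\<^sup>+z\<in>S. ennreal \<bar>f z - f y\<bar> \<partial>lebesgue)"
    by (intro nn_integral_add) measurable
  also have "\<dots> \<le> ennreal r * averaged_gradient g x r + ennreal r * averaged_gradient g y r"
    by (intro add_mono integral_increment_le_averaged_gradient[OF f g] Sx Sy) (auto simp: S_def)
  finally show ?thesis by (simp add: distrib_left)
qed

text \<open>The mass of B(x, t r) is at most a constant times (t r)^n M, which cancels t^(-n)
  uniformly in t. Cutting the gradient to \<open>B\<close> keeps the maximal function bounded when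
  \<open>B\<close> is a ball.\<close>

lemma averaged_gradient_le_maximal_op:
  fixes g :: "'n::euclidean_space \<Rightarrow> 'n"
  assumes B: "ball x r \<subseteq> B" and r: "0 < r"
  shows "averaged_gradient g x r \<le> ennreal (unit_ball_vol (real DIM('n)) * r ^ DIM('n)) *
    maximal_op (\<lambda>u. ennreal (norm (g u)) * indicator B u) x"
proof -
  let ?G = "\<lambda>u. ennreal (norm (g u)) * indicator B u"
  let ?c = "ennreal (unit_ball_vol (real DIM('n)) * r ^ DIM('n)) * maximal_op ?G x"
  have "averaged_gradient g x r \<le> (\<integral>\<^sup>+t. ?c * indicator {0<..<1::real} t \<partial>lborel)"
    unfolding averaged_gradient_def
  proof (rule nn_integral_mono)
    fix t :: real
    show "indicator {0<..<1} t * (ennreal (t powr (- real DIM('n))) * (\<integral>\<^sup>+u\<in>ball x (t * r). ennreal (norm (g u)) \<partial>lebesgue))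
      \<le> ?c * indicator {0<..<1} t"
    proof (cases "t \<in> {0<..<1}")
      case True
      then have t: "0 < t" "t < 1" by auto
      have "t * r \<le> r" using t r by simp
      then have "ball x (t * r) \<subseteq> B" using B by (meson subset_ball subset_trans)
      then have "(\<integral>\<^sup>+u\<in>ball x (t * r). ennreal (norm (g u)) \<partial>lebesgue) = (\<integral>\<^sup>+u\<in>ball x (t * r). ?G u \<partial>lebesgue)"
        by (intro nn_integral_cong) (auto simp: indicator_def)
      also have "\<dots> \<le> ennreal (unit_ball_vol (real DIM('n)) * (t * r) ^ DIM('n)) * maximal_op ?G x"
        using t r by (intro ball_integral_le_maximal_op) auto
      finally have "ennreal (t powr (- real DIM('n))) * (\<integral>\<^sup>+u\<in>ball x (t * r). ennreal (norm (g u)) \<partial>lebesgue)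
        \<le> ennreal (t powr (- real DIM('n))) * (ennreal (unit_ball_vol (real DIM('n)) * (t * r) ^ DIM('n)) * maximal_op ?G x)"
        by (intro mult_left_mono) auto
      also have "\<dots> = ?c"
      proof -
        have eq: "t powr (- real DIM('n)) * (unit_ball_vol (real DIM('n)) * (t * r) ^ DIM('n)) = unit_ball_vol (real DIM('n)) * r ^ DIM('n)"
          using t by (simp add: powr_minus powr_realpow power_mult_distrib field_simps)
        then have "ennreal (t powr (- real DIM('n))) * ennreal (unit_ball_vol (real DIM('n)) * (t * r) ^ DIM('n)) = ennreal (unit_ball_vol (real DIM('n)) * r ^ DIM('n))"
          unfolding eq[symmetric] by (intro ennreal_mult'[symmetric]) simp
        then show ?thesis by (simp only: mult.assoc[symmetric, where 'a = ennreal])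
      qed
      finally show ?thesis using True by simp
    qed simp
  qed
  also have "\<dots> = ?c" by (subst nn_integral_cmult_indicator) auto
  finally show ?thesis .
qed

text \<open>The weight \<open>t\<^bsup>-1/2\<^esup>\<close> is integrable on \<open>(0, 1)\<close>, so a large average forces one large value.\<close>

lemma averaged_gradient_large:
  fixes g :: "'n::euclidean_space \<Rightarrow> 'n"
  assumes "ennreal c < averaged_gradient g x r" and c: "0 \<le> c"
  obtains t where "0 < t" "t < 1"
    "ennreal (c / 2 * t powr (real DIM('n) - 1/2)) < (\<integral>\<^sup>+u\<in>ball x (t * r). ennreal (norm (g u)) \<partial>lebesgue)"
proof -
  have "\<exists>t. 0 < t \<and> t < 1 \<and> ennreal (c / 2 * t powr (real DIM('n) - 1/2)) < (\<integral>\<^sup>+u\<in>ball x (t * r). ennreal (norm (g u)) \<partial>lebesgue)"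
  proof (rule ccontr)
    assume ne: "\<not> ?thesis"
    have le: "(\<integral>\<^sup>+u\<in>ball x (t * r). ennreal (norm (g u)) \<partial>lebesgue) \<le> ennreal (c / 2 * t powr (real DIM('n) - 1/2))"
      if "0 < t" "t < 1" for t
      by (rule leI) (use ne that in blast)
    \<comment> \<open>The integral of t^(-1/2) over (0,1) is 2, which is the reason for the factor
      c/2 in the claim.\<close>
    have "averaged_gradient g x r \<le> (\<integral>\<^sup>+t. ennreal (indicator {0..1} t * (c / 2 * t powr (- 1/2))) \<partial>lborel)"
      unfolding averaged_gradient_def
    proof (rule nn_integral_mono)
      fix t :: real
      show "indicator {0<..<1} t * (ennreal (t powr (- real DIM('n))) * (\<integral>\<^sup>+u\<in>ball x (t * r). ennreal (norm (g u)) \<partial>lebesgue))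
        \<le> ennreal (indicator {0..1} t * (c / 2 * t powr (- 1/2)))"
      proof (cases "t \<in> {0<..<1}")
        case True
        then have t: "0 < t" "t < 1" by auto
        have "ennreal (t powr (- real DIM('n))) * (\<integral>\<^sup>+u\<in>ball x (t * r). ennreal (norm (g u)) \<partial>lebesgue)
          \<le> ennreal (t powr (- real DIM('n))) * ennreal (c / 2 * t powr (real DIM('n) - 1/2))"
          by (intro mult_left_mono le t) simp
        also have "\<dots> = ennreal (t powr (- real DIM('n)) * (c / 2 * t powr (real DIM('n) - 1/2)))"
          by (intro ennreal_mult'[symmetric]) simp
        also have "t powr (- real DIM('n)) * (c / 2 * t powr (real DIM('n) - 1/2)) = c / 2 * t powr (- 1/2)"
          using t by (simp add: mult.left_commute powr_add[symmetric])
        finally show ?thesis using True by simp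
      qed simp
    qed
    also have "\<dots> = ennreal (c / 2 * 2)"
    proof (rule nn_integral_has_integral_lebesgue)
      have "((\<lambda>t::real. t powr (- 1/2)) has_integral (1 powr (- 1/2 + 1) / (- 1/2 + 1))) {0..1}"
        by (rule has_integral_powr_from_0) auto
      then have "((\<lambda>t::real. t powr (- 1/2)) has_integral 2) {0..1}" by simp
      then show "((\<lambda>t::real. c / 2 * t powr (- 1/2)) has_integral (c / 2 * 2)) {0..1}"
        by (rule has_integral_mult_right)
    qed (use c in auto)
    finally show False using assms(1) by simp
  qed
  then show ?thesis using that by blast
qed

section \<open>Level set estimates\<close>

text \<open>The set of the theorem with the quotient cleared and both points confined to a ball, on
  which a continuous \<open>f\<close> and its gradient are bounded, as extrapolation
  requires.\<close>

definition levelset :: "('n::euclidean_space \<Rightarrow> real) \<Rightarrow> real \<Rightarrow> real \<Rightarrow> real \<Rightarrow> ('n \<times> 'n) set" where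
  "levelset f R l e = {(x, y). x \<in> ball 0 R \<and> y \<in> ball 0 R \<and> x \<noteq> y \<and> l * norm (x - y) powr e < \<bar>f x - f y\<bar>}"

definition kernel_mass :: "real \<Rightarrow> ('n::euclidean_space \<times> 'n) set \<Rightarrow> 'n \<Rightarrow> ennreal" where
  "kernel_mass \<gamma> E x = (\<integral>\<^sup>+y. indicator E (x, y) * riesz_kernel \<gamma> x y \<partial>lebesgue)"

definition C1_gradient :: "('n::euclidean_space \<Rightarrow> real) \<Rightarrow> ('n \<Rightarrow> 'n) \<Rightarrow> bool" where
  "C1_gradient f g \<longleftrightarrow> (\<forall>x. (f has_derivative (\<lambda>h. g x \<bullet> h)) (at x)) \<and> continuous_on UNIV g"

text \<open>The property supplied by \<open>weighted_transfer\<close>. The bound \<open>N\<close> on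
  \<open>a\<close> has to exist but does not enter the constant.\<close>

definition extrapolates :: "('n::euclidean_space) fnorm \<Rightarrow> real \<Rightarrow> bool" where
  "extrapolates X A \<longleftrightarrow> 1 \<le> A \<and> (\<forall>H a N c. H \<in> borel_measurable lebesgue \<longrightarrow> a \<in> borel_measurable lebesgue \<longrightarrow>
    (\<forall>x. a x \<le> ennreal N) \<longrightarrow> 0 < c \<longrightarrow>
    (\<forall>w. w \<in> borel_measurable lebesgue \<longrightarrow> (\<forall>x. maximal_op w x \<le> ennreal A * w x) \<longrightarrow>
      (\<integral>\<^sup>+x. H x * w x \<partial>lebesgue) \<le> ennreal c * (\<integral>\<^sup>+x. a x * w x \<partial>lebesgue)) \<longrightarrow>
    X H \<le> ennreal (2 * c) * X a)"

text \<open>Two functions are kept apart: \<open>a\<close> controls the set \<open>E\<close>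
  pointwise and may be unbounded, while \<open>G\<close> is the bounded function whose norm appears
  in the end. They are compared in L^1(w) only.\<close>

definition kernel_mass_bound :: "('n::euclidean_space) fnorm \<Rightarrow> real \<Rightarrow> real \<Rightarrow> real \<Rightarrow> bool" where
  "kernel_mass_bound X \<gamma> A C \<longleftrightarrow> (\<forall>(E::('n \<times> 'n) set) a G N B. E \<in> sets (lebesgue \<Otimes>\<^sub>M lebesgue) \<longrightarrow>
    a \<in> borel_measurable lebesgue \<longrightarrow> G \<in> borel_measurable lebesgue \<longrightarrow> (\<forall>x. G x \<le> ennreal N) \<longrightarrow> 0 < B \<longrightarrow>
    (\<forall>x y. (x, y) \<in> E \<longrightarrow> ennreal (norm (x - y) powr \<gamma>) < a x \<or> ennreal (norm (x - y) powr \<gamma>) < a y) \<longrightarrow>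
    (\<forall>w. w \<in> borel_measurable lebesgue \<longrightarrow> (\<forall>x. maximal_op w x \<le> ennreal A * w x) \<longrightarrow>
      (\<integral>\<^sup>+x. a x * w x \<partial>lebesgue) \<le> ennreal B * (\<integral>\<^sup>+x. G x * w x \<partial>lebesgue)) \<longrightarrow>
    X (kernel_mass \<gamma> E) \<le> ennreal (C * B) * X G)"

abbreviation grad_on :: "('n::euclidean_space \<Rightarrow> 'n) \<Rightarrow> real \<Rightarrow> 'n \<Rightarrow> ennreal" where
  "grad_on g \<rho> \<equiv> (\<lambda>x. ennreal (norm (g x)) * indicator (ball 0 \<rho>) x)"

text \<open>For x, y in B(0,R) the distance is below 2R, so balls of radius |x-y| about x or y lie
  in B(0,3R).\<close>

definition gradient_bound :: "('n::euclidean_space) fnorm \<Rightarrow> real \<Rightarrow> real \<Rightarrow> bool" where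
  "gradient_bound X \<gamma> C \<longleftrightarrow> (\<forall>f g R l. C1_gradient f g \<longrightarrow> 0 < l \<longrightarrow>
    X (kernel_mass \<gamma> (levelset f R l (1 + \<gamma>))) \<le> ennreal (C / l) * X (grad_on g (3 * R)))"

lemma C1_gradient_continuous:
  assumes "C1_gradient f g"
  shows "continuous_on UNIV f"
  using assms unfolding C1_gradient_def
  by (intro continuous_at_imp_continuous_on ballI has_derivative_continuous) auto

lemma sets_levelset [measurable]:
  assumes [measurable]: "f \<in> borel_measurable lebesgue"
  shows "levelset f R l e \<in> sets (lebesgue \<Otimes>\<^sub>M lebesgue)"
proof -
  have "{p \<in> space (lebesgue \<Otimes>\<^sub>M lebesgue). norm (fst p) < R \<and> norm (snd p) < R \<and> fst p \<noteq> snd p \<and>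
      l * norm (fst p - snd p) powr e < \<bar>f (fst p) - f (snd p)\<bar>} \<in> sets (lebesgue \<Otimes>\<^sub>M lebesgue)"
    by measurable
  also have "{p \<in> space (lebesgue \<Otimes>\<^sub>M lebesgue). norm (fst p) < R \<and> norm (snd p) < R \<and> fst p \<noteq> snd p \<and>
      l * norm (fst p - snd p) powr e < \<bar>f (fst p) - f (snd p)\<bar>} = levelset f R l e"
    by (auto simp: levelset_def space_pair_measure)
  finally show ?thesis .
qed

lemma borel_measurable_kernel_mass [measurable]:
  assumes [measurable]: "E \<in> sets (lebesgue \<Otimes>\<^sub>M lebesgue)"
  shows "kernel_mass \<gamma> E \<in> borel_measurable lebesgue"
  unfolding kernel_mass_def by (intro borel_measurable_lebesgue_nn_integral) measurable

lemma kernel_mass_mono: "E \<subseteq> F \<Longrightarrow> kernel_mass \<gamma> E x \<le> kernel_mass \<gamma> F x"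
  unfolding kernel_mass_def by (intro nn_integral_mono mult_right_mono) (auto simp: indicator_def)

lemma kernel_mass_Un_le:
  assumes [measurable]: "E \<in> sets (lebesgue \<Otimes>\<^sub>M lebesgue)" "F \<in> sets (lebesgue \<Otimes>\<^sub>M lebesgue)"
  shows "kernel_mass \<gamma> (E \<union> F) x \<le> kernel_mass \<gamma> E x + kernel_mass \<gamma> F x"
proof -
  have "kernel_mass \<gamma> (E \<union> F) x \<le> (\<integral>\<^sup>+y. indicator E (x, y) * riesz_kernel \<gamma> x y + indicator F (x, y) * riesz_kernel \<gamma> x y \<partial>lebesgue)"
    unfolding kernel_mass_def by (intro nn_integral_mono) (auto simp: indicator_def)
  also have "\<dots> = kernel_mass \<gamma> E x + kernel_mass \<gamma> F x"
    unfolding kernel_mass_def by (intro nn_integral_add) measurable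
  finally show ?thesis .
qed

lemma continuous_bounded_ball:
  fixes f :: "'n::euclidean_space \<Rightarrow> 'b::real_normed_vector"
  assumes "continuous_on UNIV f"
  obtains N where "0 < N" "\<And>x. x \<in> ball 0 R \<Longrightarrow> norm (f x) \<le> N"
proof -
  have "compact (f ` cball 0 R)"
    by (intro compact_continuous_image continuous_on_subset[OF assms]) auto
  then obtain N where "0 < N" "\<forall>v\<in>f ` cball 0 R. norm v \<le> N"
    using compact_imp_bounded bounded_pos by metis
  then show ?thesis using that[of N] by auto
qed

text \<open>The superlevel bound and the comparison of \<open>a\<close> with \<open>G\<close> are
  chained for each weight first; only the resulting inequality between \<open>kernel_mass\<close>
  and \<open>G\<close> is extrapolated, so that boundedness is required of \<open>G\<close>
  alone.\<close>

lemma extrapolated_kernel_mass: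
  fixes X :: "('n::euclidean_space) fnorm" and \<gamma> :: real
  assumes ext: "extrapolates X A" and \<gamma>: "\<gamma> \<noteq> 0"
  shows "\<exists>C>0. kernel_mass_bound X \<gamma> A C"
proof -
  have A: "1 \<le> A" using ext by (simp add: extrapolates_def)
  obtain C where C: "0 < C" and *: "\<forall>(E::('n::euclidean_space \<times> 'n) set) a w A. E \<in> sets (lebesgue \<Otimes>\<^sub>M lebesgue) \<longrightarrow>
    a \<in> borel_measurable lebesgue \<longrightarrow> w \<in> borel_measurable lebesgue \<longrightarrow> 1 \<le> A \<longrightarrow>
    (\<forall>x y. (x, y) \<in> E \<longrightarrow> ennreal (norm (x - y) powr \<gamma>) < a x \<or> ennreal (norm (x - y) powr \<gamma>) < a y) \<longrightarrow>
    (\<forall>x. maximal_op w x \<le> ennreal A * w x) \<longrightarrow>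
    (\<integral>\<^sup>+x. (\<integral>\<^sup>+y. indicator E (x, y) * riesz_kernel \<gamma> x y \<partial>lebesgue) * w x \<partial>lebesgue)
      \<le> ennreal (C * A) * (\<integral>\<^sup>+x. a x * w x \<partial>lebesgue)"
    using symmetric_superlevel_integral[OF \<gamma>] by (elim exE conjE) (rule that)
  show ?thesis
    unfolding kernel_mass_bound_def
  proof (intro exI[of _ "2 * (C * A)"] conjI allI impI)
    show "0 < 2 * (C * A)" using C A by simp
    fix E :: "('n \<times> 'n) set" and a G :: "'n \<Rightarrow> ennreal" and N B :: real
    assume E: "E \<in> sets (lebesgue \<Otimes>\<^sub>M lebesgue)" and a: "a \<in> borel_measurable lebesgue"
      and G: "G \<in> borel_measurable lebesgue" "\<forall>x. G x \<le> ennreal N" and B: "0 < B"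
      and cont: "\<forall>x y. (x, y) \<in> E \<longrightarrow> ennreal (norm (x - y) powr \<gamma>) < a x \<or> ennreal (norm (x - y) powr \<gamma>) < a y"
      and le: "\<forall>w. w \<in> borel_measurable lebesgue \<longrightarrow> (\<forall>x. maximal_op w x \<le> ennreal A * w x) \<longrightarrow>
      (\<integral>\<^sup>+x. a x * w x \<partial>lebesgue) \<le> ennreal B * (\<integral>\<^sup>+x. G x * w x \<partial>lebesgue)"
    have "(\<integral>\<^sup>+x. kernel_mass \<gamma> E x * w x \<partial>lebesgue) \<le> ennreal (C * A * B) * (\<integral>\<^sup>+x. G x * w x \<partial>lebesgue)"
      if w: "w \<in> borel_measurable lebesgue" "\<forall>x. maximal_op w x \<le> ennreal A * w x" for w
    proof -
      have "(\<integral>\<^sup>+x. kernel_mass \<gamma> E x * w x \<partial>lebesgue) \<le> ennreal (C * A) * (\<integral>\<^sup>+x. a x * w x \<partial>lebesgue)"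
        unfolding kernel_mass_def using *[rule_format, OF E a w(1) A, rule_format, OF cont[rule_format]] w(2) by blast
      also have "\<dots> \<le> ennreal (C * A) * (ennreal B * (\<integral>\<^sup>+x. G x * w x \<partial>lebesgue))"
        using le w by (intro mult_left_mono) auto
      also have "\<dots> = ennreal (C * A * B) * (\<integral>\<^sup>+x. G x * w x \<partial>lebesgue)"
        using C A B by (simp add: ennreal_mult mult.assoc)
      finally show ?thesis .
    qed
    moreover have "0 < C * A * B" using C A B by simp
    ultimately have "X (kernel_mass \<gamma> E) \<le> ennreal (2 * (C * A * B)) * X G"
      using ext G borel_measurable_kernel_mass[OF E] unfolding extrapolates_def by blast
    then show "X (kernel_mass \<gamma> E) \<le> ennreal (2 * (C * A) * B) * X G" by (simp add: mult.assoc)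
  qed
qed

text \<open>A large difference forces |f| at one end point to be at least half of it, that is,
  |x-y|^\<gamma> < (2/l)^p |f|^p there. So \<open>a\<close> is a multiple of \<open>G\<close>, and
  no geometry of balls is involved.\<close>

lemma function_levelset_bound:
  fixes X :: "('n::euclidean_space) fnorm" and \<gamma> p :: real
  assumes X: "ball_BFS X" and ext: "extrapolates X A" and \<gamma>: "\<gamma> \<noteq> 0" and p: "0 < p"
  shows "\<exists>C>0. \<forall>f R l. continuous_on UNIV f \<longrightarrow> 0 < l \<longrightarrow>
    X (kernel_mass \<gamma> (levelset f R l (\<gamma> / p)))
      \<le> ennreal (C * l powr (- p)) * X (\<lambda>x. ennreal (\<bar>f x\<bar> powr p) * indicator (ball 0 R) x)"
proof -
  obtain C where C: "0 < C" and *: "kernel_mass_bound X \<gamma> A C"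
    using extrapolated_kernel_mass[OF ext \<gamma>] by (elim exE conjE) (rule that)
  show ?thesis
  proof (intro exI[of _ "C * 2 powr p"] conjI allI impI)
    show "0 < C * 2 powr p" using C by simp
    fix f :: "'n \<Rightarrow> real" and R l :: real
    assume f: "continuous_on UNIV f" and l: "0 < l"
    have [measurable]: "f \<in> borel_measurable lebesgue" by (rule borel_measurable_continuous_lebesgue[OF f])
    define G where "G x = ennreal (\<bar>f x\<bar> powr p) * indicator (ball 0 R) x" for x
    define B where "B = (2 / l) powr p"
    have B: "0 < B" using l by (simp add: B_def)
    have [measurable]: "G \<in> borel_measurable lebesgue" unfolding G_def by measurable
    obtain N where N: "0 < N" "\<And>x. x \<in> ball 0 R \<Longrightarrow> norm (f x) \<le> N" using continuous_bounded_ball[OF f] by metis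
    have large: "ennreal (norm (x - y) powr \<gamma>) < ennreal B * G z"
      if "l * norm (x - y) powr (\<gamma> / p) < 2 * \<bar>f z\<bar>" "z \<in> ball 0 R" for x y z
    proof -
      have "norm (x - y) powr (\<gamma> / p) < 2 / l * \<bar>f z\<bar>" using that l by (simp add: field_simps)
      then have "(norm (x - y) powr (\<gamma> / p)) powr p < (2 / l * \<bar>f z\<bar>) powr p"
        using p by (intro powr_less_mono2) auto
      then have "norm (x - y) powr \<gamma> < B * \<bar>f z\<bar> powr p"
        using p unfolding powr_mult[of "2 / l"] B_def by (simp add: powr_powr)
      then show ?thesis using that B by (simp add: G_def ennreal_mult[symmetric] ennreal_less_iff)
    qed
    have "X (kernel_mass \<gamma> (levelset f R l (\<gamma> / p))) \<le> ennreal (C * B) * X G"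
    proof (rule *[unfolded kernel_mass_bound_def, rule_format, where a = "\<lambda>x. ennreal B * G x" and N = "N powr p"])
      fix x show "G x \<le> ennreal (N powr p)"
        using N(2)[of x] p by (auto simp: G_def indicator_def intro!: ennreal_leI powr_mono2)
    next
      fix x y assume "(x, y) \<in> levelset f R l (\<gamma> / p)"
      then have xy: "x \<in> ball 0 R" "y \<in> ball 0 R" "l * norm (x - y) powr (\<gamma> / p) < \<bar>f x - f y\<bar>"
        by (auto simp: levelset_def)
      then have "l * norm (x - y) powr (\<gamma> / p) < 2 * \<bar>f x\<bar> \<or> l * norm (x - y) powr (\<gamma> / p) < 2 * \<bar>f y\<bar>"
        by linarith
      then show "ennreal (norm (x - y) powr \<gamma>) < ennreal B * G x \<or> ennreal (norm (x - y) powr \<gamma>) < ennreal B * G y"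
        using large xy by blast
    next
      fix w :: "'n \<Rightarrow> ennreal" assume [measurable]: "w \<in> borel_measurable lebesgue"
      show "(\<integral>\<^sup>+x. ennreal B * G x * w x \<partial>lebesgue) \<le> ennreal B * (\<integral>\<^sup>+x. G x * w x \<partial>lebesgue)"
        unfolding mult.assoc by (subst nn_integral_cmult) auto
    qed (use B in measurable)
    also have "C * B = C * 2 powr p * l powr (- p)"
      using l by (simp add: B_def powr_divide powr_minus field_simps)
    finally show "X (kernel_mass \<gamma> (levelset f R l (\<gamma> / p)))
      \<le> ennreal (C * 2 powr p * l powr (- p)) * X (\<lambda>x. ennreal (\<bar>f x\<bar> powr p) * indicator (ball 0 R) x)"
      by (simp add: G_def[abs_def])
  qed
qed

section \<open>Bounds for the gradient set\<close>

lemma levelset_averaged_gradient: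
  fixes f :: "'n::euclidean_space \<Rightarrow> real"
  assumes f: "C1_gradient f g" and r: "r = norm (x - y)" "0 < r" and l: "0 < l"
    and less: "l * r powr (1 + \<gamma>) < \<bar>f x - f y\<bar>"
    and \<nu>: "\<nu> = l * unit_ball_vol (real DIM('n)) / 2 ^ (DIM('n) + 1)"
  shows "ennreal (\<nu> * r powr (real DIM('n) + \<gamma>)) < averaged_gradient g x r \<or>
    ennreal (\<nu> * r powr (real DIM('n) + \<gamma>)) < averaged_gradient g y r"
proof (rule ccontr)
  let ?V = "unit_ball_vol (real DIM('n))" and ?n = "DIM('n)"
  let ?c = "\<nu> * r powr (real ?n + \<gamma>)"
  have V: "0 < ?V" by simp
  assume "\<not> ?thesis"
  then have le: "averaged_gradient g x r \<le> ennreal ?c" "averaged_gradient g y r \<le> ennreal ?c" by (auto simp: not_less)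
  have c: "0 \<le> ?c" using l by (simp add: \<nu>)
  have "ennreal (\<bar>f x - f y\<bar> * (?V * (r / 2) ^ ?n)) \<le> ennreal r * (averaged_gradient g x r + averaged_gradient g y r)"
    using f r unfolding C1_gradient_def by (intro increment_le_averaged_gradient) auto
  also have "\<dots> \<le> ennreal r * (ennreal ?c + ennreal ?c)" by (intro mult_left_mono add_mono le) simp
  also have "\<dots> = ennreal (r * (?c + ?c))" using c r by (simp only: ennreal_plus[symmetric] ennreal_mult'[symmetric] less_imp_le)
  finally have "\<bar>f x - f y\<bar> * (?V * (r / 2) ^ ?n) \<le> r * (?c + ?c)"
    using c r by (subst (asm) ennreal_le_iff) auto
  \<comment> \<open>The power 2^(n+1) in \<nu> collects 2^n from the ball of radius r/2 and 2 from
    the sum of the two averages.\<close>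
  also have "r * (?c + ?c) = l * r powr (1 + \<gamma>) * (?V * (r / 2) ^ ?n)"
    using r by (simp add: \<nu> powr_add powr_realpow power_divide field_simps)
  finally have "\<bar>f x - f y\<bar> \<le> l * r powr (1 + \<gamma>)"
    using V r by (subst (asm) mult_le_cancel_right) auto
  then show False using less by simp
qed

lemma grad_on_facts:
  fixes g :: "'n::euclidean_space \<Rightarrow> 'n"
  assumes g: "continuous_on UNIV g"
  shows "grad_on g \<rho> \<in> borel_measurable lebesgue" "\<exists>N. \<forall>x. grad_on g \<rho> x \<le> ennreal N"
    "(\<integral>\<^sup>+x. grad_on g \<rho> x \<partial>lebesgue) < \<infinity>"
proof -
  have [measurable]: "g \<in> borel_measurable lebesgue" by (rule borel_measurable_continuous_lebesgue[OF g])
  show "grad_on g \<rho> \<in> borel_measurable lebesgue" by measurable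
  obtain N where N: "0 < N" "\<And>x. x \<in> ball 0 \<rho> \<Longrightarrow> norm (g x) \<le> N" using continuous_bounded_ball[OF g] by metis
  show "\<exists>N. \<forall>x. grad_on g \<rho> x \<le> ennreal N"
    using N by (intro exI[of _ N]) (auto simp: indicator_def intro!: ennreal_leI)
  have "(\<integral>\<^sup>+x. grad_on g \<rho> x \<partial>lebesgue) \<le> (\<integral>\<^sup>+x. ennreal N * indicator (ball 0 \<rho>) x \<partial>(lebesgue :: 'n measure))"
    using N by (intro nn_integral_mono) (auto simp: indicator_def intro!: ennreal_leI)
  also have "\<dots> = ennreal N * emeasure lebesgue (ball (0::'n) \<rho>)" by (subst nn_integral_cmult_indicator) auto
  also have "\<dots> < \<infinity>"
    using emeasure_bounded_finite[of "ball (0::'n) \<rho>"] by (simp add: ennreal_mult_less_top)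
  finally show "(\<integral>\<^sup>+x. grad_on g \<rho> x \<partial>lebesgue) < \<infinity>" .
qed

text \<open>The maximal function of the localised gradient plays both roles, \<open>a\<close> up to
  a factor and \<open>G\<close>. It is bounded since the gradient is bounded on B(0,3R), and its
  norm is removed at the end by boundedness of M on X.\<close>

lemma gradient_levelset_bound_maximal:
  fixes X :: "('n::euclidean_space) fnorm" and \<gamma> :: real
  assumes X: "ball_BFS X" and ext: "extrapolates X A" and \<gamma>: "\<gamma> \<noteq> 0" and M: "M_bounded X"
  shows "\<exists>C>0. gradient_bound X \<gamma> C"
proof -
  obtain C where C: "0 < C" and *: "kernel_mass_bound X \<gamma> A C"
    using extrapolated_kernel_mass[OF ext \<gamma>] by (elim exE conjE) (rule that)
  obtain K0 :: real where K0: "\<forall>f. f \<in> borel_measurable lebesgue \<longrightarrow> X (maximal_op f) \<le> ennreal K0 * X f"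
    using M by (auto simp: M_bounded_def)
  define K where "K = max 1 K0"
  have K: "1 \<le> K" "f \<in> borel_measurable lebesgue \<Longrightarrow> X (maximal_op f) \<le> ennreal K * X f" for f
    using K0[rule_format, of f] by (auto simp: K_def intro: order_trans[OF _ mult_right_mono] ennreal_leI)
  let ?n = "DIM('n)"
  let ?V = "unit_ball_vol (real ?n)"
  show ?thesis
    unfolding gradient_bound_def
  proof (intro exI[of _ "C * 2 ^ (?n + 1) * K"] conjI allI impI)
    show "0 < C * 2 ^ (?n + 1) * K" using C K by simp
    fix f :: "'n \<Rightarrow> real" and g :: "'n \<Rightarrow> 'n" and R l :: real
    assume f: "C1_gradient f g" and l: "0 < l"
    have [measurable]: "f \<in> borel_measurable lebesgue"
      by (rule borel_measurable_continuous_lebesgue[OF C1_gradient_continuous[OF f]])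
    have g: "continuous_on UNIV g" using f by (simp add: C1_gradient_def)
    note [measurable] = grad_on_facts(1)[OF g]
    obtain N where N: "\<And>x. grad_on g (3 * R) x \<le> ennreal N" using grad_on_facts(2)[OF g] by blast
    \<comment> \<open>With this value, V r^n * (r^\<gamma> / B) is exactly the threshold of
      \<open>levelset_averaged_gradient\<close>.\<close>
    define B where "B = 2 ^ (?n + 1) / l"
    have B: "0 < B" using l by (simp add: B_def)
    let ?M = "maximal_op (grad_on g (3 * R))"
    have [measurable]: "?M \<in> borel_measurable lebesgue" by measurable
    have large: "ennreal (r powr \<gamma>) < ennreal B * ?M z"
      if "ennreal (l * ?V / 2 ^ (?n + 1) * r powr (real ?n + \<gamma>)) < averaged_gradient g z r" "0 < r" "ball z r \<subseteq> ball 0 (3 * R)" for z r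
    proof (rule ccontr)
      assume "\<not> ?thesis"
      then have "ennreal B * ?M z \<le> ennreal (r powr \<gamma>)" by simp
      then have "ennreal (1 / B) * (ennreal B * ?M z) \<le> ennreal (1 / B) * ennreal (r powr \<gamma>)" by (rule mult_left_mono) simp
      moreover have "ennreal (1 / B) * ennreal B = 1" using B by (subst ennreal_mult'[symmetric]) auto
      moreover have "ennreal (1 / B) * ennreal (r powr \<gamma>) = ennreal (1 / B * r powr \<gamma>)" using B by (intro ennreal_mult'[symmetric]) simp
      ultimately have Mz: "?M z \<le> ennreal (1 / B * r powr \<gamma>)" by (simp only: mult.assoc[symmetric] mult_1_left)
      have "averaged_gradient g z r \<le> ennreal (?V * r ^ ?n) * ?M z"
        by (rule averaged_gradient_le_maximal_op) (use that in auto)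
      also have "\<dots> \<le> ennreal (?V * r ^ ?n) * ennreal (1 / B * r powr \<gamma>)" by (intro mult_left_mono Mz) simp
      also have "\<dots> = ennreal (?V * r ^ ?n * (1 / B * r powr \<gamma>))" using that by (intro ennreal_mult'[symmetric]) simp
      also have "?V * r ^ ?n * (1 / B * r powr \<gamma>) = l * ?V / 2 ^ (?n + 1) * r powr (real ?n + \<gamma>)"
        using that by (simp add: B_def powr_add powr_realpow field_simps)
      finally show False using that by simp
    qed
    have "X (kernel_mass \<gamma> (levelset f R l (1 + \<gamma>))) \<le> ennreal (C * B) * X ?M"
    proof (rule *[unfolded kernel_mass_bound_def, rule_format, where a = "\<lambda>x. ennreal B * ?M x" and N = N])
      fix x show "?M x \<le> ennreal N" by (rule maximal_op_bounded[OF N])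
    next
      fix x y assume "(x, y) \<in> levelset f R l (1 + \<gamma>)"
      then have xy: "norm x < R" "norm y < R" "x \<noteq> y" "l * norm (x - y) powr (1 + \<gamma>) < \<bar>f x - f y\<bar>"
        by (auto simp: levelset_def)
      have "ball z (norm (x - y)) \<subseteq> ball 0 (3 * R)" if "norm z < R" for z
      proof
        fix u assume "u \<in> ball z (norm (x - y))"
        then show "u \<in> ball 0 (3 * R)"
          using that xy norm_triangle_ineq4[of x y] norm_triangle_sub[of u z] by (auto simp: dist_norm norm_minus_commute)
      qed
      then have sub: "ball x (norm (x - y)) \<subseteq> ball 0 (3 * R)" "ball y (norm (x - y)) \<subseteq> ball 0 (3 * R)"
        using xy by auto
      have pos: "0 < norm (x - y)" using xy by simp
      from levelset_averaged_gradient[OF f refl pos l xy(4) refl]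
      show "ennreal (norm (x - y) powr \<gamma>) < ennreal B * ?M x \<or> ennreal (norm (x - y) powr \<gamma>) < ennreal B * ?M y"
        using large[OF _ pos sub(1)] large[OF _ pos sub(2)] by blast
    next
      fix w :: "'n \<Rightarrow> ennreal" assume [measurable]: "w \<in> borel_measurable lebesgue"
      show "(\<integral>\<^sup>+x. ennreal B * ?M x * w x \<partial>lebesgue) \<le> ennreal B * (\<integral>\<^sup>+x. ?M x * w x \<partial>lebesgue)"
        unfolding mult.assoc by (subst nn_integral_cmult) auto
    qed (use B in measurable)
    also have "\<dots> \<le> ennreal (C * B) * (ennreal K * X (grad_on g (3 * R)))"
      by (intro mult_left_mono K) auto
    also have "\<dots> = ennreal (C * B * K) * X (grad_on g (3 * R))"
      using C B K by (simp add: ennreal_mult mult.assoc)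
    also have "C * B * K = C * 2 ^ (?n + 1) * K / l" by (simp add: B_def)
    finally show "X (kernel_mass \<gamma> (levelset f R l (1 + \<gamma>))) \<le> ennreal (C * 2 ^ (?n + 1) * K / l) * X (grad_on g (3 * R))" .
  qed
qed

text \<open>A large average yields one heavy ball of radius \<rho> = t r with t between 2^(-j-1) and
  2^(-j). Recovering r^\<gamma> from \<rho>^\<gamma> costs about 2^(j \<gamma>), but relative to its
  radius the ball exceeds a threshold larger by 2^(j (\<gamma> + 1/2)). The quotient 2^(-j/2) is
  summable, so the weights of all scales j are added.\<close>

lemma gradient_levelset_bound_pos:
  fixes X :: "('n::euclidean_space) fnorm" and \<gamma> :: real
  assumes X: "ball_BFS X" and ext: "extrapolates X A" and \<gamma>: "0 < \<gamma>"
  shows "\<exists>C>0. gradient_bound X \<gamma> C"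
proof -
  have A: "1 \<le> A" using ext by (simp add: extrapolates_def)
  have \<gamma>0: "\<gamma> \<noteq> 0" using \<gamma> by simp
  obtain C where C: "0 < C" and *: "kernel_mass_bound X \<gamma> A C"
    using extrapolated_kernel_mass[OF ext \<gamma>0] by (elim exE conjE) (rule that)
  let ?n = "DIM('n)"
  let ?V = "unit_ball_vol (real ?n)"
  obtain D where D: "0 < D" and D': "\<forall>(G::'n \<Rightarrow> ennreal) \<mu>. G \<in> borel_measurable lebesgue \<longrightarrow>
    (\<integral>\<^sup>+x. G x \<partial>lebesgue) < \<infinity> \<longrightarrow> 0 < \<mu> \<longrightarrow>
    (\<exists>a. heavy_ball_weight \<gamma> D \<mu> G a)"
    using heavy_ball_weight_pos[OF \<gamma>] by (elim exE conjE) (rule that)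
  define q where "q = (2::real) powr (- 1/2)"
  have q: "0 < q" "q < 1" using powr_less_mono[of "- 1/2" 0 2] by (auto simp: q_def)
  define L where "L = 2 powr \<gamma> * 2 * D * A * 2 ^ (?n + 1) / ?V * (1 / (1 - q))"
  have L: "0 < L" using q D A by (simp add: L_def)
  show ?thesis
    unfolding gradient_bound_def
  proof (intro exI[of _ "C * L"] conjI allI impI)
    show "0 < C * L" using C L by simp
    fix f :: "'n \<Rightarrow> real" and g :: "'n \<Rightarrow> 'n" and R l :: real
    assume f: "C1_gradient f g" and l: "0 < l"
    have [measurable]: "f \<in> borel_measurable lebesgue"
      by (rule borel_measurable_continuous_lebesgue[OF C1_gradient_continuous[OF f]])
    have g: "continuous_on UNIV g" using f by (simp add: C1_gradient_def)
    let ?G = "grad_on g (3 * R)"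
    note Gm[measurable] = grad_on_facts(1)[OF g, of "3 * R"]
    have [measurable]: "g \<in> borel_measurable lebesgue" by (rule borel_measurable_continuous_lebesgue[OF g])
    obtain N where N: "\<And>x. ?G x \<le> ennreal N" using grad_on_facts(2)[OF g] by blast
    define \<nu> where "\<nu> = l * ?V / 2 ^ (?n + 1)"
    have \<nu>: "0 < \<nu>" using l by (simp add: \<nu>_def)
    \<comment> \<open>The selected ball has mass above (\<nu>/2) t^(n-1/2) r^(n+\<gamma>) =
      (\<nu>/2) t^(-(\<gamma>+1/2)) \<rho>^(n+\<gamma>) with \<rho> = t r, and t \<le>
      2^(-j).\<close>
    define \<mu> where "\<mu> j = \<nu> / 2 * 2 powr (real j * (\<gamma> + 1/2))" for j :: nat
    have \<mu>: "0 < \<mu> j" for j using \<nu> by (simp add: \<mu>_def)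
    have "\<forall>j. \<exists>a. heavy_ball_weight \<gamma> D (\<mu> j) ?G a"
      using D'[rule_format, OF Gm grad_on_facts(3)[OF g] \<mu>] by (intro allI)
    then have "\<exists>a. \<forall>j. heavy_ball_weight \<gamma> D (\<mu> j) ?G (a j)" by (rule choice)
    then obtain a where W: "\<And>j. heavy_ball_weight \<gamma> D (\<mu> j) ?G (a j)" by auto
    have a[measurable]: "a j \<in> borel_measurable lebesgue" for j using W[of j] by (simp add: heavy_ball_weight_def)
    have heavy: "ennreal (r powr \<gamma>) \<le> a j z"
      if "0 < r" "ennreal (\<mu> j * r powr (real DIM('n) + \<gamma>)) < (\<integral>\<^sup>+x\<in>ball z r. ?G x \<partial>lebesgue)" for j z r
      using W[of j] that unfolding heavy_ball_weight_def by blast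
    have aw: "(\<integral>\<^sup>+x. a j x * w x \<partial>lebesgue) \<le> ennreal (D * A / \<mu> j) * (\<integral>\<^sup>+x. ?G x * w x \<partial>lebesgue)"
      if "w \<in> borel_measurable lebesgue" "0 \<le> A" "\<forall>x. maximal_op w x \<le> ennreal A * w x" for j w A
      using W[of j] that unfolding heavy_ball_weight_def by blast
    define c where "c j = 2 powr (real (Suc j) * \<gamma>)" for j :: nat
    define b where "b x = (\<Sum>j. ennreal (c j) * a j x)" for x
    have [measurable]: "b \<in> borel_measurable lebesgue" unfolding b_def by measurable
    have large: "ennreal (r powr \<gamma>) < b z"
      if avg: "ennreal (\<nu> * r powr (real ?n + \<gamma>)) < averaged_gradient g z r" and "0 < r" "ball z r \<subseteq> ball 0 (3 * R)" for z r
    proof -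
      have "0 \<le> \<nu> * r powr (real ?n + \<gamma>)" using \<nu> by simp
      then obtain t where t: "0 < t" "t < 1"
        "ennreal (\<nu> * r powr (real ?n + \<gamma>) / 2 * t powr (real ?n - 1/2)) < (\<integral>\<^sup>+u\<in>ball z (t * r). ennreal (norm (g u)) \<partial>lebesgue)"
        by (rule averaged_gradient_large[OF avg])
      have ex: "\<exists>j. (1/2) ^ j < t" using real_arch_pow_inv[of t "1/2"] t by auto
      \<comment> \<open>The index j with k = j + 1 then satisfies 2^(-j-1) < t \<le> 2^(-j); t < 1
        excludes k = 0.\<close>
      define k where "k = (LEAST j. (1/2) ^ j < t)"
      have k: "(1/2) ^ k < t" unfolding k_def using ex by (rule LeastI_ex)
      have "k \<noteq> 0" using k t by (cases k) auto
      then obtain j where j: "k = Suc j" by (cases k) auto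
      have tj: "t \<le> (1/2) ^ j" using not_less_Least[of j "\<lambda>j. (1/2) ^ j < t"] j by (auto simp: k_def)
      have p2: "(1/2::real) ^ i = 2 powr (- real i)" for i by (simp add: powr_minus powr_realpow power_one_over inverse_eq_divide)
      define \<rho> where "\<rho> = t * r"
      have \<rho>: "0 < \<rho>" using t that by (simp add: \<rho>_def)
      have "\<mu> j * \<rho> powr (real ?n + \<gamma>) \<le> \<nu> * r powr (real ?n + \<gamma>) / 2 * t powr (real ?n - 1/2)"
      proof -
        have "(2 powr (- real j)) powr (- (\<gamma> + 1/2)) \<le> t powr (- (\<gamma> + 1/2))"
          using t tj \<gamma> unfolding p2 by (intro powr_mono2') auto
        then have "2 powr (real j * (\<gamma> + 1/2)) \<le> t powr (- (\<gamma> + 1/2))" by (simp add: powr_powr algebra_simps)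
        then have "\<nu> / 2 * 2 powr (real j * (\<gamma> + 1/2)) * (t powr (real ?n + \<gamma>) * r powr (real ?n + \<gamma>))
          \<le> \<nu> / 2 * t powr (- (\<gamma> + 1/2)) * (t powr (real ?n + \<gamma>) * r powr (real ?n + \<gamma>))"
          using \<nu> by (intro mult_right_mono mult_left_mono) auto
        also have "\<dots> = \<nu> * r powr (real ?n + \<gamma>) / 2 * (t powr (- (\<gamma> + 1/2)) * t powr (real ?n + \<gamma>))" by simp
        also have "t powr (- (\<gamma> + 1/2)) * t powr (real ?n + \<gamma>) = t powr (real ?n - 1/2)"
          using t by (simp add: powr_add[symmetric])
        finally show ?thesis by (simp add: \<mu>_def \<rho>_def powr_mult)
      qed
      then have "ennreal (\<mu> j * \<rho> powr (real ?n + \<gamma>)) \<le> ennreal (\<nu> * r powr (real ?n + \<gamma>) / 2 * t powr (real ?n - 1/2))"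
        by (rule ennreal_leI)
      also note t(3)
      also have "(\<integral>\<^sup>+u\<in>ball z (t * r). ennreal (norm (g u)) \<partial>lebesgue) = (\<integral>\<^sup>+u\<in>ball z \<rho>. ?G u \<partial>lebesgue)"
      proof (intro nn_integral_cong)
        fix u
        have "ball z (t * r) \<subseteq> ball z r" using t that by (intro subset_ball) simp
        then have "u \<in> ball z (t * r) \<Longrightarrow> u \<in> ball 0 (3 * R)" using that by blast
        then show "ennreal (norm (g u)) * indicator (ball z (t * r)) u = ?G u * indicator (ball z \<rho>) u"
          by (auto simp: \<rho>_def indicator_def)
      qed
      finally have aj: "ennreal (\<rho> powr \<gamma>) \<le> a j z" by (intro heavy \<rho>)
      have "r powr \<gamma> = t powr (- \<gamma>) * \<rho> powr \<gamma>" using t that by (simp add: \<rho>_def powr_mult powr_minus)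
      also have "\<dots> < c j * \<rho> powr \<gamma>"
      proof -
        have "t powr (- \<gamma>) < ((1/2) ^ k) powr (- \<gamma>)" using k t \<gamma> by (intro powr_less_mono2_neg) auto
        also have "\<dots> = c j" unfolding j p2 c_def by (simp only: powr_powr minus_mult_minus)
        finally show ?thesis using \<rho> by simp
      qed
      finally have "ennreal (r powr \<gamma>) < ennreal (c j * \<rho> powr \<gamma>)" by (simp add: ennreal_less_iff)
      also have "\<dots> = ennreal (c j) * ennreal (\<rho> powr \<gamma>)" by (intro ennreal_mult') (simp add: c_def)
      also have "\<dots> \<le> ennreal (c j) * a j z" by (intro mult_left_mono aj) simp
      also have "\<dots> = (\<Sum>j\<in>{j}. ennreal (c j) * a j z)" by simp
      also have "\<dots> \<le> b z" unfolding b_def by (intro sum_le_suminf) auto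
      finally show ?thesis .
    qed
    have "X (kernel_mass \<gamma> (levelset f R l (1 + \<gamma>))) \<le> ennreal (C * (L / l)) * X ?G"
    proof (rule *[unfolded kernel_mass_bound_def, rule_format, where a = b and N = N])
      fix x show "?G x \<le> ennreal N" by (rule N)
    next
      fix x y assume "(x, y) \<in> levelset f R l (1 + \<gamma>)"
      then have xy: "norm x < R" "norm y < R" "x \<noteq> y" "l * norm (x - y) powr (1 + \<gamma>) < \<bar>f x - f y\<bar>"
        by (auto simp: levelset_def)
      have "ball z (norm (x - y)) \<subseteq> ball 0 (3 * R)" if "norm z < R" for z
      proof
        fix u assume "u \<in> ball z (norm (x - y))"
        then show "u \<in> ball 0 (3 * R)"
          using that xy norm_triangle_ineq4[of x y] norm_triangle_sub[of u z] by (auto simp: dist_norm norm_minus_commute)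
      qed
      then have sub: "ball x (norm (x - y)) \<subseteq> ball 0 (3 * R)" "ball y (norm (x - y)) \<subseteq> ball 0 (3 * R)"
        using xy by auto
      have pos: "0 < norm (x - y)" using xy by simp
      from levelset_averaged_gradient[OF f refl pos l xy(4) \<nu>_def]
      show "ennreal (norm (x - y) powr \<gamma>) < b x \<or> ennreal (norm (x - y) powr \<gamma>) < b y"
        using large[OF _ pos sub(1)] large[OF _ pos sub(2)] by blast
    next
      fix w :: "'n \<Rightarrow> ennreal" assume w[measurable]: "w \<in> borel_measurable lebesgue"
        and Mw': "\<And>x. maximal_op w x \<le> ennreal A * w x"
      have Mw: "\<forall>x. maximal_op w x \<le> ennreal A * w x" using Mw' by blast
      let ?I = "\<integral>\<^sup>+x. ?G x * w x \<partial>lebesgue"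
      have "(\<integral>\<^sup>+x. b x * w x \<partial>lebesgue) = (\<integral>\<^sup>+x. (\<Sum>j. ennreal (c j) * (a j x * w x)) \<partial>lebesgue)"
        unfolding b_def ennreal_suminf_multc[symmetric] mult.assoc ..
      also have "\<dots> = (\<Sum>j. ennreal (c j) * (\<integral>\<^sup>+x. a j x * w x \<partial>lebesgue))"
        by (subst nn_integral_suminf) (auto simp: nn_integral_cmult)
      also have "\<dots> \<le> (\<Sum>j. ennreal (c j) * (ennreal (D * A / \<mu> j) * ?I))"
        using A by (intro suminf_le mult_left_mono aw w Mw) auto
      also have "\<dots> = (\<Sum>j. ennreal (2 powr \<gamma> * 2 * D * A / \<nu> * q ^ j)) * ?I"
      proof -
        have "ennreal (c j) * (ennreal (D * A / \<mu> j) * ?I) = ennreal (2 powr \<gamma> * 2 * D * A / \<nu> * q ^ j) * ?I" for j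
        proof -
          have "c j * (D * A / \<mu> j) = 2 powr \<gamma> * 2 * D * A / \<nu> * (2 powr (real j * \<gamma>) / 2 powr (real j * (\<gamma> + 1/2)))"
            using \<nu> by (simp add: c_def \<mu>_def powr_add distrib_right field_simps)
          also have "2 powr (real j * \<gamma>) / 2 powr (real j * (\<gamma> + 1/2)) = q ^ j"
            by (simp add: q_def powr_realpow[symmetric] powr_powr powr_diff[symmetric] algebra_simps)
          finally have e: "c j * (D * A / \<mu> j) = 2 powr \<gamma> * 2 * D * A / \<nu> * q ^ j" .
          have "ennreal (c j) * ennreal (D * A / \<mu> j) = ennreal (c j * (D * A / \<mu> j))"
            by (intro ennreal_mult'[symmetric]) (simp add: c_def)
          then show ?thesis unfolding e by (simp only: mult.assoc[symmetric, where 'a = ennreal])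
        qed
        then show ?thesis by simp
      qed
      also have "(\<Sum>j. ennreal (2 powr \<gamma> * 2 * D * A / \<nu> * q ^ j)) = ennreal (2 powr \<gamma> * 2 * D * A / \<nu> * (1 / (1 - q)))"
      proof -
        have "(\<lambda>j. 2 powr \<gamma> * 2 * D * A / \<nu> * q ^ j) sums (2 powr \<gamma> * 2 * D * A / \<nu> * (1 / (1 - q)))"
          using q by (intro sums_mult geometric_sums) auto
        then show ?thesis using D A \<nu> q by (intro suminf_ennreal_eq) auto
      qed
      also have "2 powr \<gamma> * 2 * D * A / \<nu> * (1 / (1 - q)) = L / l" by (simp add: L_def \<nu>_def)
      finally show "(\<integral>\<^sup>+x. b x * w x \<partial>lebesgue) \<le> ennreal (L / l) * ?I" .
    qed (measurable, use L l in simp_all)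
    then show "X (kernel_mass \<gamma> (levelset f R l (1 + \<gamma>))) \<le> ennreal (C * L / l) * X ?G" by simp
  qed
qed

text \<open>In dimension one the exponent 1 + \<gamma> of the level set is also the exponent n +
  \<gamma> of the heavy balls, and the increment is at most the mass of the gradient on the closed
  ball of radius r = |x-y| about x. So membership in the level set says directly that a ball about x
  is heavy.\<close>

lemma gradient_levelset_bound_DIM_1:
  fixes X :: "('n::euclidean_space) fnorm" and \<gamma> :: real
  assumes X: "ball_BFS X" and ext: "extrapolates X A" and dim: "DIM('n) = 1" and \<gamma>: "\<gamma> < - 1"
  shows "\<exists>C>0. gradient_bound X \<gamma> C"
proof -
  have A: "1 \<le> A" using ext by (simp add: extrapolates_def)
  have \<gamma>0: "\<gamma> \<noteq> 0" using \<gamma> by simp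
  have \<gamma>1: "real DIM('n) + \<gamma> < 0" using \<gamma> dim by simp
  obtain C where C: "0 < C" and *: "kernel_mass_bound X \<gamma> A C"
    using extrapolated_kernel_mass[OF ext \<gamma>0] by (elim exE conjE) (rule that)
  obtain D where D: "0 < D" and D': "\<forall>(G::'n \<Rightarrow> ennreal) \<mu>. G \<in> borel_measurable lebesgue \<longrightarrow>
    (\<integral>\<^sup>+x. G x \<partial>lebesgue) < \<infinity> \<longrightarrow> 0 < \<mu> \<longrightarrow>
    (\<exists>a. heavy_ball_weight \<gamma> D \<mu> G a)"
    using heavy_ball_weight_neg[OF \<gamma>1] by (elim exE conjE) (rule that)
  define L where "L = 2 * 2 powr (- \<gamma>) * D * A * 2 powr (1 + \<gamma>)"
  have L: "0 < L" using D A by (simp add: L_def)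
  show ?thesis
    unfolding gradient_bound_def
  proof (intro exI[of _ "C * L"] conjI allI impI)
    show "0 < C * L" using C L by simp
    fix f :: "'n \<Rightarrow> real" and g :: "'n \<Rightarrow> 'n" and R l :: real
    assume f: "C1_gradient f g" and l: "0 < l"
    have [measurable]: "f \<in> borel_measurable lebesgue"
      by (rule borel_measurable_continuous_lebesgue[OF C1_gradient_continuous[OF f]])
    have g: "continuous_on UNIV g" using f by (simp add: C1_gradient_def)
    let ?G = "grad_on g (3 * R)"
    note Gm[measurable] = grad_on_facts(1)[OF g, of "3 * R"]
    have [measurable]: "g \<in> borel_measurable lebesgue" by (rule borel_measurable_continuous_lebesgue[OF g])
    obtain N where N: "\<And>x. ?G x \<le> ennreal N" using grad_on_facts(2)[OF g] by blast
    \<comment> \<open>The closed ball of radius r is enlarged to the open ball of radius 2r; this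
      factor absorbs the doubling in the threshold.\<close>
    define \<mu> where "\<mu> = l * 2 powr (- (1 + \<gamma>))"
    have \<mu>: "0 < \<mu>" using l by (simp add: \<mu>_def)
    obtain a where a[measurable]: "a \<in> borel_measurable lebesgue"
      and heavy: "\<And>z r. 0 < r \<Longrightarrow> ennreal (\<mu> * r powr (real DIM('n) + \<gamma>)) < (\<integral>\<^sup>+x\<in>ball z r. ?G x \<partial>lebesgue) \<Longrightarrow>
        ennreal (r powr \<gamma>) \<le> a z"
      and aw: "\<And>w A. w \<in> borel_measurable lebesgue \<Longrightarrow> 0 \<le> A \<Longrightarrow> (\<forall>x. maximal_op w x \<le> ennreal A * w x) \<Longrightarrow>
        (\<integral>\<^sup>+x. a x * w x \<partial>lebesgue) \<le> ennreal (D * A / \<mu>) * (\<integral>\<^sup>+x. ?G x * w x \<partial>lebesgue)"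
      using D'[rule_format, OF Gm grad_on_facts(3)[OF g] \<mu>] unfolding heavy_ball_weight_def by blast
    \<comment> \<open>The factor 2^(-\<gamma>) undoes the doubling of the radius, and the remaining
      2 makes the inequality strict.\<close>
    define c where "c = 2 * 2 powr (- \<gamma>)"
    have c: "0 < c" by (simp add: c_def)
    have "X (kernel_mass \<gamma> (levelset f R l (1 + \<gamma>))) \<le> ennreal (C * (L / l)) * X ?G"
    proof (rule *[unfolded kernel_mass_bound_def, rule_format, where a = "\<lambda>x. ennreal c * a x" and N = N])
      fix x show "?G x \<le> ennreal N" by (rule N)
    next
      fix x y assume "(x, y) \<in> levelset f R l (1 + \<gamma>)"
      then have xy: "norm x < R" "norm y < R" "x \<noteq> y" "l * norm (x - y) powr (1 + \<gamma>) < \<bar>f x - f y\<bar>"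
        by (auto simp: levelset_def)
      define r where "r = norm (x - y)"
      have r: "0 < r" "norm (y - x) = r" "r < 2 * R" using xy norm_triangle_ineq4[of x y] by (auto simp: r_def norm_minus_commute)
      have "\<mu> * (2 * r) powr (real DIM('n) + \<gamma>) = l * r powr (1 + \<gamma>)"
      proof -
        have "2 powr (- (1 + \<gamma>)) * 2 powr (1 + \<gamma>) = (1::real)" by (subst powr_add[symmetric]) simp
        then show ?thesis by (simp only: \<mu>_def dim powr_mult of_nat_1 mult.assoc[of l] mult.assoc[symmetric, of "2 powr (- (1 + \<gamma>))"] mult_1_left)
      qed
      then have "ennreal (\<mu> * (2 * r) powr (real DIM('n) + \<gamma>)) < ennreal \<bar>f y - f x\<bar>"
        using xy l by (simp add: r_def ennreal_less_iff abs_minus_commute)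
      also have "\<dots> \<le> (\<integral>\<^sup>+z\<in>cball x (norm (y - x)). ennreal (norm (g z)) \<partial>lebesgue)"
        using f dim unfolding C1_gradient_def by (intro segment_gradient_bound_DIM_1) auto
      also have "\<dots> \<le> (\<integral>\<^sup>+z\<in>ball x (2 * r). ?G z \<partial>lebesgue)"
      proof (rule nn_integral_mono)
        fix z
        have "z \<in> ball x (2 * r) \<and> z \<in> ball 0 (3 * R)" if "z \<in> cball x r"
          using that xy r norm_triangle_sub[of z x] by (auto simp: dist_norm norm_minus_commute)
        then show "ennreal (norm (g z)) * indicator (cball x (norm (y - x))) z \<le> ?G z * indicator (ball x (2 * r)) z"
          unfolding r(2) by (cases "z \<in> cball x r") auto
      qed
      finally have "ennreal ((2 * r) powr \<gamma>) \<le> a x" using r by (intro heavy) auto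
      then have "ennreal c * ennreal ((2 * r) powr \<gamma>) \<le> ennreal c * a x" by (rule mult_left_mono) simp
      moreover have "ennreal c * ennreal ((2 * r) powr \<gamma>) = ennreal (2 * r powr \<gamma>)"
        using r by (subst ennreal_mult'[symmetric]) (auto simp: c_def powr_mult powr_minus)
      moreover have "ennreal (r powr \<gamma>) < ennreal (2 * r powr \<gamma>)" using r by (subst ennreal_less_iff) auto
      ultimately show "ennreal (norm (x - y) powr \<gamma>) < ennreal c * a x \<or> ennreal (norm (x - y) powr \<gamma>) < ennreal c * a y"
        by (auto simp: r_def[symmetric] intro: less_le_trans)
    next
      fix w :: "'n \<Rightarrow> ennreal" assume w[measurable]: "w \<in> borel_measurable lebesgue"
        and Mw': "\<And>x. maximal_op w x \<le> ennreal A * w x"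
      have Mw: "\<forall>x. maximal_op w x \<le> ennreal A * w x" using Mw' by blast
      let ?I = "\<integral>\<^sup>+x. ?G x * w x \<partial>lebesgue"
      have "(\<integral>\<^sup>+x. ennreal c * a x * w x \<partial>lebesgue) = ennreal c * (\<integral>\<^sup>+x. a x * w x \<partial>lebesgue)"
        unfolding mult.assoc by (subst nn_integral_cmult) auto
      also have "\<dots> \<le> ennreal c * (ennreal (D * A / \<mu>) * ?I)"
        using A by (intro mult_left_mono aw w Mw) auto
      also have "\<dots> = ennreal (c * (D * A / \<mu>)) * ?I"
        using c by (simp only: ennreal_mult' less_imp_le mult.assoc[where 'a = ennreal])
      also have "c * (D * A / \<mu>) = L / l"
      proof -
        have "D * A / \<mu> = D * A * 2 powr (1 + \<gamma>) / l" unfolding \<mu>_def powr_minus by (simp add: field_simps)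
        then show ?thesis by (simp add: c_def L_def)
      qed
      finally show "(\<integral>\<^sup>+x. ennreal c * a x * w x \<partial>lebesgue) \<le> ennreal (L / l) * ?I" .
    qed (measurable, use L l in simp_all)
    then show "X (kernel_mass \<gamma> (levelset f R l (1 + \<gamma>))) \<le> ennreal (C * L / l) * X ?G" by simp
  qed
qed

lemma gradient_levelset_bound:
  fixes X :: "('n::euclidean_space) fnorm" and \<gamma> :: real
  assumes X: "ball_BFS X" and ext: "extrapolates X A" and \<gamma>: "\<gamma> \<noteq> 0"
    and neg: "\<gamma> < 0 \<longrightarrow> (M_bounded X \<or> (DIM('n) = 1 \<and> \<gamma> < -1))"
  shows "\<exists>C>0. gradient_bound X \<gamma> C"
proof -
  consider "0 < \<gamma>" | "M_bounded X" | "DIM('n) = 1" "\<gamma> < -1" using \<gamma> neg by fastforce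
  then show ?thesis
  proof cases
    case 1 then show ?thesis by (rule gradient_levelset_bound_pos[OF X ext])
  next
    case 2 then show ?thesis by (rule gradient_levelset_bound_maximal[OF X ext \<gamma>])
  next
    case 3 then show ?thesis by (rule gradient_levelset_bound_DIM_1[OF X ext])
  qed
qed

section \<open>Interpolation between the function set and the gradient set\<close>

lemma levelset_interpolation:
  assumes s: "0 < s" "s < 1" and l: "0 < l1" "0 < l2" "l1 powr (1 - s) * l2 powr s = l"
    and e: "e = (1 - s) * e1 + s * e2"
  shows "levelset f R l e \<subseteq> levelset f R l1 e1 \<union> levelset f R l2 e2"
proof (rule subsetI, rule ccontr)
  fix z assume z: "z \<in> levelset f R l e" "z \<notin> levelset f R l1 e1 \<union> levelset f R l2 e2"
  obtain x y where xy: "z = (x, y)" by (cases z)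
  define u where "u = norm (x - y)"
  define d where "d = \<bar>f x - f y\<bar>"
  have u: "0 < u" and d: "l * u powr e < d" "d \<le> l1 * u powr e1" "d \<le> l2 * u powr e2"
    using z by (auto simp: levelset_def xy u_def d_def)
  have d0: "0 < d"
  proof -
    have "0 \<le> l * u powr e" using l(3) by (auto simp flip: l(3))
    then show ?thesis using d(1) by linarith
  qed
  have "d = d powr (1 - s) * d powr s" using d0 by (simp add: powr_add[symmetric])
  also have "\<dots> \<le> (l1 * u powr e1) powr (1 - s) * (l2 * u powr e2) powr s"
    using d d0 s by (intro mult_mono powr_mono2) auto
  also have "\<dots> = l1 powr (1 - s) * l2 powr s * (u powr (e1 * (1 - s)) * u powr (e2 * s))"
    by (simp only: powr_mult powr_powr mult_ac)
  also have "u powr (e1 * (1 - s)) * u powr (e2 * s) = u powr e"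
    by (simp add: powr_add[symmetric] e algebra_simps)
  also note l(3)
  finally show False using d(1) by simp
qed

text \<open>The counterpart for p = \<infinity>: for d = |f x - f y| one has d \<le> (2N)^(1-s) d^s,
  so a single level set of the gradient type remains and nothing has to be optimised.\<close>

lemma levelset_bounded_function:
  assumes s: "0 < s" "s < 1" and l: "0 < l" and N: "0 < N" "\<And>x. x \<in> ball 0 R \<Longrightarrow> \<bar>f x\<bar> \<le> N"
  shows "levelset f R l (s * e) \<subseteq> levelset f R ((l / (2 * N) powr (1 - s)) powr (1 / s)) e"
proof
  fix z assume z: "z \<in> levelset f R l (s * e)"
  obtain x y where xy: "z = (x, y)" by (cases z)
  define u where "u = norm (x - y)"
  define d where "d = \<bar>f x - f y\<bar>"
  have B: "x \<in> ball 0 R" "y \<in> ball 0 R" "x \<noteq> y" and u: "0 < u" and d: "l * u powr (s * e) < d"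
    using z by (auto simp: levelset_def xy u_def d_def)
  have "0 \<le> l * u powr (s * e)" using l by simp
  then have d0: "0 < d" using d by linarith
  have "d \<le> 2 * N" using N(2)[OF B(1)] N(2)[OF B(2)] by (simp add: d_def)
  then have "d powr (1 - s) * d powr s \<le> (2 * N) powr (1 - s) * d powr s"
    using d0 s by (intro mult_right_mono powr_mono2) auto
  moreover have "d powr (1 - s) * d powr s = d" using d0 by (simp add: powr_add[symmetric])
  ultimately have "l * u powr (s * e) < (2 * N) powr (1 - s) * d powr s" using d by simp
  then have "l / (2 * N) powr (1 - s) * u powr (s * e) < d powr s" using N by (simp add: field_simps)
  then have "(l / (2 * N) powr (1 - s) * u powr (s * e)) powr (1 / s) < (d powr s) powr (1 / s)"
    using l s by (intro powr_less_mono2) auto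
  moreover have "(d powr s) powr (1 / s) = d" using d0 s by (simp add: powr_powr)
  moreover have "(l / (2 * N) powr (1 - s) * u powr (s * e)) powr (1 / s) = (l / (2 * N) powr (1 - s)) powr (1 / s) * u powr e"
  proof -
    have "s * e * (1 / s) = e" using s by simp
    then show ?thesis unfolding powr_mult powr_powr by simp
  qed
  ultimately show "z \<in> levelset f R ((l / (2 * N) powr (1 - s)) powr (1 / s)) e"
    using B by (simp add: levelset_def xy u_def d_def)
qed

text \<open>Solves the estimate at a fixed level for \<open>Z\<close>, the norm itself. Limits are
  taken in that form, where the Fatou property applies, and the equivalence leads back; infinite
  values are included.\<close>

lemma ennreal_scaled_epow_le_iff:
  assumes l: "0 < l" and q: "0 < q"
  shows "ennreal l * epow Z (1 / q) \<le> D \<longleftrightarrow> Z \<le> epow (ennreal (1 / l) * D) q"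
proof
  have inv: "ennreal (1 / l) * ennreal l = 1" "ennreal l * ennreal (1 / l) = 1"
    using l by (subst ennreal_mult'[symmetric]; simp)+
  {
    assume "ennreal l * epow Z (1 / q) \<le> D"
    then have "ennreal (1 / l) * (ennreal l * epow Z (1 / q)) \<le> ennreal (1 / l) * D" by (rule mult_left_mono) simp
    then have "epow Z (1 / q) \<le> ennreal (1 / l) * D" by (simp add: mult.assoc[symmetric] inv)
    then have "epow (epow Z (1 / q)) q \<le> epow (ennreal (1 / l) * D) q" by (rule epow_mono[OF q])
    then show "Z \<le> epow (ennreal (1 / l) * D) q" using q by (simp add: epow_epow)
  next
    assume "Z \<le> epow (ennreal (1 / l) * D) q"
    then have "epow Z (1 / q) \<le> epow (epow (ennreal (1 / l) * D) q) (1 / q)" using q by (intro epow_mono) auto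
    also have "\<dots> = ennreal (1 / l) * D" using q by (simp add: epow_epow)
    finally have "ennreal l * epow Z (1 / q) \<le> ennreal l * (ennreal (1 / l) * D)" by (rule mult_left_mono) simp
    then show "ennreal l * epow Z (1 / q) \<le> D" by (simp add: mult.assoc[symmetric] inv)
  }
qed

text \<open>The choice \<open>l1\<^bsup>-p\<^esup> a = b / l2\<close> is optimal.\<close>

lemma interpolation_optimum:
  fixes s p q l C a b :: real
  assumes s: "0 < s" "s < 1" and p: "0 < p" and q: "0 < q" "1 / q = (1 - s) / p + s"
    and l: "0 < l" and C: "0 < C" and a: "0 \<le> a" and b: "0 \<le> b"
    and Z: "\<And>l1 l2. 0 < l1 \<Longrightarrow> 0 < l2 \<Longrightarrow> l1 powr (1 - s) * l2 powr s = l \<Longrightarrow>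
      Z \<le> ennreal (C * (l1 powr (- p) * a + b / l2))"
  shows "ennreal l * epow Z (1 / q) \<le> ennreal ((2 * C) powr (1 / q) * (a powr ((1 - s) / p) * b powr s))"
proof -
  \<comment> \<open>Either norm may be 0, where no optimal choice of levels exists; both are raised
    by d > 0, and d tends to 0 at the end.\<close>
  have ineq: "ennreal l * epow Z (1 / q) \<le> ennreal ((2 * C) powr (1 / q) * ((a + d) powr ((1 - s) / p) * (b + d) powr s))"
    if d: "0 < d" for d
  proof -
    define a' where "a' = a + d"
    define b' where "b' = b + d"
    have ab: "0 < a'" "0 < b'" "a \<le> a'" "b \<le> b'" using a b d by (auto simp: a'_def b'_def)
    define m where "m = a' powr ((1 - s) / p) * b' powr s"
    have m: "0 < m" using ab by (simp add: m_def)
    \<comment> \<open>The common value of l1^(-p) a' and b' / l2. By the relation between the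
      exponents, the constraint on l1 and l2 reads t^(1/q) = m / l.\<close>
    define t where "t = (m / l) powr q"
    have t: "0 < t" using m l by (simp add: t_def)
    have t1: "t powr (1 / q) = m / l" using m l q(1) by (simp add: t_def powr_powr)
    define l1 where "l1 = (a' / t) powr (1 / p)"
    define l2 where "l2 = b' / t"
    have l12: "0 < l1" "0 < l2" using ab t by (auto simp: l1_def l2_def)
    have "l1 powr (1 - s) * l2 powr s = (a' / t) powr ((1 - s) / p) * (b' / t) powr s"
      by (simp add: l1_def l2_def powr_powr)
    also have "\<dots> = m / (t powr ((1 - s) / p) * t powr s)"
      by (simp add: powr_divide m_def)
    also have "t powr ((1 - s) / p) * t powr s = m / l" by (simp add: powr_add[symmetric] q(2)[symmetric] t1)
    finally have prod: "l1 powr (1 - s) * l2 powr s = l" using m by simp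
    have l1p: "l1 powr (- p) = t / a'" using p ab t by (simp add: l1_def powr_powr powr_minus)
    have "l1 powr (- p) * a + b / l2 \<le> t + t"
    proof (rule add_mono)
      show "l1 powr (- p) * a \<le> t" unfolding l1p using ab t by (simp add: field_simps)
      show "b / l2 \<le> t" unfolding l2_def using ab t by (simp add: field_simps)
    qed
    then have "C * (l1 powr (- p) * a + b / l2) \<le> 2 * C * t" using C by simp
    then have "Z \<le> ennreal (2 * C * t)" by (rule order_trans[OF Z[OF l12 prod] ennreal_leI])
    then have "epow Z (1 / q) \<le> epow (ennreal (2 * C * t)) (1 / q)" using q(1) by (intro epow_mono) auto
    also have "\<dots> = ennreal ((2 * C) powr (1 / q) * (m / l))" using C t by (simp add: epow_ennreal powr_mult t1)
    finally have "ennreal l * epow Z (1 / q) \<le> ennreal l * ennreal ((2 * C) powr (1 / q) * (m / l))" by (rule mult_left_mono) simp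
    also have "\<dots> = ennreal (l * ((2 * C) powr (1 / q) * (m / l)))" using l by (intro ennreal_mult'[symmetric]) simp
    also have "l * ((2 * C) powr (1 / q) * (m / l)) = (2 * C) powr (1 / q) * m" using l by simp
    finally show ?thesis by (simp add: m_def a'_def b'_def)
  qed
  have "(\<lambda>n. inverse (real (Suc n))) \<longlonglongrightarrow> 0" by (rule LIMSEQ_inverse_real_of_nat)
  then have "(\<lambda>n. (2 * C) powr (1 / q) * ((a + inverse (real (Suc n))) powr ((1 - s) / p) * (b + inverse (real (Suc n))) powr s))
    \<longlonglongrightarrow> (2 * C) powr (1 / q) * ((a + 0) powr ((1 - s) / p) * (b + 0) powr s)"
    using s p a b by (intro tendsto_mult tendsto_const tendsto_powr' tendsto_add disjI2 conjI always_eventually allI) auto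
  then have "(\<lambda>n. ennreal ((2 * C) powr (1 / q) * ((a + inverse (real (Suc n))) powr ((1 - s) / p) * (b + inverse (real (Suc n))) powr s)))
    \<longlonglongrightarrow> ennreal ((2 * C) powr (1 / q) * (a powr ((1 - s) / p) * b powr s))"
    by (intro tendsto_ennrealI) simp
  then show ?thesis
    by (rule LIMSEQ_le_const) (intro exI[of _ 0] allI impI ineq, simp)
qed

lemma bfs_grad_on_le:
  assumes X: "ball_BFS X" and g: "continuous_on UNIV g"
  shows "X (grad_on g \<rho>) \<le> X (\<lambda>x. ennreal (norm (g x)))"
proof (rule bfs_mono[OF X])
  have [measurable]: "g \<in> borel_measurable lebesgue" by (rule borel_measurable_continuous_lebesgue[OF g])
  show "(\<lambda>x. ennreal (norm (g x))) \<in> borel_measurable lebesgue" "grad_on g \<rho> \<in> borel_measurable lebesgue" by measurable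
  fix x show "grad_on g \<rho> x \<le> ennreal (norm (g x))" by (simp add: indicator_def)
qed

lemma C1_local_estimate:
  fixes X :: "('n::euclidean_space) fnorm" and \<gamma> :: real
  assumes X: "ball_BFS X" and ext: "extrapolates X A" and \<gamma>: "\<gamma> \<noteq> 0"
    and neg: "\<gamma> < 0 \<longrightarrow> (M_bounded X \<or> (DIM('n) = 1 \<and> \<gamma> < -1))"
    and s: "0 < s" "s < 1" and p: "0 < p" and q: "0 < q" "1 / q = (1 - s) / p + s"
  shows "\<exists>C>0. \<forall>f g R l. C1_gradient f g \<longrightarrow> 0 < l \<longrightarrow>
    ennreal l * epow (X (kernel_mass \<gamma> (levelset f R l (s + \<gamma> / q)))) (1 / q)
      \<le> ennreal C * epow (X (\<lambda>x. ennreal (\<bar>f x\<bar> powr p))) ((1 - s) / p) * epow (X (\<lambda>x. ennreal (norm (g x)))) s"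
proof -
  obtain C1 where C1: "0 < C1" and C1': "\<forall>f R l. continuous_on UNIV f \<longrightarrow> 0 < l \<longrightarrow>
    X (kernel_mass \<gamma> (levelset f R l (\<gamma> / p)))
      \<le> ennreal (C1 * l powr (- p)) * X (\<lambda>x. ennreal (\<bar>f x\<bar> powr p) * indicator (ball 0 R) x)"
    using function_levelset_bound[OF X ext \<gamma> p] by (elim exE conjE) (rule that)
  obtain C2 where C2: "0 < C2" and C2': "gradient_bound X \<gamma> C2"
    using gradient_levelset_bound[OF X ext \<gamma> neg] by (elim exE conjE) (rule that)
  define C where "C = C1 + C2"
  have C: "0 < C" "C1 \<le> C" "C2 \<le> C" using C1 C2 by (auto simp: C_def)
  show ?thesis
  proof (intro exI[of _ "(2 * C) powr (1 / q)"] conjI allI impI)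
    show "0 < (2 * C) powr (1 / q)" using C by simp
    fix f :: "'n \<Rightarrow> real" and g :: "'n \<Rightarrow> 'n" and R l :: real
    assume f: "C1_gradient f g" and l: "0 < l"
    have fc: "continuous_on UNIV f" by (rule C1_gradient_continuous[OF f])
    have [measurable]: "f \<in> borel_measurable lebesgue" by (rule borel_measurable_continuous_lebesgue[OF fc])
    have gc: "continuous_on UNIV g" using f by (simp add: C1_gradient_def)
    have [measurable]: "g \<in> borel_measurable lebesgue" by (rule borel_measurable_continuous_lebesgue[OF gc])
    let ?F = "\<lambda>x. ennreal (\<bar>f x\<bar> powr p) * indicator (ball 0 R) x"
    let ?G = "grad_on g (3 * R)"
    \<comment> \<open>Localised functions have finite norm even if the global norms are infinite, so
      the optimisation takes place over real numbers.\<close>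
    have finF: "X ?F < \<infinity>"
    proof -
      obtain N where N: "0 < N" "\<And>x. x \<in> ball 0 R \<Longrightarrow> norm (f x) \<le> N" using continuous_bounded_ball[OF fc] by metis
      show ?thesis
      proof (rule bfs_bounded_support[OF X])
        fix x show "?F x \<le> ennreal (N powr p) * indicator (ball 0 R) x"
          using N(2)[of x] p by (auto simp: indicator_def intro!: ennreal_leI powr_mono2)
      qed measurable
    qed
    have finG: "X ?G < \<infinity>"
    proof -
      obtain N where N: "0 < N" "\<And>x. x \<in> ball 0 (3 * R) \<Longrightarrow> norm (g x) \<le> N" using continuous_bounded_ball[OF gc] by metis
      show ?thesis
      proof (rule bfs_bounded_support[OF X])
        fix x show "?G x \<le> ennreal N * indicator (ball 0 (3 * R)) x"
          using N(2)[of x] by (auto simp: indicator_def intro!: ennreal_leI)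
      qed measurable
    qed
    define a where "a = enn2real (X ?F)"
    define b where "b = enn2real (X ?G)"
    have a: "X ?F = ennreal a" "0 \<le> a" using finF by (auto simp: a_def)
    have b: "X ?G = ennreal b" "0 \<le> b" using finG by (auto simp: b_def)
    \<comment> \<open>The relation 1/q = (1-s)/p + s is what makes the exponent of the theorem the
      interpolated one.\<close>
    have e: "s + \<gamma> / q = (1 - s) * (\<gamma> / p) + s * (1 + \<gamma>)"
    proof -
      have "\<gamma> / q = \<gamma> * (1 / q)" by simp
      then show ?thesis unfolding q(2) by (simp add: algebra_simps add_divide_distrib diff_divide_distrib)
    qed
    let ?Z = "X (kernel_mass \<gamma> (levelset f R l (s + \<gamma> / q)))"
    have Z: "?Z \<le> ennreal (C * (l1 powr (- p) * a + b / l2))"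
      if l12: "0 < l1" "0 < l2" "l1 powr (1 - s) * l2 powr s = l" for l1 l2
    proof -
      let ?k1 = "kernel_mass \<gamma> (levelset f R l1 (\<gamma> / p))" and ?k2 = "kernel_mass \<gamma> (levelset f R l2 (1 + \<gamma>))"
      have "?Z \<le> X (\<lambda>x. ?k1 x + ?k2 x)"
      proof (rule bfs_mono[OF X])
        fix x
        show "kernel_mass \<gamma> (levelset f R l (s + \<gamma> / q)) x \<le> ?k1 x + ?k2 x"
          by (rule order_trans[OF kernel_mass_mono[OF levelset_interpolation[OF s l12 e]] kernel_mass_Un_le]) measurable
      qed measurable
      also have "\<dots> \<le> X ?k1 + X ?k2" by (intro bfs_add[OF X]) measurable
      also have "\<dots> \<le> ennreal (C1 * l1 powr (- p)) * ennreal a + ennreal (C2 / l2) * ennreal b"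
        using C1'[rule_format, OF fc l12(1), of R] C2'[unfolded gradient_bound_def, rule_format, OF f l12(2), of R] by (intro add_mono) (auto simp: a b)
      also have "\<dots> = ennreal (C1 * l1 powr (- p) * a + C2 / l2 * b)"
      proof -
        have "0 \<le> C1 * l1 powr (- p)" "0 \<le> C2 / l2" using C1 C2 l12 by auto
        then show ?thesis using a(2) b(2) by (simp only: ennreal_mult' ennreal_plus mult_nonneg_nonneg)
      qed
      also have "\<dots> \<le> ennreal (C * l1 powr (- p) * a + C / l2 * b)"
        using C a b l12 by (intro ennreal_leI add_mono mult_right_mono divide_right_mono) auto
      also have "C * l1 powr (- p) * a + C / l2 * b = C * (l1 powr (- p) * a + b / l2)" by (simp add: algebra_simps)
      finally show ?thesis .
    qed
    have "ennreal l * epow ?Z (1 / q) \<le> ennreal ((2 * C) powr (1 / q) * (a powr ((1 - s) / p) * b powr s))"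
      by (rule interpolation_optimum[OF s p q l C(1) a(2) b(2) Z])
    also have "\<dots> = ennreal ((2 * C) powr (1 / q)) * epow (X ?F) ((1 - s) / p) * epow (X ?G) s"
      unfolding a b using a(2) b(2) by (simp add: epow_ennreal ennreal_mult' mult.assoc)
    also have "\<dots> \<le> ennreal ((2 * C) powr (1 / q)) * epow (X (\<lambda>x. ennreal (\<bar>f x\<bar> powr p))) ((1 - s) / p) * epow (X (\<lambda>x. ennreal (norm (g x)))) s"
    proof -
      have "X ?F \<le> X (\<lambda>x. ennreal (\<bar>f x\<bar> powr p))"
      proof (rule bfs_mono[OF X])
        fix x show "?F x \<le> ennreal (\<bar>f x\<bar> powr p)" by (simp add: indicator_def)
      qed measurable
      moreover have "X ?G \<le> X (\<lambda>x. ennreal (norm (g x)))" by (rule bfs_grad_on_le[OF X gc])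
      ultimately show ?thesis using s p by (intro mult_mono mult_left_mono epow_mono) auto
    qed
    finally show "ennreal l * epow ?Z (1 / q) \<le> ennreal ((2 * C) powr (1 / q)) *
      epow (X (\<lambda>x. ennreal (\<bar>f x\<bar> powr p))) ((1 - s) / p) * epow (X (\<lambda>x. ennreal (norm (g x)))) s" .
  qed
qed

text \<open>Here q = 1/s, so the exponent s + \<gamma>/q becomes s (1 + \<gamma>). The bound
  \<open>N\<close> is local because the global supremum of |f| may be infinite.\<close>

lemma C1_local_estimate_bounded:
  fixes X :: "('n::euclidean_space) fnorm" and \<gamma> :: real
  assumes X: "ball_BFS X" and ext: "extrapolates X A" and \<gamma>: "\<gamma> \<noteq> 0"
    and neg: "\<gamma> < 0 \<longrightarrow> (M_bounded X \<or> (DIM('n) = 1 \<and> \<gamma> < -1))"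
    and s: "0 < s" "s < 1"
  shows "\<exists>C>0. \<forall>f g R l N. C1_gradient f g \<longrightarrow> 0 < l \<longrightarrow> 0 < N \<longrightarrow> (\<forall>x\<in>ball 0 R. \<bar>f x\<bar> \<le> N) \<longrightarrow>
    ennreal l * epow (X (kernel_mass \<gamma> (levelset f R l (s * (1 + \<gamma>))))) s
      \<le> ennreal (C * N powr (1 - s)) * epow (X (\<lambda>x. ennreal (norm (g x)))) s"
proof -
  obtain C where C: "0 < C" and C': "gradient_bound X \<gamma> C"
    using gradient_levelset_bound[OF X ext \<gamma> neg] by (elim exE conjE) (rule that)
  show ?thesis
  proof (intro exI[of _ "C powr s * 2 powr (1 - s)"] conjI allI impI)
    show "0 < C powr s * 2 powr (1 - s)" using C by simp
    fix f :: "'n \<Rightarrow> real" and g :: "'n \<Rightarrow> 'n" and R l N :: real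
    assume f: "C1_gradient f g" and l: "0 < l" and N: "0 < N" "\<forall>x\<in>ball 0 R. \<bar>f x\<bar> \<le> N"
    have fc: "continuous_on UNIV f" by (rule C1_gradient_continuous[OF f])
    have [measurable]: "f \<in> borel_measurable lebesgue" by (rule borel_measurable_continuous_lebesgue[OF fc])
    have gc: "continuous_on UNIV g" using f by (simp add: C1_gradient_def)
    have [measurable]: "g \<in> borel_measurable lebesgue" by (rule borel_measurable_continuous_lebesgue[OF gc])
    define l2 where "l2 = (l / (2 * N) powr (1 - s)) powr (1 / s)"
    have l2: "0 < l2" using l N by (simp add: l2_def)
    have sub: "levelset f R l (s * (1 + \<gamma>)) \<subseteq> levelset f R l2 (1 + \<gamma>)"
      unfolding l2_def using N by (intro levelset_bounded_function s l) auto
    have "X (kernel_mass \<gamma> (levelset f R l (s * (1 + \<gamma>)))) \<le> X (kernel_mass \<gamma> (levelset f R l2 (1 + \<gamma>)))"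
      by (intro bfs_mono[OF X] kernel_mass_mono sub) measurable
    also have "\<dots> \<le> ennreal (C / l2) * X (grad_on g (3 * R))" by (rule C'[unfolded gradient_bound_def, rule_format, OF f l2])
    also have "\<dots> \<le> ennreal (C / l2) * X (\<lambda>x. ennreal (norm (g x)))"
      by (intro mult_left_mono bfs_grad_on_le[OF X gc]) simp
    finally have "epow (X (kernel_mass \<gamma> (levelset f R l (s * (1 + \<gamma>))))) s \<le> epow (ennreal (C / l2) * X (\<lambda>x. ennreal (norm (g x)))) s"
      by (rule epow_mono[OF s(1)])
    also have "\<dots> = ennreal ((C / l2) powr s) * epow (X (\<lambda>x. ennreal (norm (g x)))) s"
      using C l2 s by (simp add: epow_mult epow_ennreal)
    finally have "ennreal l * epow (X (kernel_mass \<gamma> (levelset f R l (s * (1 + \<gamma>))))) s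
      \<le> ennreal l * (ennreal ((C / l2) powr s) * epow (X (\<lambda>x. ennreal (norm (g x)))) s)" by (rule mult_left_mono) simp
    also have "\<dots> = ennreal (l * (C / l2) powr s) * epow (X (\<lambda>x. ennreal (norm (g x)))) s"
      using l by (simp add: ennreal_mult' mult.assoc)
    also have "l * (C / l2) powr s = C powr s * 2 powr (1 - s) * N powr (1 - s)"
    proof -
      have "l2 powr s = l / (2 * N) powr (1 - s)" using s l N by (simp add: l2_def powr_powr)
      then have "(C / l2) powr s = C powr s / (l / (2 * N) powr (1 - s))" by (simp only: powr_divide)
      then show ?thesis using l N by (simp add: powr_mult)
    qed
    finally show "ennreal l * epow (X (kernel_mass \<gamma> (levelset f R l (s * (1 + \<gamma>))))) s
      \<le> ennreal (C powr s * 2 powr (1 - s) * N powr (1 - s)) * epow (X (\<lambda>x. ennreal (norm (g x)))) s" .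
  qed
qed

section \<open>From balls to the whole space\<close>

lemma Dset_eq_levelset: "Dset f l \<beta> \<sigma> = (\<Union>k. levelset f (real k) l (\<sigma> + \<beta>))"
proof (intro set_eqI)
  fix z :: "'a \<times> 'a"
  obtain x y where z: "z = (x, y)" by (cases z)
  obtain k where k: "max (norm x) (norm y) < real k" using reals_Archimedean2 by blast
  show "z \<in> Dset f l \<beta> \<sigma> \<longleftrightarrow> z \<in> (\<Union>k. levelset f (real k) l (\<sigma> + \<beta>))"
    using k by (cases "x = y") (auto simp: z Dset_def levelset_def pos_less_divide_eq)
qed

text \<open>The power 1/q of the inner integral cancels against the power q in the norm of X^q, so
  only the norm of X has to be estimated.\<close>

lemma lhs_quant_eq:
  assumes "0 < q"
  shows "lhs_quant X f \<gamma> q s = (SUP l\<in>{0<..}. ennreal l * epow (X (kernel_mass \<gamma> (Dset f l (\<gamma> / q) s))) (1 / q))"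
  using assms unfolding lhs_quant_def pow_space_eq kernel_mass_def riesz_kernel_def by (simp add: epow_epow)

lemma bfs_kernel_mass_Union_le:
  assumes X: "ball_BFS X" and [measurable]: "\<And>k::nat. E k \<in> sets (lebesgue \<Otimes>\<^sub>M lebesgue)"
    and inc: "\<And>k. E k \<subseteq> E (Suc k)" and le: "\<And>k. X (kernel_mass \<gamma> (E k)) \<le> U"
  shows "X (kernel_mass \<gamma> (\<Union>k. E k)) \<le> U"
proof (rule bfs_liminf_le[OF X, where F = "\<lambda>k. kernel_mass \<gamma> (E k)" and b = "\<lambda>_. U"])
  have "kernel_mass \<gamma> (\<Union>k. E k) x \<le> liminf (\<lambda>k. kernel_mass \<gamma> (E k) x)" for x
  proof -
    have "(SUP k. indicator (E k) z) = (indicator (\<Union>k. E k) z :: ennreal)" for z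
    proof (cases "z \<in> (\<Union>k. E k)")
      case True
      then obtain k where "z \<in> E k" by auto
      then have "(1::ennreal) \<le> (SUP k. indicator (E k) z)"
        using SUP_upper[of k UNIV "\<lambda>k. indicator (E k) z :: ennreal"] by simp
      moreover have "(SUP k. indicator (E k) z) \<le> (1::ennreal)" by (rule SUP_least) (simp add: indicator_def)
      ultimately have "(SUP k. indicator (E k) z) = (1::ennreal)" by (rule antisym[rotated])
      then show ?thesis using True by simp
    qed auto
    then have "kernel_mass \<gamma> (\<Union>k. E k) x = (\<integral>\<^sup>+y. (SUP k. indicator (E k) (x, y) * riesz_kernel \<gamma> x y) \<partial>lebesgue)"
      unfolding kernel_mass_def by (simp add: SUP_mult_right_ennreal[symmetric])
    also have "\<dots> = (SUP k. kernel_mass \<gamma> (E k) x)"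
      unfolding kernel_mass_def
    proof (rule nn_integral_monotone_convergence_SUP)
      show "incseq (\<lambda>k y. indicator (E k) (x, y) * riesz_kernel \<gamma> x y)"
        using inc by (intro incseq_SucI le_funI mult_right_mono) (auto simp: indicator_def)
    qed measurable
    finally have "kernel_mass \<gamma> (\<Union>k. E k) x = (SUP k. kernel_mass \<gamma> (E k) x)" .
    moreover have "(\<lambda>k. kernel_mass \<gamma> (E k) x) \<longlonglongrightarrow> (SUP k. kernel_mass \<gamma> (E k) x)"
      by (intro LIMSEQ_SUP incseq_SucI kernel_mass_mono inc)
    ultimately show ?thesis by (simp add: lim_imp_Liminf)
  qed
  then show "AE x in lebesgue. kernel_mass \<gamma> (\<Union>k. E k) x \<le> liminf (\<lambda>k. kernel_mass \<gamma> (E k) x)" by simp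
qed (use le in \<open>auto intro: sets.countable_UN\<close>)

text \<open>Removes the localisation: as R grows the level sets increase to the full set, and the
  Fatou property preserves bounds that do not depend on R.\<close>

lemma lhs_quant_le:
  fixes X :: "('n::euclidean_space) fnorm"
  assumes X: "ball_BFS X" and [measurable]: "f \<in> borel_measurable lebesgue" and q: "0 < q"
    and le: "\<And>l R. 0 < l \<Longrightarrow> ennreal l * epow (X (kernel_mass \<gamma> (levelset f R l (s + \<gamma> / q)))) (1 / q) \<le> D"
  shows "lhs_quant X f \<gamma> q s \<le> D"
  unfolding lhs_quant_eq[OF q]
proof (rule SUP_least)
  fix l :: real assume "l \<in> {0<..}"
  then have l: "0 < l" by simp
  have "X (kernel_mass \<gamma> (\<Union>k. levelset f (real k) l (s + \<gamma> / q))) \<le> epow (ennreal (1 / l) * D) q"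
  proof (rule bfs_kernel_mass_Union_le[OF X])
    fix k
    show "levelset f (real k) l (s + \<gamma> / q) \<subseteq> levelset f (real (Suc k)) l (s + \<gamma> / q)"
      by (auto simp: levelset_def)
    show "X (kernel_mass \<gamma> (levelset f (real k) l (s + \<gamma> / q))) \<le> epow (ennreal (1 / l) * D) q"
      using le[OF l] by (simp add: ennreal_scaled_epow_le_iff[OF l q])
  qed measurable
  then show "ennreal l * epow (X (kernel_mass \<gamma> (Dset f l (\<gamma> / q) s))) (1 / q) \<le> D"
    by (simp add: ennreal_scaled_epow_le_iff[OF l q] Dset_eq_levelset)
qed

lemma epow_pow_space_absn:
  assumes "0 < p"
  shows "epow (pow_space p X (absn f)) (1 - s) = epow (X (\<lambda>x. ennreal (\<bar>f x\<bar> powr p))) ((1 - s) / p)"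
  by (simp add: pow_space_eq absn_def epow_ennreal epow_epow)

lemma AE_le_Linf_norm: "AE x in lebesgue. ennreal \<bar>f x\<bar> \<le> Linf_norm f"
proof (cases "Linf_norm f = top")
  case False
  have "AE x in lebesgue. \<forall>k. ennreal \<bar>f x\<bar> \<le> Linf_norm f + ennreal (inverse (real (Suc k)))"
  proof (subst AE_all_countable, intro allI)
    fix k
    have "Linf_norm f < Linf_norm f + ennreal (inverse (real (Suc k)))"
      using False by (cases "Linf_norm f") (auto simp: ennreal_plus[symmetric] ennreal_less_iff simp del: ennreal_plus of_nat_Suc)
    then obtain C where "AE x in lebesgue. ennreal \<bar>f x\<bar> \<le> C" "C < Linf_norm f + ennreal (inverse (real (Suc k)))"
      unfolding Linf_norm_def Inf_less_iff by blast
    then show "AE x in lebesgue. ennreal \<bar>f x\<bar> \<le> Linf_norm f + ennreal (inverse (real (Suc k)))"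
      by (auto intro: order_trans less_imp_le)
  qed
  then show ?thesis
  proof eventually_elim
    fix x assume *: "\<forall>k. ennreal \<bar>f x\<bar> \<le> Linf_norm f + ennreal (inverse (real (Suc k)))"
    have "(\<lambda>k. ennreal (inverse (real (Suc k)))) \<longlonglongrightarrow> ennreal 0"
      by (intro tendsto_ennrealI LIMSEQ_inverse_real_of_nat)
    then have "(\<lambda>k. Linf_norm f + ennreal (inverse (real (Suc k)))) \<longlonglongrightarrow> Linf_norm f + 0"
      by (intro tendsto_add tendsto_const) simp
    then have "ennreal \<bar>f x\<bar> \<le> Linf_norm f + 0"
      by (rule LIMSEQ_le_const) (use * in blast)
    then show "ennreal \<bar>f x\<bar> \<le> Linf_norm f" by simp
  qed
qed simp

lemma C1_estimate:
  fixes X :: "('n::euclidean_space) fnorm" and \<gamma> :: real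
  assumes X: "ball_BFS X" and ext: "extrapolates X A" and \<gamma>: "\<gamma> \<noteq> 0"
    and neg: "\<gamma> < 0 \<longrightarrow> (M_bounded X \<or> (DIM('n) = 1 \<and> \<gamma> < -1))"
    and s: "0 < s" "s < 1" and p: "0 < p" and q: "0 < q" "1 / q = (1 - s) / p + s"
  shows "\<exists>C>0. \<forall>f g. C1_gradient f g \<longrightarrow> lhs_quant X f \<gamma> q s
      \<le> ennreal C * epow (pow_space p X (absn f)) (1 - s) * epow (X (\<lambda>x. ennreal (norm (g x)))) s"
proof -
  obtain C where C: "0 < C" and C': "\<forall>f g R l. C1_gradient f g \<longrightarrow> 0 < l \<longrightarrow>
    ennreal l * epow (X (kernel_mass \<gamma> (levelset f R l (s + \<gamma> / q)))) (1 / q)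
      \<le> ennreal C * epow (X (\<lambda>x. ennreal (\<bar>f x\<bar> powr p))) ((1 - s) / p) * epow (X (\<lambda>x. ennreal (norm (g x)))) s"
    using C1_local_estimate[OF assms] by (elim exE conjE) (rule that)
  show ?thesis
  proof (intro exI[of _ C] conjI allI impI C)
    fix f :: "'n \<Rightarrow> real" and g assume f: "C1_gradient f g"
    show "lhs_quant X f \<gamma> q s \<le> ennreal C * epow (pow_space p X (absn f)) (1 - s) * epow (X (\<lambda>x. ennreal (norm (g x)))) s"
      unfolding epow_pow_space_absn[OF p]
      by (intro lhs_quant_le[OF X _ q(1)] C'[rule_format] f
          borel_measurable_continuous_lebesgue[OF C1_gradient_continuous[OF f]])
  qed
qed

lemma C1_estimate_bounded:
  fixes X :: "('n::euclidean_space) fnorm" and \<gamma> :: real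
  assumes X: "ball_BFS X" and ext: "extrapolates X A" and \<gamma>: "\<gamma> \<noteq> 0"
    and neg: "\<gamma> < 0 \<longrightarrow> (M_bounded X \<or> (DIM('n) = 1 \<and> \<gamma> < -1))"
    and s: "0 < s" "s < 1" and q: "1 / q = s"
  shows "\<exists>C>0. \<forall>f g. C1_gradient f g \<longrightarrow> lhs_quant X f \<gamma> q s
      \<le> ennreal C * epow (Linf_norm f) (1 - s) * epow (X (\<lambda>x. ennreal (norm (g x)))) s"
proof -
  obtain C where C: "0 < C" and C': "\<forall>f g R l N. C1_gradient f g \<longrightarrow> 0 < l \<longrightarrow> 0 < N \<longrightarrow> (\<forall>x\<in>ball 0 R. \<bar>f x\<bar> \<le> N) \<longrightarrow>
    ennreal l * epow (X (kernel_mass \<gamma> (levelset f R l (s * (1 + \<gamma>))))) s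
      \<le> ennreal (C * N powr (1 - s)) * epow (X (\<lambda>x. ennreal (norm (g x)))) s"
    using C1_local_estimate_bounded[OF X ext \<gamma> neg s] by (elim exE conjE) (rule that)
  have q0: "0 < q" using q s by (metis zero_less_divide_1_iff)
  have e: "s + \<gamma> / q = s * (1 + \<gamma>)" using q by (simp add: algebra_simps divide_inverse)
  show ?thesis
  proof (intro exI[of _ C] conjI allI impI C)
    fix f :: "'n \<Rightarrow> real" and g assume f: "C1_gradient f g"
    have fc: "continuous_on UNIV f" by (rule C1_gradient_continuous[OF f])
    let ?B = "epow (X (\<lambda>x. ennreal (norm (g x)))) s"
    show "lhs_quant X f \<gamma> q s \<le> ennreal C * epow (Linf_norm f) (1 - s) * ?B"
    proof (intro lhs_quant_le[OF X _ q0] borel_measurable_continuous_lebesgue[OF fc])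
      fix l R :: real assume l: "0 < l"
      show "ennreal l * epow (X (kernel_mass \<gamma> (levelset f R l (s + \<gamma> / q)))) (1 / q)
        \<le> ennreal C * epow (Linf_norm f) (1 - s) * ?B"
      proof (cases "Linf_norm f = top")
        case True
        obtain N where N: "0 < N" "\<And>x. x \<in> ball 0 R \<Longrightarrow> norm (f x) \<le> N" using continuous_bounded_ball[OF fc] by metis
        show ?thesis
        \<comment> \<open>An infinite supremum norm makes the right-hand side infinite unless the
          gradient factor is 0, where \<open>top * 0 = 0\<close>. In that case any bound of
          \<open>f\<close> on the ball suffices, since its factor is 0 as well.\<close>
        proof (cases "?B = 0")
          case True
          then show ?thesis using C'[rule_format, OF f l N(1), of R] N(2) unfolding e q by simp
        next
          case False
          then show ?thesis using True C by (simp add: ennreal_mult_top ennreal_top_mult)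
        qed
      next
        case False
        define N where "N = enn2real (Linf_norm f)"
        have N: "Linf_norm f = ennreal N" "0 \<le> N" using False by (auto simp: N_def less_top)
        \<comment> \<open>A bound almost everywhere holds everywhere for continuous
          \<open>f\<close>, because a closed set of full measure is the whole space.\<close>
        have "AE x in lebesgue. \<bar>f x\<bar> \<le> N" using AE_le_Linf_norm[of f] by (simp add: N)
        then have "AE x in lebesgue. x \<in> {x. \<bar>f x\<bar> \<le> N}" by simp
        moreover have "closed {x. \<bar>f x\<bar> \<le> N}"
          using fc by (intro closed_Collect_le continuous_intros) auto
        ultimately have fN: "\<bar>f x\<bar> \<le> N" for x
          using mem_closed_if_AE_lebesgue[of "{x. \<bar>f x\<bar> \<le> N}" x] by simp
        show ?thesis
        \<comment> \<open>The local estimate needs a positive bound; if \<open>N\<close> is 0,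
          \<open>f\<close> vanishes and its level sets are empty.\<close>
        proof (cases "N = 0")
          case True
          then have "f x = 0" for x using fN[of x] by simp
          then have "levelset f R l (s + \<gamma> / q) = {}" using l by (auto simp: levelset_def not_less)
          then have "X (kernel_mass \<gamma> (levelset f R l (s + \<gamma> / q))) = 0"
            using bfs_zero[OF X] by (simp add: kernel_mass_def[abs_def])
          then show ?thesis by simp
        next
          case False
          then show ?thesis
            using C'[rule_format, OF f l, of N R] fN N C unfolding e q
            by (simp add: epow_ennreal ennreal_mult')
        qed
      qed
    qed
  qed
qed

section \<open>Mollification\<close>

text \<open>For j = 0 the classical flat function exp(-1/t). The powers of 1/t are included because
  derivatives of the family are combinations of its members.\<close>

definition exp_flat :: "nat \<Rightarrow> real \<Rightarrow> real" where
  "exp_flat j t = (if 0 < t then exp (- inverse t) * inverse t ^ j else 0)"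

lemma exp_flat_bounds: "0 \<le> exp_flat j t" "exp_flat j t \<le> fact j"
proof -
  show "0 \<le> exp_flat j t" by (simp add: exp_flat_def)
  show "exp_flat j t \<le> fact j"
  proof (cases "0 < t")
    case True
    define v where "v = inverse t"
    have v: "0 < v" using True by (simp add: v_def)
    \<comment> \<open>A single term of the exponential series gives v^j / j! \<le> exp v.\<close>
    have "(\<Sum>n\<in>{j}. v ^ n /\<^sub>R fact n) \<le> (\<Sum>n. v ^ n /\<^sub>R fact n)"
      using v summable_exp_generic[of v] by (intro sum_le_suminf) auto
    also have "\<dots> = exp v" by (simp add: exp_def)
    finally have "v ^ j / fact j \<le> exp v" by (simp add: divide_inverse mult.commute)
    then have "v ^ j \<le> fact j * exp v" by (simp add: pos_divide_le_eq mult.commute)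
    then have "exp (- v) * v ^ j \<le> exp (- v) * (fact j * exp v)" by (rule mult_left_mono) simp
    also have "\<dots> = fact j" by (simp add: exp_minus)
    finally have "exp (- v) * v ^ j \<le> fact j" .
    then show ?thesis using True by (simp add: exp_flat_def v_def)
  qed (simp add: exp_flat_def)
qed

lemma exp_flat_add_2: "0 < t \<Longrightarrow> exp_flat j t = exp_flat (j + 2) t * t\<^sup>2"
  by (simp add: exp_flat_def power_add power2_eq_square field_simps)

lemma DERIV_exp_flat:
  "(exp_flat j has_real_derivative (exp_flat (j + 2) t - real j * exp_flat (j + 1) t)) (at t)"
proof -
  consider "0 < t" | "t < 0" | "t = 0" by linarith
  then show ?thesis
  proof cases
    case 1
    have "((\<lambda>t. exp (- inverse t) * inverse t ^ j) has_real_derivative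
      (exp_flat (j + 2) t - real j * exp_flat (j + 1) t)) (at t)"
    proof -
      define v where "v = inverse t"
      have "((\<lambda>v. exp (- v) * v ^ j) has_real_derivative (exp (- v) * (real j * v ^ (j - 1)) - exp (- v) * v ^ j)) (at (inverse t))"
        unfolding v_def by (auto intro!: derivative_eq_intros)
      from DERIV_chain2[OF this DERIV_inverse] 1
      have "((\<lambda>t. exp (- inverse t) * inverse t ^ j) has_real_derivative
        (exp (- v) * (real j * v ^ (j - 1)) - exp (- v) * v ^ j) * - (v ^ 2)) (at t)"
        by (simp add: v_def numeral_2_eq_2)
      also have "(exp (- v) * (real j * v ^ (j - 1)) - exp (- v) * v ^ j) * - (v ^ 2) = exp_flat (j + 2) t - real j * exp_flat (j + 1) t"
        using 1 by (cases j) (simp_all add: exp_flat_def v_def[symmetric] power_add power2_eq_square algebra_simps)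
      finally show ?thesis .
    qed
    then show ?thesis
      by (rule has_field_derivative_transform_within_open[where S = "{0<..}"]) (use 1 in \<open>auto simp: exp_flat_def\<close>)
  next
    case 2
    have "((\<lambda>_. 0) has_real_derivative (exp_flat (j + 2) t - real j * exp_flat (j + 1) t)) (at t)"
      using 2 by (auto simp: exp_flat_def)
    then show ?thesis
      by (rule has_field_derivative_transform_within_open[where S = "{..<0}"]) (use 2 in \<open>auto simp: exp_flat_def\<close>)
  next
    case 3
    \<comment> \<open>Two powers of 1/t are traded for h^2, so the difference quotient at 0 is of
      order |h|.\<close>
    have bd: "\<bar>exp_flat j h / h\<bar> \<le> fact (j + 2) * \<bar>h\<bar>" for h
    proof (cases "0 < h")
      case True
      have "exp_flat j h \<le> fact (j + 2) * h\<^sup>2"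
        by (subst exp_flat_add_2[OF True]) (intro mult_right_mono exp_flat_bounds zero_le_power2)
      then show ?thesis using True exp_flat_bounds(1)[of j h] by (simp add: divide_le_eq power2_eq_square)
    next
      case False
      have "0 \<le> fact (j + 2) * \<bar>h\<bar>" by (intro mult_nonneg_nonneg fact_ge_zero abs_ge_zero)
      with False show ?thesis by (simp only: exp_flat_def if_False div_0 abs_zero)
    qed
    have "((\<lambda>h. exp_flat j h / h) \<longlongrightarrow> 0) (at 0)"
    proof (rule Lim_null_comparison)
      show "\<forall>\<^sub>F h in at 0. norm (exp_flat j h / h) \<le> fact (j + 2) * \<bar>h\<bar>"
        using bd by (auto simp del: fact_Suc)
      have "((\<lambda>h::real. fact (j + 2) * \<bar>h\<bar>) \<longlongrightarrow> fact (j + 2) * \<bar>0\<bar>) (at 0)" by (intro tendsto_intros)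
      then show "((\<lambda>h::real. fact (j + 2) * \<bar>h\<bar>) \<longlongrightarrow> 0) (at 0)" by simp
    qed
    then show ?thesis using 3 by (simp add: DERIV_def exp_flat_def)
  qed
qed

text \<open>A class of functions that contains \<open>exp_flat 0 (1 - k |x - c|\<^sup>2)\<close> and is closed under
  partial derivatives; coinduction then gives smoothness.\<close>

inductive flat_alg :: "'n::euclidean_space \<Rightarrow> real \<Rightarrow> ('n \<Rightarrow> real) \<Rightarrow> bool" for c k where
  "flat_alg c k (\<lambda>x. a)"
| "flat_alg c k (\<lambda>x. x \<bullet> b)"
| "flat_alg c k (\<lambda>x. exp_flat j (1 - k * ((x - c) \<bullet> (x - c))))"
| "flat_alg c k f \<Longrightarrow> flat_alg c k g \<Longrightarrow> flat_alg c k (\<lambda>x. f x + g x)"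
| "flat_alg c k f \<Longrightarrow> flat_alg c k g \<Longrightarrow> flat_alg c k (\<lambda>x. f x * g x)"

lemma has_derivative_flat:
  fixes c x :: "'n::euclidean_space"
  shows "((\<lambda>x. exp_flat j (1 - k * ((x - c) \<bullet> (x - c)))) has_derivative
    (\<lambda>h. (exp_flat (j + 2) (1 - k * ((x - c) \<bullet> (x - c))) - real j * exp_flat (j + 1) (1 - k * ((x - c) \<bullet> (x - c)))) *
      (- (2 * k) * ((x - c) \<bullet> h)))) (at x)"
proof -
  have "((\<lambda>x. 1 - k * ((x - c) \<bullet> (x - c))) has_derivative (\<lambda>h. - (2 * k) * ((x - c) \<bullet> h))) (at x)"
    by (auto intro!: derivative_eq_intros simp: inner_commute algebra_simps)
  from has_derivative_compose[OF this DERIV_exp_flat[unfolded has_field_derivative_def]]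
  show ?thesis by simp
qed

lemma flat_alg_derivative:
  "flat_alg c k f \<Longrightarrow> \<exists>f'. (\<forall>x. (f has_derivative f' x) (at x)) \<and> (\<forall>i. flat_alg c k (\<lambda>x. f' x i))"
proof (induction rule: flat_alg.induct)
  case (1 a)
  show ?case by (intro exI[of _ "\<lambda>x h. 0"]) (auto intro: flat_alg.intros)
next
  case (2 b)
  show ?case
    by (intro exI[of _ "\<lambda>x h. h \<bullet> b"]) (auto intro: flat_alg.intros intro!: derivative_eq_intros)
next
  case (3 j)
  let ?u = "\<lambda>x. 1 - k * ((x - c) \<bullet> (x - c))"
  \<comment> \<open>Sums and products are arranged exactly as in the introduction rules of
    \<open>flat_alg\<close>; in particular differences appear as sums with a negated
    constant.\<close>
  let ?f' = "\<lambda>x h. (exp_flat (j + 2) (?u x) + (- real j) * exp_flat (j + 1) (?u x)) * ((- (2 * k)) * (x \<bullet> h + (- (c \<bullet> h))))"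
  show ?case
  proof (intro exI[of _ ?f'] conjI allI)
    fix x
    show "((\<lambda>x. exp_flat j (?u x)) has_derivative ?f' x) (at x)"
      using has_derivative_flat[of j k c x] by (simp add: inner_diff_left)
  next
    fix i show "flat_alg c k (\<lambda>x. ?f' x i)" by (intro flat_alg.intros)
  qed
next
  case (4 f g)
  then obtain f' g' where "\<forall>x. (f has_derivative f' x) (at x)" "\<forall>i. flat_alg c k (\<lambda>x. f' x i)"
    "\<forall>x. (g has_derivative g' x) (at x)" "\<forall>i. flat_alg c k (\<lambda>x. g' x i)" by blast
  then show ?case
    by (intro exI[of _ "\<lambda>x h. f' x h + g' x h"]) (auto intro: flat_alg.intros intro!: has_derivative_add)
next
  case (5 f g)
  then obtain f' g' where "\<forall>x. (f has_derivative f' x) (at x)" "\<forall>i. flat_alg c k (\<lambda>x. f' x i)"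
    "\<forall>x. (g has_derivative g' x) (at x)" "\<forall>i. flat_alg c k (\<lambda>x. g' x i)" by blast
  with 5 show ?case
    by (intro exI[of _ "\<lambda>x h. f x * g' x h + f' x h * g x"] conjI allI has_derivative_mult
        flat_alg.intros(4) flat_alg.intros(5)) auto
qed

lemma smooth_fun_flat_alg: "flat_alg c k f \<Longrightarrow> smooth_fun f"
proof (coinduction arbitrary: f rule: smooth_fun.coinduct)
  case smooth_fun
  then obtain f' where f': "\<forall>x. (f has_derivative f' x) (at x)" "\<forall>i. flat_alg c k (\<lambda>x. f' x i)"
    using flat_alg_derivative by blast
  then have eq: "frechet_derivative f (at x) = f' x" for x
    using frechet_derivative_at by metis
  have "\<forall>x. f differentiable (at x)" using f' by (auto simp: differentiable_def)
  then show ?case using f'(2) by (auto simp: eq)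
qed

definition bump :: "real \<Rightarrow> 'n::euclidean_space \<Rightarrow> 'n \<Rightarrow> real" where
  "bump e x y = exp_flat 0 (1 - (1 / e\<^sup>2) * ((y - x) \<bullet> (y - x)))"

definition bump_mass :: "real \<Rightarrow> 'n::euclidean_space itself \<Rightarrow> real" where
  "bump_mass e T = enn2real (\<integral>\<^sup>+y. ennreal (bump e (0::'n) y) \<partial>lborel)"

definition moll :: "real \<Rightarrow> 'n::euclidean_space \<Rightarrow> 'n \<Rightarrow> real" where
  "moll e x y = bump e x y / bump_mass e TYPE('n)"

text \<open>The gradient of \<open>moll\<close> in the centre x, equivalently minus its gradient in
  y. The index 2 appears because the derivative of \<open>exp_flat 0\<close> is
  \<open>exp_flat 2\<close>.\<close>

definition moll_grad :: "real \<Rightarrow> 'n::euclidean_space \<Rightarrow> 'n \<Rightarrow> 'n" where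
  "moll_grad e x y = (exp_flat 2 (1 - (1 / e\<^sup>2) * ((y - x) \<bullet> (y - x))) * (2 / e\<^sup>2) / bump_mass e TYPE('n)) *\<^sub>R (y - x)"

lemma bump_bounds:
  assumes "0 < e"
  shows "0 \<le> bump e x y" "bump e x y \<le> 1" "y \<notin> ball x e \<Longrightarrow> bump e x y = 0"
    "y \<in> ball x (e / 2) \<Longrightarrow> exp (- 2) \<le> bump e x y"
proof -
  show "0 \<le> bump e x y" "bump e x y \<le> 1"
    using exp_flat_bounds[of 0] by (auto simp: bump_def)
  have n: "(y - x) \<bullet> (y - x) = (dist x y)\<^sup>2" by (simp only: dot_square_norm dist_norm norm_minus_commute)
  {
    assume "y \<notin> ball x e"
    then have "e\<^sup>2 \<le> (dist x y)\<^sup>2" using assms by (intro power_mono) auto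
    then have "1 - (1 / e\<^sup>2) * ((y - x) \<bullet> (y - x)) \<le> 0" using assms by (simp add: n field_simps)
    then show "bump e x y = 0" by (simp add: bump_def exp_flat_def)
  next
    assume "y \<in> ball x (e / 2)"
    then have "(dist x y)\<^sup>2 \<le> (e / 2)\<^sup>2" using assms by (intro power_mono) auto
    then have "(1 / e\<^sup>2) * (dist x y)\<^sup>2 \<le> (1 / e\<^sup>2) * (e / 2)\<^sup>2" by (rule mult_left_mono) simp
    also have "\<dots> = 1 / 4" using assms by (simp add: power_divide)
    finally have *: "1 / 2 \<le> 1 - (1 / e\<^sup>2) * ((y - x) \<bullet> (y - x))" unfolding n by linarith
    define u where "u = 1 - (1 / e\<^sup>2) * ((y - x) \<bullet> (y - x))"
    have u: "1 / 2 \<le> u" using * by (simp only: u_def)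
    then have "inverse u \<le> inverse (1 / 2)" by (intro le_imp_inverse_le) auto
    then have "exp (- 2) \<le> exp_flat 0 u" using u by (simp add: exp_flat_def)
    then show "exp (- 2) \<le> bump e x y" by (simp only: bump_def u_def)
  }
qed

lemma borel_measurable_exp_flat [measurable]: "exp_flat j \<in> borel_measurable borel"
  by (intro borel_measurable_continuous_onI continuous_at_imp_continuous_on ballI DERIV_isCont[OF DERIV_exp_flat])

lemma borel_measurable_bump [measurable]:
  "(\<lambda>y. bump e x y) \<in> borel_measurable borel"
  unfolding bump_def by measurable

text \<open>On the ball of half the radius the bump is at least exp(-2). The resulting lower bound
  for the mass gives \<open>moll\<close> an upper bound by exp 2 * 2^n over the volume of the ball,
  a factor that does not depend on e.\<close>

lemma nn_integral_bump:
  fixes x :: "'n::euclidean_space"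
  assumes e: "0 < e"
  shows "(\<integral>\<^sup>+y. ennreal (bump e x y) \<partial>lborel) = ennreal (bump_mass e TYPE('n))"
    and "exp (- 2) * (unit_ball_vol (real DIM('n)) * (e / 2) ^ DIM('n)) \<le> bump_mass e TYPE('n)"
    and "0 < bump_mass e TYPE('n)"
proof -
  let ?I = "\<integral>\<^sup>+y. ennreal (bump e (0::'n) y) \<partial>lborel"
  have [measurable]: "ball (0::'n) (e / 2) \<in> sets borel" "ball (0::'n) e \<in> sets borel" by auto
  have "?I \<le> (\<integral>\<^sup>+y. indicator (ball (0::'n) e) y \<partial>lborel)"
  proof (rule nn_integral_mono)
    fix y show "ennreal (bump e (0::'n) y) \<le> indicator (ball 0 e) y"
      using bump_bounds[OF e, where x = 0 and y = y] by (cases "y \<in> ball 0 e") (auto simp del: mem_ball)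
  qed
  also have "\<dots> < \<infinity>" using emeasure_bounded_finite[of "ball (0::'n) e"] by (subst nn_integral_indicator) auto
  finally have fin: "?I < \<infinity>" .
  then have I: "?I = ennreal (bump_mass e TYPE('n))" by (simp add: bump_mass_def)
  have "ennreal (exp (- 2) * (unit_ball_vol (real DIM('n)) * (e / 2) ^ DIM('n))) = ennreal (exp (- 2)) * emeasure lborel (ball (0::'n) (e / 2))"
    using e by (subst emeasure_ball) (auto simp: ennreal_mult')
  also have "\<dots> = (\<integral>\<^sup>+y. ennreal (exp (- 2)) * indicator (ball (0::'n) (e / 2)) y \<partial>lborel)"
    by (subst nn_integral_cmult_indicator) auto
  also have "\<dots> \<le> ?I"
    using bump_bounds(4)[OF e, where x = 0] by (intro nn_integral_mono) (auto simp: indicator_def intro!: ennreal_leI)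
  finally show le: "exp (- 2) * (unit_ball_vol (real DIM('n)) * (e / 2) ^ DIM('n)) \<le> bump_mass e TYPE('n)"
    unfolding I by (subst (asm) ennreal_le_iff) (auto simp: bump_mass_def)
  have "0 < exp (- 2) * (unit_ball_vol (real DIM('n)) * (e / 2) ^ DIM('n))" using e by simp
  then show "0 < bump_mass e TYPE('n)" using le by linarith
  have "(\<integral>\<^sup>+y. ennreal (bump e x y) \<partial>lborel) = (\<integral>\<^sup>+y. ennreal (bump e x (x + 1 *\<^sub>R y)) \<partial>lborel)"
    by (subst nn_integral_lborel_affine[of _ 1 x]) auto
  also have "\<dots> = ?I" by (simp add: bump_def)
  finally show "(\<integral>\<^sup>+y. ennreal (bump e x y) \<partial>lborel) = ennreal (bump_mass e TYPE('n))" by (simp add: I)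
qed

lemma moll_commute: "moll e x y = moll e y x"
proof -
  have "(y - x) \<bullet> (y - x) = (x - y) \<bullet> (x - y)" by (simp only: dot_square_norm norm_minus_commute)
  then show ?thesis by (simp add: moll_def bump_def)
qed

lemma moll_bounds:
  fixes x :: "'n::euclidean_space"
  assumes e: "0 < e"
  shows "0 \<le> moll e x y"
    "moll e x y \<le> exp 2 * 2 ^ DIM('n) / (unit_ball_vol (real DIM('n)) * e ^ DIM('n))"
    "y \<notin> ball x e \<Longrightarrow> moll e x y = 0"
    "(\<integral>\<^sup>+y. ennreal (moll e x y) \<partial>lebesgue) = 1"
proof -
  let ?Z = "bump_mass e TYPE('n)"
  note Z = nn_integral_bump(1)[OF e, of x] nn_integral_bump(2,3)[OF e, where 'n = 'n]
  show "0 \<le> moll e x y" "y \<notin> ball x e \<Longrightarrow> moll e x y = 0"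
    using bump_bounds[OF e, where x = x and y = y] Z(3) by (auto simp: moll_def simp del: mem_ball)
  let ?L = "exp (- 2) * (unit_ball_vol (real DIM('n)) * (e / 2) ^ DIM('n))"
  have L: "0 < ?L" using e by simp
  have "moll e x y \<le> 1 / ?L"
    unfolding moll_def using bump_bounds[OF e, where x = x and y = y] Z L by (intro frac_le) auto
  also have "1 / ?L = exp 2 * 2 ^ DIM('n) / (unit_ball_vol (real DIM('n)) * e ^ DIM('n))"
    by (simp add: exp_minus power_divide field_simps)
  finally show "moll e x y \<le> exp 2 * 2 ^ DIM('n) / (unit_ball_vol (real DIM('n)) * e ^ DIM('n))" .
  have "(\<integral>\<^sup>+y. ennreal (moll e x y) \<partial>lebesgue) = (\<integral>\<^sup>+y. ennreal (1 / ?Z) * ennreal (bump e x y) \<partial>lborel)"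
    unfolding nn_integral_completion using Z(3)
    by (intro nn_integral_cong) (simp add: moll_def ennreal_mult'[symmetric])
  also have "\<dots> = ennreal (1 / ?Z) * ennreal ?Z" unfolding Z(1)[symmetric] by (intro nn_integral_cmult) measurable
  also have "\<dots> = 1" using Z(3) by (subst ennreal_mult'[symmetric]) auto
  finally show "(\<integral>\<^sup>+y. ennreal (moll e x y) \<partial>lebesgue) = 1" .
qed

lemma has_derivative_moll_right:
  fixes x :: "'n::euclidean_space"
  shows "(moll e x has_derivative (\<lambda>h. - (moll_grad e x y \<bullet> h))) (at y)"
proof -
  have "((\<lambda>y. (1 / bump_mass e TYPE('n)) * bump e x y) has_derivative
      (\<lambda>h. (1 / bump_mass e TYPE('n)) * (exp_flat 2 (1 - (1 / e\<^sup>2) * ((y - x) \<bullet> (y - x))) * (- (2 * (1 / e\<^sup>2)) * ((y - x) \<bullet> h))))) (at y)"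
    unfolding bump_def using has_derivative_flat[of 0 "1 / e\<^sup>2" x y]
    by (intro has_derivative_mult_right) (simp add: numeral_2_eq_2)
  then show ?thesis by (simp add: moll_def[abs_def] moll_grad_def mult_ac)
qed

lemma has_derivative_moll_left:
  fixes y :: "'n::euclidean_space"
  shows "((\<lambda>x. moll e x y) has_derivative (\<lambda>h. moll_grad e x y \<bullet> h)) (at x)"
proof -
  have n: "(x - y) \<bullet> (x - y) = (y - x) \<bullet> (y - x)" by (simp only: dot_square_norm norm_minus_commute)
  have "- (moll_grad e y x \<bullet> h) = moll_grad e x y \<bullet> h" for h
    by (simp add: moll_grad_def n inner_diff_left algebra_simps)
  then show ?thesis
    using has_derivative_moll_right[of e y x] by (simp add: moll_commute[of e _ y])
qed

lemma moll_grad_bounds: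
  fixes x :: "'n::euclidean_space"
  assumes e: "0 < e"
  shows "norm (moll_grad e x y) \<le> 4 / (e * bump_mass e TYPE('n))" "y \<notin> ball x e \<Longrightarrow> moll_grad e x y = 0"
proof -
  let ?Z = "bump_mass e TYPE('n)"
  let ?u = "1 - (1 / e\<^sup>2) * ((y - x) \<bullet> (y - x))"
  have Z: "0 < ?Z" by (rule nn_integral_bump(3)[OF e])
  have n: "(y - x) \<bullet> (y - x) = (dist x y)\<^sup>2" by (simp only: dot_square_norm dist_norm norm_minus_commute)
  have off: "exp_flat 2 ?u = 0" if "y \<notin> ball x e"
  proof -
    have "e\<^sup>2 \<le> (dist x y)\<^sup>2" using that e by (intro power_mono) auto
    then have "?u \<le> 0" using e by (simp add: n field_simps)
    then show ?thesis by (simp add: exp_flat_def)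
  qed
  then show "y \<notin> ball x e \<Longrightarrow> moll_grad e x y = 0" by (simp add: moll_grad_def)
  show "norm (moll_grad e x y) \<le> 4 / (e * ?Z)"
  proof (cases "y \<in> ball x e")
    case True
    then have d: "norm (y - x) \<le> e" by (simp add: dist_norm norm_minus_commute)
    have "norm (moll_grad e x y) = exp_flat 2 ?u * (2 / e\<^sup>2) / ?Z * norm (y - x)"
      using exp_flat_bounds(1)[of 2 ?u] Z by (simp add: moll_grad_def abs_mult)
    also have "\<dots> \<le> 2 * (2 / e\<^sup>2) / ?Z * e"
      using exp_flat_bounds[of 2 ?u] Z d e by (intro mult_mono divide_right_mono mult_right_mono) (auto simp: fact_2)
    also have "\<dots> = 4 / (e * ?Z)" using e by (simp add: power2_eq_square field_simps)
    finally show ?thesis .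
  next
    case False
    then have "moll_grad e x y = 0" unfolding moll_grad_def off[OF False] by simp
    then show ?thesis using e Z by simp
  qed
qed

text \<open>Uniform in y; it dominates the difference quotients when differentiating under the
  integral.\<close>

lemma moll_Lipschitz:
  fixes x :: "'n::euclidean_space"
  assumes e: "0 < e"
  shows "\<bar>moll e x' y - moll e x y\<bar> \<le> 4 / (e * bump_mass e TYPE('n)) * norm (x' - x)"
proof -
  have "norm (moll e x' y - moll e x y) \<le> 4 / (e * bump_mass e TYPE('n)) * norm (x' - x)"
  proof (rule differentiable_bound[where S = UNIV and f' = "\<lambda>x h. moll_grad e x y \<bullet> h"])
    fix z :: 'n
    show "((\<lambda>x. moll e x y) has_derivative (\<bullet>) (moll_grad e z y)) (at z within UNIV)"
      using has_derivative_moll_left by (rule has_derivative_at_withinI)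
    show "onorm ((\<bullet>) (moll_grad e z y)) \<le> 4 / (e * bump_mass e TYPE('n))"
    proof (rule onorm_bound)
      show "0 \<le> 4 / (e * bump_mass e TYPE('n))" using e nn_integral_bump(3)[OF e, where 'n = 'n] by simp
      fix h
      have "norm (moll_grad e z y \<bullet> h) \<le> norm (moll_grad e z y) * norm h" by (simp add: Cauchy_Schwarz_ineq2)
      also have "\<dots> \<le> 4 / (e * bump_mass e TYPE('n)) * norm h" by (intro mult_right_mono moll_grad_bounds e) simp
      finally show "norm (moll_grad e z y \<bullet> h) \<le> 4 / (e * bump_mass e TYPE('n)) * norm h" .
    qed
  qed auto
  then show ?thesis by simp
qed

lemma test_fun_moll:
  fixes x :: "'n::euclidean_space"
  assumes e: "0 < e"
  shows "test_fun (moll e x)"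
  unfolding test_fun_def
proof
  have "flat_alg x (1 / e\<^sup>2) (\<lambda>y. (1 / bump_mass e TYPE('n)) * bump e x y)"
    unfolding bump_def by (intro flat_alg.intros)
  then show "smooth_fun (moll e x)"
    using smooth_fun_flat_alg by (simp add: moll_def[abs_def])
  have "{y. moll e x y \<noteq> 0} \<subseteq> ball x e" using moll_bounds(3)[OF e] by blast
  then have "bounded {y. moll e x y \<noteq> 0}" using bounded_subset bounded_ball by blast
  then show "compact (closure {y. moll e x y \<noteq> 0})" by simp
qed

lemma borel_measurable_moll [measurable]:
  "(\<lambda>y. moll e x y) \<in> borel_measurable lebesgue"
  "(\<lambda>(x, y). moll e x y) \<in> borel_measurable (lebesgue \<Otimes>\<^sub>M lebesgue)"
  "(\<lambda>y. moll_grad e x y) \<in> borel_measurable lebesgue"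
proof -
  show "(\<lambda>y. moll e x y) \<in> borel_measurable lebesgue"
    by (intro measurable_completion) (simp add: moll_def)
  show "(\<lambda>(x, y). moll e x y) \<in> borel_measurable (lebesgue \<Otimes>\<^sub>M lebesgue)"
    unfolding moll_def bump_def by measurable
  show "(\<lambda>y. moll_grad e x y) \<in> borel_measurable lebesgue"
    unfolding moll_grad_def by (intro measurable_completion) measurable
qed

section \<open>Mollification of locally integrable functions\<close>

definition mollify :: "real \<Rightarrow> ('n::euclidean_space \<Rightarrow> 'b::euclidean_space) \<Rightarrow> 'n \<Rightarrow> 'b" where
  "mollify e f x = (\<integral>y. moll e x y *\<^sub>R f y \<partial>lebesgue)"

lemma loc_integrable_measurable:
  fixes f :: "'n::euclidean_space \<Rightarrow> 'b::euclidean_space"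
  assumes "loc_integrable f"
  shows "f \<in> borel_measurable lebesgue"
proof (rule borel_measurable_LIMSEQ_metric)
  fix k :: nat
  have "compact (cball (0::'n) (real k))" by simp
  then have "set_integrable lebesgue (cball 0 (real k)) f" using assms unfolding loc_integrable_def by blast
  then show "(\<lambda>x. indicator (cball 0 (real k)) x *\<^sub>R f x) \<in> borel_measurable lebesgue"
    unfolding set_integrable_def by (rule borel_measurable_integrable)
next
  fix x :: 'n assume "x \<in> space lebesgue"
  obtain k :: nat where k: "norm x \<le> real k" using real_arch_simple by blast
  have "\<forall>\<^sub>F j in sequentially. indicator (cball 0 (real j)) x *\<^sub>R f x = f x"
    using eventually_ge_at_top[of k] by eventually_elim (use k in \<open>auto simp: indicator_def\<close>)
  then show "(\<lambda>j. indicator (cball 0 (real j)) x *\<^sub>R f x) \<longlonglongrightarrow> f x"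
    by (rule tendsto_eventually)
qed

lemma loc_integrable_bounded_mult:
  fixes f :: "'n::euclidean_space \<Rightarrow> 'b::euclidean_space" and \<phi> :: "'n \<Rightarrow> real"
  assumes f: "loc_integrable f" and [measurable]: "\<phi> \<in> borel_measurable lebesgue"
    and B: "\<And>y. \<bar>\<phi> y\<bar> \<le> B" and off: "\<And>y. y \<notin> cball x e \<Longrightarrow> \<phi> y = 0"
  shows "integrable lebesgue (\<lambda>y. \<phi> y *\<^sub>R f y)"
proof (rule Bochner_Integration.integrable_bound)
  have "compact (cball x e)" by simp
  then have "set_integrable lebesgue (cball x e) f" using f unfolding loc_integrable_def by blast
  then show "integrable lebesgue (\<lambda>y. B *\<^sub>R (indicator (cball x e) y *\<^sub>R f y))"
    unfolding set_integrable_def by (rule integrable_scaleR_right)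
  have [measurable]: "f \<in> borel_measurable lebesgue" by (rule loc_integrable_measurable[OF f])
  show "(\<lambda>y. \<phi> y *\<^sub>R f y) \<in> borel_measurable lebesgue" by measurable
  show "AE y in lebesgue. norm (\<phi> y *\<^sub>R f y) \<le> norm (B *\<^sub>R (indicator (cball x e) y *\<^sub>R f y))"
  proof (rule AE_I2)
    fix y
    have "0 \<le> B" using B[of y] by linarith
    then show "norm (\<phi> y *\<^sub>R f y) \<le> norm (B *\<^sub>R (indicator (cball x e) y *\<^sub>R f y))"
      using B[of y] off[of y] by (cases "y \<in> cball x e") (auto intro!: mult_right_mono)
  qed
qed

lemma integrable_cball_scaled:
  fixes f :: "'n::euclidean_space \<Rightarrow> 'b::euclidean_space"
  assumes "loc_integrable f" and "0 \<le> B"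
  shows "integrable lebesgue (\<lambda>y. (B * indicator (cball x e) y) *\<^sub>R f y)"
proof (rule loc_integrable_bounded_mult[OF assms(1)])
  have [measurable]: "cball x e \<in> sets lebesgue" by (simp add: fmeasurableD)
  show "(\<lambda>y. B * indicator (cball x e) y) \<in> borel_measurable lebesgue" by measurable
  show "\<bar>B * indicator (cball x e) y\<bar> \<le> B" for y using assms(2) by (simp add: indicator_def)
  show "y \<notin> cball x e \<Longrightarrow> B * indicator (cball x e) y = 0" for y by simp
qed

definition moll_bound :: "real \<Rightarrow> 'n::euclidean_space itself \<Rightarrow> real" where
  "moll_bound e T = exp 2 * 2 ^ DIM('n) / (unit_ball_vol (real DIM('n)) * e ^ DIM('n))"

lemma moll_abs_le:
  fixes x :: "'n::euclidean_space"
  assumes "0 < e"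
  shows "\<bar>moll e x y\<bar> \<le> moll_bound e TYPE('n)"
  using moll_bounds(1,2)[OF assms, of x y] by (simp add: moll_bound_def)

lemma integrable_moll:
  fixes f :: "'n::euclidean_space \<Rightarrow> 'b::euclidean_space"
  assumes e: "0 < e" and f: "loc_integrable f"
  shows "integrable lebesgue (\<lambda>y. moll e x y *\<^sub>R f y)"
proof (rule loc_integrable_bounded_mult[OF f])
  show "\<bar>moll e x y\<bar> \<le> moll_bound e TYPE('n)" for y by (rule moll_abs_le[OF e])
  show "y \<notin> cball x e \<Longrightarrow> moll e x y = 0" for y by (rule moll_bounds(3)[OF e]) auto
qed measurable

lemma continuous_mollify:
  fixes f :: "'n::euclidean_space \<Rightarrow> 'b::euclidean_space"
  assumes e: "0 < e" and f: "loc_integrable f"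
  shows "continuous_on UNIV (mollify e f)"
proof (intro continuous_at_imp_continuous_on ballI)
  fix x :: 'n
  have [measurable]: "f \<in> borel_measurable lebesgue" by (rule loc_integrable_measurable[OF f])
  have "(mollify e f \<longlongrightarrow> mollify e f x) (at x within ball x 1)"
    unfolding tendsto_at_iff_sequentially
  proof (intro allI impI)
    fix X assume X: "\<forall>i. X i \<in> ball x 1 - {x}" "X \<longlonglongrightarrow> x"
    have "(\<lambda>i. \<integral>y. moll e (X i) y *\<^sub>R f y \<partial>lebesgue) \<longlonglongrightarrow> (\<integral>y. moll e x y *\<^sub>R f y \<partial>lebesgue)"
    proof (rule integral_dominated_convergence)
      let ?w = "\<lambda>y. (moll_bound e TYPE('n) * indicator (cball x (e + 1)) y) *\<^sub>R f y"
      have "0 \<le> moll_bound e TYPE('n)" using moll_abs_le[OF e, of x x] by linarith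
      then have "integrable lebesgue ?w"
        by (rule integrable_cball_scaled[OF f])
      then show "integrable lebesgue (\<lambda>y. norm (?w y))" by (rule integrable_norm)
      show "AE y in lebesgue. norm (moll e (X i) y *\<^sub>R f y) \<le> norm (?w y)" for i
      proof (rule AE_I2)
        fix y
        show "norm (moll e (X i) y *\<^sub>R f y) \<le> norm (?w y)"
        proof (cases "y \<in> ball (X i) e")
          case True
          have "dist x (X i) < 1" using X(1) by auto
          then have "y \<in> cball x (e + 1)" using True dist_triangle[of x y "X i"] by auto
          then show ?thesis using moll_abs_le[OF e, of "X i" y] by (auto intro!: mult_right_mono)
        next
          case False
          then show ?thesis using moll_bounds(3)[OF e False] by simp
        qed
      qed
      show "AE y in lebesgue. (\<lambda>i. moll e (X i) y *\<^sub>R f y) \<longlonglongrightarrow> moll e x y *\<^sub>R f y"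
      proof (intro AE_I2 tendsto_scaleR tendsto_const)
        fix y
        show "(\<lambda>i. moll e (X i) y) \<longlonglongrightarrow> moll e x y"
          by (rule isCont_tendsto_compose[OF has_derivative_continuous[OF has_derivative_moll_left] X(2)])
      qed
    qed measurable
    then show "(mollify e f \<circ> X) \<longlonglongrightarrow> mollify e f x" by (simp add: mollify_def o_def)
  qed
  then show "isCont (mollify e f) x"
    by (simp add: isCont_def at_within_open[of x "ball x 1"])
qed

text \<open>Differentiation under the integral. The remainders of the difference quotients of
  \<open>moll\<close> tend to 0 for each y and are bounded by 2B, by the Lipschitz bound and the
  bound of the gradient; they live on a ball of radius e + 1, where |f| is integrable.\<close>

lemma has_derivative_mollify:
  fixes f :: "'n::euclidean_space \<Rightarrow> real"
  assumes e: "0 < e" and f: "loc_integrable f"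
  shows "(mollify e f has_derivative (\<lambda>h. (\<integral>y. f y *\<^sub>R moll_grad e x y \<partial>lebesgue) \<bullet> h)) (at x)"
    and "integrable lebesgue (\<lambda>y. f y *\<^sub>R moll_grad e x y)"
proof -
  have fm[measurable]: "f \<in> borel_measurable lebesgue" by (rule loc_integrable_measurable[OF f])
  define B where "B = 4 / (e * bump_mass e TYPE('n))"
  have B0: "0 \<le> B" using e nn_integral_bump(3)[OF e, where 'n = 'n] by (simp add: B_def)
  have gB: "norm (moll_grad e x y) \<le> B" for x y :: 'n unfolding B_def by (rule moll_grad_bounds(1)[OF e])
  show int: "integrable lebesgue (\<lambda>y. f y *\<^sub>R moll_grad e x y)"
  proof (rule Bochner_Integration.integrable_bound)
    show "integrable lebesgue (\<lambda>y. (B * indicator (cball x e) y) *\<^sub>R f y)"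
      by (rule integrable_cball_scaled[OF f B0])
    show "AE y in lebesgue. norm (f y *\<^sub>R moll_grad e x y) \<le> norm ((B * indicator (cball x e) y) *\<^sub>R f y)"
    proof (rule AE_I2)
      fix y show "norm (f y *\<^sub>R moll_grad e x y) \<le> norm ((B * indicator (cball x e) y) *\<^sub>R f y)"
      proof (cases "y \<in> ball x e")
        case True
        then have "y \<in> cball x e" by auto
        then show ?thesis using gB[of x y] B0 by (simp add: abs_mult mult.commute[of "\<bar>f y\<bar>"] mult_right_mono)
      next
        case False
        then show ?thesis by (simp add: moll_grad_bounds(2)[OF e False])
      qed
    qed
  qed measurable
  let ?M = "\<integral>y. f y *\<^sub>R moll_grad e x y \<partial>lebesgue"
  have "(mollify e f has_derivative (\<lambda>h. ?M \<bullet> h)) (at x within ball x 1)"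
    unfolding has_derivative_within tendsto_at_iff_sequentially
  proof (intro conjI allI impI)
    show "bounded_linear ((\<bullet>) ?M)" by (rule bounded_linear_inner_right)
    fix X assume X: "\<forall>i. X i \<in> ball x 1 - {x}" "X \<longlonglongrightarrow> x"
    define r where "r i y = (moll e (X i) y - (moll e x y + moll_grad e x y \<bullet> (X i - x))) / norm (X i - x)" for i y
    have rm[measurable]: "r i \<in> borel_measurable lebesgue" for i unfolding r_def by measurable
    have nX: "0 < norm (X i - x)" for i using X(1) by auto
    have eq: "(1 / norm (X i - x)) *\<^sub>R (mollify e f (X i) - (mollify e f x + ?M \<bullet> (X i - x))) = (\<integral>y. f y * r i y \<partial>lebesgue)" for i
    proof -
      have "?M \<bullet> (X i - x) = (\<integral>y. (f y *\<^sub>R moll_grad e x y) \<bullet> (X i - x) \<partial>lebesgue)"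
        by (rule integral_inner_left[OF int, symmetric])
      moreover have "integrable lebesgue (\<lambda>y. (f y *\<^sub>R moll_grad e x y) \<bullet> (X i - x))" using int by (rule integrable_inner_left)
      ultimately have E1: "mollify e f (X i) - (mollify e f x + ?M \<bullet> (X i - x))
        = (\<integral>y. moll e (X i) y *\<^sub>R f y - (moll e x y *\<^sub>R f y + (f y *\<^sub>R moll_grad e x y) \<bullet> (X i - x)) \<partial>lebesgue)"
        using integrable_moll[OF e f] by (simp add: mollify_def)
      have E2: "(1 / norm (X i - x)) *\<^sub>R (\<integral>y. moll e (X i) y *\<^sub>R f y - (moll e x y *\<^sub>R f y + (f y *\<^sub>R moll_grad e x y) \<bullet> (X i - x)) \<partial>lebesgue)
        = (\<integral>y. (1 / norm (X i - x)) *\<^sub>R (moll e (X i) y *\<^sub>R f y - (moll e x y *\<^sub>R f y + (f y *\<^sub>R moll_grad e x y) \<bullet> (X i - x))) \<partial>lebesgue)"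
        by simp
      have E3: "(\<integral>y. (1 / norm (X i - x)) *\<^sub>R (moll e (X i) y *\<^sub>R f y - (moll e x y *\<^sub>R f y + (f y *\<^sub>R moll_grad e x y) \<bullet> (X i - x))) \<partial>lebesgue)
        = (\<integral>y. f y * r i y \<partial>lebesgue)"
        by (intro Bochner_Integration.integral_cong refl) (simp add: r_def algebra_simps diff_divide_distrib add_divide_distrib)
      show ?thesis unfolding E1 E2 E3 ..
    qed
    have "(\<lambda>i. \<integral>y. f y * r i y \<partial>lebesgue) \<longlonglongrightarrow> (\<integral>y. 0 \<partial>(lebesgue :: 'n measure))"
    proof (rule integral_dominated_convergence)
      let ?w = "\<lambda>y. (2 * B * indicator (cball x (e + 1)) y) *\<^sub>R f y"
      have "integrable lebesgue ?w"
        using B0 by (intro integrable_cball_scaled[OF f]) simp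
      then show "integrable lebesgue (\<lambda>y. norm (?w y))" by (rule integrable_norm)
      show "AE y in lebesgue. norm (f y * r i y) \<le> norm (?w y)" for i
      proof (rule AE_I2)
        fix y
        show "norm (f y * r i y) \<le> norm (?w y)"
        proof (cases "y \<in> cball x (e + 1)")
          case True
          have "\<bar>moll_grad e x y \<bullet> (X i - x)\<bar> \<le> norm (moll_grad e x y) * norm (X i - x)" by (rule Cauchy_Schwarz_ineq2)
          also have "\<dots> \<le> B * norm (X i - x)" by (intro mult_right_mono gB) simp
          finally have "\<bar>moll e (X i) y - (moll e x y + moll_grad e x y \<bullet> (X i - x))\<bar> \<le> 2 * B * norm (X i - x)"
            using moll_Lipschitz[OF e, of "X i" y x] unfolding B_def[symmetric] by (simp add: abs_le_iff)
          then have "\<bar>r i y\<bar> \<le> 2 * B" using nX[of i] by (simp add: r_def abs_divide pos_divide_le_eq)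
          then have "\<bar>f y\<bar> * \<bar>r i y\<bar> \<le> \<bar>f y\<bar> * (2 * B)" by (intro mult_left_mono) auto
          then show ?thesis using True B0 by (simp add: abs_mult mult_ac)
        next
          case False
          have "dist x (X i) < 1" using X(1) by auto
          then have "y \<notin> ball (X i) e" "y \<notin> ball x e" using False dist_triangle[of x y "X i"] by auto
          then have "moll e (X i) y = 0" "moll e x y = 0" "moll_grad e x y = 0"
            using moll_bounds(3)[OF e] moll_grad_bounds(2)[OF e] by auto
          then have "r i y = 0" by (simp add: r_def)
          then show ?thesis by simp
        qed
      qed
      show "AE y in lebesgue. (\<lambda>i. f y * r i y) \<longlonglongrightarrow> 0"
      proof (rule AE_I2)
        fix y
        have "((\<lambda>x. moll e x y) has_derivative (\<lambda>h. moll_grad e x y \<bullet> h)) (at x within ball x 1)"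
          using has_derivative_moll_left by (rule has_derivative_at_withinI)
        then have "(\<lambda>i. (1 / norm (X i - x)) *\<^sub>R (moll e (X i) y - (moll e x y + moll_grad e x y \<bullet> (X i - x)))) \<longlonglongrightarrow> 0"
          using X unfolding has_derivative_within tendsto_at_iff_sequentially by (auto simp: o_def)
        then have "(\<lambda>i. r i y) \<longlonglongrightarrow> 0" by (simp add: r_def)
        then show "(\<lambda>i. f y * r i y) \<longlonglongrightarrow> 0" by (rule tendsto_mult_right_zero)
      qed
    qed measurable
    then show "((\<lambda>y. (1 / norm (y - x)) *\<^sub>R (mollify e f y - (mollify e f x + ?M \<bullet> (y - x)))) \<circ> X) \<longlonglongrightarrow> 0"
      unfolding o_def eq by simp
  qed
  then show "(mollify e f has_derivative (\<lambda>h. ?M \<bullet> h)) (at x)"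
    by (simp add: at_within_open[of x "ball x 1"])
qed

text \<open>\<open>moll e x\<close> is a test function in y whose derivatives in y are the negatives
  of those in x. The two signs cancel, and the weak gradient moves the derivative from the mollifier
  to \<open>g\<close>.\<close>

lemma C1_gradient_mollify:
  fixes f :: "'n::euclidean_space \<Rightarrow> real"
  assumes e: "0 < e" and w: "weak_gradient f g"
  shows "C1_gradient (mollify e f) (mollify e g)"
proof -
  have f: "loc_integrable f" and g: "loc_integrable g" using w by (auto simp: weak_gradient_def)
  have "(\<integral>y. f y *\<^sub>R moll_grad e x y \<partial>lebesgue) = mollify e g x" for x
  proof (rule euclidean_eqI)
    fix i :: 'n assume i: "i \<in> Basis"
    have fd: "frechet_derivative (moll e x) (at y) = (\<lambda>h. - (moll_grad e x y \<bullet> h))" for y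
      using frechet_derivative_at[OF has_derivative_moll_right] by metis
    have "(\<integral>y. f y * frechet_derivative (moll e x) (at y) i \<partial>lebesgue) = - (\<integral>y. (g y \<bullet> i) * moll e x y \<partial>lebesgue)"
      using w test_fun_moll[OF e, of x] i unfolding weak_gradient_def by blast
    then have "(\<integral>y. f y * (moll_grad e x y \<bullet> i) \<partial>lebesgue) = (\<integral>y. (g y \<bullet> i) * moll e x y \<partial>lebesgue)"
      by (simp add: fd)
    moreover have "(\<integral>y. f y *\<^sub>R moll_grad e x y \<partial>lebesgue) \<bullet> i = (\<integral>y. f y * (moll_grad e x y \<bullet> i) \<partial>lebesgue)"
      by (subst integral_inner_left[symmetric, OF has_derivative_mollify(2)[OF e f]]) simp
    moreover have "mollify e g x \<bullet> i = (\<integral>y. (g y \<bullet> i) * moll e x y \<partial>lebesgue)"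
      unfolding mollify_def by (subst integral_inner_left[symmetric, OF integrable_moll[OF e g]]) (simp add: mult.commute)
    ultimately show "(\<integral>y. f y *\<^sub>R moll_grad e x y \<partial>lebesgue) \<bullet> i = mollify e g x \<bullet> i" by simp
  qed
  then show ?thesis
    using has_derivative_mollify(1)[OF e f] continuous_mollify[OF e g] by (simp add: C1_gradient_def)
qed

text \<open>The mollifier is at most a constant times the normalised indicator of its ball,
  uniformly in e; this is how ball averages come to control mollification.\<close>

lemma moll_integral_le_ball_avg:
  fixes h :: "'n::euclidean_space \<Rightarrow> ennreal"
  assumes e: "0 < e" and [measurable]: "h \<in> borel_measurable lebesgue"
  shows "(\<integral>\<^sup>+y. h y * ennreal (moll e x y) \<partial>lebesgue) \<le> ennreal (exp 2 * 2 ^ DIM('n)) * ball_avg e h x"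
proof -
  let ?v = "unit_ball_vol (real DIM('n)) * e ^ DIM('n)"
  have v: "0 < ?v" using e by simp
  have "(\<integral>\<^sup>+y. h y * ennreal (moll e x y) \<partial>lebesgue) \<le> (\<integral>\<^sup>+y. ennreal (exp 2 * 2 ^ DIM('n) / ?v) * (h y * indicator (ball x e) y) \<partial>lebesgue)"
  proof (rule nn_integral_mono)
    fix y
    show "h y * ennreal (moll e x y) \<le> ennreal (exp 2 * 2 ^ DIM('n) / ?v) * (h y * indicator (ball x e) y)"
    proof (cases "y \<in> ball x e")
      case True
      have "h y * ennreal (moll e x y) \<le> h y * ennreal (exp 2 * 2 ^ DIM('n) / ?v)"
        by (intro mult_left_mono ennreal_leI moll_bounds(2)[OF e]) simp
      then show ?thesis using True by (simp add: mult.commute)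
    next
      case False
      then show ?thesis by (simp add: moll_bounds(3)[OF e False])
    qed
  qed
  also have "\<dots> = ennreal (exp 2 * 2 ^ DIM('n) / ?v) * (\<integral>\<^sup>+y\<in>ball x e. h y \<partial>lebesgue)"
    by (intro nn_integral_cmult) measurable
  also have "ennreal (exp 2 * 2 ^ DIM('n) / ?v) = ennreal (exp 2 * 2 ^ DIM('n)) / ennreal ?v"
    using v by (intro divide_ennreal[symmetric]) auto
  also have "\<dots> * (\<integral>\<^sup>+y\<in>ball x e. h y \<partial>lebesgue) = ennreal (exp 2 * 2 ^ DIM('n)) * ball_avg e h x"
    unfolding ball_avg_def emeasure_lebesgue_ball[OF less_imp_le[OF e]]
    by (simp add: ennreal_times_divide mult.commute)
  finally show ?thesis .
qed

lemma norm_mollify_le: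
  fixes f :: "'n::euclidean_space \<Rightarrow> 'b::euclidean_space"
  assumes e: "0 < e" and f: "loc_integrable f"
  shows "ennreal (norm (mollify e f x)) \<le> (\<integral>\<^sup>+y. ennreal (norm (f y)) * ennreal (moll e x y) \<partial>lebesgue)"
proof -
  have "ennreal (norm (mollify e f x)) \<le> (\<integral>\<^sup>+y. ennreal (norm (moll e x y *\<^sub>R f y)) \<partial>lebesgue)"
    unfolding mollify_def by (rule integral_norm_bound_ennreal[OF integrable_moll[OF e f]])
  also have "\<dots> = (\<integral>\<^sup>+y. ennreal (norm (f y)) * ennreal (moll e x y) \<partial>lebesgue)"
    using moll_bounds(1)[OF e, of x] by (intro nn_integral_cong) (simp add: ennreal_mult' mult.commute)
  finally show ?thesis .
qed

text \<open>The tangent of a^p at m lies below the graph. The negative term is moved to the other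
  side so that the inequality can be integrated among nonnegative extended numbers.\<close>

lemma powr_tangent:
  fixes a m p :: real
  assumes a: "0 \<le> a" and m: "0 < m" and p: "1 \<le> p"
  shows "m powr p + p * m powr (p - 1) * a \<le> a powr p + p * m powr (p - 1) * m"
proof (cases "a = 0")
  case True
  have "m powr (p - 1) * m = m powr p" using m by (simp add: powr_diff)
  then have "p * m powr (p - 1) * m = p * m powr p" by (simp add: mult.assoc)
  moreover have "1 * m powr p \<le> p * m powr p" using p by (intro mult_right_mono) auto
  ultimately have "m powr p \<le> p * m powr (p - 1) * m" by linarith
  then show ?thesis using True by simp
next
  case False
  then have a0: "0 < a" using a by simp
  define t where "t = a / m"
  have t: "0 < t" using a0 m by (simp add: t_def)
  \<comment> \<open>Young's inequality for t^p and 1 with the weights 1/p and 1 - 1/p, after scaling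
    m to 1.\<close>
  have "(t powr p) powr (1 / p) * 1 powr (1 - 1 / p) \<le> 1 / p * t powr p + (1 - 1 / p) * 1"
    using t p by (intro Youngs_inequality_0) (auto simp: divide_le_eq)
  then have "t \<le> 1 / p * t powr p + (1 - 1 / p)" using t p by (simp add: powr_powr)
  then have "p * t \<le> p * (1 / p * t powr p + (1 - 1 / p))" using p by (intro mult_left_mono) auto
  also have "\<dots> = t powr p + p - 1" using p by (simp add: algebra_simps)
  finally have "m powr p * (1 + p * t) \<le> m powr p * (t powr p + p)" by (intro mult_left_mono) auto
  moreover have "m powr p * (1 + p * t) = m powr p + p * (m powr p * t)"
    "m powr p * (t powr p + p) = m powr p * t powr p + p * m powr p" by (simp_all add: algebra_simps)
  moreover have "m powr p * t = m powr (p - 1) * a" using m by (simp add: t_def powr_diff)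
  moreover have "m powr p * t powr p = a powr p" using m a0 by (simp add: t_def powr_divide)
  ultimately have "m powr p + p * (m powr (p - 1) * a) \<le> a powr p + p * m powr p" by simp
  moreover have "p * m powr p = p * m powr (p - 1) * m" using m by (simp add: powr_diff)
  ultimately show ?thesis by (simp only: mult.assoc)
qed

text \<open>Jensen's inequality, from the tangent of \<open>a\<^sup>p\<close> at the point \<open>|mollify e f x|\<close>.\<close>

lemma mollify_powr_le:
  fixes f :: "'n::euclidean_space \<Rightarrow> real"
  assumes e: "0 < e" and f: "loc_integrable f" and p: "1 \<le> p"
  shows "ennreal (\<bar>mollify e f x\<bar> powr p) \<le> (\<integral>\<^sup>+y. ennreal (\<bar>f y\<bar> powr p) * ennreal (moll e x y) \<partial>lebesgue)"
proof (cases "mollify e f x = 0")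
  case False
  define m where "m = \<bar>mollify e f x\<bar>"
  have m: "0 < m" using False by (simp add: m_def)
  have [measurable]: "f \<in> borel_measurable lebesgue" by (rule loc_integrable_measurable[OF f])
  let ?\<phi> = "\<lambda>y. ennreal (moll e x y)"
  let ?c = "p * m powr (p - 1)"
  have one: "(\<integral>\<^sup>+y. ?\<phi> y \<partial>lebesgue) = 1" by (rule moll_bounds(4)[OF e])
  have c: "0 \<le> ?c" using p by simp
  have mint: "ennreal m \<le> (\<integral>\<^sup>+y. ennreal \<bar>f y\<bar> * ?\<phi> y \<partial>lebesgue)"
    using norm_mollify_le[OF e f, of x] by (simp add: m_def)
  \<comment> \<open>The tangent inequality is integrated against the probability density
    \<open>moll e x\<close>; the term \<open>?c * m\<close> is finite and is cancelled at the
    end.\<close>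
  have "ennreal (m powr p) + ennreal (?c * m) = ennreal (m powr p) * (\<integral>\<^sup>+y. ?\<phi> y \<partial>lebesgue) + ennreal ?c * ennreal m"
    using c unfolding one by (simp add: ennreal_mult')
  also have "\<dots> \<le> ennreal (m powr p) * (\<integral>\<^sup>+y. ?\<phi> y \<partial>lebesgue) + ennreal ?c * (\<integral>\<^sup>+y. ennreal \<bar>f y\<bar> * ?\<phi> y \<partial>lebesgue)"
    by (intro add_left_mono mult_left_mono mint) simp
  also have "\<dots> = (\<integral>\<^sup>+y. ennreal (m powr p) * ?\<phi> y + ennreal ?c * (ennreal \<bar>f y\<bar> * ?\<phi> y) \<partial>lebesgue)"
    by (subst nn_integral_add) (auto simp: nn_integral_cmult)
  also have "\<dots> \<le> (\<integral>\<^sup>+y. ennreal (\<bar>f y\<bar> powr p) * ?\<phi> y + ennreal (?c * m) * ?\<phi> y \<partial>lebesgue)"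
  proof (rule nn_integral_mono)
    fix y
    have "ennreal (m powr p) + ennreal ?c * ennreal \<bar>f y\<bar> = ennreal (m powr p + ?c * \<bar>f y\<bar>)"
      using c by (simp add: ennreal_mult' ennreal_plus)
    also have "\<dots> \<le> ennreal (\<bar>f y\<bar> powr p + ?c * m)"
      using powr_tangent[OF _ m p, of "\<bar>f y\<bar>"] by (intro ennreal_leI) simp
    also have "\<dots> = ennreal (\<bar>f y\<bar> powr p) + ennreal (?c * m)" using c m by (intro ennreal_plus) auto
    finally have "(ennreal (m powr p) + ennreal ?c * ennreal \<bar>f y\<bar>) * ?\<phi> y \<le> (ennreal (\<bar>f y\<bar> powr p) + ennreal (?c * m)) * ?\<phi> y"
      by (rule mult_right_mono) simp
    then show "ennreal (m powr p) * ?\<phi> y + ennreal ?c * (ennreal \<bar>f y\<bar> * ?\<phi> y) \<le> ennreal (\<bar>f y\<bar> powr p) * ?\<phi> y + ennreal (?c * m) * ?\<phi> y"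
      by (simp only: distrib_right mult.assoc)
  qed
  also have "\<dots> = (\<integral>\<^sup>+y. ennreal (\<bar>f y\<bar> powr p) * ?\<phi> y \<partial>lebesgue) + ennreal (?c * m)"
    by (subst nn_integral_add) (auto simp: nn_integral_cmult one)
  finally show ?thesis by (simp add: m_def[symmetric] ennreal_add_left_cancel_le add.commute)
qed simp

lemma Linf_norm_mollify_le:
  fixes f :: "'n::euclidean_space \<Rightarrow> real"
  assumes e: "0 < e" and f: "loc_integrable f"
  shows "Linf_norm (mollify e f) \<le> Linf_norm f"
proof -
  have "ennreal \<bar>mollify e f x\<bar> \<le> Linf_norm f" for x
  proof -
    have "ennreal \<bar>mollify e f x\<bar> \<le> (\<integral>\<^sup>+y. ennreal \<bar>f y\<bar> * ennreal (moll e x y) \<partial>lebesgue)"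
      using norm_mollify_le[OF e f, of x] by simp
    also have "\<dots> \<le> (\<integral>\<^sup>+y. Linf_norm f * ennreal (moll e x y) \<partial>lebesgue)"
    proof (rule nn_integral_mono_AE)
      show "AE y in lebesgue. ennreal \<bar>f y\<bar> * ennreal (moll e x y) \<le> Linf_norm f * ennreal (moll e x y)"
        using AE_le_Linf_norm[of f] by eventually_elim (rule mult_right_mono, auto)
    qed
    also have "\<dots> = Linf_norm f" by (subst nn_integral_cmult) (auto simp: moll_bounds(4)[OF e])
    finally show ?thesis .
  qed
  then show ?thesis unfolding Linf_norm_def[of "mollify e f"] by (intro Inf_lower) simp
qed

text \<open>First \<open>f\<close> is truncated at a height N. Continuous functions converging to
  \<open>f\<close> almost everywhere are then truncated at the same height, which supplies the
  dominating function on the ball that they lack themselves.\<close>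

lemma continuous_L1_approximation:
  fixes f :: "'n::euclidean_space \<Rightarrow> real"
  assumes [measurable]: "f \<in> borel_measurable lebesgue"
    and fin: "(\<integral>\<^sup>+x\<in>ball 0 R. ennreal \<bar>f x\<bar> \<partial>lebesgue) < \<infinity>" and e: "0 < e"
  obtains \<psi> where "continuous_on UNIV \<psi>" "(\<integral>\<^sup>+x\<in>ball 0 R. ennreal \<bar>f x - \<psi> x\<bar> \<partial>lebesgue) < ennreal e"
proof -
  define c where "c T v = max (- T) (min T v)" for T v :: real
  have cT: "\<bar>c T v\<bar> \<le> T" if "0 \<le> T" for T v using that by (auto simp: c_def)
  have cc: "continuous_on UNIV (c T)" for T unfolding c_def by (intro continuous_intros)
  have [measurable]: "c T \<in> borel_measurable borel" for T using cc by (rule borel_measurable_continuous_onI)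
  have "(\<lambda>n. \<integral>\<^sup>+x\<in>ball 0 R. ennreal \<bar>f x - c (real n) (f x)\<bar> \<partial>lebesgue) \<longlonglongrightarrow> (\<integral>\<^sup>+x. 0 \<partial>(lebesgue :: 'n measure))"
  proof (rule nn_integral_dominated_convergence[where w = "\<lambda>x. ennreal \<bar>f x\<bar> * indicator (ball 0 R) x"])
    show "AE x in lebesgue. ennreal \<bar>f x - c (real n) (f x)\<bar> * indicator (ball 0 R) x \<le> ennreal \<bar>f x\<bar> * indicator (ball 0 R) x" for n
      by (intro AE_I2 mult_right_mono ennreal_leI) (auto simp: c_def)
    show "AE x in lebesgue. (\<lambda>n. ennreal \<bar>f x - c (real n) (f x)\<bar> * indicator (ball 0 R) x) \<longlonglongrightarrow> 0"
    proof (rule AE_I2)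
      fix x
      obtain k :: nat where k: "\<bar>f x\<bar> \<le> real k" using real_arch_simple by blast
      have "\<forall>\<^sub>F n in sequentially. ennreal \<bar>f x - c (real n) (f x)\<bar> * indicator (ball 0 R) x = 0"
        using eventually_ge_at_top[of k] by eventually_elim (use k in \<open>auto simp: c_def\<close>)
      then show "(\<lambda>n. ennreal \<bar>f x - c (real n) (f x)\<bar> * indicator (ball 0 R) x) \<longlonglongrightarrow> 0"
        by (rule tendsto_eventually)
    qed
  qed (use fin in measurable)
  then have "\<forall>\<^sub>F n in sequentially. (\<integral>\<^sup>+x\<in>ball 0 R. ennreal \<bar>f x - c (real n) (f x)\<bar> \<partial>lebesgue) < ennreal (e / 2)"
    using e by (intro order_tendstoD(2)) auto
  then obtain N where N: "(\<integral>\<^sup>+x\<in>ball 0 R. ennreal \<bar>f x - c (real N) (f x)\<bar> \<partial>lebesgue) < ennreal (e / 2)"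
    by (auto simp: eventually_sequentially)
  have "f measurable_on UNIV" by (rule lebesgue_measurable_imp_measurable_on) auto
  then obtain Z and h :: "nat \<Rightarrow> 'n \<Rightarrow> real" where Z: "negligible Z" and h: "\<And>n. continuous_on UNIV (h n)"
    and hlim: "\<And>x. x \<notin> Z \<Longrightarrow> (\<lambda>n. h n x) \<longlonglongrightarrow> f x"
    unfolding measurable_on_def by auto
  have [measurable]: "h n \<in> borel_measurable lebesgue" for n by (rule borel_measurable_continuous_lebesgue[OF h])
  have AEZ: "AE x in lebesgue. x \<notin> Z" using Z by (auto simp: negligible_iff_null_sets intro: AE_not_in)
  have "(\<lambda>n. \<integral>\<^sup>+x\<in>ball 0 R. ennreal \<bar>c (real N) (f x) - c (real N) (h n x)\<bar> \<partial>lebesgue) \<longlonglongrightarrow> (\<integral>\<^sup>+x. 0 \<partial>(lebesgue :: 'n measure))"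
  proof (rule nn_integral_dominated_convergence[where w = "\<lambda>x. ennreal (2 * real N) * indicator (ball 0 R) x"])
    show "AE x in lebesgue. ennreal \<bar>c (real N) (f x) - c (real N) (h n x)\<bar> * indicator (ball 0 R) x \<le> ennreal (2 * real N) * indicator (ball 0 R) x" for n
    proof (intro AE_I2 mult_right_mono ennreal_leI)
      fix x show "\<bar>c (real N) (f x) - c (real N) (h n x)\<bar> \<le> 2 * real N"
        using cT[of "real N" "f x"] cT[of "real N" "h n x"] by linarith
    qed simp
    have "(\<integral>\<^sup>+x. ennreal (2 * real N) * indicator (ball (0::'n) R) x \<partial>lebesgue) = ennreal (2 * real N) * emeasure lebesgue (ball (0::'n) R)"
      by (subst nn_integral_cmult_indicator) auto
    also have "\<dots> < \<infinity>"
      using emeasure_bounded_finite[of "ball (0::'n) R"] by (simp add: ennreal_mult_less_top)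
    finally show "(\<integral>\<^sup>+x. ennreal (2 * real N) * indicator (ball (0::'n) R) x \<partial>lebesgue) < \<infinity>" .
    show "AE x in lebesgue. (\<lambda>n. ennreal \<bar>c (real N) (f x) - c (real N) (h n x)\<bar> * indicator (ball 0 R) x) \<longlonglongrightarrow> 0"
      using AEZ
    proof eventually_elim
      fix x assume "x \<notin> Z"
      have "isCont (c (real N)) (f x)" using cc by (simp add: continuous_on_eq_continuous_at)
      then have "(\<lambda>n. c (real N) (h n x)) \<longlonglongrightarrow> c (real N) (f x)"
        using hlim[OF \<open>x \<notin> Z\<close>] by (rule isCont_tendsto_compose)
      then have "(\<lambda>n. \<bar>c (real N) (f x) - c (real N) (h n x)\<bar>) \<longlonglongrightarrow> \<bar>c (real N) (f x) - c (real N) (f x)\<bar>"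
        by (intro tendsto_intros)
      then have "(\<lambda>n. ennreal \<bar>c (real N) (f x) - c (real N) (h n x)\<bar>) \<longlonglongrightarrow> ennreal 0" by (intro tendsto_ennrealI) simp
      then show "(\<lambda>n. ennreal \<bar>c (real N) (f x) - c (real N) (h n x)\<bar> * indicator (ball 0 R) x) \<longlonglongrightarrow> 0"
        by (cases "x \<in> ball 0 R") auto
    qed
  qed measurable
  then have "\<forall>\<^sub>F n in sequentially. (\<integral>\<^sup>+x\<in>ball 0 R. ennreal \<bar>c (real N) (f x) - c (real N) (h n x)\<bar> \<partial>lebesgue) < ennreal (e / 2)"
    using e by (intro order_tendstoD(2)) auto
  then obtain n where n: "(\<integral>\<^sup>+x\<in>ball 0 R. ennreal \<bar>c (real N) (f x) - c (real N) (h n x)\<bar> \<partial>lebesgue) < ennreal (e / 2)"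
    by (auto simp: eventually_sequentially)
  show ?thesis
  proof
    show "continuous_on UNIV (\<lambda>x. c (real N) (h n x))"
      using continuous_on_compose2[OF cc h] by simp
    have "(\<integral>\<^sup>+x\<in>ball 0 R. ennreal \<bar>f x - c (real N) (h n x)\<bar> \<partial>lebesgue) \<le>
      (\<integral>\<^sup>+x. ennreal \<bar>f x - c (real N) (f x)\<bar> * indicator (ball 0 R) x + ennreal \<bar>c (real N) (f x) - c (real N) (h n x)\<bar> * indicator (ball 0 R) x \<partial>lebesgue)"
    proof (rule nn_integral_mono)
      fix x
      have "ennreal \<bar>f x - c (real N) (h n x)\<bar> \<le> ennreal (\<bar>f x - c (real N) (f x)\<bar> + \<bar>c (real N) (f x) - c (real N) (h n x)\<bar>)"
        by (intro ennreal_leI) simp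
      then show "ennreal \<bar>f x - c (real N) (h n x)\<bar> * indicator (ball 0 R) x \<le>
        ennreal \<bar>f x - c (real N) (f x)\<bar> * indicator (ball 0 R) x + ennreal \<bar>c (real N) (f x) - c (real N) (h n x)\<bar> * indicator (ball 0 R) x"
        by (simp add: indicator_def)
    qed
    also have "\<dots> = (\<integral>\<^sup>+x\<in>ball 0 R. ennreal \<bar>f x - c (real N) (f x)\<bar> \<partial>lebesgue) + (\<integral>\<^sup>+x\<in>ball 0 R. ennreal \<bar>c (real N) (f x) - c (real N) (h n x)\<bar> \<partial>lebesgue)"
      by (intro nn_integral_add) measurable
    also have "\<dots> < ennreal (e / 2) + ennreal (e / 2)" by (rule add_strict_mono[OF N n])
    also have "\<dots> = ennreal e" using e by (subst ennreal_plus[symmetric]) auto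
    finally show "(\<integral>\<^sup>+x\<in>ball 0 R. ennreal \<bar>f x - c (real N) (h n x)\<bar> \<partial>lebesgue) < ennreal e" .
  qed
qed

lemma mollify_diff_le:
  fixes f :: "'n::euclidean_space \<Rightarrow> real"
  assumes e: "0 < e" and f: "loc_integrable f"
  shows "ennreal \<bar>mollify e f x - f x\<bar> \<le> (\<integral>\<^sup>+y. ennreal \<bar>f y - f x\<bar> * ennreal (moll e x y) \<partial>lebesgue)"
proof -
  have m: "integrable lebesgue (moll e x)" "(\<integral>y. moll e x y \<partial>lebesgue) = 1"
  proof -
    have "has_bochner_integral lebesgue (moll e x) 1"
      using moll_bounds(1,4)[OF e, of x] by (intro has_bochner_integral_nn_integral) auto
    then show "integrable lebesgue (moll e x)" "(\<integral>y. moll e x y \<partial>lebesgue) = 1"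
      by (auto simp: has_bochner_integral_iff)
  qed
  have "mollify e f x - f x = (\<integral>y. moll e x y *\<^sub>R f y - moll e x y * f x \<partial>lebesgue)"
    using integrable_moll[OF e f, of x] m by (simp add: mollify_def)
  also have "ennreal \<bar>\<dots>\<bar> \<le> (\<integral>\<^sup>+y. ennreal (norm (moll e x y *\<^sub>R f y - moll e x y * f x)) \<partial>lebesgue)"
    using integrable_moll[OF e f, of x] m(1)
    by (intro order_trans[OF _ integral_norm_bound_ennreal]) auto
  also have "\<dots> = (\<integral>\<^sup>+y. ennreal \<bar>f y - f x\<bar> * ennreal (moll e x y) \<partial>lebesgue)"
  proof (rule nn_integral_cong)
    fix y
    have "moll e x y *\<^sub>R f y - moll e x y * f x = (f y - f x) * moll e x y" by (simp add: algebra_simps)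
    then show "ennreal (norm (moll e x y *\<^sub>R f y - moll e x y * f x)) = ennreal \<bar>f y - f x\<bar> * ennreal (moll e x y)"
      using moll_bounds(1)[OF e, of x y] by (simp add: abs_mult ennreal_mult')
  qed
  finally show ?thesis .
qed

text \<open>Compare with a continuous \<psi> close to \<open>f\<close> in L^1: |f y - f x| is at
  most |f - \<psi>| at y, plus |f - \<psi>| at x, plus an increment of \<psi>, small by uniform
  continuity. The ball of radius R + 1 contains all y met by x in B(0,R) when e \<le> 1.\<close>

lemma mollify_L1_converges:
  fixes f :: "'n::euclidean_space \<Rightarrow> real"
  assumes f: "loc_integrable f"
  shows "(\<lambda>k. \<integral>\<^sup>+x\<in>ball 0 R. ennreal \<bar>mollify (1 / real (Suc k)) f x - f x\<bar> \<partial>lebesgue) \<longlonglongrightarrow> 0"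
proof -
  have [measurable]: "f \<in> borel_measurable lebesgue" by (rule loc_integrable_measurable[OF f])
  show ?thesis
  proof (rule order_tendstoI)
    fix a :: ennreal assume "0 < a"
    obtain \<eta> where \<eta>: "0 < \<eta>" "ennreal (3 * \<eta>) < a"
    proof -
      obtain b where "0 < b" "b < a" using dense[OF \<open>0 < a\<close>] by auto
      then have "b < top" by (simp add: less_trans[OF _ less_le_trans[OF _ top_greatest]] order_less_le_trans)
      then show ?thesis
        using \<open>0 < b\<close> \<open>b < a\<close> that[of "enn2real b / 3"] by (cases b) (auto simp: ennreal_less_iff)
    qed
    have fin: "(\<integral>\<^sup>+x\<in>ball 0 (R + 1). ennreal \<bar>f x\<bar> \<partial>lebesgue) < \<infinity>"
    proof -
      have "compact (cball (0::'n) (R + 1))" by simp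
      then have "set_integrable lebesgue (cball 0 (R + 1)) f" using f unfolding loc_integrable_def by blast
      then have "(\<integral>\<^sup>+x. ennreal (norm (indicator (cball 0 (R + 1)) x *\<^sub>R f x)) \<partial>lebesgue) < \<infinity>"
        unfolding set_integrable_def integrable_iff_bounded by simp
      moreover have "(\<integral>\<^sup>+x\<in>ball 0 (R + 1). ennreal \<bar>f x\<bar> \<partial>lebesgue) \<le> (\<integral>\<^sup>+x. ennreal (norm (indicator (cball 0 (R + 1)) x *\<^sub>R f x)) \<partial>lebesgue)"
        by (intro nn_integral_mono) (auto simp: indicator_def)
      ultimately show ?thesis by (rule le_less_trans[rotated])
    qed
    obtain \<psi> where \<psi>: "continuous_on UNIV \<psi>" and \<psi>f: "(\<integral>\<^sup>+x\<in>ball 0 (R + 1). ennreal \<bar>f x - \<psi> x\<bar> \<partial>lebesgue) < ennreal \<eta>"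
      by (rule continuous_L1_approximation[OF _ fin \<eta>(1)]) measurable
    have [measurable]: "\<psi> \<in> borel_measurable lebesgue" by (rule borel_measurable_continuous_lebesgue[OF \<psi>])
    \<comment> \<open>The added 1 keeps the divisor positive also when the ball is empty.\<close>
    define v where "v = measure lebesgue (ball (0::'n) R) + 1"
    have v: "0 < v" by (simp add: v_def add_nonneg_pos)
    have ev: "emeasure lebesgue (ball (0::'n) R) \<le> ennreal v"
    proof -
      have "emeasure lebesgue (ball (0::'n) R) < top" using emeasure_bounded_finite[of "ball (0::'n) R"] by simp
      then have "emeasure lebesgue (ball (0::'n) R) = ennreal (measure lebesgue (ball (0::'n) R))"
        by (intro emeasure_eq_ennreal_measure) auto
      then show ?thesis by (simp add: v_def ennreal_leI)
    qed
    have "uniformly_continuous_on (cball 0 (R + 1)) \<psi>"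
      by (intro compact_uniformly_continuous continuous_on_subset[OF \<psi>]) auto
    then obtain d where d: "0 < d" "\<And>x y. x \<in> cball 0 (R + 1) \<Longrightarrow> y \<in> cball 0 (R + 1) \<Longrightarrow> dist y x < d \<Longrightarrow> dist (\<psi> y) (\<psi> x) < \<eta> / v"
      unfolding uniformly_continuous_on_def using \<eta> v by (metis divide_pos_pos)
    have bound: "(\<integral>\<^sup>+x\<in>ball 0 R. ennreal \<bar>mollify e f x - f x\<bar> \<partial>lebesgue) < a" if e: "0 < e" "e < d" "e \<le> 1" for e
    proof -
      let ?m = "\<lambda>x y. ennreal (moll e x y)"
      let ?B = "indicator (ball (0::'n) R) :: 'n \<Rightarrow> ennreal" and ?B1 = "indicator (ball (0::'n) (R + 1)) :: 'n \<Rightarrow> ennreal"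
      let ?F = "\<lambda>y. ennreal \<bar>f y - \<psi> y\<bar> * ?B1 y"
      have pt: "ennreal \<bar>f y - f x\<bar> * ?m x y \<le> ?F y * ?m x y + (ennreal (\<eta> / v) + ?F x) * ?m x y"
        if x: "x \<in> ball 0 R" for x y
      proof (cases "y \<in> ball x e")
        case True
        have nx: "norm x < R" using x by simp
        have "norm y \<le> norm x + dist x y" by (metis dist_norm norm_triangle_sub norm_minus_commute)
        then have ny: "norm y < R + 1" using nx True e by simp
        have "dist y x < d" using True e by (simp add: dist_commute)
        then have "dist (\<psi> y) (\<psi> x) < \<eta> / v" using nx ny by (intro d(2)) auto
        then have "\<bar>f y - f x\<bar> \<le> \<bar>f y - \<psi> y\<bar> + (\<eta> / v + \<bar>f x - \<psi> x\<bar>)" by (simp add: dist_real_def)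
        then have "ennreal \<bar>f y - f x\<bar> \<le> ennreal (\<bar>f y - \<psi> y\<bar> + (\<eta> / v + \<bar>f x - \<psi> x\<bar>))" by (rule ennreal_leI)
        also have "\<dots> = ?F y + (ennreal (\<eta> / v) + ?F x)" using nx ny \<eta> v by simp
        finally show ?thesis unfolding distrib_right[symmetric] by (rule mult_right_mono) simp
      next
        case False
        then show ?thesis by (simp add: moll_bounds(3)[OF e(1) False])
      qed
      have [measurable]: "?F \<in> borel_measurable lebesgue" by measurable
      have inner: "ennreal \<bar>mollify e f x - f x\<bar> * ?B x \<le> (\<integral>\<^sup>+y. ?B x * (?F y * ?m x y) \<partial>lebesgue) + (ennreal (\<eta> / v) * ?B x + ?F x)" for x
      proof (cases "x \<in> ball 0 R")
        case True
        have "ennreal \<bar>mollify e f x - f x\<bar> \<le> (\<integral>\<^sup>+y. ennreal \<bar>f y - f x\<bar> * ?m x y \<partial>lebesgue)"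
          by (rule mollify_diff_le[OF e(1) f])
        also have "\<dots> \<le> (\<integral>\<^sup>+y. ?F y * ?m x y + (ennreal (\<eta> / v) + ?F x) * ?m x y \<partial>lebesgue)"
          by (intro nn_integral_mono pt True)
        also have "\<dots> = (\<integral>\<^sup>+y. ?F y * ?m x y \<partial>lebesgue) + (\<integral>\<^sup>+y. (ennreal (\<eta> / v) + ?F x) * ?m x y \<partial>lebesgue)"
          by (intro nn_integral_add) measurable
        also have "(\<integral>\<^sup>+y. (ennreal (\<eta> / v) + ?F x) * ?m x y \<partial>lebesgue) = ennreal (\<eta> / v) + ?F x"
          by (subst nn_integral_cmult) (auto simp: moll_bounds(4)[OF e(1)])
        finally show ?thesis using True by simp
      qed simp
      have "(\<integral>\<^sup>+x\<in>ball 0 R. ennreal \<bar>mollify e f x - f x\<bar> \<partial>lebesgue)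
        \<le> (\<integral>\<^sup>+x. (\<integral>\<^sup>+y. ?B x * (?F y * ?m x y) \<partial>lebesgue) + (ennreal (\<eta> / v) * ?B x + ?F x) \<partial>lebesgue)"
        by (intro nn_integral_mono inner)
      also have "\<dots> = (\<integral>\<^sup>+x. (\<integral>\<^sup>+y. ?B x * (?F y * ?m x y) \<partial>lebesgue) \<partial>lebesgue) + (\<integral>\<^sup>+x. ennreal (\<eta> / v) * ?B x + ?F x \<partial>lebesgue)"
        by (intro nn_integral_add borel_measurable_lebesgue_nn_integral) measurable
      also have "(\<integral>\<^sup>+x. ennreal (\<eta> / v) * ?B x + ?F x \<partial>lebesgue) = (\<integral>\<^sup>+x. ennreal (\<eta> / v) * ?B x \<partial>lebesgue) + (\<integral>\<^sup>+x. ?F x \<partial>lebesgue)"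
        by (intro nn_integral_add) measurable
      also have "(\<integral>\<^sup>+x. ennreal (\<eta> / v) * ?B x \<partial>lebesgue) \<le> ennreal (\<eta> / v) * ennreal v"
        by (subst nn_integral_cmult_indicator) (auto intro!: mult_left_mono ev simp del: emeasure_completion)
      also have "ennreal (\<eta> / v) * ennreal v = ennreal \<eta>" using \<eta> v by (subst ennreal_mult'[symmetric]) auto
      \<comment> \<open>The mollifier is symmetric, so after the exchange it has integral 1 in x as
        well, and the error |f - \<psi>| at y is not enlarged.\<close>
      also have "(\<integral>\<^sup>+x. (\<integral>\<^sup>+y. ?B x * (?F y * ?m x y) \<partial>lebesgue) \<partial>lebesgue) = (\<integral>\<^sup>+y. (\<integral>\<^sup>+x. ?B x * (?F y * ?m x y) \<partial>lebesgue) \<partial>lebesgue)"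
        by (intro lebesgue_Fubini[symmetric]) measurable
      also have "\<dots> \<le> (\<integral>\<^sup>+y. ?F y \<partial>lebesgue)"
      proof (rule nn_integral_mono)
        fix y
        have "(\<integral>\<^sup>+x. ?B x * (?F y * ?m x y) \<partial>lebesgue) \<le> (\<integral>\<^sup>+x. ?F y * ?m y x \<partial>lebesgue)"
          by (intro nn_integral_mono) (auto simp: indicator_def moll_commute[of e y])
        also have "\<dots> = ?F y" by (subst nn_integral_cmult) (auto simp: moll_bounds(4)[OF e(1)])
        finally show "(\<integral>\<^sup>+x. ?B x * (?F y * ?m x y) \<partial>lebesgue) \<le> ?F y" .
      qed
      finally have "(\<integral>\<^sup>+x\<in>ball 0 R. ennreal \<bar>mollify e f x - f x\<bar> \<partial>lebesgue) \<le> (\<integral>\<^sup>+y. ?F y \<partial>lebesgue) + (ennreal \<eta> + (\<integral>\<^sup>+y. ?F y \<partial>lebesgue))"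
        by (simp add: add_mono)
      also have "\<dots> \<le> ennreal \<eta> + (ennreal \<eta> + ennreal \<eta>)" using \<psi>f by (intro add_mono) auto
      also have "\<dots> = ennreal (3 * \<eta>)" using \<eta> by (simp flip: ennreal_plus)
      finally show ?thesis using \<eta>(2) by (rule le_less_trans)
    qed
    obtain j :: nat where j: "1 / real (Suc j) < d" using d(1) by (metis nat_approx_posE)
    have "\<forall>k\<ge>j. (\<integral>\<^sup>+x\<in>ball 0 R. ennreal \<bar>mollify (1 / real (Suc k)) f x - f x\<bar> \<partial>lebesgue) < a"
    proof (intro allI impI bound)
      fix k assume "j \<le> k"
      then have "1 / real (Suc k) \<le> 1 / real (Suc j)" by (intro divide_left_mono) auto
      then show "1 / real (Suc k) < d" using j by linarith
    qed auto
    then show "\<forall>\<^sub>F k in sequentially. (\<integral>\<^sup>+x\<in>ball 0 R. ennreal \<bar>mollify (1 / real (Suc k)) f x - f x\<bar> \<partial>lebesgue) < a"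
      by (auto simp: eventually_sequentially)
  qed simp
qed

text \<open>Convergence in L^1 on a ball yields a subsequence converging almost everywhere there. It
  depends on R, which suffices because level sets are localised before the limit is taken.\<close>

lemma mollify_AE_subsequence:
  fixes f :: "'n::euclidean_space \<Rightarrow> real"
  assumes f: "loc_integrable f"
  obtains \<epsilon> :: "nat \<Rightarrow> real" where "\<forall>k. 0 < \<epsilon> k" "AE x in lebesgue. x \<in> ball 0 R \<longrightarrow> (\<lambda>k. mollify (\<epsilon> k) f x) \<longlonglongrightarrow> f x"
proof -
  have [measurable]: "f \<in> borel_measurable lebesgue" by (rule loc_integrable_measurable[OF f])
  let ?F = "\<lambda>k. mollify (1 / real (Suc k)) f"
  let ?u = "\<lambda>k x. indicator (ball 0 R) x * (?F k x - f x)"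
  have [measurable]: "?F k \<in> borel_measurable lebesgue" for k
    by (intro borel_measurable_continuous_lebesgue continuous_mollify[OF _ f]) simp
  have um[measurable]: "?u k \<in> borel_measurable lebesgue" for k by measurable
  have nn: "(\<integral>\<^sup>+x. ennreal (norm (?u k x)) \<partial>lebesgue) = (\<integral>\<^sup>+x\<in>ball 0 R. ennreal \<bar>?F k x - f x\<bar> \<partial>lebesgue)" for k
    by (intro nn_integral_cong) (auto simp: indicator_def)
  have int: "integrable lebesgue (?u k)" for k
  proof -
    have 1: "integrable lebesgue (\<lambda>x. indicator (ball (0::'n) R) x *\<^sub>R f x)"
    proof (rule loc_integrable_bounded_mult[OF f, where B = 1 and x = 0 and e = R])
      show "\<bar>indicator (ball (0::'n) R) y\<bar> \<le> (1::real)" for y by (simp add: indicator_def)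
      show "y \<notin> cball 0 R \<Longrightarrow> indicator (ball (0::'n) R) y = (0::real)" for y by (simp add: indicator_def)
    qed measurable
    have c: "continuous_on UNIV (?F k)" by (intro continuous_mollify[OF _ f]) simp
    obtain N where N: "0 < N" "\<And>x. x \<in> ball 0 R \<Longrightarrow> norm (?F k x) \<le> N" using continuous_bounded_ball[OF c] by metis
    have "integrable lebesgue (\<lambda>x. indicator (ball (0::'n) R) x * ?F k x)"
    proof (rule integrable_bounded_support)
      show "\<bar>indicator (ball 0 R) x * ?F k x\<bar> \<le> N" for x using N(1) N(2)[of x] by (auto simp: indicator_def)
      show "x \<notin> ball 0 R \<Longrightarrow> indicator (ball 0 R) x * ?F k x = 0" for x by simp
    qed measurable
    with 1 show ?thesis by (simp add: right_diff_distrib)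
  qed
  have "(\<lambda>k. \<integral>x. norm (?u k x) \<partial>lebesgue) \<longlonglongrightarrow> 0"
  proof -
    have "(\<lambda>k. ennreal (\<integral>x. norm (?u k x) \<partial>lebesgue)) \<longlonglongrightarrow> ennreal 0"
      using mollify_L1_converges[OF f, of R] int
      by (subst nn_integral_eq_integral[symmetric]) (auto simp: nn[simplified])
    then show ?thesis by (subst (asm) tendsto_ennreal_iff) auto
  qed
  from tendsto_L1_AE_subseq[OF int this]
  obtain r :: "nat \<Rightarrow> nat" where "strict_mono r" and r: "AE x in lebesgue. (\<lambda>k. ?u (r k) x) \<longlonglongrightarrow> 0" by blast
  show ?thesis
  proof (rule that[of "\<lambda>k. 1 / real (Suc (r k))"])
    show "AE x in lebesgue. x \<in> ball 0 R \<longrightarrow> (\<lambda>k. ?F (r k) x) \<longlonglongrightarrow> f x"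
      using r
    proof eventually_elim
      fix x assume *: "(\<lambda>k. ?u (r k) x) \<longlonglongrightarrow> 0"
      show "x \<in> ball 0 R \<longrightarrow> (\<lambda>k. ?F (r k) x) \<longlonglongrightarrow> f x"
        using * by (auto simp: LIM_zero_iff)
    qed
  qed simp
qed

section \<open>Passage to Sobolev functions\<close>

lemma lhs_quant_mollify_limit:
  fixes X :: "('n::euclidean_space) fnorm"
  assumes X: "ball_BFS X" and f: "loc_integrable f" and q: "0 < q"
    and le: "\<And>e. 0 < e \<Longrightarrow> lhs_quant X (mollify e f) \<gamma> q s \<le> D"
  shows "lhs_quant X f \<gamma> q s \<le> D"
proof (rule lhs_quant_le[OF X loc_integrable_measurable[OF f] q])
  have [measurable]: "f \<in> borel_measurable lebesgue" by (rule loc_integrable_measurable[OF f])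
  fix l R :: real assume l: "0 < l"
  obtain \<epsilon> :: "nat \<Rightarrow> real" where \<epsilon>': "\<forall>k. 0 < \<epsilon> k"
    and conv: "AE x in lebesgue. x \<in> ball 0 R \<longrightarrow> (\<lambda>k. mollify (\<epsilon> k) f x) \<longlonglongrightarrow> f x"
    by (rule mollify_AE_subsequence[OF f])
  have \<epsilon>: "0 < \<epsilon> k" for k using \<epsilon>' by simp
  let ?e = "s + \<gamma> / q"
  let ?E = "levelset f R l ?e" and ?Ek = "\<lambda>k. levelset (mollify (\<epsilon> k) f) R l ?e"
  have [measurable]: "mollify (\<epsilon> k) f \<in> borel_measurable lebesgue" for k
    by (intro borel_measurable_continuous_lebesgue continuous_mollify[OF \<epsilon> f])
  let ?U = "epow (ennreal (1 / l) * D) q"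
  have bound: "X (kernel_mass \<gamma> (?Ek k)) \<le> ?U" for k
  proof -
    have Dm: "Dset (mollify (\<epsilon> k) f) l (\<gamma> / q) s \<in> sets (lebesgue \<Otimes>\<^sub>M lebesgue)"
      unfolding Dset_eq_levelset by measurable
    have "ennreal l * epow (X (kernel_mass \<gamma> (Dset (mollify (\<epsilon> k) f) l (\<gamma> / q) s))) (1 / q) \<le> lhs_quant X (mollify (\<epsilon> k) f) \<gamma> q s"
      unfolding lhs_quant_eq[OF q] using l by (intro SUP_upper) simp
    also have "\<dots> \<le> D" by (rule le[OF \<epsilon>])
    finally have "X (kernel_mass \<gamma> (Dset (mollify (\<epsilon> k) f) l (\<gamma> / q) s)) \<le> ?U"
      by (simp add: ennreal_scaled_epow_le_iff[OF l q])
    moreover have "?Ek k \<subseteq> Dset (mollify (\<epsilon> k) f) l (\<gamma> / q) s"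
      by (auto simp: Dset_def levelset_def pos_less_divide_eq)
    then have "X (kernel_mass \<gamma> (?Ek k)) \<le> X (kernel_mass \<gamma> (Dset (mollify (\<epsilon> k) f) l (\<gamma> / q) s))"
      by (intro bfs_mono[OF X] kernel_mass_mono borel_measurable_kernel_mass Dm) measurable
    ultimately show ?thesis by simp
  qed
  have "X (kernel_mass \<gamma> ?E) \<le> ?U"
  proof (rule bfs_liminf_le[OF X, where F = "\<lambda>k. kernel_mass \<gamma> (?Ek k)" and b = "\<lambda>_. ?U"])
    show "AE x in lebesgue. kernel_mass \<gamma> ?E x \<le> liminf (\<lambda>k. kernel_mass \<gamma> (?Ek k) x)"
      using conv
    proof eventually_elim
      fix x assume x: "x \<in> ball 0 R \<longrightarrow> (\<lambda>k. mollify (\<epsilon> k) f x) \<longlonglongrightarrow> f x"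
      \<comment> \<open>The inequality defining the level set is strict, so a pair at which the
        mollifications converge enters their level sets eventually. Fatou's lemma is then used
        twice, for the integral in y here and for the norm of X around it.\<close>
      have "kernel_mass \<gamma> ?E x \<le> (\<integral>\<^sup>+y. liminf (\<lambda>k. indicator (?Ek k) (x, y) * riesz_kernel \<gamma> x y) \<partial>lebesgue)"
        unfolding kernel_mass_def
      proof (rule nn_integral_mono_AE)
        show "AE y in lebesgue. indicator ?E (x, y) * riesz_kernel \<gamma> x y \<le> liminf (\<lambda>k. indicator (?Ek k) (x, y) * riesz_kernel \<gamma> x y)"
          using conv
        proof eventually_elim
          fix y assume y: "y \<in> ball 0 R \<longrightarrow> (\<lambda>k. mollify (\<epsilon> k) f y) \<longlonglongrightarrow> f y"
          show "indicator ?E (x, y) * riesz_kernel \<gamma> x y \<le> liminf (\<lambda>k. indicator (?Ek k) (x, y) * riesz_kernel \<gamma> x y)"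
          proof (cases "(x, y) \<in> ?E")
            case True
            then have xy: "x \<in> ball 0 R" "y \<in> ball 0 R" "x \<noteq> y" "l * norm (x - y) powr ?e < \<bar>f x - f y\<bar>"
              by (auto simp: levelset_def)
            have "(\<lambda>k. \<bar>mollify (\<epsilon> k) f x - mollify (\<epsilon> k) f y\<bar>) \<longlonglongrightarrow> \<bar>f x - f y\<bar>"
              using x y xy by (intro tendsto_intros) auto
            from order_tendstoD(1)[OF this xy(4)]
            have "\<forall>\<^sub>F k in sequentially. indicator ?E (x, y) * riesz_kernel \<gamma> x y \<le> indicator (?Ek k) (x, y) * riesz_kernel \<gamma> x y"
              by eventually_elim (use xy True in \<open>auto simp: levelset_def\<close>)
            then show ?thesis by (rule Liminf_bounded)
          qed simp
        qed
      qed
      also have "\<dots> \<le> liminf (\<lambda>k. kernel_mass \<gamma> (?Ek k) x)"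
        unfolding kernel_mass_def by (intro nn_integral_liminf) measurable
      finally show "kernel_mass \<gamma> ?E x \<le> liminf (\<lambda>k. kernel_mass \<gamma> (?Ek k) x)" .
    qed
  qed (use bound in \<open>auto intro: borel_measurable_kernel_mass sets_levelset\<close>)
  then show "ennreal l * epow (X (kernel_mass \<gamma> ?E)) (1 / q) \<le> D"
    by (simp add: ennreal_scaled_epow_le_iff[OF l q])
qed

text \<open>Stated for an arbitrary density \<open>h\<close>, as it is applied both to |f|^p and to
  the norm of the gradient. K \<ge> 1 ensures that the final constant is not smaller than the one
  for smooth functions.\<close>

lemma bfs_ball_avg_domination:
  fixes X :: "('n::euclidean_space) fnorm"
  assumes X: "ball_BFS X" and B: "ball_avg_unif_bounded X"
  shows "\<exists>K\<ge>1. \<forall>e h u. 0 < e \<longrightarrow> h \<in> borel_measurable lebesgue \<longrightarrow> u \<in> borel_measurable lebesgue \<longrightarrow>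
    (\<forall>x. u x \<le> (\<integral>\<^sup>+y. h y * ennreal (moll e x y) \<partial>lebesgue)) \<longrightarrow> X u \<le> ennreal K * X h"
proof -
  obtain C0 :: real where C0: "\<forall>r>0. \<forall>f. f \<in> borel_measurable lebesgue \<longrightarrow> X (ball_avg r f) \<le> ennreal C0 * X f"
    using B by (auto simp: ball_avg_unif_bounded_def)
  let ?D = "exp 2 * 2 ^ DIM('n) :: real"
  define C where "C = max 1 C0"
  show ?thesis
  proof (intro exI[of _ "?D * C"] conjI allI impI)
    have "1 * 1 \<le> exp 2 * (2 ^ DIM('n) :: real)" by (intro mult_mono) auto
    then show "1 \<le> ?D * C" using mult_mono[of 1 ?D 1 C] by (auto simp: C_def)
    fix e :: real and h u :: "'n \<Rightarrow> ennreal"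
    assume e: "0 < e" and [measurable]: "h \<in> borel_measurable lebesgue" "u \<in> borel_measurable lebesgue"
      and le: "\<forall>x. u x \<le> (\<integral>\<^sup>+y. h y * ennreal (moll e x y) \<partial>lebesgue)"
    have [measurable]: "ball_avg e h \<in> borel_measurable lebesgue" by (rule borel_measurable_ball_avg[OF _ e]) measurable
    have "X u \<le> X (\<lambda>x. ennreal ?D * ball_avg e h x)"
    proof (rule bfs_mono[OF X])
      fix x show "u x \<le> ennreal ?D * ball_avg e h x"
        using le moll_integral_le_ball_avg[OF e, of h x] by (auto intro: order_trans)
    qed measurable
    also have "\<dots> = ennreal ?D * X (ball_avg e h)"
      by (intro bfs_cmult[OF X]) auto
    also have "\<dots> \<le> ennreal ?D * (ennreal C * X h)"
    proof (intro mult_left_mono)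
      have "X (ball_avg e h) \<le> ennreal C0 * X h" using C0 e by simp
      also have "\<dots> \<le> ennreal C * X h" by (intro mult_right_mono ennreal_leI) (auto simp: C_def)
      finally show "X (ball_avg e h) \<le> ennreal C * X h" .
    qed simp
    also have "\<dots> = ennreal (?D * C) * X h"
      by (simp only: ennreal_mult'[of ?D] mult.assoc[where 'a = ennreal] mult_nonneg_nonneg exp_ge_zero zero_le_power zero_le_numeral)
    finally show "X u \<le> ennreal (?D * C) * X h" .
  qed
qed

text \<open>By Jensen's inequality |f|^p is averaged just like the gradient, so the bound of ball
  averages on X handles both factors; each contributes a power of K. The conclusion C' \<ge> C
  allows one constant for both classes of functions.\<close>

lemma Sobolev_estimate:
  fixes X :: "('n::euclidean_space) fnorm"
  assumes X: "ball_BFS X" and B: "ball_avg_unif_bounded X" and C: "0 < C"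
    and s: "0 < s" "s < 1" and p: "1 \<le> p" and q: "0 < q"
    and C1: "\<And>f g. C1_gradient f g \<Longrightarrow> lhs_quant X f \<gamma> q s
      \<le> ennreal C * epow (pow_space p X (absn f)) (1 - s) * epow (X (\<lambda>x. ennreal (norm (g x)))) s"
  shows "\<exists>C'\<ge>C. \<forall>f g. weak_gradient f g \<longrightarrow> lhs_quant X f \<gamma> q s
      \<le> ennreal C' * epow (pow_space p X (absn f)) (1 - s) * epow (X (\<lambda>x. ennreal (norm (g x)))) s"
proof -
  have p0: "0 < p" using p by simp
  obtain K where K: "1 \<le> K" and K': "\<forall>e h u. 0 < e \<longrightarrow> h \<in> borel_measurable lebesgue \<longrightarrow> u \<in> borel_measurable lebesgue \<longrightarrow>
    (\<forall>x. u x \<le> (\<integral>\<^sup>+y. h y * ennreal (moll e x y) \<partial>lebesgue)) \<longrightarrow> X u \<le> ennreal K * X h"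
    using bfs_ball_avg_domination[OF X B] by (elim exE conjE) (rule that)
  define \<alpha> where "\<alpha> = (1 - s) / p"
  have \<alpha>: "0 < \<alpha>" using s p by (simp add: \<alpha>_def)
  define K1 where "K1 = K powr \<alpha> * K powr s"
  have K1: "1 \<le> K1"
    using mult_mono[of 1 "K powr \<alpha>" 1 "K powr s"] ge_one_powr_ge_zero[OF K] \<alpha> s by (auto simp: K1_def)
  show ?thesis
  proof (intro exI[of _ "C * K1"] conjI allI impI)
    show "C \<le> C * K1" using C K1 by simp
    fix f :: "'n \<Rightarrow> real" and g assume w: "weak_gradient f g"
    have f: "loc_integrable f" and g: "loc_integrable g" using w by (auto simp: weak_gradient_def)
    have [measurable]: "f \<in> borel_measurable lebesgue" "g \<in> borel_measurable lebesgue"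
      by (rule loc_integrable_measurable[OF f], rule loc_integrable_measurable[OF g])
    let ?A = "X (\<lambda>x. ennreal (\<bar>f x\<bar> powr p))" and ?B = "X (\<lambda>x. ennreal (norm (g x)))"
    show "lhs_quant X f \<gamma> q s \<le> ennreal (C * K1) * epow (pow_space p X (absn f)) (1 - s) * epow ?B s"
    proof (rule lhs_quant_mollify_limit[OF X f q])
      fix e :: real assume e: "0 < e"
      have [measurable]: "mollify e f \<in> borel_measurable lebesgue" "mollify e g \<in> borel_measurable lebesgue"
        by (intro borel_measurable_continuous_lebesgue continuous_mollify e f g)+
      have A: "X (\<lambda>x. ennreal (\<bar>mollify e f x\<bar> powr p)) \<le> ennreal K * ?A"
        by (rule K'[rule_format, OF e]) (measurable, rule mollify_powr_le[OF e f p])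
      have B: "X (\<lambda>x. ennreal (norm (mollify e g x))) \<le> ennreal K * ?B"
        by (rule K'[rule_format, OF e]) (measurable, rule norm_mollify_le[OF e g])
      have "lhs_quant X (mollify e f) \<gamma> q s \<le> ennreal C * epow (X (\<lambda>x. ennreal (\<bar>mollify e f x\<bar> powr p))) \<alpha>
          * epow (X (\<lambda>x. ennreal (norm (mollify e g x)))) s"
        using C1[OF C1_gradient_mollify[OF e w]] unfolding epow_pow_space_absn[OF p0] \<alpha>_def .
      also have "\<dots> \<le> ennreal C * epow (ennreal K * ?A) \<alpha> * epow (ennreal K * ?B) s"
        using \<alpha> s by (intro mult_mono mult_left_mono epow_mono A B) auto
      also have "\<dots> = ennreal C * (ennreal (K powr \<alpha>) * epow ?A \<alpha>) * (ennreal (K powr s) * epow ?B s)"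
        using \<alpha> s K by (simp add: epow_mult epow_ennreal)
      also have "\<dots> = ennreal C * (ennreal (K powr \<alpha>) * ennreal (K powr s)) * epow ?A \<alpha> * epow ?B s"
        by (simp only: mult_ac)
      also have "ennreal (K powr \<alpha>) * ennreal (K powr s) = ennreal K1" unfolding K1_def by (intro ennreal_mult'[symmetric]) simp
      also have "ennreal C * ennreal K1 = ennreal (C * K1)" using C by (intro ennreal_mult'[symmetric]) simp
      finally show "lhs_quant X (mollify e f) \<gamma> q s \<le> ennreal (C * K1) * epow (pow_space p X (absn f)) (1 - s) * epow ?B s"
        unfolding epow_pow_space_absn[OF p0] \<alpha>_def .
    qed
  qed
qed

text \<open>Mollification does not increase the supremum norm, so only the gradient factor
  contributes a power of K.\<close>

lemma Sobolev_estimate_bounded: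
  fixes X :: "('n::euclidean_space) fnorm"
  assumes X: "ball_BFS X" and B: "ball_avg_unif_bounded X" and C: "0 < C"
    and s: "0 < s" "s < 1" and q: "0 < q"
    and C1: "\<And>f g. C1_gradient f g \<Longrightarrow> lhs_quant X f \<gamma> q s
      \<le> ennreal C * epow (Linf_norm f) (1 - s) * epow (X (\<lambda>x. ennreal (norm (g x)))) s"
  shows "\<exists>C'\<ge>C. \<forall>f g. weak_gradient f g \<longrightarrow> lhs_quant X f \<gamma> q s
      \<le> ennreal C' * epow (Linf_norm f) (1 - s) * epow (X (\<lambda>x. ennreal (norm (g x)))) s"
proof -
  obtain K where K: "1 \<le> K" and K': "\<forall>e h u. 0 < e \<longrightarrow> h \<in> borel_measurable lebesgue \<longrightarrow> u \<in> borel_measurable lebesgue \<longrightarrow>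
    (\<forall>x. u x \<le> (\<integral>\<^sup>+y. h y * ennreal (moll e x y) \<partial>lebesgue)) \<longrightarrow> X u \<le> ennreal K * X h"
    using bfs_ball_avg_domination[OF X B] by (elim exE conjE) (rule that)
  have K1: "1 \<le> K powr s" using ge_one_powr_ge_zero[OF K] s by simp
  show ?thesis
  proof (intro exI[of _ "C * K powr s"] conjI allI impI)
    show "C \<le> C * K powr s" using C K1 by simp
    fix f :: "'n \<Rightarrow> real" and g assume w: "weak_gradient f g"
    have f: "loc_integrable f" and g: "loc_integrable g" using w by (auto simp: weak_gradient_def)
    have [measurable]: "g \<in> borel_measurable lebesgue" by (rule loc_integrable_measurable[OF g])
    let ?B = "X (\<lambda>x. ennreal (norm (g x)))"
    show "lhs_quant X f \<gamma> q s \<le> ennreal (C * K powr s) * epow (Linf_norm f) (1 - s) * epow ?B s"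
    proof (rule lhs_quant_mollify_limit[OF X f q])
      fix e :: real assume e: "0 < e"
      have [measurable]: "mollify e g \<in> borel_measurable lebesgue"
        by (intro borel_measurable_continuous_lebesgue continuous_mollify e g)
      have B: "X (\<lambda>x. ennreal (norm (mollify e g x))) \<le> ennreal K * ?B"
        by (rule K'[rule_format, OF e]) (measurable, rule norm_mollify_le[OF e g])
      have "lhs_quant X (mollify e f) \<gamma> q s \<le> ennreal C * epow (Linf_norm (mollify e f)) (1 - s)
          * epow (X (\<lambda>x. ennreal (norm (mollify e g x)))) s"
        by (rule C1[OF C1_gradient_mollify[OF e w]])
      also have "\<dots> \<le> ennreal C * epow (Linf_norm f) (1 - s) * epow (ennreal K * ?B) s"
        using s by (intro mult_mono mult_left_mono epow_mono Linf_norm_mollify_le[OF e f] B) auto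
      also have "\<dots> = ennreal C * epow (Linf_norm f) (1 - s) * (ennreal (K powr s) * epow ?B s)"
        using s K by (simp add: epow_mult epow_ennreal)
      also have "\<dots> = ennreal C * ennreal (K powr s) * epow (Linf_norm f) (1 - s) * epow ?B s"
        by (simp only: mult_ac)
      also have "ennreal C * ennreal (K powr s) = ennreal (C * K powr s)" using C by (intro ennreal_mult'[symmetric]) simp
      finally show "lhs_quant X (mollify e f) \<gamma> q s \<le> ennreal (C * K powr s) * epow (Linf_norm f) (1 - s) * epow ?B s" .
    qed
  qed
qed

lemma C1_grad_cc_imp: "C1_grad_cc f g \<Longrightarrow> C1_gradient f g"
  by (simp add: C1_grad_cc_def C1_gradient_def)

lemma ennreal_mult3_mono_left:
  "a \<le> b \<Longrightarrow> ennreal a * x * y \<le> ennreal b * x * y"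
  by (intro mult_right_mono ennreal_leI) auto

theorem theorem4p1:
  fixes X :: "('n::euclidean_space) fnorm"
    and \<gamma> s :: real and \<theta> :: "nat \<Rightarrow> real"
  assumes X: "ball_BFS X"
    and \<gamma>: "\<gamma> \<noteq> 0"
    and s: "0 < s" "s < 1"
    and \<theta>: "\<forall>m. 0 < \<theta> m \<and> \<theta> m < 1" "\<theta> \<longlonglongrightarrow> 1"
    and Xth: "\<forall>m. ball_BFS (pow_space (1 / \<theta> m) X)"
    and Mth: "\<forall>m. M_bounded (assoc_space (pow_space (1 / \<theta> m) X))"
    and Mlim: "\<exists>L. L < \<infinity> \<and> (\<lambda>m. M_opnorm (assoc_space (pow_space (1 / \<theta> m) X))) \<longlonglongrightarrow> L"
    and neg: "\<gamma> < 0 \<longrightarrow> (M_bounded X \<or> (DIM('n) = 1 \<and> \<gamma> < -1))"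
  shows
   "(\<forall>p q. 1 \<le> p \<longrightarrow> 1 \<le> q \<longrightarrow> q \<le> p \<longrightarrow> 1 / q = (1 - s) / p + s \<longrightarrow>
       (\<exists>C>0. (\<forall>f g. C1_grad_cc f g \<longrightarrow>
                 lhs_quant X f \<gamma> q s
                   \<le> ennreal C * epow (pow_space p X (absn f)) (1 - s)
                                * epow (X (\<lambda>x. ennreal (norm (g x)))) s) \<and>
              ((abs_cont_norm X \<and> ball_BFS (pow_space p X) \<and> ball_avg_unif_bounded X) \<longrightarrow>
               (\<forall>f g. f \<in> borel_measurable lebesgue \<longrightarrow> weak_gradient f g \<longrightarrow>
                   X (\<lambda>x. ennreal (norm (g x))) < \<infinity> \<longrightarrow>
                 lhs_quant X f \<gamma> q s
                   \<le> ennreal C * epow (pow_space p X (absn f)) (1 - s)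
                                * epow (X (\<lambda>x. ennreal (norm (g x)))) s)))) \<and>
    (\<forall>q. 1 / q = s \<longrightarrow>
       (\<exists>C>0. (\<forall>f g. C1_grad_cc f g \<longrightarrow>
                 lhs_quant X f \<gamma> q s
                   \<le> ennreal C * epow (Linf_norm f) (1 - s)
                                * epow (X (\<lambda>x. ennreal (norm (g x)))) s) \<and>
              ((abs_cont_norm X \<and> ball_avg_unif_bounded X) \<longrightarrow>
               (\<forall>f g. f \<in> borel_measurable lebesgue \<longrightarrow> weak_gradient f g \<longrightarrow>
                   X (\<lambda>x. ennreal (norm (g x))) < \<infinity> \<longrightarrow>
                 lhs_quant X f \<gamma> q s
                   \<le> ennreal C * epow (Linf_norm f) (1 - s)
                                * epow (X (\<lambda>x. ennreal (norm (g x)))) s))))"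
proof -
  obtain A where A: "extrapolates X A"
    using weighted_transfer[OF X \<theta> Xth Mlim] unfolding extrapolates_def by blast
  show ?thesis
  proof (intro conjI allI impI)
    fix p q :: real
    assume p: "1 \<le> p" and q: "1 \<le> q" "q \<le> p" "1 / q = (1 - s) / p + s"
    have p0: "0 < p" and q0: "0 < q" using p q by auto
    let ?rhs = "\<lambda>C f g. ennreal C * epow (pow_space p X (absn f)) (1 - s) * epow (X (\<lambda>x. ennreal (norm (g x :: 'n)))) s"
    obtain C where C: "0 < C" and C1: "\<And>f g. C1_gradient f g \<Longrightarrow> lhs_quant X f \<gamma> q s \<le> ?rhs C f g"
      using C1_estimate[OF X A \<gamma> neg s p0 q0 q(3)] by blast
    \<comment> \<open>The theorem asks for one constant, chosen outside the implication about
      Sobolev functions; the case distinction fixes it according to whether the ball averages are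
      bounded.\<close>
    obtain C' where C': "C \<le> C'" and
      W: "ball_avg_unif_bounded X \<Longrightarrow> \<forall>f g. weak_gradient f g \<longrightarrow> lhs_quant X f \<gamma> q s \<le> ?rhs C' f g"
    proof (cases "ball_avg_unif_bounded X")
      case True
      from Sobolev_estimate[OF X True C s p q0 C1] show ?thesis using that by blast
    qed (use that in blast)
    have "lhs_quant X f \<gamma> q s \<le> ?rhs C' f g" if "C1_grad_cc f g" for f g
      by (rule order_trans[OF C1[OF C1_grad_cc_imp[OF that]] ennreal_mult3_mono_left[OF C']])
    then show "\<exists>C>0. (\<forall>f g. C1_grad_cc f g \<longrightarrow> lhs_quant X f \<gamma> q s \<le> ?rhs C f g) \<and>
      ((abs_cont_norm X \<and> ball_BFS (pow_space p X) \<and> ball_avg_unif_bounded X) \<longrightarrow>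
       (\<forall>f g. f \<in> borel_measurable lebesgue \<longrightarrow> weak_gradient f g \<longrightarrow> X (\<lambda>x. ennreal (norm (g x))) < \<infinity> \<longrightarrow>
         lhs_quant X f \<gamma> q s \<le> ?rhs C f g))"
      using W C C' by (intro exI[of _ C']) auto
  next
    fix q :: real
    assume q: "1 / q = s"
    have q0: "0 < q" using q s by (metis zero_less_divide_1_iff)
    let ?rhs = "\<lambda>C f g. ennreal C * epow (Linf_norm f) (1 - s) * epow (X (\<lambda>x. ennreal (norm (g x :: 'n)))) s"
    obtain C where C: "0 < C" and C1: "\<And>f g. C1_gradient f g \<Longrightarrow> lhs_quant X f \<gamma> q s \<le> ?rhs C f g"
      using C1_estimate_bounded[OF X A \<gamma> neg s q] by blast
    obtain C' where C': "C \<le> C'" and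
      W: "ball_avg_unif_bounded X \<Longrightarrow> \<forall>f g. weak_gradient f g \<longrightarrow> lhs_quant X f \<gamma> q s \<le> ?rhs C' f g"
    proof (cases "ball_avg_unif_bounded X")
      case True
      from Sobolev_estimate_bounded[OF X True C s q0 C1] show ?thesis using that by blast
    qed (use that in blast)
    have "lhs_quant X f \<gamma> q s \<le> ?rhs C' f g" if "C1_grad_cc f g" for f g
      by (rule order_trans[OF C1[OF C1_grad_cc_imp[OF that]] ennreal_mult3_mono_left[OF C']])
    then show "\<exists>C>0. (\<forall>f g. C1_grad_cc f g \<longrightarrow> lhs_quant X f \<gamma> q s \<le> ?rhs C f g) \<and>
      ((abs_cont_norm X \<and> ball_avg_unif_bounded X) \<longrightarrow>
       (\<forall>f g. f \<in> borel_measurable lebesgue \<longrightarrow> weak_gradient f g \<longrightarrow> X (\<lambda>x. ennreal (norm (g x))) < \<infinity> \<longrightarrow>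
         lhs_quant X f \<gamma> q s \<le> ?rhs C f g))"
      using W C C' by (intro exI[of _ C']) auto
  qed
qed

end
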